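(* Let $k$ be a commutative ring and $i\colon H\to G$ a group monomorphism. Let $\mathrm{res}_i\colon\mathrm{Mod}(kG)\to\mathrm{Mod}(kH)$ be restriction along $i$, with left adjoint $\mathrm{ind}_i$ and right adjoint $\mathrm{coind}_i$. Then the pairs $(\mathrm{ind}_i,\mathrm{res}_i)$ and $(\mathrm{res}_i,\mathrm{coind}_i)$ are Quillen adjunctions with respect to the proper model structures on $\mathrm{Mod}(kH)$ and $\mathrm{Mod}(kG)$.
   Context: For a group $G$ and a commutative ring $k$, $\mathrm{Mod}(kG)$ is the category of left $kG$-modules. For a class $\mathcal X$ of modules, $\mathcal X^\perp=\{y : \mathrm{Ext}^1(x,y)=0\ \forall x\in\mathcal X\}$ and ${}^\perp\mathcal X=\{x : \mathrm{Ext}^1(x,y)=0\ \forall y\in\mathcal X\}$. $B(G,k)$ is the $kG$-module of functions $f\colon G\to k$ taking only finitely many values, with $(gf)(x)=f(g^{-1}x)$. $\mathrm{Cof}(kG)$ is the class of $kG$-modules $x$ such that $B(G,k)\otimes_k x$ (diagonal action) is $kG$-projective. $\mathcal W_G$ is the class of $kG$-modules $x$ with $\mathrm{res}^G_F x\in\mathrm{Cof}(kF)^\perp$ for every finite subgroup $F\leqslant G$, and $\mathrm{PCof}(kG)={}^\perp\mathcal W_G$. The proper model structure on $\mathrm{Mod}(kG)$ is the abelian model structure determined by the hereditary Hovey triple $(\mathrm{PCof}(kG),\mathcal W_G,\mathrm{Mod}(kG))$: cofibrations (resp. trivial cofibrations) are the monomorphisms with cokernel in $\mathrm{PCof}(kG)$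 (resp. with projective cokernel), fibrations (resp. trivial fibrations) are the epimorphisms (resp. the epimorphisms with kernel in $\mathcal W_G$), and weak equivalences are the composites of a trivial cofibration followed by a trivial fibration. *)

theory Defs
  imports "HOL-Algebra.Module" "HOL-Library.Equipollence" "HOL-Library.FuncSet"
begin

section \<open>Categories, adjunctions and Quillen adjunctions\<close>

record ('o, 'a) category =
  Obj :: "'o set"
  Hom :: "'o \<Rightarrow> 'o \<Rightarrow> 'a set"
  Comp :: "'o \<Rightarrow> 'o \<Rightarrow> 'o \<Rightarrow> 'a \<Rightarrow> 'a \<Rightarrow> 'a"
  Ident :: "'o \<Rightarrow> 'a"

text \<open>\<open>Comp C X Y Z g f\<close> is the composite of \<open>f : X \<rightarrow> Y\<close> followed by \<open>g : Y \<rightarrow> Z\<close>.\<close>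

record ('o, 'a, 'p, 'b) functor_data =
  fobj :: "'o \<Rightarrow> 'p"
  farr :: "'o \<Rightarrow> 'o \<Rightarrow> 'a \<Rightarrow> 'b"

definition is_functor ::
  "('o, 'a, 'c) category_scheme \<Rightarrow> ('p, 'b, 'd) category_scheme \<Rightarrow> ('o, 'a, 'p, 'b) functor_data \<Rightarrow> bool"
where
  "is_functor C D F \<longleftrightarrow>
    (\<forall>X \<in> Obj C. fobj F X \<in> Obj D) \<and>
    (\<forall>X \<in> Obj C. \<forall>Y \<in> Obj C. \<forall>f \<in> Hom C X Y. farr F X Y f \<in> Hom D (fobj F X) (fobj F Y)) \<and>
    (\<forall>X \<in> Obj C. farr F X X (Ident C X) = Ident D (fobj F X)) \<and>
    (\<forall>X \<in> Obj C. \<forall>Y \<in> Obj C. \<forall>Z \<in> Obj C. \<forall>f \<in> Hom C X Y. \<forall>g \<in> Hom C Y Z.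
       farr F X Z (Comp C X Y Z g f) =
       Comp D (fobj F X) (fobj F Y) (fobj F Z) (farr F Y Z g) (farr F X Y f))"

text \<open>\<open>adjunction C D L R\<close>: \<open>L : C \<rightarrow> D\<close> is left adjoint to \<open>R : D \<rightarrow> C\<close>.\<close>

definition adjunction ::
  "('o, 'a, 'c) category_scheme \<Rightarrow> ('p, 'b, 'd) category_scheme \<Rightarrow>
   ('o, 'a, 'p, 'b) functor_data \<Rightarrow> ('p, 'b, 'o, 'a) functor_data \<Rightarrow> bool"
where
  "adjunction C D L R \<longleftrightarrow>
    is_functor C D L \<and> is_functor D C R \<and>
    (\<exists>\<phi>. (\<forall>X \<in> Obj C. \<forall>Y \<in> Obj D.
            bij_betw (\<phi> X Y) (Hom D (fobj L X) Y) (Hom C X (fobj R Y))) \<and>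
         (\<forall>X \<in> Obj C. \<forall>X' \<in> Obj C. \<forall>Y \<in> Obj D. \<forall>Y' \<in> Obj D.
          \<forall>f \<in> Hom C X' X. \<forall>u \<in> Hom D (fobj L X) Y. \<forall>g \<in> Hom D Y Y'.
            \<phi> X' Y' (Comp D (fobj L X') Y Y' g
                       (Comp D (fobj L X') (fobj L X) Y u (farr L X' X f))) =
            Comp C X' (fobj R Y) (fobj R Y') (farr R Y Y' g)
                       (Comp C X' X (fobj R Y) (\<phi> X Y u) f)))"

record ('o, 'a) model_category = "('o, 'a) category" +
  Cofib :: "'o \<Rightarrow> 'o \<Rightarrow> 'a set"
  Fibr :: "'o \<Rightarrow> 'o \<Rightarrow> 'a set"
  Weq :: "'o \<Rightarrow> 'o \<Rightarrow> 'a set"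

definition preserves ::
  "('o, 'a, 'c) category_scheme \<Rightarrow> ('o, 'a, 'p, 'b) functor_data \<Rightarrow>
   ('o \<Rightarrow> 'o \<Rightarrow> 'a set) \<Rightarrow> ('p \<Rightarrow> 'p \<Rightarrow> 'b set) \<Rightarrow> bool"
where
  "preserves C F A B \<longleftrightarrow>
    (\<forall>X \<in> Obj C. \<forall>Y \<in> Obj C. \<forall>f \<in> A X Y. farr F X Y f \<in> B (fobj F X) (fobj F Y))"

text \<open>Between model categories the conditions on \<open>L\<close> and on \<open>R\<close> imply each other. Both are
  recorded, so that the definition does not depend on which of the two is taken as primitive.\<close>

definition quillen_adjunction ::
  "('o, 'a, 'c) model_category_scheme \<Rightarrow> ('p, 'b, 'd) model_category_scheme \<Rightarrow>
   ('o, 'a, 'p, 'b) functor_data \<Rightarrow> ('p, 'b, 'o, 'a) functor_data \<Rightarrow> bool"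
where
  "quillen_adjunction C D L R \<longleftrightarrow>
    adjunction C D L R \<and>
    preserves C L (Cofib C) (Cofib D) \<and>
    preserves C L (\<lambda>X Y. Cofib C X Y \<inter> Weq C X Y) (\<lambda>X Y. Cofib D X Y \<inter> Weq D X Y) \<and>
    preserves D R (Fibr D) (Fibr C) \<and>
    preserves D R (\<lambda>X Y. Fibr D X Y \<inter> Weq D X Y) (\<lambda>X Y. Fibr C X Y \<inter> Weq C X Y)"


section \<open>Universes\<close>

text \<open>
  HOL has no class of all modules, so \<open>Mod(kG)\<close> is formed relative to a collection \<open>U\<close> of
  small sets: its objects are the \<open>kG\<close>-modules whose carrier belongs to \<open>U\<close>. The small subsets
  of any Grothendieck universe having \<open>k\<close> and \<open>G\<close> as elements satisfy the closure properties
  below, which imply closure under all constructions involved here (finite limits and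
  colimits, extensions, free modules on small sets, tensor products, induced and coinduced
  modules). No strong axiom is needed for an instance: for an infinite set \<open>S\<close> of cardinality at
  least that of \<open>k\<close> and \<open>G\<close>, all subsets of the type of subsets of \<open>S\<close> qualify as well.
\<close>

definition closed_under_powers :: "'i set \<Rightarrow> 'u set set \<Rightarrow> bool" where
  "closed_under_powers I U \<longleftrightarrow> (\<forall>A \<in> U. \<exists>B \<in> U. (I \<rightarrow>\<^sub>E A) \<approx> B)"

definition module_universe :: "'k ring \<Rightarrow> 'g monoid \<Rightarrow> 'u set set \<Rightarrow> bool" where
  "module_universe k G U \<longleftrightarrow>
    (\<exists>A \<in> U. \<exists>a \<in> A. \<exists>b \<in> A. a \<noteq> b) \<and>
    (\<forall>A \<in> U. \<forall>B. B \<lesssim> A \<longrightarrow> B \<in> U) \<and>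
    closed_under_powers (UNIV :: nat set) U \<and>
    closed_under_powers (carrier k) U \<and>
    closed_under_powers (carrier G) U"


section \<open>Modules over group algebras\<close>

text \<open>A left \<open>kG\<close>-module is a \<open>k\<close>-module together with a \<open>k\<close>-linear action of \<open>G\<close>. The ring
  fields \<open>mult\<close> and \<open>one\<close>, which module records inherit in the library, carry no meaning.\<close>

record ('k, 'b, 'g) gmodule = "('k, 'b) module" +
  act :: "'g \<Rightarrow> 'b \<Rightarrow> 'b"

definition linear_maps ::
  "'k ring \<Rightarrow> ('k, 'b, 'c) module_scheme \<Rightarrow> ('k, 'd, 'e) module_scheme \<Rightarrow> ('b \<Rightarrow> 'd) set"
where
  "linear_maps k M N =
    {f \<in> carrier M \<rightarrow>\<^sub>E carrier N.
       (\<forall>x \<in> carrier M. \<forall>y \<in> carrier M. f (x \<oplus>\<^bsub>M\<^esub> y) = f x \<oplus>\<^bsub>N\<^esub> f y) \<and>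
       (\<forall>a \<in> carrier k. \<forall>x \<in> carrier M. f (a \<odot>\<^bsub>M\<^esub> x) = a \<odot>\<^bsub>N\<^esub> f x)}"

definition is_gmodule :: "'k ring \<Rightarrow> 'g monoid \<Rightarrow> ('k, 'b, 'g) gmodule \<Rightarrow> bool" where
  "is_gmodule k G M \<longleftrightarrow>
    module k M \<and>
    (\<forall>g \<in> carrier G. restrict (act M g) (carrier M) \<in> linear_maps k M M) \<and>
    (\<forall>x \<in> carrier M. act M \<one>\<^bsub>G\<^esub> x = x) \<and>
    (\<forall>g \<in> carrier G. \<forall>h \<in> carrier G. \<forall>x \<in> carrier M.
       act M (g \<otimes>\<^bsub>G\<^esub> h) x = act M g (act M h x))"

definition gmod :: "'u set set \<Rightarrow> 'k ring \<Rightarrow> 'g monoid \<Rightarrow> ('k, 'u, 'g) gmodule set" where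
  "gmod U k G = {M. is_gmodule k G M \<and> carrier M \<in> U}"

text \<open>Homomorphisms are extensional functions, so that equality of morphisms is equality in HOL.\<close>

definition ghom ::
  "'k ring \<Rightarrow> 'g monoid \<Rightarrow> ('k, 'b, 'g) gmodule \<Rightarrow> ('k, 'd, 'g) gmodule \<Rightarrow> ('b \<Rightarrow> 'd) set"
where
  "ghom k G M N =
    {f \<in> linear_maps k M N. \<forall>g \<in> carrier G. \<forall>x \<in> carrier M. f (act M g x) = act N g (f x)}"

definition gmod_category ::
  "'u set set \<Rightarrow> 'k ring \<Rightarrow> 'g monoid \<Rightarrow> (('k, 'u, 'g) gmodule, 'u \<Rightarrow> 'u) category"
where
  "gmod_category U k G =
    \<lparr> Obj = gmod U k G,
      Hom = ghom k G,
      Comp = (\<lambda>X Y Z g f. compose (carrier X) g f),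
      Ident = (\<lambda>X. \<lambda>x \<in> carrier X. x) \<rparr>"

definition res_gmodule :: "('h \<Rightarrow> 'g) \<Rightarrow> ('k, 'b, 'g) gmodule \<Rightarrow> ('k, 'b, 'h) gmodule" where
  "res_gmodule i M =
    \<lparr> carrier = carrier M, mult = mult M, one = one M, zero = zero M, add = add M,
      smult = smult M, act = (\<lambda>h. act M (i h)) \<rparr>"

definition res_functor ::
  "('h \<Rightarrow> 'g) \<Rightarrow> (('k, 'u, 'g) gmodule, 'u \<Rightarrow> 'u, ('k, 'u, 'h) gmodule, 'u \<Rightarrow> 'u) functor_data"
where
  "res_functor i = \<lparr> fobj = res_gmodule i, farr = (\<lambda>M N f. f) \<rparr>"

definition short_exact ::
  "'k ring \<Rightarrow> 'g monoid \<Rightarrow> ('k, 'u, 'g) gmodule \<Rightarrow> ('k, 'u, 'g) gmodule \<Rightarrow> ('k, 'u, 'g) gmodule \<Rightarrow>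
   ('u \<Rightarrow> 'u) \<Rightarrow> ('u \<Rightarrow> 'u) \<Rightarrow> bool"
where
  "short_exact k G A B C f p \<longleftrightarrow>
    f \<in> ghom k G A B \<and> p \<in> ghom k G B C \<and>
    inj_on f (carrier A) \<and> p ` carrier B = carrier C \<and>
    f ` carrier A = {b \<in> carrier B. p b = \<zero>\<^bsub>C\<^esub>}"

definition projectives :: "'u set set \<Rightarrow> 'k ring \<Rightarrow> 'g monoid \<Rightarrow> ('k, 'u, 'g) gmodule set" where
  "projectives U k G =
    {P \<in> gmod U k G.
       \<forall>M \<in> gmod U k G. \<forall>N \<in> gmod U k G. \<forall>p \<in> ghom k G M N. \<forall>f \<in> ghom k G P N.
         p ` carrier M = carrier N \<longrightarrow>
         (\<exists>h \<in> ghom k G P M. compose (carrier P) p h = f)}"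


subsection \<open>Ext and orthogonal classes\<close>

text \<open>\<open>Ext1 U k G x y\<close> is the Yoneda Ext: the set of congruence classes of extensions
  \<open>0 \<rightarrow> y \<rightarrow> e \<rightarrow> x \<rightarrow> 0\<close>. As the underlying set of an abelian group (under Baer sum) it is
  zero iff it has exactly one element.\<close>

definition extensions ::
  "'u set set \<Rightarrow> 'k ring \<Rightarrow> 'g monoid \<Rightarrow> ('k, 'u, 'g) gmodule \<Rightarrow> ('k, 'u, 'g) gmodule \<Rightarrow>
   (('k, 'u, 'g) gmodule \<times> ('u \<Rightarrow> 'u) \<times> ('u \<Rightarrow> 'u)) set"
where
  "extensions U k G x y = {(e, j, p). e \<in> gmod U k G \<and> short_exact k G y e x j p}"

definition ext_congruence ::
  "'u set set \<Rightarrow> 'k ring \<Rightarrow> 'g monoid \<Rightarrow> ('k, 'u, 'g) gmodule \<Rightarrow> ('k, 'u, 'g) gmodule \<Rightarrow>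
   (('k, 'u, 'g) gmodule \<times> ('u \<Rightarrow> 'u) \<times> ('u \<Rightarrow> 'u)) rel"
where
  "ext_congruence U k G x y =
    {((e, j, p), (e', j', p')).
       (e, j, p) \<in> extensions U k G x y \<and> (e', j', p') \<in> extensions U k G x y \<and>
       (\<exists>f \<in> ghom k G e e'. compose (carrier y) f j = j' \<and> compose (carrier e) p' f = p)}"

definition Ext1 ::
  "'u set set \<Rightarrow> 'k ring \<Rightarrow> 'g monoid \<Rightarrow> ('k, 'u, 'g) gmodule \<Rightarrow> ('k, 'u, 'g) gmodule \<Rightarrow>
   (('k, 'u, 'g) gmodule \<times> ('u \<Rightarrow> 'u) \<times> ('u \<Rightarrow> 'u)) set set"
where
  "Ext1 U k G x y = extensions U k G x y // ext_congruence U k G x y"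

definition Ext1_zero ::
  "'u set set \<Rightarrow> 'k ring \<Rightarrow> 'g monoid \<Rightarrow> ('k, 'u, 'g) gmodule \<Rightarrow> ('k, 'u, 'g) gmodule \<Rightarrow> bool"
where
  "Ext1_zero U k G x y \<longleftrightarrow> is_singleton (Ext1 U k G x y)"

definition right_orth ::
  "'u set set \<Rightarrow> 'k ring \<Rightarrow> 'g monoid \<Rightarrow> ('k, 'u, 'g) gmodule set \<Rightarrow> ('k, 'u, 'g) gmodule set"
where
  "right_orth U k G X = {y \<in> gmod U k G. \<forall>x \<in> X. Ext1_zero U k G x y}"

definition left_orth ::
  "'u set set \<Rightarrow> 'k ring \<Rightarrow> 'g monoid \<Rightarrow> ('k, 'u, 'g) gmodule set \<Rightarrow> ('k, 'u, 'g) gmodule set"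
where
  "left_orth U k G X = {x \<in> gmod U k G. \<forall>y \<in> X. Ext1_zero U k G x y}"


subsection \<open>Tensor products with the diagonal action\<close>

definition bilinear_maps ::
  "'k ring \<Rightarrow> ('k, 'a, 'c) module_scheme \<Rightarrow> ('k, 'b, 'd) module_scheme \<Rightarrow>
   ('k, 'u, 'e) module_scheme \<Rightarrow> ('a \<Rightarrow> 'b \<Rightarrow> 'u) set"
where
  "bilinear_maps k M N P =
    {\<beta>. (\<forall>m \<in> carrier M. restrict (\<beta> m) (carrier N) \<in> linear_maps k N P) \<and>
        (\<forall>n \<in> carrier N. (\<lambda>m \<in> carrier M. \<beta> m n) \<in> linear_maps k M P)}"

definition is_tensor_product ::
  "'u set set \<Rightarrow> 'k ring \<Rightarrow> ('k, 'a, 'c) module_scheme \<Rightarrow> ('k, 'b, 'd) module_scheme \<Rightarrow>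
   ('k, 'u, 'e) module_scheme \<Rightarrow> ('a \<Rightarrow> 'b \<Rightarrow> 'u) \<Rightarrow> bool"
where
  "is_tensor_product U k M N T \<tau> \<longleftrightarrow>
    \<tau> \<in> bilinear_maps k M N T \<and>
    (\<forall>P :: ('k, 'u) module. module k P \<and> carrier P \<in> U \<longrightarrow>
      (\<forall>\<beta> \<in> bilinear_maps k M N P.
        \<exists>!f. f \<in> linear_maps k T P \<and>
             (\<forall>m \<in> carrier M. \<forall>n \<in> carrier N. f (\<tau> m n) = \<beta> m n)))"

text \<open>\<open>T\<close> is the tensor product over \<open>k\<close> of the \<open>kG\<close>-modules \<open>M\<close> and \<open>N\<close>, with diagonal action.\<close>

definition is_diagonal_tensor_product ::
  "'u set set \<Rightarrow> 'k ring \<Rightarrow> 'g monoid \<Rightarrow> ('k, 'a, 'g) gmodule \<Rightarrow> ('k, 'b, 'g) gmodule \<Rightarrow>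
   ('k, 'u, 'g) gmodule \<Rightarrow> bool"
where
  "is_diagonal_tensor_product U k G M N T \<longleftrightarrow>
    T \<in> gmod U k G \<and>
    (\<exists>\<tau>. is_tensor_product U k M N T \<tau> \<and>
         (\<forall>g \<in> carrier G. \<forall>m \<in> carrier M. \<forall>n \<in> carrier N.
            act T g (\<tau> m n) = \<tau> (act M g m) (act N g n)))"


section \<open>The proper model structure\<close>

text \<open>The module \<open>B(G,k)\<close>.\<close>

definition bounded_functions :: "'k ring \<Rightarrow> 'g monoid \<Rightarrow> ('k, 'g \<Rightarrow> 'k, 'g) gmodule" where
  "bounded_functions k G =
    \<lparr> carrier = {f \<in> carrier G \<rightarrow>\<^sub>E carrier k. finite (f ` carrier G)},
      mult = undefined,
      one = undefined,
      zero = (\<lambda>x \<in> carrier G. \<zero>\<^bsub>k\<^esub>),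
      add = (\<lambda>f f'. \<lambda>x \<in> carrier G. f x \<oplus>\<^bsub>k\<^esub> f' x),
      smult = (\<lambda>a f. \<lambda>x \<in> carrier G. a \<otimes>\<^bsub>k\<^esub> f x),
      act = (\<lambda>g f. \<lambda>x \<in> carrier G. f (inv\<^bsub>G\<^esub> g \<otimes>\<^bsub>G\<^esub> x)) \<rparr>"

text \<open>Tensor products exist in \<open>Mod(kG)\<close> and are unique up to isomorphism, so it does not matter
  which one is tested for projectivity.\<close>

definition Cof :: "'u set set \<Rightarrow> 'k ring \<Rightarrow> 'g monoid \<Rightarrow> ('k, 'u, 'g) gmodule set" where
  "Cof U k G =
    {x \<in> gmod U k G.
       \<exists>T. is_diagonal_tensor_product U k G (bounded_functions k G) x T \<and> T \<in> projectives U k G}"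

definition W_class :: "'u set set \<Rightarrow> 'k ring \<Rightarrow> 'g monoid \<Rightarrow> ('k, 'u, 'g) gmodule set" where
  "W_class U k G =
    {x \<in> gmod U k G.
       \<forall>F. subgroup F G \<and> finite F \<longrightarrow>
         res_gmodule (\<lambda>g. g) x \<in>
           right_orth U k (G\<lparr>carrier := F\<rparr>) (Cof U k (G\<lparr>carrier := F\<rparr>))}"

definition PCof :: "'u set set \<Rightarrow> 'k ring \<Rightarrow> 'g monoid \<Rightarrow> ('k, 'u, 'g) gmodule set" where
  "PCof U k G = left_orth U k G (W_class U k G)"

definition mono_with_coker_in ::
  "'u set set \<Rightarrow> 'k ring \<Rightarrow> 'g monoid \<Rightarrow> ('k, 'u, 'g) gmodule set \<Rightarrow>
   ('k, 'u, 'g) gmodule \<Rightarrow> ('k, 'u, 'g) gmodule \<Rightarrow> ('u \<Rightarrow> 'u) set"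
where
  "mono_with_coker_in U k G X M N =
    {f. \<exists>C \<in> gmod U k G. \<exists>p. short_exact k G M N C f p \<and> C \<in> X}"

definition epi_with_ker_in ::
  "'u set set \<Rightarrow> 'k ring \<Rightarrow> 'g monoid \<Rightarrow> ('k, 'u, 'g) gmodule set \<Rightarrow>
   ('k, 'u, 'g) gmodule \<Rightarrow> ('k, 'u, 'g) gmodule \<Rightarrow> ('u \<Rightarrow> 'u) set"
where
  "epi_with_ker_in U k G X M N =
    {p. \<exists>K \<in> gmod U k G. \<exists>j. short_exact k G K M N j p \<and> K \<in> X}"

definition proper_weq ::
  "'u set set \<Rightarrow> 'k ring \<Rightarrow> 'g monoid \<Rightarrow>
   ('k, 'u, 'g) gmodule \<Rightarrow> ('k, 'u, 'g) gmodule \<Rightarrow> ('u \<Rightarrow> 'u) set"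
where
  "proper_weq U k G M N =
    {compose (carrier M) p j | p j L.
       L \<in> gmod U k G \<and>
       j \<in> mono_with_coker_in U k G (projectives U k G) M L \<and>
       p \<in> epi_with_ker_in U k G (W_class U k G) L N}"

definition proper_model ::
  "'u set set \<Rightarrow> 'k ring \<Rightarrow> 'g monoid \<Rightarrow> (('k, 'u, 'g) gmodule, 'u \<Rightarrow> 'u) model_category"
where
  "proper_model U k G =
    category.extend (gmod_category U k G)
      (model_category.fields
        (mono_with_coker_in U k G (PCof U k G))
        (epi_with_ker_in U k G (gmod U k G))
        (proper_weq U k G))"

end

(* The induced module is the submodule of coind M = {f : G \<rightarrow> M | f (x i(h)) = h\<^sup>-\<^sup>1 f x} of
   functions with finite support modulo H, so ind and coind are exact. Over a finite group F the
   class Cof(kF) consists of the modules that are projective over k, hence an Ext-orthogonality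
   against it may be tested on k-split extensions. Together with a double coset argument this gives
   res W_G \<subseteq> W_H and coind W_H \<subseteq> W_G, and pulling extensions back along a unit gives
   ind PCof(kH) \<subseteq> PCof(kG) and res PCof(kG) \<subseteq> PCof(kH). Trivial cofibrations are the
   monomorphisms with projective cokernel and trivial fibrations the epimorphisms with kernel in W,
   and any adjoint of res agrees with the explicit one by uniqueness of universal arrows. *)

theory Submission
  imports Defs
begin


section \<open>Modules over group algebras\<close>

text \<open>Two obstacles shape the development. Modules built on the way (function modules, direct
  sums, pull-backs) live on other types than the objects of the category, so they are only bounded
  in size relative to \<open>U\<close> and copied back when an object is required. Quotients are
  avoided: cokernels are handled by factoring maps through surjections, push-outs by cocycles. For
  finite \<open>F\<close> the diagonal action on the tensor product of \<open>B(F,k)\<close> with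
  \<open>x\<close> can be untwisted, which makes it a module induced from the trivial group;
  conversely \<open>x\<close> is a \<open>k\<close>-summand of it, through the point mass at 1 and
  evaluation at 1. Hence membership in \<open>Cof\<close> depends on the underlying
  \<open>k\<close>-module alone and survives any change of the finite acting group. The hard
  inclusion is the one for coinduced modules: restricted to a finite \<open>F\<close>, such a module
  splits as a product over double cosets, and the factor at \<open>g\<close> is governed by the
  finite group of those \<open>h\<close> in \<open>H\<close> that conjugation by \<open>g\<close>
  carries into \<open>F\<close>. All classes of maps are given by short exact sequences, so
  exactness of the adjoints turns each preservation claim into one about kernels or
  cokernels.\<close>

locale group_module = module k M + G: group G
  for k :: "'k ring" and G :: "'g monoid" and M :: "('k, 'b, 'g) gmodule" +
  assumes act_closed [simp]: "\<lbrakk>g \<in> carrier G; x \<in> carrier M\<rbrakk> \<Longrightarrow> act M g x \<in> carrier M"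
    and act_add: "\<lbrakk>g \<in> carrier G; x \<in> carrier M; y \<in> carrier M\<rbrakk> \<Longrightarrow>
      act M g (x \<oplus>\<^bsub>M\<^esub> y) = act M g x \<oplus>\<^bsub>M\<^esub> act M g y"
    and act_smult: "\<lbrakk>g \<in> carrier G; a \<in> carrier k; x \<in> carrier M\<rbrakk> \<Longrightarrow>
      act M g (a \<odot>\<^bsub>M\<^esub> x) = a \<odot>\<^bsub>M\<^esub> act M g x"
    and act_one [simp]: "x \<in> carrier M \<Longrightarrow> act M \<one>\<^bsub>G\<^esub> x = x"
    and act_mult: "\<lbrakk>g \<in> carrier G; h \<in> carrier G; x \<in> carrier M\<rbrakk> \<Longrightarrow>
      act M (g \<otimes>\<^bsub>G\<^esub> h) x = act M g (act M h x)"

lemma group_module_iff: "group_module k G M \<longleftrightarrow> is_gmodule k G M \<and> group G"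
proof
  assume "group_module k G M"
  then interpret group_module k G M .
  show "is_gmodule k G M \<and> group G"
    by (auto simp: is_gmodule_def linear_maps_def module_axioms G.group_axioms act_add act_smult act_mult)
next
  assume asm: "is_gmodule k G M \<and> group G"
  then interpret module k M by (simp add: is_gmodule_def)
  interpret G: group G using asm by simp
  have *: "restrict (act M g) (carrier M) \<in> linear_maps k M M" if "g \<in> carrier G" for g
    using asm that by (simp add: is_gmodule_def)
  have cl: "act M g x \<in> carrier M" if "g \<in> carrier G" "x \<in> carrier M" for g x
    using *[OF that(1)] that(2) by (auto simp: linear_maps_def dest: PiE_mem)
  show "group_module k G M"
  proof
    fix g x y assume "g \<in> carrier G" "x \<in> carrier M" "y \<in> carrier M"
    then show "act M g (x \<oplus>\<^bsub>M\<^esub> y) = act M g x \<oplus>\<^bsub>M\<^esub> act M g y"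
      using *[of g] by (auto simp: linear_maps_def)
  next
    fix g a x assume "g \<in> carrier G" "a \<in> carrier k" "x \<in> carrier M"
    then show "act M g (a \<odot>\<^bsub>M\<^esub> x) = a \<odot>\<^bsub>M\<^esub> act M g x"
      using *[of g] by (auto simp: linear_maps_def)
  qed (use asm cl in \<open>auto simp: is_gmodule_def\<close>)
qed

text \<open>Additive inverses are produced by the scalar -1; the assumption that the scalar 0
  annihilates is what makes this work.\<close>

lemma group_moduleI:
  fixes M :: "('k, 'b, 'g) gmodule"
  assumes "cring k" "group G"
    and "\<zero>\<^bsub>M\<^esub> \<in> carrier M"
    and "\<And>x y. \<lbrakk>x \<in> carrier M; y \<in> carrier M\<rbrakk> \<Longrightarrow> x \<oplus>\<^bsub>M\<^esub> y \<in> carrier M"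
    and "\<And>a x. \<lbrakk>a \<in> carrier k; x \<in> carrier M\<rbrakk> \<Longrightarrow> a \<odot>\<^bsub>M\<^esub> x \<in> carrier M"
    and "\<And>g x. \<lbrakk>g \<in> carrier G; x \<in> carrier M\<rbrakk> \<Longrightarrow> act M g x \<in> carrier M"
    and "\<And>x y z. \<lbrakk>x \<in> carrier M; y \<in> carrier M; z \<in> carrier M\<rbrakk> \<Longrightarrow>
      (x \<oplus>\<^bsub>M\<^esub> y) \<oplus>\<^bsub>M\<^esub> z = x \<oplus>\<^bsub>M\<^esub> (y \<oplus>\<^bsub>M\<^esub> z)"
    and "\<And>x y. \<lbrakk>x \<in> carrier M; y \<in> carrier M\<rbrakk> \<Longrightarrow> x \<oplus>\<^bsub>M\<^esub> y = y \<oplus>\<^bsub>M\<^esub> x"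
    and "\<And>x. x \<in> carrier M \<Longrightarrow> \<zero>\<^bsub>M\<^esub> \<oplus>\<^bsub>M\<^esub> x = x"
    and "\<And>x. x \<in> carrier M \<Longrightarrow> \<zero>\<^bsub>k\<^esub> \<odot>\<^bsub>M\<^esub> x = \<zero>\<^bsub>M\<^esub>"
    and "\<And>a b x. \<lbrakk>a \<in> carrier k; b \<in> carrier k; x \<in> carrier M\<rbrakk> \<Longrightarrow>
      (a \<oplus>\<^bsub>k\<^esub> b) \<odot>\<^bsub>M\<^esub> x = a \<odot>\<^bsub>M\<^esub> x \<oplus>\<^bsub>M\<^esub> b \<odot>\<^bsub>M\<^esub> x"
    and "\<And>a x y. \<lbrakk>a \<in> carrier k; x \<in> carrier M; y \<in> carrier M\<rbrakk> \<Longrightarrow>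
      a \<odot>\<^bsub>M\<^esub> (x \<oplus>\<^bsub>M\<^esub> y) = a \<odot>\<^bsub>M\<^esub> x \<oplus>\<^bsub>M\<^esub> a \<odot>\<^bsub>M\<^esub> y"
    and "\<And>a b x. \<lbrakk>a \<in> carrier k; b \<in> carrier k; x \<in> carrier M\<rbrakk> \<Longrightarrow>
      (a \<otimes>\<^bsub>k\<^esub> b) \<odot>\<^bsub>M\<^esub> x = a \<odot>\<^bsub>M\<^esub> (b \<odot>\<^bsub>M\<^esub> x)"
    and "\<And>x. x \<in> carrier M \<Longrightarrow> \<one>\<^bsub>k\<^esub> \<odot>\<^bsub>M\<^esub> x = x"
    and "\<And>g x y. \<lbrakk>g \<in> carrier G; x \<in> carrier M; y \<in> carrier M\<rbrakk> \<Longrightarrow>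
      act M g (x \<oplus>\<^bsub>M\<^esub> y) = act M g x \<oplus>\<^bsub>M\<^esub> act M g y"
    and "\<And>g a x. \<lbrakk>g \<in> carrier G; a \<in> carrier k; x \<in> carrier M\<rbrakk> \<Longrightarrow>
      act M g (a \<odot>\<^bsub>M\<^esub> x) = a \<odot>\<^bsub>M\<^esub> act M g x"
    and "\<And>x. x \<in> carrier M \<Longrightarrow> act M \<one>\<^bsub>G\<^esub> x = x"
    and "\<And>g h x. \<lbrakk>g \<in> carrier G; h \<in> carrier G; x \<in> carrier M\<rbrakk> \<Longrightarrow>
      act M (g \<otimes>\<^bsub>G\<^esub> h) x = act M g (act M h x)"
  shows "group_module k G M"
proof -
  interpret k: cring k by fact
  have inv: "\<exists>y \<in> carrier M. y \<oplus>\<^bsub>M\<^esub> x = \<zero>\<^bsub>M\<^esub>" if "x \<in> carrier M" for x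
  proof -
    have "(\<ominus>\<^bsub>k\<^esub> \<one>\<^bsub>k\<^esub>) \<odot>\<^bsub>M\<^esub> x \<oplus>\<^bsub>M\<^esub> \<one>\<^bsub>k\<^esub> \<odot>\<^bsub>M\<^esub> x = (\<ominus>\<^bsub>k\<^esub> \<one>\<^bsub>k\<^esub> \<oplus>\<^bsub>k\<^esub> \<one>\<^bsub>k\<^esub>) \<odot>\<^bsub>M\<^esub> x"
      using that by (simp add: assms(11))
    also have "\<dots> = \<zero>\<^bsub>M\<^esub>"
      using that by (simp add: k.l_neg assms(10))
    finally show ?thesis
      using that assms(5)[of "\<ominus>\<^bsub>k\<^esub> \<one>\<^bsub>k\<^esub>" x] by (auto simp: assms(14))
  qed
  have "abelian_group M"
    by (rule abelian_groupI) (fact assms(4) assms(3) assms(7) assms(8) assms(9) inv)+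
  then have "module k M"
    by (rule moduleI[OF \<open>cring k\<close>]) (fact assms(5) assms(11-14))+
  then show ?thesis
    using \<open>group G\<close> by (rule group_module.intro) (rule group_module_axioms.intro; fact assms(6) assms(15-18))
qed

lemma (in group_module) act_zero [simp]: "g \<in> carrier G \<Longrightarrow> act M g \<zero>\<^bsub>M\<^esub> = \<zero>\<^bsub>M\<^esub>"
  using act_smult[of g "\<zero>\<^bsub>k\<^esub>" "\<zero>\<^bsub>M\<^esub>"] by simp

text \<open>Rewriting a difference as a sum with a scalar multiple brings it within reach of the
  rules for additive, scalar-compatible and equivariant maps.\<close>

lemma (in group_module) minus_as_smult:
  "x \<in> carrier M \<Longrightarrow> y \<in> carrier M \<Longrightarrow> x \<ominus>\<^bsub>M\<^esub> y = x \<oplus>\<^bsub>M\<^esub> (\<ominus>\<^bsub>k\<^esub> \<one>\<^bsub>k\<^esub>) \<odot>\<^bsub>M\<^esub> y"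
  by (simp add: M.minus_eq smult_l_minus)

lemma (in group_module) act_minus:
  "\<lbrakk>g \<in> carrier G; x \<in> carrier M; y \<in> carrier M\<rbrakk> \<Longrightarrow>
    act M g (x \<ominus>\<^bsub>M\<^esub> y) = act M g x \<ominus>\<^bsub>M\<^esub> act M g y"
  by (simp add: minus_as_smult act_add act_smult)

lemma (in group_module) act_inv_act [simp]:
  "\<lbrakk>g \<in> carrier G; x \<in> carrier M\<rbrakk> \<Longrightarrow> act M (inv\<^bsub>G\<^esub> g) (act M g x) = x"
  "\<lbrakk>g \<in> carrier G; x \<in> carrier M\<rbrakk> \<Longrightarrow> act M g (act M (inv\<^bsub>G\<^esub> g) x) = x"
  by (simp_all flip: act_mult)

lemma (in group_module) add_minus_cancel [simp]:
  "\<lbrakk>x \<in> carrier M; y \<in> carrier M\<rbrakk> \<Longrightarrow> (x \<oplus>\<^bsub>M\<^esub> y) \<ominus>\<^bsub>M\<^esub> y = x"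
  "\<lbrakk>x \<in> carrier M; y \<in> carrier M\<rbrakk> \<Longrightarrow> (x \<ominus>\<^bsub>M\<^esub> y) \<oplus>\<^bsub>M\<^esub> y = x"
  by (simp_all add: M.minus_eq M.a_assoc M.r_neg M.l_neg)

lemma (in group_module) minus_eq_zero_iff:
  assumes "x \<in> carrier M" "y \<in> carrier M"
  shows "x \<ominus>\<^bsub>M\<^esub> y = \<zero>\<^bsub>M\<^esub> \<longleftrightarrow> x = y"
proof
  assume "x \<ominus>\<^bsub>M\<^esub> y = \<zero>\<^bsub>M\<^esub>"
  then have "(x \<ominus>\<^bsub>M\<^esub> y) \<oplus>\<^bsub>M\<^esub> y = y" using assms(2) by simp
  then show "x = y" using assms by simp
qed (simp add: assms M.minus_eq M.r_neg)

lemma linear_mapsD: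
  assumes "f \<in> linear_maps k M N"
  shows "x \<in> carrier M \<Longrightarrow> f x \<in> carrier N"
    and "\<lbrakk>x \<in> carrier M; y \<in> carrier M\<rbrakk> \<Longrightarrow> f (x \<oplus>\<^bsub>M\<^esub> y) = f x \<oplus>\<^bsub>N\<^esub> f y"
    and "\<lbrakk>a \<in> carrier k; x \<in> carrier M\<rbrakk> \<Longrightarrow> f (a \<odot>\<^bsub>M\<^esub> x) = a \<odot>\<^bsub>N\<^esub> f x"
    and "f \<in> extensional (carrier M)"
  using assms by (auto simp: linear_maps_def PiE_def)

lemma linear_maps_zero:
  assumes "f \<in> linear_maps k M N" "module k M" "module k N"
  shows "f \<zero>\<^bsub>M\<^esub> = \<zero>\<^bsub>N\<^esub>"
proof -
  interpret M: module k M by fact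
  interpret N: module k N by fact
  have "f (\<zero>\<^bsub>k\<^esub> \<odot>\<^bsub>M\<^esub> \<zero>\<^bsub>M\<^esub>) = \<zero>\<^bsub>k\<^esub> \<odot>\<^bsub>N\<^esub> f \<zero>\<^bsub>M\<^esub>"
    by (rule linear_mapsD(3)[OF assms(1)]) auto
  then show ?thesis using linear_mapsD(1)[OF assms(1), of "\<zero>\<^bsub>M\<^esub>"] by simp
qed

lemma ghomD:
  assumes "f \<in> ghom k G M N"
  shows "f \<in> linear_maps k M N"
    and "x \<in> carrier M \<Longrightarrow> f x \<in> carrier N"
    and "\<lbrakk>x \<in> carrier M; y \<in> carrier M\<rbrakk> \<Longrightarrow> f (x \<oplus>\<^bsub>M\<^esub> y) = f x \<oplus>\<^bsub>N\<^esub> f y"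
    and "\<lbrakk>a \<in> carrier k; x \<in> carrier M\<rbrakk> \<Longrightarrow> f (a \<odot>\<^bsub>M\<^esub> x) = a \<odot>\<^bsub>N\<^esub> f x"
    and "\<lbrakk>g \<in> carrier G; x \<in> carrier M\<rbrakk> \<Longrightarrow> f (act M g x) = act N g (f x)"
    and "f \<in> extensional (carrier M)"
  using assms by (auto simp: ghom_def linear_maps_def PiE_def)

lemma ghom_eqI:
  assumes "f \<in> ghom k G M N" "g \<in> ghom k G M N'" "\<And>x. x \<in> carrier M \<Longrightarrow> f x = g x"
  shows "f = g"
  using assms by (meson extensionalityI ghomD(6))

lemma ghomI:
  assumes "group_module k G M"
    and "\<And>x. x \<in> carrier M \<Longrightarrow> f x \<in> carrier N"
    and "\<And>x y. \<lbrakk>x \<in> carrier M; y \<in> carrier M\<rbrakk> \<Longrightarrow> f (x \<oplus>\<^bsub>M\<^esub> y) = f x \<oplus>\<^bsub>N\<^esub> f y"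
    and "\<And>a x. \<lbrakk>a \<in> carrier k; x \<in> carrier M\<rbrakk> \<Longrightarrow> f (a \<odot>\<^bsub>M\<^esub> x) = a \<odot>\<^bsub>N\<^esub> f x"
    and "\<And>g x. \<lbrakk>g \<in> carrier G; x \<in> carrier M\<rbrakk> \<Longrightarrow> f (act M g x) = act N g (f x)"
  shows "restrict f (carrier M) \<in> ghom k G M N"
proof -
  interpret group_module k G M by fact
  show ?thesis using assms(2-) by (auto simp: ghom_def linear_maps_def)
qed

lemma ghom_zero:
  assumes "f \<in> ghom k G M N" "group_module k G M" "group_module k G N"
  shows "f \<zero>\<^bsub>M\<^esub> = \<zero>\<^bsub>N\<^esub>"
  using assms linear_maps_zero[of f k M N] by (auto simp: ghom_def group_module_iff is_gmodule_def)

lemma ghom_minus: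
  assumes "f \<in> ghom k G M N" "group_module k G M" "group_module k G N"
    and "x \<in> carrier M" "y \<in> carrier M"
  shows "f (x \<ominus>\<^bsub>M\<^esub> y) = f x \<ominus>\<^bsub>N\<^esub> f y"
proof -
  interpret M: group_module k G M by fact
  interpret N: group_module k G N by fact
  show ?thesis using assms(4,5) ghomD[OF assms(1)] by (simp add: M.minus_as_smult N.minus_as_smult)
qed

lemma ghom_compose:
  assumes "f \<in> ghom k G M N" "g \<in> ghom k G N P" "group_module k G M"
  shows "compose (carrier M) g f \<in> ghom k G M P"
  unfolding compose_def using assms by (intro ghomI) (auto simp: ghomD)

lemma ghom_id: "group_module k G M \<Longrightarrow> (\<lambda>x \<in> carrier M. x) \<in> ghom k G M M"
  by (rule ghomI) auto

lemma ghom_inj_onI: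
  assumes "f \<in> ghom k G M N" "group_module k G M" "group_module k G N"
    and "\<And>x. \<lbrakk>x \<in> carrier M; f x = \<zero>\<^bsub>N\<^esub>\<rbrakk> \<Longrightarrow> x = \<zero>\<^bsub>M\<^esub>"
  shows "inj_on f (carrier M)"
proof (rule inj_onI)
  interpret M: group_module k G M by fact
  interpret N: group_module k G N by fact
  fix x y assume xy: "x \<in> carrier M" "y \<in> carrier M" "f x = f y"
  then have "f (x \<ominus>\<^bsub>M\<^esub> y) = \<zero>\<^bsub>N\<^esub>"
    by (simp add: ghom_minus[OF assms(1-3)] N.minus_eq_zero_iff ghomD[OF assms(1)])
  then show "x = y" using xy assms(4)[of "x \<ominus>\<^bsub>M\<^esub> y"] by (simp add: M.minus_eq_zero_iff)
qed

text \<open>Preimages under an injective \<open>f\<close> are unique, so linearity and equivariance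
  of \<open>h\<close> pass to them. This is the universal property of a kernel; retractions are
  built with it.\<close>

lemma ghom_inv_into:
  assumes f: "f \<in> ghom k G M N" and inj: "inj_on f (carrier M)"
    and h: "h \<in> ghom k G P N" "h ` carrier P \<subseteq> f ` carrier M"
    and M: "group_module k G M" and P: "group_module k G P"
  shows "\<exists>r \<in> ghom k G P M. \<forall>x \<in> carrier P. f (r x) = h x"
proof -
  interpret M: group_module k G M by fact
  interpret P: group_module k G P by fact
  define r where "r x = inv_into (carrier M) f (h x)" for x
  have fr: "f (r x) = h x" and rc: "r x \<in> carrier M" if "x \<in> carrier P" for x
    using h(2) that by (auto simp: r_def f_inv_into_f inv_into_into image_subset_iff)
  have "restrict r (carrier P) \<in> ghom k G P M"
    by (rule ghomI[OF P]) (auto intro!: inj_onD[OF inj] simp: rc fr ghomD[OF f] ghomD[OF h(1)])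
  then show ?thesis by (intro bexI) (auto simp: fr)
qed

lemma group_module_sub:
  assumes "group_module k G M" "S \<subseteq> carrier M" "\<zero>\<^bsub>M\<^esub> \<in> S"
    and "\<And>x y. \<lbrakk>x \<in> S; y \<in> S\<rbrakk> \<Longrightarrow> x \<oplus>\<^bsub>M\<^esub> y \<in> S"
    and "\<And>a x. \<lbrakk>a \<in> carrier k; x \<in> S\<rbrakk> \<Longrightarrow> a \<odot>\<^bsub>M\<^esub> x \<in> S"
    and "\<And>g x. \<lbrakk>g \<in> carrier G; x \<in> S\<rbrakk> \<Longrightarrow> act M g x \<in> S"
  shows "group_module k G (M\<lparr>carrier := S\<rparr>)"
proof -
  interpret M: group_module k G M by fact
  have *: "x \<in> carrier M" if "x \<in> S" for x using that assms(2) by auto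
  show ?thesis
    by (rule group_moduleI)
      (use * assms(3-) in \<open>auto simp: M.M.a_ac M.smult_l_distr M.smult_r_distr
        M.smult_assoc1 M.act_add M.act_smult M.act_mult M.R.cring_axioms M.G.group_axioms\<close>)
qed


subsection \<open>Restriction\<close>

lemma res_gmodule_simps [simp]:
  "carrier (res_gmodule i M) = carrier M"
  "zero (res_gmodule i M) = zero M"
  "add (res_gmodule i M) = add M"
  "smult (res_gmodule i M) = smult M"
  "act (res_gmodule i M) h = act M (i h)"
  by (simp_all add: res_gmodule_def)

text \<open>An equality of records, so a module over \<open>G\<close> is literally the same object
  when it is regarded as a module over a subgroup.\<close>

lemma res_gmodule_id [simp]: "res_gmodule (\<lambda>g. g) M = M"
  by (simp add: res_gmodule_def)

lemma res_gmodule_res: "res_gmodule i (res_gmodule j M) = res_gmodule (\<lambda>x. j (i x)) M"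
  by (simp add: res_gmodule_def)

lemma group_module_res:
  assumes "group_module k G M" "group H" "i \<in> hom H G"
  shows "group_module k H (res_gmodule i M)"
proof -
  interpret M: group_module k G M by fact
  interpret i: group_hom H G i
    using assms by (simp add: group_hom_def group_hom_axioms_def M.G.group_axioms)
  show ?thesis
    by (rule group_moduleI) (auto simp: M.M.a_ac M.smult_l_distr M.smult_r_distr
        M.smult_assoc1 M.act_add M.act_smult M.act_mult M.R.cring_axioms assms(2))
qed

lemma ghom_res:
  "f \<in> ghom k G M N \<Longrightarrow> i \<in> hom H G \<Longrightarrow> f \<in> ghom k H (res_gmodule i M) (res_gmodule i N)"
  by (auto simp: ghom_def linear_maps_def hom_def)


subsection \<open>Small modules\<close>

text \<open>Measures sets of an arbitrary type against \<open>U\<close>: coinduced modules and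
  direct sums do not live on the type of \<open>U\<close>.\<close>

definition small :: "'u set set \<Rightarrow> 'c set \<Rightarrow> bool" where
  "small U X \<longleftrightarrow> (\<exists>A \<in> U. X \<lesssim> A)"

text \<open>The share of \<open>module_universe\<close> that mentions neither \<open>k\<close> nor
  \<open>G\<close>; it serves \<open>G\<close>, \<open>H\<close>, their finite subgroups and the
  trivial group alike.\<close>

definition set_universe :: "'u set set \<Rightarrow> bool" where
  "set_universe U \<longleftrightarrow>
    (\<exists>A \<in> U. A \<noteq> {}) \<and> (\<forall>A \<in> U. \<forall>B. B \<lesssim> A \<longrightarrow> B \<in> U) \<and> closed_under_powers (UNIV :: nat set) U"

lemma small_lepoll: "X \<lesssim> Y \<Longrightarrow> small U Y \<Longrightarrow> small U X"
  unfolding small_def by (meson lepoll_trans)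

lemma small_subset: "X \<subseteq> Y \<Longrightarrow> small U Y \<Longrightarrow> small U X"
  by (meson small_lepoll subset_imp_lepoll)

lemma small_mem: "X \<in> U \<Longrightarrow> small U X"
  unfolding small_def by auto

lemma small_PiE:
  assumes "closed_under_powers I U" "small U X"
  shows "small U (I \<rightarrow>\<^sub>E X)"
proof -
  obtain A where "A \<in> U" and A: "X \<lesssim> A" using assms(2) by (auto simp: small_def)
  then obtain B where "B \<in> U" and B: "(I \<rightarrow>\<^sub>E A) \<approx> B"
    using assms(1) by (auto simp: closed_under_powers_def)
  have "(I \<rightarrow>\<^sub>E X) \<lesssim> (I \<rightarrow>\<^sub>E A)" using A by (intro lepoll_PiE)
  then show ?thesis using \<open>B \<in> U\<close> B unfolding small_def by (meson lepoll_trans2)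
qed

text \<open>A family over \<open>J\<close> is spread over \<open>I\<close> along an injection and
  padded with one fixed element of \<open>X\<close>; the padding is why \<open>X\<close> has to be
  inhabited.\<close>

lemma small_PiE_lepoll:
  assumes "closed_under_powers I U" "small U X" "J \<lesssim> I" "X \<noteq> {}"
  shows "small U (J \<rightarrow>\<^sub>E X)"
proof -
  obtain x where x: "x \<in> X" using assms(4) by auto
  obtain e where e: "inj_on e J" "e ` J \<subseteq> I" using assms(3) by (auto simp: lepoll_def)
  define \<Phi> where "\<Phi> f = (\<lambda>t \<in> I. if t \<in> e ` J then f (inv_into J e t) else x)" for f
  have "inj_on \<Phi> (J \<rightarrow>\<^sub>E X)"
  proof (rule inj_onI)
    fix f f' assume f: "f \<in> J \<rightarrow>\<^sub>E X" "f' \<in> J \<rightarrow>\<^sub>E X" and eq: "\<Phi> f = \<Phi> f'"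
    have "f j = f' j" if "j \<in> J" for j
    proof -
      have "\<Phi> f (e j) = \<Phi> f' (e j)" using eq by simp
      then show ?thesis using that e by (auto simp: \<Phi>_def)
    qed
    then show "f = f'" by (rule PiE_ext[OF f])
  qed
  moreover have "\<Phi> \<in> (J \<rightarrow>\<^sub>E X) \<rightarrow> (I \<rightarrow>\<^sub>E X)"
    using x e by (auto simp: \<Phi>_def PiE_iff)
  ultimately have "(J \<rightarrow>\<^sub>E X) \<lesssim> (I \<rightarrow>\<^sub>E X)" unfolding lepoll_def' by blast
  then show ?thesis by (rule small_lepoll) (rule small_PiE[OF assms(1,2)])
qed

lemma lepoll_linear: "A \<lesssim> B \<or> B \<lesssim> A"
  unfolding lepoll_def using ordLeq_total[OF card_of_Well_order card_of_Well_order, of A B]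
  by (auto simp: card_of_ordLeq)

text \<open>Comparability of cardinals puts both factors into one member \<open>C\<close> of
  \<open>U\<close>. A pair is then coded as a sequence in \<open>C\<close> whose entry 0 is the
  first component and whose other entries are the second.\<close>

lemma small_Times:
  fixes U :: "'u set set"
  assumes U: "set_universe U" and X: "small U X" and Y: "small U Y"
  shows "small U (X \<times> Y)"
proof -
  obtain A B where AB: "A \<in> U" "X \<lesssim> A" "B \<in> U" "Y \<lesssim> B" using X Y by (auto simp: small_def)
  have "\<exists>C \<in> U. X \<lesssim> C \<and> Y \<lesssim> C"
    using lepoll_linear[of A B] AB by (meson lepoll_trans)
  then obtain C where C: "C \<in> U" "X \<lesssim> C" "Y \<lesssim> C" by blast
  obtain e where e: "inj_on e X" "e ` X \<subseteq> C" using C by (auto simp: lepoll_def)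
  obtain e' where e': "inj_on e' Y" "e' ` Y \<subseteq> C" using C by (auto simp: lepoll_def)
  define \<Phi> where "\<Phi> = (\<lambda>(x, y). \<lambda>n :: nat. if n = 0 then e x else e' y)"
  have "inj_on \<Phi> (X \<times> Y)"
  proof (rule inj_onI, clarify)
    fix x y x' y' assume xy: "x \<in> X" "y \<in> Y" "x' \<in> X" "y' \<in> Y" and eq: "\<Phi> (x, y) = \<Phi> (x', y')"
    show "x = x' \<and> y = y'"
      using fun_cong[OF eq, of 0] fun_cong[OF eq, of 1] xy e(1) e'(1)
      by (auto simp: \<Phi>_def dest: inj_onD)
  qed
  moreover have "\<Phi> \<in> X \<times> Y \<rightarrow> ((UNIV :: nat set) \<rightarrow>\<^sub>E C)"
    using e(2) e'(2) by (auto simp: \<Phi>_def image_subset_iff)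
  ultimately have "X \<times> Y \<lesssim> ((UNIV :: nat set) \<rightarrow>\<^sub>E C)" unfolding lepoll_def' by blast
  moreover have "small U ((UNIV :: nat set) \<rightarrow>\<^sub>E C)"
    using U C(1) by (intro small_PiE) (auto simp: set_universe_def small_mem)
  ultimately show ?thesis by (rule small_lepoll)
qed

definition transport_gmodule :: "('b \<Rightarrow> 'u) \<Rightarrow> ('k, 'b, 'g) gmodule \<Rightarrow> ('k, 'u, 'g) gmodule" where
  "transport_gmodule b M = (let c = inv_into (carrier M) b in
    \<lparr> carrier = b ` carrier M, mult = undefined, one = undefined, zero = b \<zero>\<^bsub>M\<^esub>,
      add = (\<lambda>x y. b (c x \<oplus>\<^bsub>M\<^esub> c y)), smult = (\<lambda>a x. b (a \<odot>\<^bsub>M\<^esub> c x)),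
      act = (\<lambda>g x. b (act M g (c x))) \<rparr>)"

text \<open>The way back into the category: a small module on any type is replaced by an object
  along mutually inverse isomorphisms \<open>b\<close> and \<open>c\<close>.\<close>

lemma small_gmodule_copy:
  fixes M :: "('k, 'b, 'g) gmodule" and U :: "'u set set"
  assumes U: "set_universe U" and M: "group_module k G M" and small: "small U (carrier M)"
  obtains N b c where "N \<in> gmod U k G" "b \<in> ghom k G M N" "c \<in> ghom k G N M"
    "\<And>x. x \<in> carrier M \<Longrightarrow> c (b x) = x" "\<And>y. y \<in> carrier N \<Longrightarrow> b (c y) = y"
proof -
  interpret M: group_module k G M by fact
  obtain A where "A \<in> U" "carrier M \<lesssim> A" using small by (auto simp: small_def)
  then obtain b where b: "inj_on b (carrier M)" "b ` carrier M \<subseteq> A" by (auto simp: lepoll_def)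
  define N where "N = transport_gmodule b M"
  define c where "c = inv_into (carrier M) b"
  have [simp]: "c (b x) = x" if "x \<in> carrier M" for x using b(1) that by (simp add: c_def)
  have N [simp]: "carrier N = b ` carrier M" "\<zero>\<^bsub>N\<^esub> = b \<zero>\<^bsub>M\<^esub>" "x \<oplus>\<^bsub>N\<^esub> y = b (c x \<oplus>\<^bsub>M\<^esub> c y)"
    "a \<odot>\<^bsub>N\<^esub> x = b (a \<odot>\<^bsub>M\<^esub> c x)" "act N g x = b (act M g (c x))" for a g x y
    by (simp_all add: N_def transport_gmodule_def Let_def c_def)
  have gmN: "group_module k G N"
    by (rule group_moduleI) (auto simp: M.M.a_ac M.smult_l_distr M.smult_r_distr
        M.smult_assoc1 M.act_add M.act_smult M.act_mult M.R.cring_axioms M.G.group_axioms)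
  have "carrier N \<lesssim> A" using b(2) by (simp add: subset_imp_lepoll)
  then have "carrier N \<in> U" using U \<open>A \<in> U\<close> by (auto simp: set_universe_def)
  then have "N \<in> gmod U k G" using gmN by (simp add: gmod_def group_module_iff)
  moreover have "restrict b (carrier M) \<in> ghom k G M N" by (rule ghomI[OF M]) auto
  moreover have "restrict c (carrier N) \<in> ghom k G N M" by (rule ghomI[OF gmN]) auto
  ultimately show ?thesis by (rule that) auto
qed

lemma gmodD: "M \<in> gmod U k G \<Longrightarrow> group G \<Longrightarrow> group_module k G M"
  "M \<in> gmod U k G \<Longrightarrow> carrier M \<in> U"
  "M \<in> gmod U k G \<Longrightarrow> small U (carrier M)"
  by (auto simp: gmod_def group_module_iff small_mem)


section \<open>Extensions\<close>

lemma ghom_diff: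
  assumes "f \<in> ghom k G M N" "g \<in> ghom k G M N" "group_module k G M" "group_module k G N"
  shows "(\<lambda>x \<in> carrier M. f x \<ominus>\<^bsub>N\<^esub> g x) \<in> ghom k G M N"
proof -
  interpret M: group_module k G M by fact
  interpret N: group_module k G N by fact
  note f = ghomD(2-5)[OF assms(1)] and g = ghomD(2-5)[OF assms(2)]
  show ?thesis
    by (rule ghomI[OF assms(3)])
      (simp_all add: f g N.minus_as_smult N.smult_r_distr N.act_add N.act_smult N.M.a_ac
        M.m_comm flip: N.smult_assoc1)
qed

lemma ghom_add:
  assumes "f \<in> ghom k G M N" "g \<in> ghom k G M N" "group_module k G M" "group_module k G N"
  shows "(\<lambda>x \<in> carrier M. f x \<oplus>\<^bsub>N\<^esub> g x) \<in> ghom k G M N"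
proof -
  interpret M: group_module k G M by fact
  interpret N: group_module k G N by fact
  note f = ghomD(2-5)[OF assms(1)] and g = ghomD(2-5)[OF assms(2)]
  show ?thesis
    by (rule ghomI[OF assms(3)])
      (simp_all add: f g N.smult_r_distr N.act_add N.act_smult N.M.a_ac)
qed

text \<open>The universal property of a cokernel with chosen preimages instead of cosets: two
  preimages of one point differ by an element of the kernel of \<open>p\<close>, which
  \<open>f\<close> kills.\<close>

lemma ghom_factor:
  assumes p: "p \<in> ghom k G M N" "p ` carrier M = carrier N" and f: "f \<in> ghom k G M P"
    and ker: "\<And>x. \<lbrakk>x \<in> carrier M; p x = \<zero>\<^bsub>N\<^esub>\<rbrakk> \<Longrightarrow> f x = \<zero>\<^bsub>P\<^esub>"
    and M: "group_module k G M" and N: "group_module k G N" and P: "group_module k G P"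
  shows "\<exists>s \<in> ghom k G N P. \<forall>x \<in> carrier M. s (p x) = f x"
proof -
  interpret M: group_module k G M by fact
  interpret N: group_module k G N by fact
  interpret P: group_module k G P by fact
  define s where "s = (\<lambda>y \<in> carrier N. f (inv_into (carrier M) p y))"
  have s: "s (p x) = f x" if x: "x \<in> carrier M" for x
  proof -
    let ?x' = "inv_into (carrier M) p (p x)"
    have x': "?x' \<in> carrier M" "p ?x' = p x" using x by (auto intro: inv_into_into f_inv_into_f)
    then have "p (?x' \<ominus>\<^bsub>M\<^esub> x) = \<zero>\<^bsub>N\<^esub>"
      using x by (simp add: ghom_minus[OF p(1) M N] ghomD(2)[OF p(1)] N.minus_eq_zero_iff)
    then have "f (?x' \<ominus>\<^bsub>M\<^esub> x) = \<zero>\<^bsub>P\<^esub>" using ker x x' by simp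
    then have "f ?x' = f x"
      using x x' by (simp add: ghom_minus[OF f M P] ghomD(2)[OF f] P.minus_eq_zero_iff)
    then show ?thesis using x ghomD(2)[OF p(1)] by (simp add: s_def)
  qed
  have ex: "\<exists>x \<in> carrier M. y = p x" if "y \<in> carrier N" for y using that p(2) by auto
  have "restrict s (carrier N) \<in> ghom k G N P"
  proof (rule ghomI[OF N])
    fix y assume "y \<in> carrier N"
    then show "s y \<in> carrier P" using ex s ghomD(2)[OF f] by metis
  next
    fix y y' assume "y \<in> carrier N" "y' \<in> carrier N"
    then obtain x x' where "x \<in> carrier M" "x' \<in> carrier M" "y = p x" "y' = p x'" using ex by metis
    then show "s (y \<oplus>\<^bsub>N\<^esub> y') = s y \<oplus>\<^bsub>P\<^esub> s y'"
      using s[of "x \<oplus>\<^bsub>M\<^esub> x'"] by (simp add: s ghomD[OF f] ghomD[OF p(1)])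
  next
    fix a y assume "a \<in> carrier k" "y \<in> carrier N"
    then obtain x where "x \<in> carrier M" "y = p x" using ex by metis
    then show "s (a \<odot>\<^bsub>N\<^esub> y) = a \<odot>\<^bsub>P\<^esub> s y"
      using \<open>a \<in> carrier k\<close> s[of "a \<odot>\<^bsub>M\<^esub> x"] by (simp add: s ghomD[OF f] ghomD[OF p(1)])
  next
    fix g y assume "g \<in> carrier G" "y \<in> carrier N"
    then obtain x where "x \<in> carrier M" "y = p x" using ex by metis
    then show "s (act N g y) = act P g (s y)"
      using \<open>g \<in> carrier G\<close> s[of "act M g x"] by (simp add: s ghomD[OF f] ghomD[OF p(1)])
  qed
  then show ?thesis using s by (intro bexI[of _ s]) (auto simp: s_def)
qed

lemma short_exactD:
  assumes "short_exact k G A B C f p"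
  shows "f \<in> ghom k G A B" "p \<in> ghom k G B C" "inj_on f (carrier A)" "p ` carrier B = carrier C"
    "f ` carrier A = {b \<in> carrier B. p b = \<zero>\<^bsub>C\<^esub>}"
    "a \<in> carrier A \<Longrightarrow> p (f a) = \<zero>\<^bsub>C\<^esub>"
  using assms by (auto simp: short_exact_def)

text \<open>The element \<open>a - s (p a)\<close> is killed by \<open>p\<close>, hence lies in the
  image of \<open>j\<close>, and reading it back through \<open>j\<close> gives
  \<open>r\<close>.\<close>

lemma short_exact_retraction:
  assumes "short_exact k G y e x j p"
    and x: "group_module k G x" and y: "group_module k G y" and e: "group_module k G e"
    and s: "s \<in> ghom k G x e" "\<And>a. a \<in> carrier x \<Longrightarrow> p (s a) = a"
  shows "\<exists>r \<in> ghom k G e y. \<forall>a \<in> carrier e. a = j (r a) \<oplus>\<^bsub>e\<^esub> s (p a)"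
proof -
  interpret x: group_module k G x by fact
  interpret e: group_module k G e by fact
  note se = short_exactD[OF assms(1)]
  define h where "h = (\<lambda>a \<in> carrier e. a \<ominus>\<^bsub>e\<^esub> s (p a))"
  have "(\<lambda>a \<in> carrier e. (\<lambda>a\<in>carrier e. a) a \<ominus>\<^bsub>e\<^esub> compose (carrier e) s p a) \<in> ghom k G e e"
    by (rule ghom_diff[OF ghom_id[OF e] ghom_compose[OF se(2) s(1) e] e e])
  then have h: "h \<in> ghom k G e e"
    unfolding h_def by (rule back_subst[of "\<lambda>f. f \<in> _"]) (auto simp: compose_def)
  have "h ` carrier e \<subseteq> j ` carrier y"
    using s(2) ghomD(2)[OF se(2)] ghomD(2)[OF s(1)]
    by (auto simp: se(5) h_def ghom_minus[OF se(2) e x] x.minus_eq_zero_iff)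
  from ghom_inv_into[OF se(1,3) h this y e]
  obtain r where r: "r \<in> ghom k G e y" "\<forall>a \<in> carrier e. j (r a) = h a" by blast
  show ?thesis
    using r(1) by (rule bexI[rotated]) (simp add: r h_def ghomD(2)[OF se(2)] ghomD(2)[OF s(1)])
qed

text \<open>The map \<open>a - j (r a)\<close> vanishes on the kernel of \<open>p\<close>, so it
  descends along \<open>p\<close> to a section.\<close>

lemma short_exact_section:
  assumes "short_exact k G y e x j p"
    and x: "group_module k G x" and y: "group_module k G y" and e: "group_module k G e"
    and r: "r \<in> ghom k G e y" "\<And>a. a \<in> carrier y \<Longrightarrow> r (j a) = a"
  shows "\<exists>s \<in> ghom k G x e. \<forall>a \<in> carrier x. p (s a) = a"
proof -
  interpret x: group_module k G x by fact
  interpret e: group_module k G e by fact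
  note se = short_exactD[OF assms(1)]
  define h where "h = (\<lambda>a \<in> carrier e. a \<ominus>\<^bsub>e\<^esub> j (r a))"
  have "(\<lambda>a \<in> carrier e. (\<lambda>a\<in>carrier e. a) a \<ominus>\<^bsub>e\<^esub> compose (carrier e) j r a) \<in> ghom k G e e"
    by (rule ghom_diff[OF ghom_id[OF e] ghom_compose[OF r(1) se(1) e] e e])
  then have h: "h \<in> ghom k G e e"
    unfolding h_def by (rule back_subst[of "\<lambda>f. f \<in> _"]) (auto simp: compose_def)
  have "h a = \<zero>\<^bsub>e\<^esub>" if a: "a \<in> carrier e" "p a = \<zero>\<^bsub>x\<^esub>" for a
  proof -
    obtain b where "b \<in> carrier y" "a = j b" using a se(5) by auto
    then show ?thesis using a by (simp add: h_def r(2) e.minus_eq_zero_iff)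
  qed
  from ghom_factor[OF se(2,4) h this e x e]
  obtain s where s: "s \<in> ghom k G x e" "\<forall>a \<in> carrier e. s (p a) = h a" by blast
  have "p (s a) = a" if a: "a \<in> carrier x" for a
  proof -
    obtain b where b: "b \<in> carrier e" "a = p b" using a se(4) by auto
    then show ?thesis
      using s(2) ghomD(2)[OF se(2)] ghomD(2)[OF se(1)] ghomD(2)[OF r(1)]
      by (simp add: h_def ghom_minus[OF se(2) e x] se(6) x.M.minus_eq)
  qed
  then show ?thesis using s(1) by blast
qed

text \<open>The extension of \<open>Y\<close> by \<open>W\<close> with cocycle \<open>c\<close>; for \<open>c = 0\<close> it is the direct sum.\<close>

definition twisted_sum ::
  "('g \<Rightarrow> 'c \<Rightarrow> 'b) \<Rightarrow> ('k, 'b, 'g) gmodule \<Rightarrow> ('k, 'c, 'g) gmodule \<Rightarrow> ('k, 'b \<times> 'c, 'g) gmodule"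
where
  "twisted_sum c W Y =
    \<lparr> carrier = carrier W \<times> carrier Y, mult = undefined, one = undefined,
      zero = (\<zero>\<^bsub>W\<^esub>, \<zero>\<^bsub>Y\<^esub>),
      add = (\<lambda>u v. (fst u \<oplus>\<^bsub>W\<^esub> fst v, snd u \<oplus>\<^bsub>Y\<^esub> snd v)),
      smult = (\<lambda>a u. (a \<odot>\<^bsub>W\<^esub> fst u, a \<odot>\<^bsub>Y\<^esub> snd u)),
      act = (\<lambda>g u. (act W g (fst u) \<oplus>\<^bsub>W\<^esub> c g (snd u), act Y g (snd u))) \<rparr>"

lemma twisted_sum_simps [simp]:
  "carrier (twisted_sum c W Y) = carrier W \<times> carrier Y"
  "\<zero>\<^bsub>twisted_sum c W Y\<^esub> = (\<zero>\<^bsub>W\<^esub>, \<zero>\<^bsub>Y\<^esub>)"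
  "u \<oplus>\<^bsub>twisted_sum c W Y\<^esub> v = (fst u \<oplus>\<^bsub>W\<^esub> fst v, snd u \<oplus>\<^bsub>Y\<^esub> snd v)"
  "a \<odot>\<^bsub>twisted_sum c W Y\<^esub> u = (a \<odot>\<^bsub>W\<^esub> fst u, a \<odot>\<^bsub>Y\<^esub> snd u)"
  "act (twisted_sum c W Y) g u = (act W g (fst u) \<oplus>\<^bsub>W\<^esub> c g (snd u), act Y g (snd u))"
  by (simp_all add: twisted_sum_def)

text \<open>\<open>c1\<close> and \<open>cm\<close> are the normalised cocycle identities for
  \<open>c\<close> with values in the linear maps from \<open>Y\<close> to \<open>W\<close>; they
  say precisely that the twisted action respects unit and multiplication.\<close>

lemma group_module_twisted_sum:
  assumes W: "group_module k G W" and Y: "group_module k G Y"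
    and c: "\<And>g. g \<in> carrier G \<Longrightarrow> restrict (c g) (carrier Y) \<in> linear_maps k Y W"
    and c1: "\<And>v. v \<in> carrier Y \<Longrightarrow> c \<one>\<^bsub>G\<^esub> v = \<zero>\<^bsub>W\<^esub>"
    and cm: "\<And>g h v. \<lbrakk>g \<in> carrier G; h \<in> carrier G; v \<in> carrier Y\<rbrakk> \<Longrightarrow>
      c (g \<otimes>\<^bsub>G\<^esub> h) v = act W g (c h v) \<oplus>\<^bsub>W\<^esub> c g (act Y h v)"
  shows "group_module k G (twisted_sum c W Y)"
proof -
  interpret W: group_module k G W by fact
  interpret Y: group_module k G Y by fact
  have cl [simp]: "c g v \<in> carrier W" if "g \<in> carrier G" "v \<in> carrier Y" for g v
    using linear_mapsD(1)[OF c] that by fastforce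
  have ca: "c g (v \<oplus>\<^bsub>Y\<^esub> w) = c g v \<oplus>\<^bsub>W\<^esub> c g w"
    if "g \<in> carrier G" "v \<in> carrier Y" "w \<in> carrier Y" for g v w
    using linear_mapsD(2)[OF c[OF that(1)] that(2,3)] that by simp
  have cs: "c g (a \<odot>\<^bsub>Y\<^esub> v) = a \<odot>\<^bsub>W\<^esub> c g v"
    if "g \<in> carrier G" "a \<in> carrier k" "v \<in> carrier Y" for g v a
    using linear_mapsD(3)[OF c[OF that(1)] that(2,3)] that by simp
  show ?thesis
    by (rule group_moduleI) (auto simp: W.M.a_ac Y.M.a_ac W.smult_l_distr W.smult_r_distr
        W.smult_assoc1 Y.smult_l_distr Y.smult_r_distr Y.smult_assoc1 W.act_add W.act_smult
        W.act_mult Y.act_add Y.act_smult Y.act_mult W.R.cring_axioms W.G.group_axioms ca cs c1 cm)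
qed

lemma group_module_direct_sum:
  assumes "group_module k G W" "group_module k G Y"
  shows "group_module k G (twisted_sum (\<lambda>_ _. \<zero>\<^bsub>W\<^esub>) W Y)"
proof -
  interpret W: group_module k G W by fact
  interpret Y: group_module k G Y by fact
  show ?thesis
    by (rule group_module_twisted_sum[OF assms]) (auto simp: linear_maps_def)
qed

text \<open>Extensions are built with a middle term on a product type. Here the middle term is
  exchanged for an object of the category, so that a hypothesis on \<open>Ext1_zero\<close> can be
  applied.\<close>

lemma short_exact_transport:
  fixes e' :: "('k, 'c, 'g) gmodule"
  assumes U: "set_universe U" and e': "group_module k G e'" and sm: "small U (carrier e')"
    and x: "group_module k G x" and y: "group_module k G y"
    and j: "j \<in> ghom k G y e'" "inj_on j (carrier y)"
    and p: "p \<in> ghom k G e' x" "p ` carrier e' = carrier x"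
    and ex: "j ` carrier y = {b \<in> carrier e'. p b = \<zero>\<^bsub>x\<^esub>}"
  obtains e b c where "e \<in> gmod U k G" "b \<in> ghom k G e' e" "c \<in> ghom k G e e'"
    "short_exact k G y e x (compose (carrier y) b j) (compose (carrier e) p c)"
    "\<And>v. v \<in> carrier e' \<Longrightarrow> c (b v) = v"
proof -
  obtain e b c where e: "e \<in> gmod U k G" and b: "b \<in> ghom k G e' e" and c: "c \<in> ghom k G e e'"
    and cb: "\<And>x. x \<in> carrier e' \<Longrightarrow> c (b x) = x" and bc: "\<And>y. y \<in> carrier e \<Longrightarrow> b (c y) = y"
    using small_gmodule_copy[OF U e' sm] by metis
  interpret e': group_module k G e' by fact
  have gme: "group_module k G e" using e e'.G.group_axioms by (rule gmodD)
  have "short_exact k G y e x (compose (carrier y) b j) (compose (carrier e) p c)"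
    unfolding short_exact_def
  proof (intro conjI)
    show "inj_on (compose (carrier y) b j) (carrier y)"
      by (rule inj_onI) (use j(2) cb ghomD(2)[OF j(1)] in \<open>metis compose_eq inj_onD\<close>)
    show "compose (carrier e) p c ` carrier e = carrier x"
    proof (intro equalityI subsetI)
      fix v assume "v \<in> carrier x"
      then obtain u where "u \<in> carrier e'" "v = p u" using p by auto
      then have "v = compose (carrier e) p c (b u)" "b u \<in> carrier e"
        using ghomD(2)[OF b] by (simp_all add: compose_def cb)
      then show "v \<in> compose (carrier e) p c ` carrier e" by blast
    qed (use ghomD(2)[OF c] ghomD(2)[OF p(1)] in \<open>auto simp: compose_def\<close>)
    show "compose (carrier y) b j ` carrier y = {b \<in> carrier e. compose (carrier e) p c b = \<zero>\<^bsub>x\<^esub>}"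
    proof (intro equalityI subsetI)
      fix v assume "v \<in> compose (carrier y) b j ` carrier y"
      then obtain a where a: "a \<in> carrier y" "v = b (j a)" by (auto simp: compose_def)
      then have "p (j a) = \<zero>\<^bsub>x\<^esub>" using ex by auto
      then show "v \<in> {b \<in> carrier e. compose (carrier e) p c b = \<zero>\<^bsub>x\<^esub>}"
        using a ghomD(2)[OF b] ghomD(2)[OF j(1)] by (simp add: compose_def cb)
    next
      fix v assume v: "v \<in> {b \<in> carrier e. compose (carrier e) p c b = \<zero>\<^bsub>x\<^esub>}"
      then have "c v \<in> j ` carrier y" using ghomD(2)[OF c] by (auto simp: ex compose_def)
      then obtain a where "a \<in> carrier y" "c v = j a" by auto
      then have "v = compose (carrier y) b j a" using v bc[of v] by (simp add: compose_def)
      then show "v \<in> compose (carrier y) b j ` carrier y" using \<open>a \<in> carrier y\<close> by blast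
    qed
  qed (use ghom_compose[OF j(1) b y] ghom_compose[OF c p(1) gme] in auto)
  then show ?thesis using that e b c cb by blast
qed

text \<open>One congruence class means that every extension receives a map from the direct sum, and
  the inclusion of \<open>x\<close> into the direct sum followed by that map is a section.
  Conversely, sections of two extensions provide a congruence between them.\<close>

lemma Ext1_zero_iff:
  fixes U :: "'u set set"
  assumes U: "set_universe U" and G: "group G" and x: "x \<in> gmod U k G" and y: "y \<in> gmod U k G"
  shows "Ext1_zero U k G x y \<longleftrightarrow>
    (\<forall>e \<in> gmod U k G. \<forall>j p. short_exact k G y e x j p \<longrightarrow>
      (\<exists>s \<in> ghom k G x e. \<forall>a \<in> carrier x. p (s a) = a))" (is "?E \<longleftrightarrow> ?S")
proof -
  interpret x: group_module k G x using x G by (rule gmodD)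
  interpret y: group_module k G y using y G by (rule gmodD)
  note xg = x.group_module_axioms and yg = y.group_module_axioms
  let ?A = "extensions U k G x y" and ?R = "ext_congruence U k G x y"
  define D where "D = twisted_sum (\<lambda>_ _. \<zero>\<^bsub>y\<^esub>) y x"
  have D: "group_module k G D" unfolding D_def by (rule group_module_direct_sum) fact+
  define j0 where "j0 = (\<lambda>a \<in> carrier y. (a, \<zero>\<^bsub>x\<^esub>))"
  define p0 where "p0 = (\<lambda>a \<in> carrier D. snd a)"
  define s0 where "s0 = (\<lambda>a \<in> carrier x. (\<zero>\<^bsub>y\<^esub>, a))"
  have j0: "j0 \<in> ghom k G y D" unfolding j0_def by (rule ghomI) (auto simp: D_def yg)
  have p0: "p0 \<in> ghom k G D x" unfolding p0_def by (rule ghomI[OF D]) (auto simp: D_def)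
  have s0: "s0 \<in> ghom k G x D" unfolding s0_def by (rule ghomI) (auto simp: D_def xg)
  obtain E b c where E: "E \<in> gmod U k G" and b: "b \<in> ghom k G D E" and c: "c \<in> ghom k G E D"
    and seE: "short_exact k G y E x (compose (carrier y) b j0) (compose (carrier E) p0 c)"
    and cb: "\<And>v. v \<in> carrier D \<Longrightarrow> c (b v) = v"
  proof (rule short_exact_transport[OF U D _ xg yg j0 _ p0])
    show "small U (carrier D)"
      unfolding D_def using small_Times[OF U gmodD(3)[OF y] gmodD(3)[OF x]] by simp
    show "p0 ` carrier D = carrier x" "inj_on j0 (carrier y)"
      "j0 ` carrier y = {b \<in> carrier D. p0 b = \<zero>\<^bsub>x\<^esub>}"
      by (auto simp: p0_def D_def image_iff j0_def inj_on_def)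
  qed blast
  have Ein: "(E, compose (carrier y) b j0, compose (carrier E) p0 c) \<in> ?A"
    using E seE by (simp add: extensions_def)
  have "?R `` {X} = ?R `` {Y}" if ?E "X \<in> ?A" "Y \<in> ?A" for X Y
  proof -
    have "?R `` {X} \<in> Ext1 U k G x y" "?R `` {Y} \<in> Ext1 U k G x y"
      using that by (auto simp: Ext1_def intro: quotientI)
    then show ?thesis using \<open>?E\<close> by (auto simp: Ext1_zero_def is_singleton_def)
  qed
  \<comment> \<open>Reflexivity places \<open>Y\<close> in its own class; as all classes coincide,
    \<open>Y\<close> then lies in the class of \<open>X\<close>, which yields a morphism from
    \<open>X\<close> to \<open>Y\<close> without proving symmetry.\<close>
  moreover have refl: "(X, X) \<in> ?R" if X: "X \<in> ?A" for X
  proof -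
    obtain e j p where X': "X = (e, j, p)" by (cases X)
    have e: "group_module k G e" "short_exact k G y e x j p"
      using X X' G by (auto simp: extensions_def gmodD)
    note se = short_exactD[OF e(2)]
    have "compose (carrier y) (\<lambda>x \<in> carrier e. x) j = j"
      by (rule ghom_eqI[OF ghom_compose[OF se(1) ghom_id[OF e(1)] yg] se(1)])
        (simp add: compose_def ghomD(2)[OF se(1)])
    moreover have "compose (carrier e) p (\<lambda>x \<in> carrier e. x) = p"
      by (rule ghom_eqI[OF ghom_compose[OF ghom_id[OF e(1)] se(2) e(1)] se(2)])
        (simp add: compose_def)
    ultimately show ?thesis
      using X X' ghom_id[OF e(1)] by (auto simp: ext_congruence_def)
  qed
  ultimately have rel: "(X, Y) \<in> ?R" if ?E "X \<in> ?A" "Y \<in> ?A" for X Y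
    using that by blast
  show ?thesis
  proof
    assume ?E
    show ?S
    proof (intro ballI allI impI)
      fix e j p assume e: "e \<in> gmod U k G" and se: "short_exact k G y e x j p"
      \<comment> \<open>The morphism is taken out of the split extension, so that the copy of
        \<open>x\<close> inside it can be pushed forward to \<open>e\<close>.\<close>
      have "((E, compose (carrier y) b j0, compose (carrier E) p0 c), (e, j, p)) \<in> ?R"
        by (rule rel[OF \<open>?E\<close> Ein]) (use e se in \<open>simp add: extensions_def\<close>)
      then obtain f where f: "f \<in> ghom k G E e"
        and pf: "compose (carrier E) p f = compose (carrier E) p0 c"
        by (auto simp: ext_congruence_def)
      have "compose (carrier x) f (compose (carrier x) b s0) \<in> ghom k G x e"
        by (intro ghom_compose[OF _ f] ghom_compose[OF s0 b] xg)
      moreover have "p (f (b (s0 a))) = a" if "a \<in> carrier x" for a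
      proof -
        have "b (s0 a) \<in> carrier E" "s0 a \<in> carrier D"
          using that ghomD(2)[OF s0] ghomD(2)[OF b] by auto
        then show ?thesis
          using fun_cong[OF pf, of "b (s0 a)"] that
          by (simp add: compose_def cb) (simp add: s0_def p0_def)
      qed
      ultimately show "\<exists>s \<in> ghom k G x e. \<forall>a \<in> carrier x. p (s a) = a"
        by (intro bexI) (auto simp: compose_def)
    qed
  next
    assume S: ?S
    have rel: "(X, Y) \<in> ?R" if X: "X \<in> ?A" and Y: "Y \<in> ?A" for X Y
    proof -
      obtain e j p e' j' p' where X': "X = (e, j, p)" and Y': "Y = (e', j', p')"
        by (cases X, cases Y)
      have e: "group_module k G e" "e \<in> gmod U k G" "short_exact k G y e x j p"
        and e': "group_module k G e'" "e' \<in> gmod U k G" "short_exact k G y e' x j' p'"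
        using X X' Y Y' G by (auto simp: extensions_def gmodD)
      interpret e: group_module k G e by fact
      interpret e': group_module k G e' by fact
      note se = short_exactD[OF e(3)] and se' = short_exactD[OF e'(3)]
      obtain s where s: "s \<in> ghom k G x e" "\<And>a. a \<in> carrier x \<Longrightarrow> p (s a) = a"
        using S e by blast
      obtain s' where s': "s' \<in> ghom k G x e'" "\<And>a. a \<in> carrier x \<Longrightarrow> p' (s' a) = a"
        using S e' by blast
      obtain r where r: "r \<in> ghom k G e y" "\<And>a. a \<in> carrier e \<Longrightarrow> a = j (r a) \<oplus>\<^bsub>e\<^esub> s (p a)"
        using short_exact_retraction[OF e(3) xg yg e(1) s] by blast
      have s0: "s \<zero>\<^bsub>x\<^esub> = \<zero>\<^bsub>e\<^esub>" "s' \<zero>\<^bsub>x\<^esub> = \<zero>\<^bsub>e'\<^esub>"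
        using ghom_zero[OF s(1) xg e(1)] ghom_zero[OF s'(1) xg e'(1)] by auto
      have rj: "r (j a) = a" if "a \<in> carrier y" for a
      proof -
        have "j a = j (r (j a)) \<oplus>\<^bsub>e\<^esub> \<zero>\<^bsub>e\<^esub>"
          using r(2)[of "j a"] that s0 by (simp add: se(6) ghomD(2)[OF se(1)])
        then have "j (r (j a)) = j a"
          using that ghomD(2)[OF se(1)] ghomD(2)[OF r(1)] by simp
        then show ?thesis using that se(3) ghomD(2)[OF se(1)] ghomD(2)[OF r(1)] by (auto dest: inj_onD)
      qed
      \<comment> \<open>Decompose along \<open>j\<close> and \<open>s\<close> in the first
        extension, reassemble along \<open>j'\<close> and \<open>s'\<close> in the second.\<close>
      define f where "f = (\<lambda>a \<in> carrier e. j' (r a) \<oplus>\<^bsub>e'\<^esub> s' (p a))"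
      have "(\<lambda>a \<in> carrier e. compose (carrier e) j' r a \<oplus>\<^bsub>e'\<^esub> compose (carrier e) s' p a) \<in> ghom k G e e'"
        by (intro ghom_add ghom_compose[OF r(1) se'(1)] ghom_compose[OF se(2) s'(1)] e e')
      then have f: "f \<in> ghom k G e e'"
        unfolding f_def by (rule back_subst[of "\<lambda>f. f \<in> _"]) (auto simp: compose_def)
      have "compose (carrier y) f j = j'"
        by (rule ghom_eqI[OF ghom_compose[OF se(1) f yg] se'(1)])
          (simp add: compose_def f_def ghomD(2)[OF se(1)] rj se(6) s0 ghomD(2)[OF se'(1)])
      moreover have "compose (carrier e) p' f = p"
        by (rule ghom_eqI[OF ghom_compose[OF f se'(2) e(1)] se(2)])
          (simp add: compose_def f_def ghomD(2,3)[OF se'(2)] ghomD(2)[OF se(2)] se'(6)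
            ghomD(2)[OF se'(1)] ghomD(2)[OF r(1)] ghomD(2)[OF s'(1)] s'(2))
      ultimately show ?thesis using X Y f by (auto simp: ext_congruence_def X' Y')
    qed
    have "?R `` {X} = ?A" if "X \<in> ?A" for X
      using rel[OF that] by (auto simp: ext_congruence_def)
    then have "Ext1 U k G x y = {?A}"
      using Ein by (auto simp: Ext1_def quotient_def)
    then show ?E by (simp add: Ext1_zero_def)
  qed
qed

lemma Ext1_zeroI_retraction:
  assumes U: "set_universe U" and G: "group G" and x: "x \<in> gmod U k G" and y: "y \<in> gmod U k G"
    and r: "\<And>e j p. \<lbrakk>e \<in> gmod U k G; short_exact k G y e x j p\<rbrakk> \<Longrightarrow>
      \<exists>r \<in> ghom k G e y. \<forall>a \<in> carrier y. r (j a) = a"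
  shows "Ext1_zero U k G x y"
  unfolding Ext1_zero_iff[OF assms(1-4)]
  using short_exact_section[OF _ gmodD(1)[OF x G] gmodD(1)[OF y G] gmodD(1)[OF _ G]] r by metis

text \<open>Pulling an extension back along \<open>f\<close> and splitting the result lifts \<open>f\<close>.\<close>

lemma Ext1_zero_lift:
  fixes U :: "'u set set" and E :: "('k, 'c, 'g) gmodule" and B :: "('k, 'd, 'g) gmodule"
  assumes U: "set_universe U" and G: "group G" and x: "x \<in> gmod U k G" and y: "y \<in> gmod U k G"
    and ext: "Ext1_zero U k G x y"
    and E: "group_module k G E" "small U (carrier E)" and B: "group_module k G B"
    and q: "q \<in> ghom k G y E" "inj_on q (carrier y)"
    and p: "p \<in> ghom k G E B"
    and ker: "q ` carrier y = {b \<in> carrier E. p b = \<zero>\<^bsub>B\<^esub>}"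
    and f: "f \<in> ghom k G x B" "f ` carrier x \<subseteq> p ` carrier E"
  shows "\<exists>s \<in> ghom k G x E. \<forall>a \<in> carrier x. p (s a) = f a"
proof -
  interpret x: group_module k G x using x G by (rule gmodD)
  interpret y: group_module k G y using y G by (rule gmodD)
  interpret E: group_module k G E by fact
  interpret B: group_module k G B by fact
  note xg = x.group_module_axioms and yg = y.group_module_axioms
  \<comment> \<open>The fibre product of \<open>p\<close> and \<open>f\<close>. It projects onto
    \<open>x\<close> because the image of \<open>f\<close> lies in that of \<open>p\<close>, and the
    kernel of this projection is the copy of \<open>y\<close> under \<open>q\<close>.\<close>
  define S where "S = {u \<in> carrier E \<times> carrier x. p (fst u) = f (snd u)}"
  define D where "D = (twisted_sum (\<lambda>_ _. \<zero>\<^bsub>E\<^esub>) E x)\<lparr>carrier := S\<rparr>"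
  have p0: "p \<zero>\<^bsub>E\<^esub> = \<zero>\<^bsub>B\<^esub>" "f \<zero>\<^bsub>x\<^esub> = \<zero>\<^bsub>B\<^esub>"
    using ghom_zero[OF p E(1) B] ghom_zero[OF f(1) xg B] by auto
  have D: "group_module k G D"
    unfolding D_def
    by (rule group_module_sub[OF group_module_direct_sum[OF E(1) xg]])
      (auto simp: S_def p0 ghomD(2-5)[OF p] ghomD(2-5)[OF f(1)])
  have Ds [simp]: "carrier D = S" "\<zero>\<^bsub>D\<^esub> = (\<zero>\<^bsub>E\<^esub>, \<zero>\<^bsub>x\<^esub>)"
    "u \<oplus>\<^bsub>D\<^esub> v = (fst u \<oplus>\<^bsub>E\<^esub> fst v, snd u \<oplus>\<^bsub>x\<^esub> snd v)"
    "a \<odot>\<^bsub>D\<^esub> u = (a \<odot>\<^bsub>E\<^esub> fst u, a \<odot>\<^bsub>x\<^esub> snd u)"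
    "act D g u = (act E g (fst u) \<oplus>\<^bsub>E\<^esub> \<zero>\<^bsub>E\<^esub>, act x g (snd u))" for u v a g
    by (simp_all add: D_def)
  define j0 where "j0 = (\<lambda>a \<in> carrier y. (q a, \<zero>\<^bsub>x\<^esub>))"
  define p1 where "p1 = (\<lambda>a \<in> carrier D. snd a)"
  define p2 where "p2 = (\<lambda>a \<in> carrier D. fst a)"
  have qk: "p (q a) = \<zero>\<^bsub>B\<^esub>" if "a \<in> carrier y" for a using ker that by auto
  have j0: "j0 \<in> ghom k G y D"
    unfolding j0_def by (rule ghomI) (auto simp: yg S_def qk p0 ghomD(2-5)[OF q(1)])
  have p1: "p1 \<in> ghom k G D x" unfolding p1_def by (rule ghomI[OF D]) (auto simp: S_def)
  have p2: "p2 \<in> ghom k G D E" unfolding p2_def by (rule ghomI[OF D]) (auto simp: S_def)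
  obtain E' b c where E': "E' \<in> gmod U k G" and b: "b \<in> ghom k G D E'" and c: "c \<in> ghom k G E' D"
    and seE: "short_exact k G y E' x (compose (carrier y) b j0) (compose (carrier E') p1 c)"
  proof (rule short_exact_transport[OF U D _ xg yg j0 _ p1])
    have "small U (carrier E \<times> carrier x)" by (rule small_Times[OF U E(2) gmodD(3)[OF x]])
    then show "small U (carrier D)" by (rule small_subset[rotated]) (auto simp: S_def)
    show "p1 ` carrier D = carrier x"
    proof (intro equalityI subsetI)
      fix a assume a: "a \<in> carrier x"
      then obtain b where "b \<in> carrier E" "f a = p b" using f by auto
      then have "(b, a) \<in> S" using a by (simp add: S_def)
      then have "p1 (b, a) = a" "(b, a) \<in> carrier D" by (simp_all add: p1_def)
      then show "a \<in> p1 ` carrier D" by force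
    qed (auto simp: p1_def S_def)
    show "inj_on j0 (carrier y)"
      using q(2) by (auto simp: j0_def inj_on_def)
    show "j0 ` carrier y = {b \<in> carrier D. p1 b = \<zero>\<^bsub>x\<^esub>}"
    proof (intro equalityI subsetI)
      fix v assume "v \<in> {b \<in> carrier D. p1 b = \<zero>\<^bsub>x\<^esub>}"
      then have v: "snd v = \<zero>\<^bsub>x\<^esub>" "fst v \<in> carrier E" "p (fst v) = \<zero>\<^bsub>B\<^esub>"
        by (auto simp: p1_def S_def p0)
      then obtain a where "a \<in> carrier y" "fst v = q a" using ker by auto
      then have "v = j0 a" using v(1) by (simp add: j0_def prod_eq_iff)
      then show "v \<in> j0 ` carrier y" using \<open>a \<in> carrier y\<close> by blast
    qed (auto simp: j0_def p1_def S_def qk p0 ghomD(2)[OF q(1)])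
  qed blast
  obtain s where s: "s \<in> ghom k G x E'"
    "\<forall>a \<in> carrier x. compose (carrier E') p1 c (s a) = a"
    using ext E' seE unfolding Ext1_zero_iff[OF U G x y] by blast
  \<comment> \<open>A section of the pulled-back extension, followed by the projection to
    \<open>E\<close>, is the wanted lift.\<close>
  have "compose (carrier x) p2 (compose (carrier x) c s) \<in> ghom k G x E"
    by (intro ghom_compose[OF _ p2] ghom_compose[OF s(1) c] xg)
  moreover have "p (p2 (c (s a))) = f a" if a: "a \<in> carrier x" for a
  proof -
    have sa: "s a \<in> carrier E'" using a ghomD(2)[OF s(1)] by auto
    then have ca: "c (s a) \<in> S" using ghomD(2)[OF c] by auto
    have "p1 (c (s a)) = a" using bspec[OF s(2) a] sa by (simp add: compose_def)
    then show ?thesis using ca by (simp add: p1_def p2_def S_def)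
  qed
  ultimately show ?thesis by (intro bexI) (auto simp: compose_def)
qed

text \<open>Given a \<open>k\<close>-linear section \<open>\<sigma>\<close>, the push-out of \<open>E\<close> along \<open>\<phi>\<close> has the underlying
  \<open>k\<close>-module \<open>w \<times> y\<close>, which avoids forming a quotient. With \<open>\<psi>\<close> the \<open>k\<close>-linear extension of
  \<open>\<phi>\<close> that vanishes on \<open>\<sigma>\<close>, its cocycle is \<open>(g, v) \<mapsto> \<psi> (g \<sigma> v)\<close>.\<close>

lemma Ext1_zero_extend:
  fixes U :: "'u set set"
  assumes U: "set_universe U" and G: "group G" and y: "y \<in> gmod U k G" and w: "w \<in> gmod U k G"
    and ext: "Ext1_zero U k G y w"
    and E: "group_module k G E" and A: "group_module k G A"
    and j: "j \<in> ghom k G A E" "inj_on j (carrier A)"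
    and p: "p \<in> ghom k G E y"
    and ker: "j ` carrier A = {b \<in> carrier E. p b = \<zero>\<^bsub>y\<^esub>}"
    and \<sigma>: "\<sigma> \<in> linear_maps k y E" "\<And>v. v \<in> carrier y \<Longrightarrow> p (\<sigma> v) = v"
    and \<phi>: "\<phi> \<in> ghom k G A w"
  shows "\<exists>\<psi> \<in> ghom k G E w. \<forall>a \<in> carrier A. \<psi> (j a) = \<phi> a"
proof -
  interpret y: group_module k G y using y G by (rule gmodD)
  interpret w: group_module k G w using w G by (rule gmodD)
  interpret E: group_module k G E by fact
  interpret A: group_module k G A by fact
  note yg = y.group_module_axioms and wg = w.group_module_axioms
  note \<sigma>s = linear_mapsD(1-3)[OF \<sigma>(1)] and ps = ghomD(2-5)[OF p] and js = ghomD(2-5)[OF j(1)]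
    and \<phi>s = ghomD(2-5)[OF \<phi>]
  \<comment> \<open>The \<open>k\<close>-linear projection of \<open>E\<close> onto \<open>A\<close>
    along \<open>\<sigma>\<close>; it need not be equivariant because \<open>\<sigma>\<close> is
    not.\<close>
  define \<alpha> where "\<alpha> b = inv_into (carrier A) j (b \<ominus>\<^bsub>E\<^esub> \<sigma> (p b))" for b
  have \<alpha>: "\<alpha> b \<in> carrier A" "j (\<alpha> b) = b \<ominus>\<^bsub>E\<^esub> \<sigma> (p b)" if "b \<in> carrier E" for b
  proof -
    have "b \<ominus>\<^bsub>E\<^esub> \<sigma> (p b) \<in> j ` carrier A"
      using that by (auto simp: ker ghom_minus[OF p E yg] \<sigma>s ps \<sigma>(2) y.minus_eq_zero_iff)
    then show "\<alpha> b \<in> carrier A" "j (\<alpha> b) = b \<ominus>\<^bsub>E\<^esub> \<sigma> (p b)"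
      by (auto simp: \<alpha>_def f_inv_into_f intro: inv_into_into)
  qed
  have \<alpha>_add: "\<alpha> (b \<oplus>\<^bsub>E\<^esub> b') = \<alpha> b \<oplus>\<^bsub>A\<^esub> \<alpha> b'" if "b \<in> carrier E" "b' \<in> carrier E" for b b'
    by (rule inj_onD[OF j(2)])
      (use that in \<open>simp_all add: \<alpha> js ps \<sigma>s E.minus_as_smult E.smult_r_distr E.M.a_ac\<close>)
  have \<alpha>_smult: "\<alpha> (a \<odot>\<^bsub>E\<^esub> b) = a \<odot>\<^bsub>A\<^esub> \<alpha> b" if "a \<in> carrier k" "b \<in> carrier E" for a b
    by (rule inj_onD[OF j(2)])
      (use that in \<open>simp_all add: \<alpha> js ps \<sigma>s E.minus_as_smult E.smult_r_distr y.m_comm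
        flip: E.smult_assoc1\<close>)
  have pj: "p (j a) = \<zero>\<^bsub>y\<^esub>" if "a \<in> carrier A" for a using that ker by auto
  have \<sigma>0: "\<sigma> \<zero>\<^bsub>y\<^esub> = \<zero>\<^bsub>E\<^esub>"
    using linear_maps_zero[OF \<sigma>(1)] y.module_axioms E.module_axioms by auto
  have \<alpha>j: "\<alpha> (j a) = a" if "a \<in> carrier A" for a
    by (rule inj_onD[OF j(2)]) (use that in \<open>simp_all add: \<alpha> js pj \<sigma>0 E.M.minus_eq\<close>)
  define \<psi> where "\<psi> b = \<phi> (\<alpha> b)" for b
  have \<psi>s: "b \<in> carrier E \<Longrightarrow> \<psi> b \<in> carrier w"
    "b \<in> carrier E \<Longrightarrow> b' \<in> carrier E \<Longrightarrow> \<psi> (b \<oplus>\<^bsub>E\<^esub> b') = \<psi> b \<oplus>\<^bsub>w\<^esub> \<psi> b'"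
    "a \<in> carrier k \<Longrightarrow> b \<in> carrier E \<Longrightarrow> \<psi> (a \<odot>\<^bsub>E\<^esub> b) = a \<odot>\<^bsub>w\<^esub> \<psi> b" for b b' a
    by (simp_all add: \<psi>_def \<alpha> \<alpha>_add \<alpha>_smult \<phi>s)
  \<comment> \<open>The term \<open>\<psi> (g \<sigma> (p b))\<close> measures how far
    \<open>\<psi>\<close> is from being equivariant, and it depends on \<open>b\<close> only through
    \<open>p b\<close>.\<close>
  have \<psi>_act: "\<psi> (act E g b) = act w g (\<psi> b) \<oplus>\<^bsub>w\<^esub> \<psi> (act E g (\<sigma> (p b)))"
    if g: "g \<in> carrier G" and b: "b \<in> carrier E" for g b
  proof -
    have [simp]: "\<sigma> (p b) \<in> carrier E" using b by (simp add: \<sigma>s ps)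
    have b_eq: "b = j (\<alpha> b) \<oplus>\<^bsub>E\<^esub> \<sigma> (p b)" using b by (simp add: \<alpha>)
    have "\<psi> (act E g b) = \<psi> (act E g (j (\<alpha> b) \<oplus>\<^bsub>E\<^esub> \<sigma> (p b)))" using b_eq by simp
    also have "\<dots> = \<psi> (j (act A g (\<alpha> b))) \<oplus>\<^bsub>w\<^esub> \<psi> (act E g (\<sigma> (p b)))"
      using g b by (simp add: E.act_add \<psi>s \<alpha>(1) js)
    also have "\<psi> (j (act A g (\<alpha> b))) = act w g (\<psi> b)"
      using g b by (simp add: \<psi>_def \<alpha>j \<alpha>(1) \<phi>s)
    finally show ?thesis .
  qed
  have \<psi>\<sigma>: "\<psi> (\<sigma> v) = \<zero>\<^bsub>w\<^esub>" if "v \<in> carrier y" for v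
  proof -
    have "\<alpha> (\<sigma> v) = \<zero>\<^bsub>A\<^esub>"
      by (rule inj_onD[OF j(2)])
        (use that in \<open>simp_all add: \<alpha> \<sigma>s \<sigma>(2) E.minus_eq_zero_iff ghom_zero[OF j(1) A E]\<close>)
    then show ?thesis by (simp add: \<psi>_def ghom_zero[OF \<phi> A wg])
  qed
  define c where "c g v = \<psi> (act E g (\<sigma> v))" for g v
  define D where "D = twisted_sum c w y"
  have D: "group_module k G D"
    unfolding D_def
  proof (rule group_module_twisted_sum[OF wg yg])
    fix g assume "g \<in> carrier G"
    then show "restrict (c g) (carrier y) \<in> linear_maps k y w"
      by (auto simp: linear_maps_def c_def \<sigma>s \<psi>s E.act_add E.act_smult)
  next
    \<comment> \<open>The cocycle identity is \<open>\<psi>_act\<close> at the element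
      \<open>h \<sigma> v\<close>, whose image under \<open>p\<close> is \<open>h v\<close>.\<close>
    fix g h v assume "g \<in> carrier G" "h \<in> carrier G" "v \<in> carrier y"
    then show "c (g \<otimes>\<^bsub>G\<^esub> h) v = act w g (c h v) \<oplus>\<^bsub>w\<^esub> c g (act y h v)"
      by (simp add: c_def E.act_mult \<sigma>s \<psi>_act[of g "act E h (\<sigma> v)"] ps \<sigma>(2))
  qed (simp add: c_def \<sigma>s \<psi>\<sigma>)
  define j0 where "j0 = (\<lambda>a \<in> carrier w. (a, \<zero>\<^bsub>y\<^esub>))"
  define p0 where "p0 = (\<lambda>a \<in> carrier D. snd a)"
  define q0 where "q0 a = fst a" for a :: "'u \<times> 'u"
  have c0: "c g \<zero>\<^bsub>y\<^esub> = \<zero>\<^bsub>w\<^esub>" if "g \<in> carrier G" for g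
    using that \<psi>\<sigma>[of "\<zero>\<^bsub>y\<^esub>"] by (simp add: c_def \<sigma>0)
  have cc: "c g v \<in> carrier w" if "g \<in> carrier G" "v \<in> carrier y" for g v
    using that by (simp add: c_def \<psi>s \<sigma>s)
  have j0: "j0 \<in> ghom k G w D" unfolding j0_def by (rule ghomI) (auto simp: D_def wg c0)
  have p0: "p0 \<in> ghom k G D y" unfolding p0_def by (rule ghomI[OF D]) (auto simp: D_def cc)
  obtain E' b c' where E': "E' \<in> gmod U k G" and b: "b \<in> ghom k G D E'" and c': "c' \<in> ghom k G E' D"
    and seE: "short_exact k G w E' y (compose (carrier w) b j0) (compose (carrier E') p0 c')"
  proof (rule short_exact_transport[OF U D _ yg wg j0 _ p0])
    show "small U (carrier D)"
      unfolding D_def using small_Times[OF U gmodD(3)[OF w] gmodD(3)[OF y]] by simp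
    show "p0 ` carrier D = carrier y" "inj_on j0 (carrier w)"
      "j0 ` carrier w = {b \<in> carrier D. p0 b = \<zero>\<^bsub>y\<^esub>}"
      by (auto simp: p0_def D_def image_iff j0_def inj_on_def)
  qed blast
  obtain s where s: "s \<in> ghom k G y E'"
    "\<forall>a \<in> carrier y. compose (carrier E') p0 c' (s a) = a"
    using ext E' seE unfolding Ext1_zero_iff[OF U G y w] by blast
  define t where "t = compose (carrier y) c' s"
  have t: "t \<in> ghom k G y D" unfolding t_def by (rule ghom_compose[OF s(1) c' yg])
  note ts = ghomD(2-5)[OF t]
  have t2: "snd (t v) = v" if "v \<in> carrier y" for v
  proof -
    have "s v \<in> carrier E'" "c' (s v) \<in> carrier D"
      using that ghomD(2)[OF s(1)] ghomD(2)[OF c'] by auto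
    then show ?thesis using bspec[OF s(2) that] that by (simp add: compose_def p0_def t_def)
  qed
  have t1 [simp]: "fst (t v) \<in> carrier w" if "v \<in> carrier y" for v
    using ts(1)[OF that] by (auto simp: D_def)
  \<comment> \<open>The first component of the section \<open>t\<close> has the same equivariance
    defect as \<open>\<psi>\<close>, so the difference is equivariant. On the image of
    \<open>j\<close> the correction vanishes, since \<open>p j = 0\<close>.\<close>
  define \<rho> where "\<rho> b = \<psi> b \<ominus>\<^bsub>w\<^esub> fst (t (p b))" for b
  have "restrict \<rho> (carrier E) \<in> ghom k G E w"
  proof (rule ghomI[OF E])
    fix g b assume gb: "g \<in> carrier G" "b \<in> carrier E"
    let ?u = "fst (t (p b))" and ?c = "\<psi> (act E g (\<sigma> (p b)))"
    have [simp]: "?u \<in> carrier w" "?c \<in> carrier w" "\<psi> b \<in> carrier w"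
      using gb by (simp_all add: ps \<psi>s \<sigma>s)
    have "fst (t (p (act E g b))) = act w g ?u \<oplus>\<^bsub>w\<^esub> ?c"
      using gb by (simp add: ps ts t2 D_def c_def)
    then have "\<rho> (act E g b) = (act w g (\<psi> b) \<oplus>\<^bsub>w\<^esub> ?c) \<ominus>\<^bsub>w\<^esub> (act w g ?u \<oplus>\<^bsub>w\<^esub> ?c)"
      using gb by (simp add: \<rho>_def \<psi>_act[of g b])
    also have "\<dots> = act w g (\<psi> b) \<ominus>\<^bsub>w\<^esub> act w g ?u"
      using gb by (simp add: w.M.minus_eq w.M.minus_add w.M.a_ac w.M.r_neg1 w.M.r_neg2 w.M.r_neg)
    finally show "\<rho> (act E g b) = act w g (\<rho> b)"
      using gb by (simp add: \<rho>_def w.act_minus)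
  qed (simp_all add: \<rho>_def \<psi>s ps ts D_def w.minus_as_smult w.smult_r_distr w.M.a_ac y.m_comm
      flip: w.smult_assoc1)
  moreover have "\<rho> (j a) = \<phi> a" if "a \<in> carrier A" for a
    using that by (simp add: \<rho>_def \<psi>_def \<alpha>j pj ghom_zero[OF t yg D] D_def \<phi>s w.M.minus_eq)
  ultimately show ?thesis by (intro bexI) (auto simp: js)
qed


section \<open>Induced and coinduced modules\<close>

text \<open>This is the module of \<open>kH\<close>-linear maps from \<open>kG\<close> to
  \<open>M\<close>, with the argument inverted so that \<open>G\<close> acts by left translation, as
  it does on \<open>bounded_functions\<close>.\<close>

definition coind_gmodule ::
  "'g monoid \<Rightarrow> 'h monoid \<Rightarrow> ('h \<Rightarrow> 'g) \<Rightarrow> ('k, 'b, 'h) gmodule \<Rightarrow> ('k, 'g \<Rightarrow> 'b, 'g) gmodule"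
where
  "coind_gmodule G H i M =
    \<lparr> carrier = {f \<in> carrier G \<rightarrow>\<^sub>E carrier M. \<forall>h \<in> carrier H. \<forall>x \<in> carrier G.
        f (x \<otimes>\<^bsub>G\<^esub> i h) = act M (inv\<^bsub>H\<^esub> h) (f x)},
      mult = undefined, one = undefined,
      zero = (\<lambda>x \<in> carrier G. \<zero>\<^bsub>M\<^esub>),
      add = (\<lambda>f f'. \<lambda>x \<in> carrier G. f x \<oplus>\<^bsub>M\<^esub> f' x),
      smult = (\<lambda>a f. \<lambda>x \<in> carrier G. a \<odot>\<^bsub>M\<^esub> f x),
      act = (\<lambda>g f. \<lambda>x \<in> carrier G. f (inv\<^bsub>G\<^esub> g \<otimes>\<^bsub>G\<^esub> x)) \<rparr>"

text \<open>The induced module is realised as the functions in the coinduced one whose support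
  meets only finitely many cosets of the image of \<open>H\<close>.\<close>

definition ind_gmodule ::
  "'g monoid \<Rightarrow> 'h monoid \<Rightarrow> ('h \<Rightarrow> 'g) \<Rightarrow> ('k, 'b, 'h) gmodule \<Rightarrow> ('k, 'g \<Rightarrow> 'b, 'g) gmodule"
where
  "ind_gmodule G H i M = (coind_gmodule G H i M)\<lparr>carrier :=
     {f \<in> carrier (coind_gmodule G H i M). \<exists>S. finite S \<and> S \<subseteq> carrier G \<and>
        (\<forall>x \<in> carrier G. f x \<noteq> \<zero>\<^bsub>M\<^esub> \<longrightarrow> (\<exists>s \<in> S. \<exists>h \<in> carrier H. x = s \<otimes>\<^bsub>G\<^esub> i h))}\<rparr>"

text \<open>Corresponds to \<open>1\<close> tensor \<open>m\<close>: the value at the unit of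
  \<open>G\<close> is \<open>m\<close>, and the coset condition then forces \<open>h^-1 m\<close> at
  \<open>i h\<close>.\<close>

definition ind_unit ::
  "'g monoid \<Rightarrow> 'h monoid \<Rightarrow> ('h \<Rightarrow> 'g) \<Rightarrow> ('k, 'b, 'h) gmodule \<Rightarrow> 'b \<Rightarrow> 'g \<Rightarrow> 'b"
where
  "ind_unit G H i M m = (\<lambda>x \<in> carrier G. if x \<in> i ` carrier H
     then act M (inv\<^bsub>H\<^esub> (inv_into (carrier H) i x)) m else \<zero>\<^bsub>M\<^esub>)"

text \<open>The action of coinduction on morphisms; restricted to functions with finite support
  modulo \<open>H\<close>, the same formula gives induction on morphisms.\<close>

definition coind_map ::
  "'g monoid \<Rightarrow> 'h monoid \<Rightarrow> ('h \<Rightarrow> 'g) \<Rightarrow> ('k, 'b, 'h) gmodule \<Rightarrow> ('b \<Rightarrow> 'c) \<Rightarrow>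
   ('g \<Rightarrow> 'b) \<Rightarrow> 'g \<Rightarrow> 'c"
where
  "coind_map G H i M f = (\<lambda>s \<in> carrier (coind_gmodule G H i M). \<lambda>x \<in> carrier G. f (s x))"

lemma coind_gmodule_simps [simp]:
  "\<zero>\<^bsub>coind_gmodule G H i M\<^esub> = (\<lambda>x \<in> carrier G. \<zero>\<^bsub>M\<^esub>)"
  "f \<oplus>\<^bsub>coind_gmodule G H i M\<^esub> f' = (\<lambda>x \<in> carrier G. f x \<oplus>\<^bsub>M\<^esub> f' x)"
  "a \<odot>\<^bsub>coind_gmodule G H i M\<^esub> f = (\<lambda>x \<in> carrier G. a \<odot>\<^bsub>M\<^esub> f x)"
  "act (coind_gmodule G H i M) g f = (\<lambda>x \<in> carrier G. f (inv\<^bsub>G\<^esub> g \<otimes>\<^bsub>G\<^esub> x))"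
  by (simp_all add: coind_gmodule_def)

lemma ind_gmodule_simps [simp]:
  "\<zero>\<^bsub>ind_gmodule G H i M\<^esub> = (\<lambda>x \<in> carrier G. \<zero>\<^bsub>M\<^esub>)"
  "f \<oplus>\<^bsub>ind_gmodule G H i M\<^esub> f' = (\<lambda>x \<in> carrier G. f x \<oplus>\<^bsub>M\<^esub> f' x)"
  "a \<odot>\<^bsub>ind_gmodule G H i M\<^esub> f = (\<lambda>x \<in> carrier G. a \<odot>\<^bsub>M\<^esub> f x)"
  "act (ind_gmodule G H i M) g f = (\<lambda>x \<in> carrier G. f (inv\<^bsub>G\<^esub> g \<otimes>\<^bsub>G\<^esub> x))"
  by (simp_all add: ind_gmodule_def)

lemma coind_carrierD:
  assumes "f \<in> carrier (coind_gmodule G H i M)"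
  shows "f \<in> extensional (carrier G)"
    and "x \<in> carrier G \<Longrightarrow> f x \<in> carrier M"
    and "\<lbrakk>x \<in> carrier G; h \<in> carrier H\<rbrakk> \<Longrightarrow> f (x \<otimes>\<^bsub>G\<^esub> i h) = act M (inv\<^bsub>H\<^esub> h) (f x)"
  using assms by (auto simp: coind_gmodule_def PiE_iff)

lemma coind_carrierI:
  assumes "f \<in> extensional (carrier G)"
    and "\<And>x. x \<in> carrier G \<Longrightarrow> f x \<in> carrier M"
    and "\<And>x h. \<lbrakk>x \<in> carrier G; h \<in> carrier H\<rbrakk> \<Longrightarrow> f (x \<otimes>\<^bsub>G\<^esub> i h) = act M (inv\<^bsub>H\<^esub> h) (f x)"
  shows "f \<in> carrier (coind_gmodule G H i M)"
  using assms by (auto simp: coind_gmodule_def PiE_iff)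

lemma coind_eqI:
  assumes "f \<in> carrier (coind_gmodule G H i M)" "f' \<in> carrier (coind_gmodule G H i M')"
    and "\<And>x. x \<in> carrier G \<Longrightarrow> f x = f' x"
  shows "f = f'"
  using coind_carrierD(1)[OF assms(1)] coind_carrierD(1)[OF assms(2)] assms(3)
  by (rule extensionalityI)

lemma ind_carrier_subset: "carrier (ind_gmodule G H i M) \<subseteq> carrier (coind_gmodule G H i M)"
  by (auto simp: ind_gmodule_def)

lemma ind_carrierI:
  assumes "f \<in> carrier (coind_gmodule G H i M)" "finite S" "S \<subseteq> carrier G"
    and "\<And>x. \<lbrakk>x \<in> carrier G; f x \<noteq> \<zero>\<^bsub>M\<^esub>\<rbrakk> \<Longrightarrow> \<exists>s \<in> S. \<exists>h \<in> carrier H. x = s \<otimes>\<^bsub>G\<^esub> i h"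
  shows "f \<in> carrier (ind_gmodule G H i M)"
  using assms by (auto simp: ind_gmodule_def)

lemma ind_carrierE:
  assumes "f \<in> carrier (ind_gmodule G H i M)"
  obtains S where "f \<in> carrier (coind_gmodule G H i M)" "finite S" "S \<subseteq> carrier G"
    "\<And>x. \<lbrakk>x \<in> carrier G; f x \<noteq> \<zero>\<^bsub>M\<^esub>\<rbrakk> \<Longrightarrow> \<exists>s \<in> S. \<exists>h \<in> carrier H. x = s \<otimes>\<^bsub>G\<^esub> i h"
  using assms by (auto simp: ind_gmodule_def)

locale group_embedding = G: group G + H: group H
  for G :: "'g monoid" and H :: "'h monoid" +
  fixes i :: "'h \<Rightarrow> 'g"
  assumes hom: "i \<in> hom H G" and inj: "inj_on i (carrier H)"
begin

sublocale i: group_hom H G i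
  by unfold_locales (rule hom)

lemma i_simps [simp]:
  "h \<in> carrier H \<Longrightarrow> i h \<in> carrier G"
  "h \<in> carrier H \<Longrightarrow> h' \<in> carrier H \<Longrightarrow> i (h \<otimes>\<^bsub>H\<^esub> h') = i h \<otimes>\<^bsub>G\<^esub> i h'"
  "i \<one>\<^bsub>H\<^esub> = \<one>\<^bsub>G\<^esub>"
  "h \<in> carrier H \<Longrightarrow> i (inv\<^bsub>H\<^esub> h) = inv\<^bsub>G\<^esub> i h"
  by auto

lemma group_module_coind:
  assumes "group_module k H M"
  shows "group_module k G (coind_gmodule G H i M)"
proof -
  interpret M: group_module k H M by fact
  note D = coind_carrierD(2,3)
  note ext = extensionalityI[of _ "carrier G"]
  show ?thesis
  proof (rule group_moduleI)
    show "\<zero>\<^bsub>k\<^esub> \<odot>\<^bsub>coind_gmodule G H i M\<^esub> f = \<zero>\<^bsub>coind_gmodule G H i M\<^esub>"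
      if "f \<in> carrier (coind_gmodule G H i M)" for f
      by (rule ext) (use that in \<open>auto simp: D\<close>)
    show "\<zero>\<^bsub>coind_gmodule G H i M\<^esub> \<oplus>\<^bsub>coind_gmodule G H i M\<^esub> f = f"
      "\<one>\<^bsub>k\<^esub> \<odot>\<^bsub>coind_gmodule G H i M\<^esub> f = f"
      "act (coind_gmodule G H i M) \<one>\<^bsub>G\<^esub> f = f"
      if "f \<in> carrier (coind_gmodule G H i M)" for f
      by (rule ext; use that coind_carrierD(1)[OF that] in \<open>auto simp: D\<close>)+
    show "act (coind_gmodule G H i M) (g \<otimes>\<^bsub>G\<^esub> h) f =
        act (coind_gmodule G H i M) g (act (coind_gmodule G H i M) h f)"
      if "g \<in> carrier G" "h \<in> carrier G" "f \<in> carrier (coind_gmodule G H i M)" for g h f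
      by (rule ext) (use that in \<open>auto simp: D G.inv_mult_group G.m_assoc\<close>)
    show "act (coind_gmodule G H i M) g f \<in> carrier (coind_gmodule G H i M)"
      if "g \<in> carrier G" "f \<in> carrier (coind_gmodule G H i M)" for g f
    proof (rule coind_carrierI)
      fix x h assume "x \<in> carrier G" "h \<in> carrier H"
      then show "act (coind_gmodule G H i M) g f (x \<otimes>\<^bsub>G\<^esub> i h) =
          act M (inv\<^bsub>H\<^esub> h) (act (coind_gmodule G H i M) g f x)"
        using that D(2)[OF that(2), of "inv\<^bsub>G\<^esub> g \<otimes>\<^bsub>G\<^esub> x" h] by (simp add: G.m_assoc)
    qed (use that in \<open>auto simp: D\<close>)
  qed (auto intro!: coind_carrierI simp: fun_eq_iff D M.act_add M.act_smult M.R.cring_axioms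
        G.is_group M.smult_l_distr M.smult_r_distr M.smult_assoc1 intro: M.M.a_assoc M.M.a_comm)
qed

lemma group_module_ind:
  assumes "group_module k H M"
  shows "group_module k G (ind_gmodule G H i M)"
  unfolding ind_gmodule_def
proof (rule group_module_sub[OF group_module_coind[OF assms]])
  interpret M: group_module k H M by fact
  interpret C: group_module k G "coind_gmodule G H i M" by (rule group_module_coind) fact
  let ?C = "coind_gmodule G H i M"
  let ?I = "{f \<in> carrier ?C. \<exists>S. finite S \<and> S \<subseteq> carrier G \<and>
        (\<forall>x \<in> carrier G. f x \<noteq> \<zero>\<^bsub>M\<^esub> \<longrightarrow> (\<exists>s \<in> S. \<exists>h \<in> carrier H. x = s \<otimes>\<^bsub>G\<^esub> i h))}"
  have I: "?I = carrier (ind_gmodule G H i M)" by (simp add: ind_gmodule_def)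
  note D = coind_carrierD(2,3)
  show "?I \<subseteq> carrier ?C" by auto
  show "\<zero>\<^bsub>?C\<^esub> \<in> ?I" using C.M.zero_closed by auto
  show "f \<oplus>\<^bsub>?C\<^esub> f' \<in> ?I" if f: "f \<in> ?I" and f': "f' \<in> ?I" for f f'
  proof -
    obtain S where S: "f \<in> carrier ?C" "finite S" "S \<subseteq> carrier G"
      "\<And>x. \<lbrakk>x \<in> carrier G; f x \<noteq> \<zero>\<^bsub>M\<^esub>\<rbrakk> \<Longrightarrow> \<exists>s \<in> S. \<exists>h \<in> carrier H. x = s \<otimes>\<^bsub>G\<^esub> i h"
      using f by auto
    obtain S' where S': "f' \<in> carrier ?C" "finite S'" "S' \<subseteq> carrier G"
      "\<And>x. \<lbrakk>x \<in> carrier G; f' x \<noteq> \<zero>\<^bsub>M\<^esub>\<rbrakk> \<Longrightarrow> \<exists>s \<in> S'. \<exists>h \<in> carrier H. x = s \<otimes>\<^bsub>G\<^esub> i h"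
      using f' by auto
    show ?thesis
      unfolding I
    proof (rule ind_carrierI[of _ _ _ _ _ "S \<union> S'"])
      fix x assume x: "x \<in> carrier G" and "(f \<oplus>\<^bsub>?C\<^esub> f') x \<noteq> \<zero>\<^bsub>M\<^esub>"
      then have "f x \<noteq> \<zero>\<^bsub>M\<^esub> \<or> f' x \<noteq> \<zero>\<^bsub>M\<^esub>" by auto
      then show "\<exists>s \<in> S \<union> S'. \<exists>h \<in> carrier H. x = s \<otimes>\<^bsub>G\<^esub> i h"
        using S(4) S'(4) x by blast
    qed (use S S' C.M.a_closed in auto)
  qed
  show "a \<odot>\<^bsub>?C\<^esub> f \<in> ?I" if a: "a \<in> carrier k" and f: "f \<in> ?I" for a f
  proof -
    obtain S where S: "f \<in> carrier ?C" "finite S" "S \<subseteq> carrier G"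
      "\<And>x. \<lbrakk>x \<in> carrier G; f x \<noteq> \<zero>\<^bsub>M\<^esub>\<rbrakk> \<Longrightarrow> \<exists>s \<in> S. \<exists>h \<in> carrier H. x = s \<otimes>\<^bsub>G\<^esub> i h"
      using f by auto
    show ?thesis
      unfolding I
    proof (rule ind_carrierI[of _ _ _ _ _ S])
      fix x assume x: "x \<in> carrier G" and "(a \<odot>\<^bsub>?C\<^esub> f) x \<noteq> \<zero>\<^bsub>M\<^esub>"
      then have "f x \<noteq> \<zero>\<^bsub>M\<^esub>" using a by auto
      then show "\<exists>s \<in> S. \<exists>h \<in> carrier H. x = s \<otimes>\<^bsub>G\<^esub> i h" using S(4) x by blast
    qed (use S a C.smult_closed in auto)
  qed
  show "act ?C g f \<in> ?I" if g: "g \<in> carrier G" and f: "f \<in> ?I" for g f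
  proof -
    obtain S where S: "f \<in> carrier ?C" "finite S" "S \<subseteq> carrier G"
      "\<And>x. \<lbrakk>x \<in> carrier G; f x \<noteq> \<zero>\<^bsub>M\<^esub>\<rbrakk> \<Longrightarrow> \<exists>s \<in> S. \<exists>h \<in> carrier H. x = s \<otimes>\<^bsub>G\<^esub> i h"
      using f by auto
    show ?thesis
      unfolding I
    \<comment> \<open>Translating a function by \<open>g\<close> translates the cosets that meet its
      support.\<close>
    proof (rule ind_carrierI[of _ _ _ _ _ "(\<lambda>s. g \<otimes>\<^bsub>G\<^esub> s) ` S"])
      fix x assume x: "x \<in> carrier G" and "act ?C g f x \<noteq> \<zero>\<^bsub>M\<^esub>"
      then have "f (inv\<^bsub>G\<^esub> g \<otimes>\<^bsub>G\<^esub> x) \<noteq> \<zero>\<^bsub>M\<^esub>" by auto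
      then obtain s h where sh: "s \<in> S" "h \<in> carrier H" "inv\<^bsub>G\<^esub> g \<otimes>\<^bsub>G\<^esub> x = s \<otimes>\<^bsub>G\<^esub> i h"
        using S(4)[of "inv\<^bsub>G\<^esub> g \<otimes>\<^bsub>G\<^esub> x"] x g by auto
      have "x = g \<otimes>\<^bsub>G\<^esub> (inv\<^bsub>G\<^esub> g \<otimes>\<^bsub>G\<^esub> x)" using x g by (simp flip: G.m_assoc)
      also have "\<dots> = (g \<otimes>\<^bsub>G\<^esub> s) \<otimes>\<^bsub>G\<^esub> i h" using sh g S(3) by (auto simp: G.m_assoc subset_iff)
      finally show "\<exists>s \<in> (\<lambda>s. g \<otimes>\<^bsub>G\<^esub> s) ` S. \<exists>h \<in> carrier H. x = s \<otimes>\<^bsub>G\<^esub> i h" using sh by blast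
    qed (use S g C.act_closed in auto)
  qed
qed

lemma coset_cancel:
  assumes "x \<in> carrier G" "h \<in> carrier H" "h' \<in> carrier H"
  shows "x \<otimes>\<^bsub>G\<^esub> i h = x \<otimes>\<^bsub>G\<^esub> i h' \<longleftrightarrow> h = h'"
  using assms inj by (auto dest: inj_onD)

lemma inv_into_i [simp]: "h \<in> carrier H \<Longrightarrow> inv_into (carrier H) i (i h) = h"
  using inj by simp

text \<open>Describes \<open>g\<close> tensor \<open>m\<close> as a function: it is concentrated on
  the coset of \<open>g\<close>, where it is determined by its value \<open>m\<close> at
  \<open>g\<close>.\<close>

lemma act_ind_unit:
  assumes M: "group_module k H M" and m: "m \<in> carrier M" and g: "g \<in> carrier G"
  shows "h \<in> carrier H \<Longrightarrow> act (ind_gmodule G H i M) g (ind_unit G H i M m) (g \<otimes>\<^bsub>G\<^esub> i h) = act M (inv\<^bsub>H\<^esub> h) m"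
    and "\<lbrakk>x \<in> carrier G; \<And>h. h \<in> carrier H \<Longrightarrow> x \<noteq> g \<otimes>\<^bsub>G\<^esub> i h\<rbrakk> \<Longrightarrow>
      act (ind_gmodule G H i M) g (ind_unit G H i M m) x = \<zero>\<^bsub>M\<^esub>"
proof -
  assume "h \<in> carrier H"
  then show "act (ind_gmodule G H i M) g (ind_unit G H i M m) (g \<otimes>\<^bsub>G\<^esub> i h) = act M (inv\<^bsub>H\<^esub> h) m"
    using g by (simp add: ind_unit_def flip: G.m_assoc)
next
  assume x: "x \<in> carrier G" "\<And>h. h \<in> carrier H \<Longrightarrow> x \<noteq> g \<otimes>\<^bsub>G\<^esub> i h"
  have "inv\<^bsub>G\<^esub> g \<otimes>\<^bsub>G\<^esub> x \<noteq> i h" if "h \<in> carrier H" for h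
  proof
    assume "inv\<^bsub>G\<^esub> g \<otimes>\<^bsub>G\<^esub> x = i h"
    then have "x = g \<otimes>\<^bsub>G\<^esub> i h" using x(1) g by (simp flip: \<open>inv\<^bsub>G\<^esub> g \<otimes>\<^bsub>G\<^esub> x = i h\<close> G.m_assoc)
    then show False using x(2) that by blast
  qed
  then have "inv\<^bsub>G\<^esub> g \<otimes>\<^bsub>G\<^esub> x \<notin> i ` carrier H" by auto
  then show "act (ind_gmodule G H i M) g (ind_unit G H i M m) x = \<zero>\<^bsub>M\<^esub>"
    using x g by (simp add: ind_unit_def)
qed

lemma ind_unit_eq:
  assumes M: "group_module k H M" and m: "m \<in> carrier M"
  shows "h \<in> carrier H \<Longrightarrow> ind_unit G H i M m (i h) = act M (inv\<^bsub>H\<^esub> h) m"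
    and "ind_unit G H i M m \<one>\<^bsub>G\<^esub> = m"
    and "x \<in> carrier G - i ` carrier H \<Longrightarrow> ind_unit G H i M m x = \<zero>\<^bsub>M\<^esub>"
proof -
  interpret M: group_module k H M by fact
  show 1: "h \<in> carrier H \<Longrightarrow> ind_unit G H i M m (i h) = act M (inv\<^bsub>H\<^esub> h) m" for h
    by (simp add: ind_unit_def)
  show "ind_unit G H i M m \<one>\<^bsub>G\<^esub> = m" using 1[of "\<one>\<^bsub>H\<^esub>"] m by simp
qed (simp add: ind_unit_def)

lemma ind_unit_closed:
  assumes M: "group_module k H M" and m: "m \<in> carrier M"
  shows "ind_unit G H i M m \<in> carrier (ind_gmodule G H i M)"
proof (rule ind_carrierI[of _ _ _ _ _ "{\<one>\<^bsub>G\<^esub>}"])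
  interpret M: group_module k H M by fact
  note eq = ind_unit_eq[OF assms]
  show "ind_unit G H i M m \<in> carrier (coind_gmodule G H i M)"
  proof (rule coind_carrierI)
    fix x assume x: "x \<in> carrier G"
    show "ind_unit G H i M m x \<in> carrier M"
      using x m eq(1) eq(3)[of x] by (cases "x \<in> i ` carrier H") auto
    fix h assume h: "h \<in> carrier H"
    show "ind_unit G H i M m (x \<otimes>\<^bsub>G\<^esub> i h) = act M (inv\<^bsub>H\<^esub> h) (ind_unit G H i M m x)"
    proof (cases "x \<in> i ` carrier H")
      case True
      then obtain h' where h': "h' \<in> carrier H" "x = i h'" by auto
      then have "ind_unit G H i M m (i (h' \<otimes>\<^bsub>H\<^esub> h)) = act M (inv\<^bsub>H\<^esub> (h' \<otimes>\<^bsub>H\<^esub> h)) m"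
        using h by (intro eq) auto
      then show ?thesis using h h' m by (simp add: eq H.inv_mult_group M.act_mult)
    next
      case False
      have "x \<otimes>\<^bsub>G\<^esub> i h \<noteq> i h'" if "h' \<in> carrier H" for h'
      proof
        assume "x \<otimes>\<^bsub>G\<^esub> i h = i h'"
        then have "x = i (h' \<otimes>\<^bsub>H\<^esub> inv\<^bsub>H\<^esub> h)"
          using x h that by (simp add: G.inv_solve_right)
        then show False using False H.m_closed[OF that H.inv_closed[OF h]] by blast
      qed
      then have "x \<otimes>\<^bsub>G\<^esub> i h \<notin> i ` carrier H" by auto
      then show ?thesis using x h False by (simp add: eq)
    qed
  qed (simp add: ind_unit_def)
  fix x assume "x \<in> carrier G" "ind_unit G H i M m x \<noteq> \<zero>\<^bsub>M\<^esub>"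
  then show "\<exists>s \<in> {\<one>\<^bsub>G\<^esub>}. \<exists>h \<in> carrier H. x = s \<otimes>\<^bsub>G\<^esub> i h"
    by (auto simp: ind_unit_def split: if_splits)
qed auto

lemma ind_unit_hom:
  assumes M: "group_module k H M"
  shows "(\<lambda>m \<in> carrier M. ind_unit G H i M m) \<in> ghom k H M (res_gmodule i (ind_gmodule G H i M))"
proof (rule ghomI[OF M])
  interpret M: group_module k H M by fact
  interpret I: group_module k G "ind_gmodule G H i M" by (rule group_module_ind) fact
  let ?I = "ind_gmodule G H i M"
  note closed = ind_unit_closed[OF M] and sub = subsetD[OF ind_carrier_subset]
  show "ind_unit G H i M m \<in> carrier (res_gmodule i ?I)" if "m \<in> carrier M" for m
    using closed that by simp
  show "ind_unit G H i M (m \<oplus>\<^bsub>M\<^esub> m') = ind_unit G H i M m \<oplus>\<^bsub>res_gmodule i ?I\<^esub> ind_unit G H i M m'"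
    if "m \<in> carrier M" "m' \<in> carrier M" for m m'
    using that by (auto simp: ind_unit_def M.act_add fun_eq_iff)
  show "ind_unit G H i M (a \<odot>\<^bsub>M\<^esub> m) = a \<odot>\<^bsub>res_gmodule i ?I\<^esub> ind_unit G H i M m"
    if "a \<in> carrier k" "m \<in> carrier M" for a m
    using that by (auto simp: ind_unit_def M.act_smult fun_eq_iff)
  show "ind_unit G H i M (act M g m) = act (res_gmodule i ?I) g (ind_unit G H i M m)"
    if g: "g \<in> carrier H" and m: "m \<in> carrier M" for g m
  proof (rule coind_eqI)
    show "ind_unit G H i M (act M g m) \<in> carrier (coind_gmodule G H i M)"
      by (rule sub[OF closed[OF M.act_closed[OF g m]]])
    show "act (res_gmodule i ?I) g (ind_unit G H i M m) \<in> carrier (coind_gmodule G H i M)"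
      using sub[OF I.act_closed[of "i g"]] closed[OF m] g by simp
    fix x assume x: "x \<in> carrier G"
    show "ind_unit G H i M (act M g m) x = act (res_gmodule i ?I) g (ind_unit G H i M m) x"
    proof (cases "x \<in> i ` carrier H")
      case True
      then obtain h where h: "h \<in> carrier H" "x = i h" by auto
      have "act (res_gmodule i ?I) g (ind_unit G H i M m) x = ind_unit G H i M m (i (inv\<^bsub>H\<^esub> g \<otimes>\<^bsub>H\<^esub> h))"
        using g h by simp
      also have "\<dots> = act M (inv\<^bsub>H\<^esub> h) (act M g m)"
        using g h m by (subst ind_unit_eq[OF M]) (auto simp: H.inv_mult_group M.act_mult)
      finally show ?thesis using g h m by (simp add: ind_unit_eq[OF M])
    next
      case False
      have "inv\<^bsub>G\<^esub> i g \<otimes>\<^bsub>G\<^esub> x \<noteq> i h" if "h \<in> carrier H" for h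
      proof
        assume "inv\<^bsub>G\<^esub> i g \<otimes>\<^bsub>G\<^esub> x = i h"
        then have "x = i (g \<otimes>\<^bsub>H\<^esub> h)" using g x that by (simp flip: \<open>_ = i h\<close> G.m_assoc)
        then show False using False H.m_closed[OF g that] by blast
      qed
      then have "inv\<^bsub>G\<^esub> i g \<otimes>\<^bsub>G\<^esub> x \<notin> i ` carrier H" by auto
      then show ?thesis using x g m False by (simp add: ind_unit_eq[OF M])
    qed
  qed
qed

text \<open>The elements \<open>g\<close> tensor \<open>m\<close> generate the induced module
  additively. The induction runs over a finite set of points whose cosets cover the support, and
  clears one coset at a time.\<close>

lemma ind_induct [consumes 2, case_names add unit]:
  assumes M: "group_module k H M" and f: "f \<in> carrier (ind_gmodule G H i M)"
    and add: "\<And>f f'. \<lbrakk>f \<in> carrier (ind_gmodule G H i M); f' \<in> carrier (ind_gmodule G H i M); Q f; Q f'\<rbrakk>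
      \<Longrightarrow> Q (f \<oplus>\<^bsub>ind_gmodule G H i M\<^esub> f')"
    and unit: "\<And>g m. \<lbrakk>g \<in> carrier G; m \<in> carrier M\<rbrakk> \<Longrightarrow>
      Q (act (ind_gmodule G H i M) g (ind_unit G H i M m))"
  shows "Q f"
proof -
  interpret M: group_module k H M by fact
  let ?I = "ind_gmodule G H i M" and ?C = "coind_gmodule G H i M" and ?\<eta> = "ind_unit G H i M"
  interpret I: group_module k G ?I by (rule group_module_ind) fact
  note D = coind_carrierD(2,3) and sub = subsetD[OF ind_carrier_subset]
  have "Q f" if "finite S" "S \<subseteq> carrier G" "f \<in> carrier ?I"
    "\<And>x. \<lbrakk>x \<in> carrier G; f x \<noteq> \<zero>\<^bsub>M\<^esub>\<rbrakk> \<Longrightarrow> \<exists>s \<in> S. \<exists>h \<in> carrier H. x = s \<otimes>\<^bsub>G\<^esub> i h" for S f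
    using that
  proof (induction S arbitrary: f rule: finite_induct)
    case empty
    have "f x = \<zero>\<^bsub>M\<^esub>" if "x \<in> carrier G" for x using empty(3)[OF that] by auto
    then have "f = \<zero>\<^bsub>?I\<^esub>"
      using coind_eqI[OF sub[OF empty(2)] sub[OF I.M.zero_closed]] by simp
    \<comment> \<open>The zero function has the shape demanded by \<open>unit\<close>, with
      \<open>m\<close> equal to zero, so it needs no case of its own.\<close>
    also have "\<zero>\<^bsub>?I\<^esub> = act ?I \<one>\<^bsub>G\<^esub> (?\<eta> \<zero>\<^bsub>M\<^esub>)"
      by (auto simp: ind_unit_def fun_eq_iff)
    finally show ?case by (simp only: unit[OF G.one_closed M.zero_closed])
  next
    case (insert r S)
    have r: "r \<in> carrier G" using insert by auto
    \<comment> \<open>The element \<open>r\<close> tensor \<open>f r\<close> agrees with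
      \<open>f\<close> on the coset of \<open>r\<close> and vanishes off it; subtracting it clears
      exactly this coset.\<close>
    define e where "e = act ?I r (?\<eta> (f r))"
    define f2 where "f2 = f \<ominus>\<^bsub>?I\<^esub> e"
    have fc: "f \<in> carrier ?C" and fI: "f \<in> carrier ?I" using insert sub by auto
    have fr: "f r \<in> carrier M" using D(1)[OF fc] r .
    have e: "e \<in> carrier ?I" unfolding e_def using r ind_unit_closed[OF M fr] by (rule I.act_closed)
    have f2: "f2 \<in> carrier ?I" unfolding f2_def using fI e by (rule I.M.minus_closed)
    have ec: "e x \<in> carrier M" "f x \<in> carrier M" if "x \<in> carrier G" for x
      using D(1)[OF sub[OF e] that] D(1)[OF fc that] .
    have f2x: "f2 x = f x \<ominus>\<^bsub>M\<^esub> e x" if "x \<in> carrier G" for x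
      using that ec[OF that] unfolding f2_def I.minus_as_smult[OF fI e] M.minus_as_smult[OF ec(2,1)[OF that]]
      by simp
    have "Q f2"
    proof (rule insert.IH)
      fix x assume x: "x \<in> carrier G" and nz: "f2 x \<noteq> \<zero>\<^bsub>M\<^esub>"
      have not: "x \<noteq> r \<otimes>\<^bsub>G\<^esub> i h" if h: "h \<in> carrier H" for h
      proof
        assume "x = r \<otimes>\<^bsub>G\<^esub> i h"
        then have "e x = f x"
          unfolding e_def using h by (simp only: act_ind_unit(1)[OF M fr r h] D(2)[OF fc r h])
        then show False using nz x ec[OF x] by (simp add: f2x M.minus_eq_zero_iff)
      qed
      have "e x = \<zero>\<^bsub>M\<^esub>" unfolding e_def by (rule act_ind_unit(2)[OF M fr r x not])
      then have "f x \<noteq> \<zero>\<^bsub>M\<^esub>" using nz x by (auto simp: f2x M.M.minus_eq)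
      then show "\<exists>s \<in> S. \<exists>h \<in> carrier H. x = s \<otimes>\<^bsub>G\<^esub> i h" using insert.prems(3)[OF x] not by auto
    qed (use insert f2 in auto)
    moreover have "Q e" unfolding e_def using r fr by (rule unit)
    ultimately have "Q (f2 \<oplus>\<^bsub>?I\<^esub> e)" using f2 e by (intro add)
    then show ?case unfolding f2_def I.add_minus_cancel(2)[OF fI e] .
  qed
  then show ?thesis using f by (meson ind_carrierE)
qed

end

section \<open>Coset representatives and the universal properties of induction and
  coinduction\<close>

context group_embedding
begin

text \<open>The choice is made from the coset as a set, hence it is constant on cosets.\<close>

definition coset_rep :: "'g \<Rightarrow> 'g" where
  "coset_rep x = (SOME y. y \<in> (\<lambda>h. x \<otimes>\<^bsub>G\<^esub> i h) ` carrier H)"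

lemma coset_rep_mem:
  assumes "x \<in> carrier G"
  shows "\<exists>h \<in> carrier H. coset_rep x = x \<otimes>\<^bsub>G\<^esub> i h"
proof -
  have "x \<otimes>\<^bsub>G\<^esub> i \<one>\<^bsub>H\<^esub> \<in> (\<lambda>h. x \<otimes>\<^bsub>G\<^esub> i h) ` carrier H" by blast
  then have "coset_rep x \<in> (\<lambda>h. x \<otimes>\<^bsub>G\<^esub> i h) ` carrier H" unfolding coset_rep_def by (rule someI)
  then show ?thesis by auto
qed

lemma coset_rep_eq:
  assumes x: "x \<in> carrier G" and h: "h \<in> carrier H"
  shows "coset_rep (x \<otimes>\<^bsub>G\<^esub> i h) = coset_rep x"
proof -
  define cos where "cos x = (\<lambda>h. x \<otimes>\<^bsub>G\<^esub> i h) ` carrier H" for x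
  have "cos (x \<otimes>\<^bsub>G\<^esub> i h) = cos x"
  proof (intro equalityI subsetI)
    fix y assume "y \<in> cos (x \<otimes>\<^bsub>G\<^esub> i h)"
    then obtain h' where h': "h' \<in> carrier H" "y = x \<otimes>\<^bsub>G\<^esub> i h \<otimes>\<^bsub>G\<^esub> i h'" by (auto simp: cos_def)
    then have "y = x \<otimes>\<^bsub>G\<^esub> i (h \<otimes>\<^bsub>H\<^esub> h')" using x h by (simp add: G.m_assoc)
    then show "y \<in> cos x" using h h' unfolding cos_def by blast
  next
    fix y assume "y \<in> cos x"
    then obtain h' where h': "h' \<in> carrier H" "y = x \<otimes>\<^bsub>G\<^esub> i h'" by (auto simp: cos_def)
    have "i h' = i h \<otimes>\<^bsub>G\<^esub> i (inv\<^bsub>H\<^esub> h \<otimes>\<^bsub>H\<^esub> h')" using h h' by (simp flip: G.m_assoc)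
    then have "y = x \<otimes>\<^bsub>G\<^esub> i h \<otimes>\<^bsub>G\<^esub> i (inv\<^bsub>H\<^esub> h \<otimes>\<^bsub>H\<^esub> h')" using x h h' by (simp add: G.m_assoc)
    then show "y \<in> cos (x \<otimes>\<^bsub>G\<^esub> i h)" using h h' unfolding cos_def by blast
  qed
  then show ?thesis by (simp add: coset_rep_def cos_def)
qed

text \<open>A linear map on the induced module is a sum over a set of coset representatives.\<close>

lemma ind_linear_map:
  fixes P :: "('k, 'p, 'q) module_scheme"
  assumes M: "group_module k H M" and P: "module k P"
    and t: "\<And>x m. \<lbrakk>x \<in> carrier G; m \<in> carrier M\<rbrakk> \<Longrightarrow> t x m \<in> carrier P"
      "\<And>x m m'. \<lbrakk>x \<in> carrier G; m \<in> carrier M; m' \<in> carrier M\<rbrakk> \<Longrightarrow>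
        t x (m \<oplus>\<^bsub>M\<^esub> m') = t x m \<oplus>\<^bsub>P\<^esub> t x m'"
      "\<And>x a m. \<lbrakk>x \<in> carrier G; a \<in> carrier k; m \<in> carrier M\<rbrakk> \<Longrightarrow>
        t x (a \<odot>\<^bsub>M\<^esub> m) = a \<odot>\<^bsub>P\<^esub> t x m"
    and coset: "\<And>x h m. \<lbrakk>x \<in> carrier G; h \<in> carrier H; m \<in> carrier M\<rbrakk> \<Longrightarrow>
        t (x \<otimes>\<^bsub>G\<^esub> i h) (act M (inv\<^bsub>H\<^esub> h) m) = t x m"
  shows "\<exists>u \<in> linear_maps k (ind_gmodule G H i M) P.
    \<forall>x \<in> carrier G. \<forall>m \<in> carrier M. u (act (ind_gmodule G H i M) x (ind_unit G H i M m)) = t x m"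
proof -
  interpret M: group_module k H M by fact
  interpret P: module k P by fact
  let ?I = "ind_gmodule G H i M" and ?C = "coind_gmodule G H i M" and ?\<eta> = "ind_unit G H i M"
  interpret I: group_module k G ?I by (rule group_module_ind) fact
  note D = coind_carrierD(2,3) and sub = subsetD[OF ind_carrier_subset]
  have t0: "t x \<zero>\<^bsub>M\<^esub> = \<zero>\<^bsub>P\<^esub>" if "x \<in> carrier G" for x
    using t(3)[OF that, of "\<zero>\<^bsub>k\<^esub>" "\<zero>\<^bsub>M\<^esub>"] t(1)[OF that] by simp
  note rep = coset_rep_mem and rep_eq = coset_rep_eq
  define R where "R = coset_rep ` carrier G"
  have RG: "R \<subseteq> carrier G" using rep by (fastforce simp: R_def)
  have rep_R: "coset_rep r = r" if "r \<in> R" for r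
    using that rep rep_eq by (force simp: R_def)
  \<comment> \<open>The summand contributed by the coset of \<open>x\<close>; assumption
    \<open>coset\<close> makes it independent of the point taken in that coset.\<close>
  define T where "T f x = t x (f x)" for f x
  have T_cl: "T f x \<in> carrier P" if "f \<in> carrier ?I" "x \<in> carrier G" for f x
    using t(1)[OF that(2) D(1)[OF sub[OF that(1)] that(2)]] by (simp add: T_def)
  have T_rep: "T f (coset_rep x) = T f x" if f: "f \<in> carrier ?I" and x: "x \<in> carrier G" for f x
  proof -
    obtain h where "h \<in> carrier H" "coset_rep x = x \<otimes>\<^bsub>G\<^esub> i h" using rep x by auto
    then show ?thesis using f x D[OF sub[OF f]] by (simp add: T_def coset)
  qed
  define N where "N f = {r \<in> R. T f r \<noteq> \<zero>\<^bsub>P\<^esub>}" for f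
  have N_fin: "finite (N f)" if f: "f \<in> carrier ?I" for f
  proof -
    obtain S where S: "finite S" "S \<subseteq> carrier G"
      "\<And>x. \<lbrakk>x \<in> carrier G; f x \<noteq> \<zero>\<^bsub>M\<^esub>\<rbrakk> \<Longrightarrow> \<exists>s \<in> S. \<exists>h \<in> carrier H. x = s \<otimes>\<^bsub>G\<^esub> i h"
      using f by (auto simp: ind_gmodule_def)
    have "N f \<subseteq> coset_rep ` S"
    proof
      fix r assume r: "r \<in> N f"
      then have rR: "r \<in> R" "r \<in> carrier G" using RG by (auto simp: N_def)
      then have "f r \<noteq> \<zero>\<^bsub>M\<^esub>" using r t0 by (auto simp: N_def T_def)
      then obtain s h where "s \<in> S" "h \<in> carrier H" "r = s \<otimes>\<^bsub>G\<^esub> i h" using S(3) rR by blast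
      then have "coset_rep r = coset_rep s" using rep_eq S(2) by auto
      then show "r \<in> coset_rep ` S" using rep_R[OF rR(1)] \<open>s \<in> S\<close> by force
    qed
    then show ?thesis using S(1) finite_subset by blast
  qed
  define u where "u = (\<lambda>f \<in> carrier ?I. finsum P (T f) (N f))"
  \<comment> \<open>The sum may be taken over any finite set of representatives that contains the
    relevant ones, which gives \<open>f\<close>, \<open>f'\<close> and their sum a common index
    set.\<close>
  have u_eq: "u f = finsum P (T f) S" if f: "f \<in> carrier ?I" and "finite S" "N f \<subseteq> S" "S \<subseteq> R" for f S
    unfolding u_def using that RG T_cl[OF f]
    by (auto intro!: P.add.finprod_mono_neutral_cong_left simp: N_def subset_iff)
  have "u \<in> linear_maps k ?I P"
    unfolding linear_maps_def
  proof (intro CollectI conjI ballI)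
    show "u \<in> carrier ?I \<rightarrow>\<^sub>E carrier P"
    proof (rule PiE_I)
      fix f assume "f \<in> carrier ?I"
      then show "u f \<in> carrier P"
        using T_cl RG by (auto simp: u_def N_def intro!: P.finsum_closed)
    qed (simp add: u_def)
    fix f assume f: "f \<in> carrier ?I"
    have TR: "T f \<in> S \<rightarrow> carrier P" if "f \<in> carrier ?I" "S \<subseteq> R" for f S using that T_cl RG by auto
    show "u (f \<oplus>\<^bsub>?I\<^esub> f') = u f \<oplus>\<^bsub>P\<^esub> u f'" if f': "f' \<in> carrier ?I" for f'
    proof -
      let ?S = "N f \<union> N f' \<union> N (f \<oplus>\<^bsub>?I\<^esub> f')"
      have S: "finite ?S" "?S \<subseteq> R" using f f' N_fin I.M.a_closed[OF f f'] by (auto simp: N_def)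
      have "u (f \<oplus>\<^bsub>?I\<^esub> f') = finsum P (T (f \<oplus>\<^bsub>?I\<^esub> f')) ?S"
        by (rule u_eq) (use S I.M.a_closed[OF f f'] in auto)
      also have "\<dots> = finsum P (\<lambda>x. T f x \<oplus>\<^bsub>P\<^esub> T f' x) ?S"
      proof (rule P.finsum_cong')
        fix x assume "x \<in> ?S"
        then have "x \<in> carrier G" using S RG by auto
        then show "T (f \<oplus>\<^bsub>?I\<^esub> f') x = T f x \<oplus>\<^bsub>P\<^esub> T f' x"
          using D(1)[OF sub[OF f]] D(1)[OF sub[OF f']] by (simp add: T_def t)
      qed (use TR[OF f S(2)] TR[OF f' S(2)] in auto)
      also have "\<dots> = finsum P (T f) ?S \<oplus>\<^bsub>P\<^esub> finsum P (T f') ?S"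
        by (rule P.finsum_addf) (use TR[OF f S(2)] TR[OF f' S(2)] in auto)
      also have "finsum P (T f) ?S = u f" by (rule u_eq[symmetric]) (use S f in auto)
      also have "finsum P (T f') ?S = u f'" by (rule u_eq[symmetric]) (use S f' in auto)
      finally show ?thesis .
    qed
    show "u (a \<odot>\<^bsub>?I\<^esub> f) = a \<odot>\<^bsub>P\<^esub> u f" if a: "a \<in> carrier k" "f \<in> carrier ?I" for a f
    proof -
      note f = a(2)
      let ?S = "N f \<union> N (a \<odot>\<^bsub>?I\<^esub> f)"
      have S: "finite ?S" "?S \<subseteq> R" using f N_fin I.smult_closed[OF a] by (auto simp: N_def)
      have "u (a \<odot>\<^bsub>?I\<^esub> f) = finsum P (T (a \<odot>\<^bsub>?I\<^esub> f)) ?S"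
        by (rule u_eq) (use S I.smult_closed[OF a] in auto)
      also have "\<dots> = finsum P (\<lambda>x. a \<odot>\<^bsub>P\<^esub> T f x) ?S"
      proof (rule P.finsum_cong')
        fix x assume "x \<in> ?S"
        then have "x \<in> carrier G" using S RG by auto
        then show "T (a \<odot>\<^bsub>?I\<^esub> f) x = a \<odot>\<^bsub>P\<^esub> T f x"
          using D(1)[OF sub[OF f]] a by (simp add: T_def t)
      qed (use TR[OF f S(2)] a in auto)
      also have "\<dots> = a \<odot>\<^bsub>P\<^esub> finsum P (T f) ?S"
        by (rule P.finsum_smult_ldistr[symmetric]) (use TR[OF f S(2)] S a in auto)
      also have "finsum P (T f) ?S = u f" by (rule u_eq[symmetric]) (use S f in auto)
      finally show ?thesis .
    qed
  qed
  moreover have "u (act ?I x (?\<eta> m)) = t x m" if x: "x \<in> carrier G" and m: "m \<in> carrier M" for x m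
  proof -
    let ?f = "act ?I x (?\<eta> m)"
    have f: "?f \<in> carrier ?I" using x ind_unit_closed[OF M m] by (rule I.act_closed)
    have rx: "coset_rep x \<in> R" "coset_rep x \<in> carrier G" using x RG by (auto simp: R_def)
    \<comment> \<open>The function is concentrated on the coset of \<open>x\<close>, so only the
      representative of that coset contributes.\<close>
    have "N ?f \<subseteq> {coset_rep x}"
    proof
      fix r assume r: "r \<in> N ?f"
      then have rR: "r \<in> R" "r \<in> carrier G" using RG by (auto simp: N_def)
      then have "?f r \<noteq> \<zero>\<^bsub>M\<^esub>" using r t0 by (auto simp: N_def T_def simp del: ind_gmodule_simps)
      then obtain h where "h \<in> carrier H" "r = x \<otimes>\<^bsub>G\<^esub> i h"
        using act_ind_unit(2)[OF M m x rR(2)] by blast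
      then show "r \<in> {coset_rep x}" using rep_R[OF rR(1)] rep_eq[OF x] by simp
    qed
    then have "u ?f = finsum P (T ?f) {coset_rep x}" by (intro u_eq f) (use rx in auto)
    also have "\<dots> = T ?f (coset_rep x)" using T_cl[OF f rx(2)] by (simp del: ind_gmodule_simps)
    also have "\<dots> = T ?f x" by (rule T_rep[OF f x])
    also have "?f x = m"
      using act_ind_unit(1)[OF M m x, of "\<one>\<^bsub>H\<^esub>"] x m by (simp del: ind_gmodule_simps)
    then have "T ?f x = t x m" by (simp add: T_def del: ind_gmodule_simps)
    finally show ?thesis .
  qed
  ultimately show ?thesis by blast
qed

text \<open>Send \<open>x\<close> tensor \<open>m\<close> to \<open>x (h m)\<close>. Equivariance of
  \<open>h\<close> makes this independent of the representative, and equivariance of the result is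
  checked on generators.\<close>

lemma ind_universal:
  assumes M: "group_module k H M" and Y: "group_module k G Y" and h: "h \<in> ghom k H M (res_gmodule i Y)"
  shows "\<exists>u \<in> ghom k G (ind_gmodule G H i M) Y. \<forall>m \<in> carrier M. u (ind_unit G H i M m) = h m"
proof -
  interpret M: group_module k H M by fact
  interpret Y: group_module k G Y by fact
  let ?I = "ind_gmodule G H i M" and ?\<eta> = "ind_unit G H i M"
  interpret I: group_module k G ?I by (rule group_module_ind) fact
  note hs = ghomD(2-5)[OF h, simplified]
  have "\<exists>u \<in> linear_maps k ?I Y. \<forall>x \<in> carrier G. \<forall>m \<in> carrier M.
      u (act ?I x (?\<eta> m)) = act Y x (h m)"
  proof (rule ind_linear_map[OF M Y.module_axioms])
    fix x h' m assume "x \<in> carrier G" "h' \<in> carrier H" "m \<in> carrier M"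
    then show "act Y (x \<otimes>\<^bsub>G\<^esub> i h') (h (act M (inv\<^bsub>H\<^esub> h') m)) = act Y x (h m)"
      by (simp add: hs Y.act_mult)
  qed (simp_all add: hs Y.act_add Y.act_smult)
  then obtain u where u: "u \<in> linear_maps k ?I Y"
    and eq: "\<And>x m. x \<in> carrier G \<Longrightarrow> m \<in> carrier M \<Longrightarrow> u (act ?I x (?\<eta> m)) = act Y x (h m)"
    by blast
  note us = linear_mapsD(1-3)[OF u]
  have "u (act ?I g f) = act Y g (u f)" if g: "g \<in> carrier G" and f: "f \<in> carrier ?I" for g f
    using M f
  proof (induction rule: ind_induct)
    case (add f f')
    then show ?case using g
      by (simp add: us Y.act_add I.act_add del: ind_gmodule_simps)
  next
    case (unit g' m)
    have "act ?I g (act ?I g' (?\<eta> m)) = act ?I (g \<otimes>\<^bsub>G\<^esub> g') (?\<eta> m)"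
      by (rule I.act_mult[symmetric]) (use g unit ind_unit_closed[OF M] in auto)
    then show ?case using g unit by (simp add: eq Y.act_mult hs del: ind_gmodule_simps)
  qed
  then have "u \<in> ghom k G ?I Y" using u by (simp add: ghom_def del: ind_gmodule_simps)
  moreover have "u (?\<eta> m) = h m" if m: "m \<in> carrier M" for m
    using eq[OF G.one_closed m] I.act_one[OF ind_unit_closed[OF M m]] hs m by simp
  ultimately show ?thesis by blast
qed

lemma ind_hom_eqI:
  assumes M: "group_module k H M"
    and u: "u \<in> ghom k G (ind_gmodule G H i M) Y" "u' \<in> ghom k G (ind_gmodule G H i M) Y"
    and eq: "\<And>m. m \<in> carrier M \<Longrightarrow> u (ind_unit G H i M m) = u' (ind_unit G H i M m)"
  shows "u = u'"
proof (rule ghom_eqI[OF u])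
  let ?I = "ind_gmodule G H i M"
  fix f assume "f \<in> carrier ?I"
  with M show "u f = u' f"
  proof (induction rule: ind_induct)
    case (add f f')
    then show ?case by (simp add: ghomD[OF u(1)] ghomD[OF u(2)] del: ind_gmodule_simps)
  next
    case (unit g m)
    then show ?case
      using ind_unit_closed[OF M]
      by (simp add: ghomD[OF u(1)] ghomD[OF u(2)] eq del: ind_gmodule_simps)
  qed
qed

text \<open>Evaluation at 1 is the counit: the value of \<open>i h s\<close> at 1 is that of
  \<open>s\<close> at the inverse of \<open>i h\<close>, which the coset condition turns into
  \<open>h (s 1)\<close>.\<close>

lemma coind_counit_hom:
  assumes "group_module k H M"
  shows "(\<lambda>s \<in> carrier (coind_gmodule G H i M). s \<one>\<^bsub>G\<^esub>) \<in>
    ghom k H (res_gmodule i (coind_gmodule G H i M)) M"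
proof -
  interpret C: group_module k G "coind_gmodule G H i M" by (rule group_module_coind) fact
  have "restrict (\<lambda>s. s \<one>\<^bsub>G\<^esub>) (carrier (res_gmodule i (coind_gmodule G H i M))) \<in>
      ghom k H (res_gmodule i (coind_gmodule G H i M)) M"
  proof (rule ghomI)
    show "group_module k H (res_gmodule i (coind_gmodule G H i M))"
      by (rule group_module_res[OF C.group_module_axioms H.is_group hom])
    fix g s assume gs: "g \<in> carrier H" "s \<in> carrier (res_gmodule i (coind_gmodule G H i M))"
    then show "act (res_gmodule i (coind_gmodule G H i M)) g s \<one>\<^bsub>G\<^esub> = act M g (s \<one>\<^bsub>G\<^esub>)"
      using coind_carrierD(3)[of s G H i M "\<one>\<^bsub>G\<^esub>" "inv\<^bsub>H\<^esub> g"] by simp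
  qed (auto simp: coind_carrierD)
  then show ?thesis by simp
qed

text \<open>The formula is forced: by equivariance the value at \<open>x\<close> of the image of
  \<open>y\<close> is the value at 1 of the image of \<open>x^-1 y\<close>.\<close>

lemma coind_universal:
  assumes M: "group_module k H M" and Y: "group_module k G Y" and h: "h \<in> ghom k H (res_gmodule i Y) M"
  shows "(\<lambda>y \<in> carrier Y. \<lambda>x \<in> carrier G. h (act Y (inv\<^bsub>G\<^esub> x) y)) \<in> ghom k G Y (coind_gmodule G H i M)"
proof (rule ghomI[OF Y])
  interpret M: group_module k H M by fact
  interpret Y: group_module k G Y by fact
  note hs = ghomD(2-5)[OF h, simplified]
  let ?u = "\<lambda>y. \<lambda>x \<in> carrier G. h (act Y (inv\<^bsub>G\<^esub> x) y)" and ?C = "coind_gmodule G H i M"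
  show "?u y \<in> carrier ?C" if "y \<in> carrier Y" for y
  proof (rule coind_carrierI)
    fix x g assume "x \<in> carrier G" "g \<in> carrier H"
    then show "?u y (x \<otimes>\<^bsub>G\<^esub> i g) = act M (inv\<^bsub>H\<^esub> g) (?u y x)"
      using that by (simp add: G.inv_mult_group Y.act_mult flip: hs(4))
  qed (use that in \<open>auto simp: hs\<close>)
  show "?u (y \<oplus>\<^bsub>Y\<^esub> y') = ?u y \<oplus>\<^bsub>?C\<^esub> ?u y'" if "y \<in> carrier Y" "y' \<in> carrier Y" for y y'
    using that by (auto simp: fun_eq_iff hs Y.act_add)
  show "?u (a \<odot>\<^bsub>Y\<^esub> y) = a \<odot>\<^bsub>?C\<^esub> ?u y" if "a \<in> carrier k" "y \<in> carrier Y" for a y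
    using that by (auto simp: fun_eq_iff hs Y.act_smult)
  show "?u (act Y g y) = act ?C g (?u y)" if "g \<in> carrier G" "y \<in> carrier Y" for g y
    using that by (auto simp: fun_eq_iff G.inv_mult_group simp flip: Y.act_mult)
qed

lemma coind_hom_eq:
  assumes Y: "group_module k G Y" and u: "u \<in> ghom k G Y (coind_gmodule G H i M)"
    and "y \<in> carrier Y" "x \<in> carrier G"
  shows "u y x = u (act Y (inv\<^bsub>G\<^esub> x) y) \<one>\<^bsub>G\<^esub>"
  using assms by (simp add: ghomD(5)[OF u])

section \<open>Functoriality and exactness of coinduction and induction\<close>

lemma coind_map_hom:
  assumes M: "group_module k H M" and f: "f \<in> ghom k H M N"
  shows "coind_map G H i M f \<in> ghom k G (coind_gmodule G H i M) (coind_gmodule G H i N)"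
  unfolding coind_map_def
proof (rule ghomI[OF group_module_coind[OF M]])
  show "(\<lambda>x \<in> carrier G. f (s x)) \<in> carrier (coind_gmodule G H i N)"
    if "s \<in> carrier (coind_gmodule G H i M)" for s
    using that by (intro coind_carrierI) (auto simp: coind_carrierD ghomD[OF f])
qed (auto simp: fun_eq_iff coind_carrierD ghomD[OF f])

lemma coind_map_apply:
  "s \<in> carrier (coind_gmodule G H i M) \<Longrightarrow> x \<in> carrier G \<Longrightarrow> coind_map G H i M f s x = f (s x)"
  by (simp add: coind_map_def)

text \<open>Arbitrary pointwise preimages would violate the coset condition. They are chosen at
  coset representatives and spread by the action of \<open>H\<close>; this is the concrete form of
  \<open>kG\<close> being free over \<open>kH\<close>.\<close>

lemma coind_map_image:
  assumes M: "group_module k H M" and N: "group_module k H N" and f: "f \<in> ghom k H M N"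
    and s: "s \<in> carrier (coind_gmodule G H i N)" "\<And>x. x \<in> carrier G \<Longrightarrow> s x \<in> f ` carrier M"
  shows "s \<in> coind_map G H i M f ` carrier (coind_gmodule G H i M)"
proof -
  interpret M: group_module k H M by fact
  interpret N: group_module k H N by fact
  \<comment> \<open>The element of \<open>H\<close> that carries the representative of the coset of
    \<open>x\<close> to \<open>x\<close>.\<close>
  define \<kappa> where "\<kappa> x = inv_into (carrier H) i (inv\<^bsub>G\<^esub> (coset_rep x) \<otimes>\<^bsub>G\<^esub> x)" for x
  have repG: "coset_rep x \<in> carrier G" if "x \<in> carrier G" for x
    using coset_rep_mem[OF that] that by auto
  have \<kappa>: "\<kappa> x \<in> carrier H" "x = coset_rep x \<otimes>\<^bsub>G\<^esub> i (\<kappa> x)" if x: "x \<in> carrier G" for x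
  proof -
    obtain h where h: "h \<in> carrier H" "coset_rep x = x \<otimes>\<^bsub>G\<^esub> i h" using coset_rep_mem[OF x] by auto
    then have "inv\<^bsub>G\<^esub> (coset_rep x) \<otimes>\<^bsub>G\<^esub> x = i (inv\<^bsub>H\<^esub> h)"
      using x by (simp add: G.inv_mult_group G.m_assoc)
    then have "\<kappa> x = inv\<^bsub>H\<^esub> h" unfolding \<kappa>_def using h by (simp only: inv_into_i H.inv_closed)
    then show "\<kappa> x \<in> carrier H" "x = coset_rep x \<otimes>\<^bsub>G\<^esub> i (\<kappa> x)" using h x by (simp_all add: G.m_assoc)
  qed
  have \<kappa>_mult: "\<kappa> (x \<otimes>\<^bsub>G\<^esub> i h) = \<kappa> x \<otimes>\<^bsub>H\<^esub> h" if x: "x \<in> carrier G" and h: "h \<in> carrier H" for x h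
  proof -
    have "coset_rep x \<otimes>\<^bsub>G\<^esub> i (\<kappa> (x \<otimes>\<^bsub>G\<^esub> i h)) = x \<otimes>\<^bsub>G\<^esub> i h"
      using \<kappa>(2)[of "x \<otimes>\<^bsub>G\<^esub> i h"] x h by (simp add: coset_rep_eq)
    also have "\<dots> = coset_rep x \<otimes>\<^bsub>G\<^esub> i (\<kappa> x) \<otimes>\<^bsub>G\<^esub> i h" using \<kappa>(2)[OF x] by simp
    also have "\<dots> = coset_rep x \<otimes>\<^bsub>G\<^esub> i (\<kappa> x \<otimes>\<^bsub>H\<^esub> h)"
      using x h \<kappa>(1)[OF x] repG[OF x] by (simp add: G.m_assoc)
    finally show ?thesis
      by (rule iffD1[OF coset_cancel[OF repG[OF x]], rotated 2]) (use \<kappa>(1) x h in auto)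
  qed
  define m where "m x = inv_into (carrier M) f (s (coset_rep x))" for x
  have m: "m x \<in> carrier M" "f (m x) = s (coset_rep x)" if "x \<in> carrier G" for x
    using s(2)[OF repG[OF that]] by (auto simp: m_def inv_into_into f_inv_into_f)
  define s' where "s' = (\<lambda>x \<in> carrier G. act M (inv\<^bsub>H\<^esub> (\<kappa> x)) (m x))"
  have s': "s' \<in> carrier (coind_gmodule G H i M)"
  proof (rule coind_carrierI)
    fix x h assume x: "x \<in> carrier G" and h: "h \<in> carrier H"
    have "m (x \<otimes>\<^bsub>G\<^esub> i h) = m x" using x h by (simp add: m_def coset_rep_eq)
    then show "s' (x \<otimes>\<^bsub>G\<^esub> i h) = act M (inv\<^bsub>H\<^esub> h) (s' x)"
      using x h \<kappa>(1)[OF x] m(1)[OF x] by (simp add: s'_def \<kappa>_mult H.inv_mult_group M.act_mult)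
  qed (auto simp: s'_def m \<kappa>)
  have "f (s' x) = s x" if x: "x \<in> carrier G" for x
  proof -
    have "f (s' x) = act N (inv\<^bsub>H\<^esub> (\<kappa> x)) (s (coset_rep x))"
      using x \<kappa>(1)[OF x] m[OF x] by (simp add: s'_def ghomD(5)[OF f])
    also have "\<dots> = s (coset_rep x \<otimes>\<^bsub>G\<^esub> i (\<kappa> x))"
      using coind_carrierD(3)[OF s(1) repG[OF x] \<kappa>(1)[OF x]] by simp
    finally show ?thesis using \<kappa>(2)[OF x] by simp
  qed
  then have "coind_map G H i M f s' = s"
    using coind_eqI[OF _ s(1)] ghomD(2)[OF coind_map_hom[OF M f] s']
    by (metis coind_map_apply s')
  then show ?thesis using s' by blast
qed

lemma coind_map_surj:
  assumes "group_module k H M" "group_module k H N" "f \<in> ghom k H M N" "f ` carrier M = carrier N"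
  shows "coind_map G H i M f ` carrier (coind_gmodule G H i M) = carrier (coind_gmodule G H i N)"
  using coind_map_image[OF assms(1-3)] ghomD(2)[OF coind_map_hom[OF assms(1,3)]] assms(4)
  by (auto simp: coind_carrierD)

lemma coind_map_inj:
  assumes "inj_on f (carrier M)"
  shows "inj_on (coind_map G H i M f) (carrier (coind_gmodule G H i M))"
proof (rule inj_onI)
  fix s s' assume s: "s \<in> carrier (coind_gmodule G H i M)" "s' \<in> carrier (coind_gmodule G H i M)"
    and eq: "coind_map G H i M f s = coind_map G H i M f s'"
  show "s = s'"
  proof (rule coind_eqI[OF s])
    fix x assume "x \<in> carrier G"
    then show "s x = s' x"
      using fun_cong[OF eq, of x] s assms by (auto simp: coind_map_apply coind_carrierD dest: inj_onD)
  qed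
qed

text \<open>A function killed by \<open>p\<close> takes all its values in the image of
  \<open>f\<close>, so it is lifted by \<open>coind_map_image\<close>.\<close>

lemma coind_map_kernel:
  assumes M: "group_module k H M" and N: "group_module k H N" and f: "f \<in> ghom k H M N"
    and p: "p \<in> ghom k H N C" and ex: "f ` carrier M = {b \<in> carrier N. p b = \<zero>\<^bsub>C\<^esub>}"
  shows "coind_map G H i M f ` carrier (coind_gmodule G H i M) =
    {b \<in> carrier (coind_gmodule G H i N). coind_map G H i N p b = \<zero>\<^bsub>coind_gmodule G H i C\<^esub>}"
proof (intro equalityI subsetI)
  fix b assume "b \<in> coind_map G H i M f ` carrier (coind_gmodule G H i M)"
  then obtain s where s: "s \<in> carrier (coind_gmodule G H i M)" "b = coind_map G H i M f s" by auto
  then have b: "b \<in> carrier (coind_gmodule G H i N)"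
    using ghomD(2)[OF coind_map_hom[OF M f]] by auto
  have "p (f (s x)) = \<zero>\<^bsub>C\<^esub>" if "x \<in> carrier G" for x using ex coind_carrierD(2)[OF s(1) that] by auto
  then show "b \<in> {b \<in> carrier (coind_gmodule G H i N). coind_map G H i N p b = \<zero>\<^bsub>coind_gmodule G H i C\<^esub>}"
    using b s by (simp add: coind_map_def[of _ _ _ N] coind_map_apply cong: restrict_cong)
next
  fix b assume b: "b \<in> {b \<in> carrier (coind_gmodule G H i N). coind_map G H i N p b = \<zero>\<^bsub>coind_gmodule G H i C\<^esub>}"
  have "b x \<in> f ` carrier M" if x: "x \<in> carrier G" for x
  proof -
    have bc: "b \<in> carrier (coind_gmodule G H i N)" using b by simp
    have "p (b x) = coind_map G H i N p b x" using bc x by (simp add: coind_map_apply)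
    also have "\<dots> = \<zero>\<^bsub>C\<^esub>" using b x by simp
    finally show ?thesis using coind_carrierD(2)[OF bc x] by (simp add: ex)
  qed
  then show "b \<in> coind_map G H i M f ` carrier (coind_gmodule G H i M)"
    using b by (intro coind_map_image[OF M N f]) auto
qed

lemma coind_map_ind_unit:
  assumes M: "group_module k H M" and N: "group_module k H N" and f: "f \<in> ghom k H M N"
    and m: "m \<in> carrier M"
  shows "coind_map G H i M f (ind_unit G H i M m) = ind_unit G H i N (f m)"
proof (rule coind_eqI)
  note sub = subsetD[OF ind_carrier_subset]
  note c = sub[OF ind_unit_closed[OF M m]]
  show "coind_map G H i M f (ind_unit G H i M m) \<in> carrier (coind_gmodule G H i N)"
    by (rule ghomD(2)[OF coind_map_hom[OF M f] c])
  show "ind_unit G H i N (f m) \<in> carrier (coind_gmodule G H i N)"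
    by (rule sub[OF ind_unit_closed[OF N ghomD(2)[OF f m]]])
  fix x assume "x \<in> carrier G"
  then show "coind_map G H i M f (ind_unit G H i M m) x = ind_unit G H i N (f m) x"
    using m ghom_zero[OF f M N] ghomD(2)[OF f m]
    by (cases "x \<in> i ` carrier H")
      (auto simp: coind_map_apply[OF c] ind_unit_eq[OF M] ind_unit_eq[OF N] ghomD(5)[OF f])
qed

lemma ind_map_closed:
  assumes M: "group_module k H M" and N: "group_module k H N" and f: "f \<in> ghom k H M N"
    and s: "s \<in> carrier (ind_gmodule G H i M)"
  shows "coind_map G H i M f s \<in> carrier (ind_gmodule G H i N)"
proof -
  obtain S where S: "s \<in> carrier (coind_gmodule G H i M)" "finite S" "S \<subseteq> carrier G"
    "\<And>x. \<lbrakk>x \<in> carrier G; s x \<noteq> \<zero>\<^bsub>M\<^esub>\<rbrakk> \<Longrightarrow> \<exists>r \<in> S. \<exists>h \<in> carrier H. x = r \<otimes>\<^bsub>G\<^esub> i h"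
    using s by (auto simp: ind_gmodule_def)
  show ?thesis
  proof (rule ind_carrierI[OF ghomD(2)[OF coind_map_hom[OF M f] S(1)] S(2,3)])
    fix x assume x: "x \<in> carrier G" "coind_map G H i M f s x \<noteq> \<zero>\<^bsub>N\<^esub>"
    then have "s x \<noteq> \<zero>\<^bsub>M\<^esub>" using ghom_zero[OF f M N] by (auto simp: coind_map_apply[OF S(1)])
    then show "\<exists>r \<in> S. \<exists>h \<in> carrier H. x = r \<otimes>\<^bsub>G\<^esub> i h" using S(4) x by blast
  qed
qed

lemma ind_map_hom:
  fixes M :: "('k, 'a, 'h) gmodule" and N :: "('k, 'c, 'h) gmodule"
  assumes M: "group_module k H M" and N: "group_module k H N" and f: "f \<in> ghom k H M N"
  shows "restrict (coind_map G H i M f) (carrier (ind_gmodule G H i M)) \<in>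
    ghom k G (ind_gmodule G H i M) (ind_gmodule G H i N)"
proof -
  have eq: "add (ind_gmodule G H i L) = add (coind_gmodule G H i L)"
    "smult (ind_gmodule G H i L) = smult (coind_gmodule G H i L)"
    "act (ind_gmodule G H i L) = act (coind_gmodule G H i L)" for L :: "('k, 'a, 'h) gmodule"
    by (simp_all add: ind_gmodule_def)
  have eq': "add (ind_gmodule G H i L) = add (coind_gmodule G H i L)"
    "smult (ind_gmodule G H i L) = smult (coind_gmodule G H i L)"
    "act (ind_gmodule G H i L) = act (coind_gmodule G H i L)" for L :: "('k, 'c, 'h) gmodule"
    by (simp_all add: ind_gmodule_def)
  note cs = ghomD(2-5)[OF coind_map_hom[OF M f]] and sub = subsetD[OF ind_carrier_subset]
  show ?thesis
    by (rule ghomI[OF group_module_ind[OF M]])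
      (auto simp: ind_map_closed[OF M N f] cs sub eq eq'
        simp del: ind_gmodule_simps coind_gmodule_simps)
qed

text \<open>Preimages are found for the generators \<open>g\<close> tensor \<open>m\<close>, which
  keeps the support of the preimage finite modulo \<open>H\<close>.\<close>

lemma ind_map_surj:
  assumes M: "group_module k H M" and N: "group_module k H N" and f: "f \<in> ghom k H M N"
    and surj: "f ` carrier M = carrier N"
  shows "coind_map G H i M f ` carrier (ind_gmodule G H i M) = carrier (ind_gmodule G H i N)"
proof (intro equalityI subsetI)
  let ?f = "restrict (coind_map G H i M f) (carrier (ind_gmodule G H i M))"
  interpret M: group_module k G "ind_gmodule G H i M" by (rule group_module_ind) fact
  note fs = ghomD(2-5)[OF ind_map_hom[OF M N f]]
  fix s assume "s \<in> carrier (ind_gmodule G H i N)"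
  with N have "s \<in> ?f ` carrier (ind_gmodule G H i M)"
  proof (induction rule: ind_induct)
    case (add s s')
    then obtain r r' where r: "r \<in> carrier (ind_gmodule G H i M)" "r' \<in> carrier (ind_gmodule G H i M)"
      "s = ?f r" "s' = ?f r'" by blast
    then show ?case using fs(2)[OF r(1,2)] M.M.a_closed[OF r(1,2)] by (metis imageI)
  next
    case (unit g m)
    obtain m' where m': "m' \<in> carrier M" "m = f m'" using surj unit by auto
    note c = ind_unit_closed[OF M m'(1)]
    have "?f (act (ind_gmodule G H i M) g (ind_unit G H i M m')) =
        act (ind_gmodule G H i N) g (ind_unit G H i N m)"
      using fs(4)[OF unit(1) c] c by (simp add: coind_map_ind_unit[OF M N f m'(1)] m' del: ind_gmodule_simps)
    then show ?case using M.act_closed[OF unit(1) c] by (metis imageI)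
  qed
  then show "s \<in> coind_map G H i M f ` carrier (ind_gmodule G H i M)" by auto
qed (use ind_map_closed[OF M N f] in auto)

text \<open>The preimage is taken in the coinduced module; injectivity of \<open>f\<close> keeps its
  support inside that of \<open>b\<close>, hence finite modulo \<open>H\<close>.\<close>

lemma ind_map_kernel:
  assumes M: "group_module k H M" and N: "group_module k H N" and f: "f \<in> ghom k H M N"
    and inj: "inj_on f (carrier M)"
    and p: "p \<in> ghom k H N C" and ex: "f ` carrier M = {b \<in> carrier N. p b = \<zero>\<^bsub>C\<^esub>}"
  shows "coind_map G H i M f ` carrier (ind_gmodule G H i M) =
    {b \<in> carrier (ind_gmodule G H i N). coind_map G H i N p b = \<zero>\<^bsub>ind_gmodule G H i C\<^esub>}"
proof (intro equalityI subsetI)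
  interpret M: group_module k H M by fact
  note ker = coind_map_kernel[OF M N f p ex]
  fix b assume b: "b \<in> {b \<in> carrier (ind_gmodule G H i N). coind_map G H i N p b = \<zero>\<^bsub>ind_gmodule G H i C\<^esub>}"
  then have "b \<in> coind_map G H i M f ` carrier (coind_gmodule G H i M)"
    using ker ind_carrier_subset[of G H i N] by auto
  then obtain s where s: "s \<in> carrier (coind_gmodule G H i M)" "b = coind_map G H i M f s" by auto
  have bI: "b \<in> carrier (ind_gmodule G H i N)" using b by auto
  obtain S where S: "finite S" "S \<subseteq> carrier G"
    "\<And>x. \<lbrakk>x \<in> carrier G; b x \<noteq> \<zero>\<^bsub>N\<^esub>\<rbrakk> \<Longrightarrow> \<exists>r \<in> S. \<exists>h \<in> carrier H. x = r \<otimes>\<^bsub>G\<^esub> i h"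
    using bI by (auto simp: ind_gmodule_def)
  have "s \<in> carrier (ind_gmodule G H i M)"
  proof (rule ind_carrierI[OF s(1) S(1,2)])
    fix x assume x: "x \<in> carrier G" "s x \<noteq> \<zero>\<^bsub>M\<^esub>"
    then have "b x \<noteq> \<zero>\<^bsub>N\<^esub>"
      using inj coind_carrierD(2)[OF s(1)] ghom_zero[OF f M N]
      by (metis M.M.zero_closed coind_map_apply inj_onD s)
    then show "\<exists>r \<in> S. \<exists>h \<in> carrier H. x = r \<otimes>\<^bsub>G\<^esub> i h" using S(3) x by blast
  qed
  then show "b \<in> coind_map G H i M f ` carrier (ind_gmodule G H i M)" using s by blast
next
  fix b assume b: "b \<in> coind_map G H i M f ` carrier (ind_gmodule G H i M)"
  then have "b \<in> coind_map G H i M f ` carrier (coind_gmodule G H i M)"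
    using ind_carrier_subset[of G H i M] by auto
  then show "b \<in> {b \<in> carrier (ind_gmodule G H i N). coind_map G H i N p b = \<zero>\<^bsub>ind_gmodule G H i C\<^esub>}"
    using b ind_map_closed[OF M N f] unfolding coind_map_kernel[OF M N f p ex] by auto
qed

end


section \<open>Universal arrows\<close>

text \<open>The universal arrow from \<open>X\<close> to restriction, that is, a left adjoint at the
  single object \<open>X\<close>. Any adjoint supplies such arrows, and they determine it up to
  isomorphism.\<close>

definition ind_arrow ::
  "'u set set \<Rightarrow> 'k ring \<Rightarrow> 'g monoid \<Rightarrow> 'h monoid \<Rightarrow> ('h \<Rightarrow> 'g) \<Rightarrow>
   ('k, 'u, 'h) gmodule \<Rightarrow> ('k, 'u, 'g) gmodule \<Rightarrow> ('u \<Rightarrow> 'u) \<Rightarrow> bool"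
where
  "ind_arrow U k G H i X L \<eta> \<longleftrightarrow>
    L \<in> gmod U k G \<and> \<eta> \<in> ghom k H X (res_gmodule i L) \<and>
    (\<forall>Y \<in> gmod U k G. \<forall>h \<in> ghom k H X (res_gmodule i Y).
      \<exists>!u. u \<in> ghom k G L Y \<and> (\<forall>x \<in> carrier X. u (\<eta> x) = h x))"

definition coind_arrow ::
  "'u set set \<Rightarrow> 'k ring \<Rightarrow> 'g monoid \<Rightarrow> 'h monoid \<Rightarrow> ('h \<Rightarrow> 'g) \<Rightarrow>
   ('k, 'u, 'h) gmodule \<Rightarrow> ('k, 'u, 'g) gmodule \<Rightarrow> ('u \<Rightarrow> 'u) \<Rightarrow> bool"
where
  "coind_arrow U k G H i X R \<epsilon> \<longleftrightarrow>
    R \<in> gmod U k G \<and> \<epsilon> \<in> ghom k H (res_gmodule i R) X \<and>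
    (\<forall>Y \<in> gmod U k G. \<forall>h \<in> ghom k H (res_gmodule i Y) X.
      \<exists>!u. u \<in> ghom k G Y R \<and> (\<forall>y \<in> carrier Y. \<epsilon> (u y) = h y))"

lemma ind_arrowD:
  assumes "ind_arrow U k G H i X L \<eta>"
  shows "L \<in> gmod U k G" "\<eta> \<in> ghom k H X (res_gmodule i L)"
    "\<lbrakk>Y \<in> gmod U k G; h \<in> ghom k H X (res_gmodule i Y)\<rbrakk> \<Longrightarrow>
      \<exists>u \<in> ghom k G L Y. \<forall>x \<in> carrier X. u (\<eta> x) = h x"
  using assms by (simp_all add: ind_arrow_def Bex_def ex1_implies_ex)

lemma ind_arrow_eqI:
  assumes L: "ind_arrow U k G H i X L \<eta>" and X: "group_module k H X" and i: "i \<in> hom H G"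
    and Y: "Y \<in> gmod U k G" and u: "u \<in> ghom k G L Y" "u' \<in> ghom k G L Y"
    and eq: "\<And>x. x \<in> carrier X \<Longrightarrow> u (\<eta> x) = u' (\<eta> x)"
  shows "u = u'"
proof -
  have "compose (carrier X) u \<eta> \<in> ghom k H X (res_gmodule i Y)"
    by (rule ghom_compose[OF ind_arrowD(2)[OF L] ghom_res[OF u(1) i] X])
  then have "\<exists>!v. v \<in> ghom k G L Y \<and> (\<forall>x \<in> carrier X. v (\<eta> x) = compose (carrier X) u \<eta> x)"
    using L Y by (auto simp: ind_arrow_def)
  then show ?thesis using u eq by (auto simp: compose_eq)
qed

lemma coind_arrowD:
  assumes "coind_arrow U k G H i X R \<epsilon>"
  shows "R \<in> gmod U k G" "\<epsilon> \<in> ghom k H (res_gmodule i R) X"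
    "\<lbrakk>Y \<in> gmod U k G; h \<in> ghom k H (res_gmodule i Y) X\<rbrakk> \<Longrightarrow>
      \<exists>u \<in> ghom k G Y R. \<forall>y \<in> carrier Y. \<epsilon> (u y) = h y"
  using assms by (simp_all add: coind_arrow_def Bex_def ex1_implies_ex)

lemma coind_arrow_eqI:
  assumes R: "coind_arrow U k G H i X R \<epsilon>" and G: "group G" and H: "group H" and i: "i \<in> hom H G"
    and Y: "Y \<in> gmod U k G" and u: "u \<in> ghom k G Y R" "u' \<in> ghom k G Y R"
    and eq: "\<And>y. y \<in> carrier Y \<Longrightarrow> \<epsilon> (u y) = \<epsilon> (u' y)"
  shows "u = u'"
proof -
  have "compose (carrier Y) \<epsilon> u \<in> ghom k H (res_gmodule i Y) X"
    using ghom_compose[OF ghom_res[OF u(1) i] coind_arrowD(2)[OF R]]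
      group_module_res[OF gmodD(1)[OF Y G] H i] by simp
  then have "\<exists>!v. v \<in> ghom k G Y R \<and> (\<forall>y \<in> carrier Y. \<epsilon> (v y) = compose (carrier Y) \<epsilon> u y)"
    using R Y by (auto simp: coind_arrow_def)
  then show ?thesis using u eq by (auto simp: compose_eq)
qed

text \<open>The primed sequence will be the explicit one on functions, the other its counterpart
  under an arbitrary adjoint; \<open>u\<close> and \<open>v\<close> correspond to \<open>f\<close>
  and \<open>p\<close> under the isomorphisms.\<close>

lemma short_exact_iso:
  assumes b: "bA \<in> ghom k G A' A" "bB \<in> ghom k G B' B" "bC \<in> ghom k G C' C"
    and c: "cA \<in> ghom k G A A'" "cB \<in> ghom k G B B'" "cC \<in> ghom k G C C'"
    and cb: "\<And>x. x \<in> carrier A' \<Longrightarrow> cA (bA x) = x" "\<And>x. x \<in> carrier B' \<Longrightarrow> cB (bB x) = x"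
    and bc: "\<And>y. y \<in> carrier A \<Longrightarrow> bA (cA y) = y" "\<And>y. y \<in> carrier B \<Longrightarrow> bB (cB y) = y"
      "\<And>y. y \<in> carrier C \<Longrightarrow> bC (cC y) = y"
    and C: "group_module k G C" "group_module k G C'"
    and u: "u \<in> ghom k G A B" "\<And>y. y \<in> carrier A \<Longrightarrow> cB (u y) = f (cA y)"
    and v: "v \<in> ghom k G B C" "\<And>y. y \<in> carrier B \<Longrightarrow> cC (v y) = p (cB y)"
    and inj: "inj_on f (carrier A')" and surj: "p ` carrier B' = carrier C'"
    and ker: "f ` carrier A' = {b \<in> carrier B'. p b = \<zero>\<^bsub>C'\<^esub>}"
  shows "short_exact k G A B C u v"
proof -
  have zero: "\<zero>\<^bsub>C\<^esub> = bC \<zero>\<^bsub>C'\<^esub>" "cC \<zero>\<^bsub>C\<^esub> = \<zero>\<^bsub>C'\<^esub>"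
    using ghom_zero[OF b(3) C(2,1)] ghom_zero[OF c(3) C] by simp_all
  have "inj_on u (carrier A)"
  proof (rule inj_onI)
    fix x y assume xy: "x \<in> carrier A" "y \<in> carrier A" "u x = u y"
    then have "f (cA x) = f (cA y)" using u(2) by metis
    then have "cA x = cA y" using inj_onD[OF inj] ghomD(2)[OF c(1)] xy(1,2) by metis
    then show "x = y" using bc(1) xy by metis
  qed
  moreover have "v ` carrier B = carrier C"
  proof (intro equalityI subsetI)
    fix y assume y: "y \<in> carrier C"
    then have "cC y \<in> p ` carrier B'" using ghomD(2)[OF c(3)] surj by auto
    then obtain s where s: "s \<in> carrier B'" "cC y = p s" by auto
    have bs: "bB s \<in> carrier B" using ghomD(2)[OF b(2) s(1)] .
    have "cC (v (bB s)) = cC y" using v(2)[OF bs] cb(2)[OF s(1)] s(2) by simp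
    then have "v (bB s) = y" using bc(3) y ghomD(2)[OF v(1) bs] by metis
    then show "y \<in> v ` carrier B" using bs by blast
  qed (use ghomD(2)[OF v(1)] in auto)
  moreover have "u ` carrier A = {b \<in> carrier B. v b = \<zero>\<^bsub>C\<^esub>}"
  proof (intro equalityI subsetI)
    fix y assume "y \<in> u ` carrier A"
    then obtain x where x: "x \<in> carrier A" "y = u x" by auto
    then have y: "y \<in> carrier B" using ghomD(2)[OF u(1)] by auto
    have "cB y \<in> f ` carrier A'" using u(2) x ghomD(2)[OF c(1)] by auto
    then have "p (cB y) = \<zero>\<^bsub>C'\<^esub>" unfolding ker by simp
    then have "v y = \<zero>\<^bsub>C\<^esub>" using v(2)[OF y] bc(3)[OF ghomD(2)[OF v(1) y]] zero by metis
    then show "y \<in> {b \<in> carrier B. v b = \<zero>\<^bsub>C\<^esub>}" using y by simp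
  next
    fix y assume "y \<in> {b \<in> carrier B. v b = \<zero>\<^bsub>C\<^esub>}"
    then have y: "y \<in> carrier B" "v y = \<zero>\<^bsub>C\<^esub>" by auto
    then have "cB y \<in> f ` carrier A'"
      unfolding ker using v(2)[OF y(1)] zero ghomD(2)[OF c(2) y(1)] by simp
    then obtain s where s: "s \<in> carrier A'" "cB y = f s" by auto
    have as: "bA s \<in> carrier A" using ghomD(2)[OF b(1) s(1)] .
    have "cB (u (bA s)) = cB y" using u(2)[OF as] cb(1)[OF s(1)] s(2) by simp
    then have "u (bA s) = y" using bc(2) y ghomD(2)[OF u(1) as] by metis
    then show "y \<in> u ` carrier A" using as by blast
  qed
  ultimately show ?thesis using u(1) v(1) by (simp add: short_exact_def)
qed

text \<open>Used for the given embedding and again for the trivial group inside a finite group,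
  where closure under powers of a finite set is enough.\<close>

locale res_setting = group_embedding G H i
  for U :: "'u set set" and k :: "'k ring" and G :: "'g monoid" and H :: "'h monoid" and i :: "'h \<Rightarrow> 'g" +
  assumes U: "set_universe U" and k: "cring k" and powers: "closed_under_powers (carrier G) U"
begin

lemma gmG: "M \<in> gmod U k G \<Longrightarrow> group_module k G M"
  by (rule gmodD(1)[OF _ G.is_group])

lemma gmH: "M \<in> gmod U k H \<Longrightarrow> group_module k H M"
  by (rule gmodD(1)[OF _ H.is_group])

lemma res_gmod: "M \<in> gmod U k G \<Longrightarrow> res_gmodule i M \<in> gmod U k H"
  using group_module_res[OF gmG H.is_group hom] by (auto simp: gmod_def group_module_iff)

lemma small_coind: "M \<in> gmod U k H \<Longrightarrow> small U (carrier (coind_gmodule G H i M))"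
  using small_PiE[OF powers gmodD(3)] by (rule small_subset[rotated]) (auto simp: coind_gmodule_def)

lemma small_ind: "M \<in> gmod U k H \<Longrightarrow> small U (carrier (ind_gmodule G H i M))"
  using small_coind by (rule small_subset[OF ind_carrier_subset])

lemma ind_arrow_exists:
  assumes X: "X \<in> gmod U k H"
  shows "\<exists>L \<eta>. ind_arrow U k G H i X L \<eta>"
proof -
  let ?I = "ind_gmodule G H i X"
  note Xg = gmH[OF X] and Ig = group_module_ind[OF gmH[OF X]]
  obtain L b c where L: "L \<in> gmod U k G" and b: "b \<in> ghom k G ?I L" and c: "c \<in> ghom k G L ?I"
    and cb: "\<And>x. x \<in> carrier ?I \<Longrightarrow> c (b x) = x" and bc: "\<And>y. y \<in> carrier L \<Longrightarrow> b (c y) = y"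
    using small_gmodule_copy[OF U Ig small_ind[OF X]] by metis
  let ?\<eta> = "compose (carrier X) b (\<lambda>m \<in> carrier X. ind_unit G H i X m)"
  have "?\<eta> \<in> ghom k H X (res_gmodule i L)"
    by (rule ghom_compose[OF ind_unit_hom[OF Xg] ghom_res[OF b hom] Xg])
  moreover have "\<exists>!u. u \<in> ghom k G L Y \<and> (\<forall>x \<in> carrier X. u (?\<eta> x) = h x)"
    if Y: "Y \<in> gmod U k G" and h: "h \<in> ghom k H X (res_gmodule i Y)" for Y h
  proof -
    obtain v where v: "v \<in> ghom k G ?I Y" "\<forall>m \<in> carrier X. v (ind_unit G H i X m) = h m"
      using ind_universal[OF Xg gmG[OF Y] h] by blast
    have "compose (carrier L) v c \<in> ghom k G L Y" by (rule ghom_compose[OF c v(1) gmG[OF L]])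
    moreover have "compose (carrier L) v c (?\<eta> x) = h x" if "x \<in> carrier X" for x
      using that v(2) ind_unit_closed[OF Xg that] ghomD(2)[OF b]
      by (simp add: compose_eq cb)
    moreover have "u = u'" if u: "u \<in> ghom k G L Y" "u' \<in> ghom k G L Y"
      and eq: "\<forall>x \<in> carrier X. u (?\<eta> x) = h x" "\<forall>x \<in> carrier X. u' (?\<eta> x) = h x" for u u'
    proof (rule ghom_eqI[OF u])
      have "compose (carrier ?I) u b = compose (carrier ?I) u' b"
        by (rule ind_hom_eqI[OF Xg ghom_compose[OF b u(1) Ig] ghom_compose[OF b u(2) Ig]])
          (use eq ind_unit_closed[OF Xg] in \<open>simp add: compose_eq\<close>)
      then have "u (b z) = u' (b z)" if "z \<in> carrier ?I" for z
        using that by (metis compose_eq)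
      then show "u y = u' y" if "y \<in> carrier L" for y
        using that bc ghomD(2)[OF c] by metis
    qed
    ultimately show ?thesis by blast
  qed
  ultimately show ?thesis using L unfolding ind_arrow_def by blast
qed

lemma ind_arrow_iso:
  assumes X: "X \<in> gmod U k H" and L: "ind_arrow U k G H i X L \<eta>"
  obtains b c where "b \<in> ghom k G (ind_gmodule G H i X) L" "c \<in> ghom k G L (ind_gmodule G H i X)"
    "\<And>x. x \<in> carrier (ind_gmodule G H i X) \<Longrightarrow> c (b x) = x" "\<And>y. y \<in> carrier L \<Longrightarrow> b (c y) = y"
    "\<And>x. x \<in> carrier X \<Longrightarrow> b (ind_unit G H i X x) = \<eta> x"
    "\<And>x. x \<in> carrier X \<Longrightarrow> c (\<eta> x) = ind_unit G H i X x"
proof -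
  let ?I = "ind_gmodule G H i X"
  note Xg = gmH[OF X] and Ig = group_module_ind[OF gmH[OF X]] and Ld = ind_arrowD(1,2)[OF L]
  note Lg = gmG[OF Ld(1)]
  \<comment> \<open>The universal property of \<open>L\<close> only reaches objects of the category,
    so a map from \<open>L\<close> to the explicit induced module is obtained through the copy
    \<open>L0\<close>.\<close>
  obtain L0 b0 c0 where L0: "L0 \<in> gmod U k G" and b0: "b0 \<in> ghom k G ?I L0" and c0: "c0 \<in> ghom k G L0 ?I"
    and cb0: "\<And>x. x \<in> carrier ?I \<Longrightarrow> c0 (b0 x) = x"
    using small_gmodule_copy[OF U Ig small_ind[OF X]] by metis
  obtain b where b: "b \<in> ghom k G ?I L" "\<forall>x \<in> carrier X. b (ind_unit G H i X x) = \<eta> x"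
    using ind_universal[OF Xg Lg Ld(2)] by blast
  have "compose (carrier X) b0 (\<lambda>m \<in> carrier X. ind_unit G H i X m) \<in> ghom k H X (res_gmodule i L0)"
    by (rule ghom_compose[OF ind_unit_hom[OF Xg] ghom_res[OF b0 hom] Xg])
  from ind_arrowD(3)[OF L L0 this]
  obtain u where u: "u \<in> ghom k G L L0" "\<forall>x \<in> carrier X. u (\<eta> x) = b0 (ind_unit G H i X x)"
    by (auto simp: compose_eq)
  define c where "c = compose (carrier L) c0 u"
  have c: "c \<in> ghom k G L ?I" unfolding c_def by (rule ghom_compose[OF u(1) c0 Lg])
  have c\<eta>: "c (\<eta> x) = ind_unit G H i X x" if "x \<in> carrier X" for x
    using that u(2) ghomD(2)[OF Ld(2) that] ind_unit_closed[OF Xg that]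
    by (simp add: c_def compose_eq cb0)
  have bc: "compose (carrier L) b c = (\<lambda>y \<in> carrier L. y)"
    by (rule ind_arrow_eqI[OF L Xg hom Ld(1) ghom_compose[OF c b(1) Lg] ghom_id[OF Lg]])
      (use ghomD(2)[OF Ld(2)] c\<eta> b(2) in \<open>simp add: compose_eq\<close>)
  have cb: "compose (carrier ?I) c b = (\<lambda>y \<in> carrier ?I. y)"
    by (rule ind_hom_eqI[OF Xg ghom_compose[OF b(1) c Ig] ghom_id[OF Ig]])
      (use ind_unit_closed[OF Xg] c\<eta> b(2) in \<open>simp add: compose_eq\<close>)
  show ?thesis
  proof (rule that[OF b(1) c])
    show "c (b x) = x" if "x \<in> carrier ?I" for x using fun_cong[OF cb, of x] that by (simp add: compose_eq)
    show "b (c y) = y" if "y \<in> carrier L" for y using fun_cong[OF bc, of y] that by (simp add: compose_eq)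
  qed (use b(2) c\<eta> in auto)
qed

text \<open>Naturality of the comparison isomorphisms: \<open>u\<close> and the map assembled from
  \<open>coind_map\<close> agree after \<open>\<eta>\<close>, hence agree.\<close>

lemma ind_arrow_map:
  assumes X: "X \<in> gmod U k H" "ind_arrow U k G H i X L \<eta>"
    and b: "b \<in> ghom k G (ind_gmodule G H i X) L" "c \<in> ghom k G L (ind_gmodule G H i X)"
    "\<And>x. x \<in> carrier X \<Longrightarrow> c (\<eta> x) = ind_unit G H i X x"
    and X': "X' \<in> gmod U k H" "ind_arrow U k G H i X' L' \<eta>'"
    and b': "b' \<in> ghom k G (ind_gmodule G H i X') L'" "c' \<in> ghom k G L' (ind_gmodule G H i X')"
    "\<And>x. x \<in> carrier (ind_gmodule G H i X') \<Longrightarrow> c' (b' x) = x"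
    "\<And>x. x \<in> carrier X' \<Longrightarrow> b' (ind_unit G H i X' x) = \<eta>' x"
    and f: "f \<in> ghom k H X X'" and u: "u \<in> ghom k G L L'" "\<And>x. x \<in> carrier X \<Longrightarrow> u (\<eta> x) = \<eta>' (f x)"
    and y: "y \<in> carrier L"
  shows "c' (u y) = coind_map G H i X f (c y)"
proof -
  let ?I = "ind_gmodule G H i X" and ?I' = "ind_gmodule G H i X'"
  let ?f = "restrict (coind_map G H i X f) (carrier ?I)"
  let ?v = "compose (carrier L) b' (compose (carrier L) ?f c)"
  note Xg = gmH[OF X(1)] and Xg' = gmH[OF X'(1)]
  have f': "?f \<in> ghom k G ?I ?I'" by (rule ind_map_hom[OF Xg Xg' f])
  have L: "L \<in> gmod U k G" "L' \<in> gmod U k G" using X X' by (auto dest: ind_arrowD)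
  have "u = ?v"
  proof (rule ind_arrow_eqI[OF X(2) Xg hom L(2) u(1)])
    show "?v \<in> ghom k G L L'" by (intro ghom_compose[OF _ b'(1)] ghom_compose[OF b(2) f'] gmG L)
    fix x assume x: "x \<in> carrier X"
    have "\<eta> x \<in> carrier L" using ghomD(2)[OF ind_arrowD(2)[OF X(2)] x] by simp
    then show "u (\<eta> x) = ?v (\<eta> x)"
      using x ind_unit_closed[OF Xg x] ghomD(2)[OF f x]
      by (simp add: compose_eq u b(3) b'(4) coind_map_ind_unit[OF Xg Xg' f x])
  qed
  moreover have "c' (?v y) = coind_map G H i X f (c y)"
    using y ghomD(2)[OF b(2) y] ghomD(2)[OF f'] by (simp add: compose_eq b'(3) ind_map_closed[OF Xg Xg' f])
  ultimately show ?thesis by simp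
qed

text \<open>The explicit induced modules form a short exact sequence, and naturality of the
  comparison isomorphisms carries it to any other choice of universal arrows.\<close>

lemma ind_arrow_short_exact:
  assumes A: "A \<in> gmod U k H" "ind_arrow U k G H i A LA \<eta>A"
    and B: "B \<in> gmod U k H" "ind_arrow U k G H i B LB \<eta>B"
    and C: "C \<in> gmod U k H" "ind_arrow U k G H i C LC \<eta>C"
    and se: "short_exact k H A B C f p"
    and u: "u \<in> ghom k G LA LB" "\<And>x. x \<in> carrier A \<Longrightarrow> u (\<eta>A x) = \<eta>B (f x)"
    and v: "v \<in> ghom k G LB LC" "\<And>x. x \<in> carrier B \<Longrightarrow> v (\<eta>B x) = \<eta>C (p x)"
  shows "short_exact k G LA LB LC u v"
proof -
  note se' = short_exactD[OF se]
  obtain bA cA where a: "bA \<in> ghom k G (ind_gmodule G H i A) LA" "cA \<in> ghom k G LA (ind_gmodule G H i A)"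
    "\<And>x. x \<in> carrier (ind_gmodule G H i A) \<Longrightarrow> cA (bA x) = x" "\<And>y. y \<in> carrier LA \<Longrightarrow> bA (cA y) = y"
    "\<And>x. x \<in> carrier A \<Longrightarrow> bA (ind_unit G H i A x) = \<eta>A x"
    "\<And>x. x \<in> carrier A \<Longrightarrow> cA (\<eta>A x) = ind_unit G H i A x"
    by (rule ind_arrow_iso[OF A]) (rule that; assumption)
  obtain bB cB where b: "bB \<in> ghom k G (ind_gmodule G H i B) LB" "cB \<in> ghom k G LB (ind_gmodule G H i B)"
    "\<And>x. x \<in> carrier (ind_gmodule G H i B) \<Longrightarrow> cB (bB x) = x" "\<And>y. y \<in> carrier LB \<Longrightarrow> bB (cB y) = y"
    "\<And>x. x \<in> carrier B \<Longrightarrow> bB (ind_unit G H i B x) = \<eta>B x"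
    "\<And>x. x \<in> carrier B \<Longrightarrow> cB (\<eta>B x) = ind_unit G H i B x"
    by (rule ind_arrow_iso[OF B]) (rule that; assumption)
  obtain bC cC where c: "bC \<in> ghom k G (ind_gmodule G H i C) LC" "cC \<in> ghom k G LC (ind_gmodule G H i C)"
    "\<And>x. x \<in> carrier (ind_gmodule G H i C) \<Longrightarrow> cC (bC x) = x" "\<And>y. y \<in> carrier LC \<Longrightarrow> bC (cC y) = y"
    "\<And>x. x \<in> carrier C \<Longrightarrow> bC (ind_unit G H i C x) = \<eta>C x"
    "\<And>x. x \<in> carrier C \<Longrightarrow> cC (\<eta>C x) = ind_unit G H i C x"
    by (rule ind_arrow_iso[OF C]) (rule that; assumption)
  note Ag = gmH[OF A(1)] and Bg = gmH[OF B(1)] and Cg = gmH[OF C(1)]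
  have uu: "cB (u y) = coind_map G H i A f (cA y)" if "y \<in> carrier LA" for y
    by (rule ind_arrow_map[OF A a(1,2,6) B b(1,2,3,5) se'(1) u that])
  have vv: "cC (v y) = coind_map G H i B p (cB y)" if "y \<in> carrier LB" for y
    by (rule ind_arrow_map[OF B b(1,2,6) C c(1,2,3,5) se'(2) v that])
  show ?thesis
    by (rule short_exact_iso[OF a(1) b(1) c(1) a(2) b(2) c(2) a(3) b(3) a(4) b(4) c(4)
          gmG[OF ind_arrowD(1)[OF C(2)]] group_module_ind[OF Cg] u(1) uu v(1) vv
          inj_on_subset[OF coind_map_inj[OF se'(3)] ind_carrier_subset]
          ind_map_surj[OF Bg Cg se'(2,4)] ind_map_kernel[OF Ag Bg se'(1,3,2,5)]])
qed

lemma coind_arrow_exists: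
  assumes X: "X \<in> gmod U k H"
  shows "\<exists>R \<epsilon>. coind_arrow U k G H i X R \<epsilon>"
proof -
  let ?C = "coind_gmodule G H i X"
  note Xg = gmH[OF X] and Cg = group_module_coind[OF gmH[OF X]]
  obtain R b c where R: "R \<in> gmod U k G" and b: "b \<in> ghom k G ?C R" and c: "c \<in> ghom k G R ?C"
    and cb: "\<And>x. x \<in> carrier ?C \<Longrightarrow> c (b x) = x" and bc: "\<And>y. y \<in> carrier R \<Longrightarrow> b (c y) = y"
    using small_gmodule_copy[OF U Cg small_coind[OF X]] by metis
  let ?\<epsilon> = "compose (carrier R) (\<lambda>s \<in> carrier ?C. s \<one>\<^bsub>G\<^esub>) c"
  have \<epsilon>: "?\<epsilon> r = c r \<one>\<^bsub>G\<^esub>" if "r \<in> carrier R" for r using that ghomD(2)[OF c] by (simp add: compose_eq)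
  have "?\<epsilon> \<in> ghom k H (res_gmodule i R) X"
    using ghom_compose[OF ghom_res[OF c hom] coind_counit_hom[OF Xg] gmH[OF res_gmod[OF R]]] by simp
  moreover have "\<exists>!u. u \<in> ghom k G Y R \<and> (\<forall>y \<in> carrier Y. ?\<epsilon> (u y) = h y)"
    if Y: "Y \<in> gmod U k G" and h: "h \<in> ghom k H (res_gmodule i Y) X" for Y h
  proof -
    interpret Y: group_module k G Y by (rule gmG[OF Y])
    let ?v = "\<lambda>y \<in> carrier Y. \<lambda>x \<in> carrier G. h (act Y (inv\<^bsub>G\<^esub> x) y)"
    have v: "?v \<in> ghom k G Y ?C" by (rule coind_universal[OF Xg Y.group_module_axioms h])
    have "compose (carrier Y) b ?v \<in> ghom k G Y R" by (rule ghom_compose[OF v b gmG[OF Y]])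
    moreover have "?\<epsilon> (compose (carrier Y) b ?v y) = h y" if y: "y \<in> carrier Y" for y
      using y ghomD(2)[OF v y] ghomD(2)[OF b] by (simp add: \<epsilon> compose_eq cb)
    moreover have "u = u'" if u: "u \<in> ghom k G Y R" "u' \<in> ghom k G Y R"
      and eq: "\<forall>y \<in> carrier Y. ?\<epsilon> (u y) = h y" "\<forall>y \<in> carrier Y. ?\<epsilon> (u' y) = h y" for u u'
    proof (rule ghom_eqI[OF u])
      fix y assume y: "y \<in> carrier Y"
      have cu: "compose (carrier Y) c u \<in> ghom k G Y ?C" "compose (carrier Y) c u' \<in> ghom k G Y ?C"
        using ghom_compose[OF u(1) c gmG[OF Y]] ghom_compose[OF u(2) c gmG[OF Y]] by auto
      have "c (u y) = c (u' y)"
      proof (rule coind_eqI)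
        show "c (u y) \<in> carrier ?C" "c (u' y) \<in> carrier ?C"
          using y ghomD(2)[OF c] ghomD(2)[OF u(1)] ghomD(2)[OF u(2)] by auto
        \<comment> \<open>The universal property only controls values at 1; translating
          \<open>y\<close> by the inverse of \<open>x\<close> moves the value at \<open>x\<close>
          there.\<close>
        fix x assume x: "x \<in> carrier G"
        have "c (u (act Y (inv\<^bsub>G\<^esub> x) y)) \<one>\<^bsub>G\<^esub> = c (u' (act Y (inv\<^bsub>G\<^esub> x) y)) \<one>\<^bsub>G\<^esub>"
          using eq x y \<epsilon> ghomD(2)[OF u(1)] ghomD(2)[OF u(2)] by (metis G.inv_closed Y.act_closed)
        then show "c (u y) x = c (u' y) x"
          using coind_hom_eq[OF Y.group_module_axioms cu(1) y x]
            coind_hom_eq[OF Y.group_module_axioms cu(2) y x] x y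
          by (simp add: compose_eq)
      qed
      then show "u y = u' y" using bc y ghomD(2)[OF u(1)] ghomD(2)[OF u(2)] by metis
    qed
    ultimately show ?thesis by blast
  qed
  ultimately show ?thesis using R unfolding coind_arrow_def by blast
qed

lemma coind_arrow_iso:
  assumes X: "X \<in> gmod U k H" and R: "coind_arrow U k G H i X R \<epsilon>"
  obtains b c where "b \<in> ghom k G (coind_gmodule G H i X) R" "c \<in> ghom k G R (coind_gmodule G H i X)"
    "\<And>x. x \<in> carrier (coind_gmodule G H i X) \<Longrightarrow> c (b x) = x" "\<And>y. y \<in> carrier R \<Longrightarrow> b (c y) = y"
    "\<And>y x. \<lbrakk>y \<in> carrier R; x \<in> carrier G\<rbrakk> \<Longrightarrow> c y x = \<epsilon> (act R (inv\<^bsub>G\<^esub> x) y)"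
proof -
  let ?C = "coind_gmodule G H i X"
  note Xg = gmH[OF X] and Cg = group_module_coind[OF gmH[OF X]] and Rd = coind_arrowD(1,2)[OF R]
  interpret R: group_module k G R by (rule gmG[OF Rd(1)])
  note Rg = R.group_module_axioms
  obtain R0 b0 c0 where R0: "R0 \<in> gmod U k G" and b0: "b0 \<in> ghom k G ?C R0" and c0: "c0 \<in> ghom k G R0 ?C"
    and cb0: "\<And>x. x \<in> carrier ?C \<Longrightarrow> c0 (b0 x) = x"
    using small_gmodule_copy[OF U Cg small_coind[OF X]] by metis
  \<comment> \<open>One direction has an explicit formula into functions; the inverse
    \<open>b\<close> comes from the universal property of \<open>R\<close>, again through a copy of
    the function module.\<close>
  define c where "c = (\<lambda>y \<in> carrier R. \<lambda>x \<in> carrier G. \<epsilon> (act R (inv\<^bsub>G\<^esub> x) y))"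
  have c: "c \<in> ghom k G R ?C" unfolding c_def by (rule coind_universal[OF Xg Rg Rd(2)])
  have c_eq: "c y x = \<epsilon> (act R (inv\<^bsub>G\<^esub> x) y)" if "y \<in> carrier R" "x \<in> carrier G" for y x
    using that by (simp add: c_def)
  have "compose (carrier R0) (\<lambda>s \<in> carrier ?C. s \<one>\<^bsub>G\<^esub>) c0 \<in> ghom k H (res_gmodule i R0) X"
    using ghom_compose[OF ghom_res[OF c0 hom] coind_counit_hom[OF Xg] gmH[OF res_gmod[OF R0]]] by simp
  from coind_arrowD(3)[OF R R0 this]
  obtain u where u: "u \<in> ghom k G R0 R" "\<forall>r \<in> carrier R0. \<epsilon> (u r) = c0 r \<one>\<^bsub>G\<^esub>"
    using ghomD(2)[OF c0] by (auto simp: compose_eq)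
  define b where "b = compose (carrier ?C) u b0"
  have b: "b \<in> ghom k G ?C R" unfolding b_def by (rule ghom_compose[OF b0 u(1) Cg])
  have \<epsilon>b: "\<epsilon> (b s) = s \<one>\<^bsub>G\<^esub>" if "s \<in> carrier ?C" for s
    using that u(2) ghomD(2)[OF b0 that] by (simp add: b_def compose_eq cb0)
  have cb: "c (b s) = s" if s: "s \<in> carrier ?C" for s
  proof (rule coind_eqI[OF _ s])
    show "c (b s) \<in> carrier ?C" using ghomD(2)[OF c ghomD(2)[OF b s]] .
    fix x assume x: "x \<in> carrier G"
    have as: "act ?C (inv\<^bsub>G\<^esub> x) s \<in> carrier ?C" by (rule group_module.act_closed[OF Cg G.inv_closed[OF x] s])
    have "c (b s) x = \<epsilon> (b (act ?C (inv\<^bsub>G\<^esub> x) s))"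
      using x s ghomD(2)[OF b s] ghomD(5)[OF b _ s] by (simp add: c_eq del: coind_gmodule_simps)
    also have "\<dots> = s x" using x by (simp only: \<epsilon>b[OF as]) simp
    finally show "c (b s) x = s x" .
  qed
  have bc: "compose (carrier R) b c = (\<lambda>y \<in> carrier R. y)"
  proof (rule coind_arrow_eqI[OF R G.is_group H.is_group hom Rd(1) ghom_compose[OF c b Rg] ghom_id[OF Rg]])
    fix y assume y: "y \<in> carrier R"
    then show "\<epsilon> (compose (carrier R) b c y) = \<epsilon> ((\<lambda>y \<in> carrier R. y) y)"
      using ghomD(2)[OF c y] by (simp add: compose_eq \<epsilon>b c_eq)
  qed
  have bcy: "b (c y) = y" if "y \<in> carrier R" for y using fun_cong[OF bc, of y] that by (simp add: compose_eq)
  show ?thesis by (rule that[OF b c cb bcy c_eq])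
qed

lemma coind_arrow_map:
  assumes c: "\<And>y x. \<lbrakk>y \<in> carrier R; x \<in> carrier G\<rbrakk> \<Longrightarrow> c y x = \<epsilon> (act R (inv\<^bsub>G\<^esub> x) y)"
    "c \<in> ghom k G R (coind_gmodule G H i X)"
    and c': "\<And>y x. \<lbrakk>y \<in> carrier R'; x \<in> carrier G\<rbrakk> \<Longrightarrow> c' y x = \<epsilon>' (act R' (inv\<^bsub>G\<^esub> x) y)"
    "c' \<in> ghom k G R' (coind_gmodule G H i X')"
    and X: "X \<in> gmod U k H" and R: "R \<in> gmod U k G" and f: "f \<in> ghom k H X X'"
    and u: "u \<in> ghom k G R R'" "\<And>y. y \<in> carrier R \<Longrightarrow> \<epsilon>' (u y) = f (\<epsilon> y)"
    and y: "y \<in> carrier R"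
  shows "c' (u y) = coind_map G H i X f (c y)"
proof (rule coind_eqI)
  interpret R: group_module k G R by (rule gmG[OF R])
  show "c' (u y) \<in> carrier (coind_gmodule G H i X')"
    by (rule ghomD(2)[OF c'(2) ghomD(2)[OF u(1) y]])
  show "coind_map G H i X f (c y) \<in> carrier (coind_gmodule G H i X')"
    by (rule ghomD(2)[OF coind_map_hom[OF gmH[OF X] f] ghomD(2)[OF c(2) y]])
  fix x assume x: "x \<in> carrier G"
  then show "c' (u y) x = coind_map G H i X f (c y) x"
    using y u(2)[of "act R (inv\<^bsub>G\<^esub> x) y"]
    by (simp add: coind_map_apply[OF ghomD(2)[OF c(2) y]] c(1) c'(1) ghomD(2)[OF u(1)] flip: ghomD(5)[OF u(1)])
qed

lemma coind_arrow_short_exact: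
  assumes A: "A \<in> gmod U k H" "coind_arrow U k G H i A RA \<epsilon>A"
    and B: "B \<in> gmod U k H" "coind_arrow U k G H i B RB \<epsilon>B"
    and C: "C \<in> gmod U k H" "coind_arrow U k G H i C RC \<epsilon>C"
    and se: "short_exact k H A B C f p"
    and u: "u \<in> ghom k G RA RB" "\<And>x. x \<in> carrier RA \<Longrightarrow> \<epsilon>B (u x) = f (\<epsilon>A x)"
    and v: "v \<in> ghom k G RB RC" "\<And>x. x \<in> carrier RB \<Longrightarrow> \<epsilon>C (v x) = p (\<epsilon>B x)"
  shows "short_exact k G RA RB RC u v"
proof -
  note se' = short_exactD[OF se]
  obtain bA cA where a: "bA \<in> ghom k G (coind_gmodule G H i A) RA" "cA \<in> ghom k G RA (coind_gmodule G H i A)"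
    "\<And>x. x \<in> carrier (coind_gmodule G H i A) \<Longrightarrow> cA (bA x) = x" "\<And>y. y \<in> carrier RA \<Longrightarrow> bA (cA y) = y"
    "\<And>y x. \<lbrakk>y \<in> carrier RA; x \<in> carrier G\<rbrakk> \<Longrightarrow> cA y x = \<epsilon>A (act RA (inv\<^bsub>G\<^esub> x) y)"
    by (rule coind_arrow_iso[OF A]) (rule that; assumption)
  obtain bB cB where b: "bB \<in> ghom k G (coind_gmodule G H i B) RB" "cB \<in> ghom k G RB (coind_gmodule G H i B)"
    "\<And>x. x \<in> carrier (coind_gmodule G H i B) \<Longrightarrow> cB (bB x) = x" "\<And>y. y \<in> carrier RB \<Longrightarrow> bB (cB y) = y"
    "\<And>y x. \<lbrakk>y \<in> carrier RB; x \<in> carrier G\<rbrakk> \<Longrightarrow> cB y x = \<epsilon>B (act RB (inv\<^bsub>G\<^esub> x) y)"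
    by (rule coind_arrow_iso[OF B]) (rule that; assumption)
  obtain bC cC where c: "bC \<in> ghom k G (coind_gmodule G H i C) RC" "cC \<in> ghom k G RC (coind_gmodule G H i C)"
    "\<And>x. x \<in> carrier (coind_gmodule G H i C) \<Longrightarrow> cC (bC x) = x" "\<And>y. y \<in> carrier RC \<Longrightarrow> bC (cC y) = y"
    "\<And>y x. \<lbrakk>y \<in> carrier RC; x \<in> carrier G\<rbrakk> \<Longrightarrow> cC y x = \<epsilon>C (act RC (inv\<^bsub>G\<^esub> x) y)"
    by (rule coind_arrow_iso[OF C]) (rule that; assumption)
  note Ag = gmH[OF A(1)] and Bg = gmH[OF B(1)] and Cg = gmH[OF C(1)]
  note RA = coind_arrowD(1)[OF A(2)] and RB = coind_arrowD(1)[OF B(2)] and RC = coind_arrowD(1)[OF C(2)]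
  have uu: "cB (u y) = coind_map G H i A f (cA y)" if "y \<in> carrier RA" for y
    by (rule coind_arrow_map[OF a(5,2) b(5,2) A(1) RA se'(1) u that])
  have vv: "cC (v y) = coind_map G H i B p (cB y)" if "y \<in> carrier RB" for y
    by (rule coind_arrow_map[OF b(5,2) c(5,2) B(1) RB se'(2) v that])
  show ?thesis
    by (rule short_exact_iso[OF a(1) b(1) c(1) a(2) b(2) c(2) a(3) b(3) a(4) b(4) c(4)
          gmG[OF RC] group_module_coind[OF Cg] u(1) uu v(1) vv coind_map_inj[OF se'(3)]
          coind_map_surj[OF Bg Cg se'(2,4)] coind_map_kernel[OF Ag Bg se'(1,2,5)]])
qed

end


section \<open>Projective modules\<close>

lemma closed_under_powers_lepoll:
  assumes U: "set_universe U" and I: "closed_under_powers I U" and J: "J \<lesssim> I" "J \<noteq> {}"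
  shows "closed_under_powers J U"
  unfolding closed_under_powers_def
proof
  fix A assume A: "A \<in> U"
  have "small U (J \<rightarrow>\<^sub>E A)"
  proof (cases "A = {}")
    case True
    then have "(J \<rightarrow>\<^sub>E A) = {}" using J(2) by (auto simp: PiE_eq_empty_iff)
    then show ?thesis using A by (auto simp: small_def)
  qed (rule small_PiE_lepoll[OF I small_mem[OF A] J(1)])
  then obtain C f where C: "C \<in> U" and f: "inj_on f (J \<rightarrow>\<^sub>E A)" "f ` (J \<rightarrow>\<^sub>E A) \<subseteq> C"
    by (auto simp: small_def lepoll_def)
  have "f ` (J \<rightarrow>\<^sub>E A) \<in> U"
    using U C subset_imp_lepoll[OF f(2)] by (auto simp: set_universe_def)
  moreover have "(J \<rightarrow>\<^sub>E A) \<approx> f ` (J \<rightarrow>\<^sub>E A)"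
    using f(1) by (auto simp: eqpoll_def bij_betw_def)
  ultimately show "\<exists>B \<in> U. (J \<rightarrow>\<^sub>E A) \<approx> B" by blast
qed

lemma closed_under_powers_finite:
  assumes "set_universe U" "finite I" "I \<noteq> {}"
  shows "closed_under_powers I U"
proof (rule closed_under_powers_lepoll[OF assms(1) _ _ assms(3)])
  show "closed_under_powers (UNIV :: nat set) U" using assms(1) by (simp add: set_universe_def)
  show "I \<lesssim> (UNIV :: nat set)"
    using finite_lepoll_infinite[OF infinite_UNIV_nat assms(2)] .
qed

lemma projectivesI:
  assumes "group G" "P \<in> gmod U k G"
    and "\<And>M N p f. \<lbrakk>M \<in> gmod U k G; N \<in> gmod U k G; p \<in> ghom k G M N; p ` carrier M = carrier N;
      f \<in> ghom k G P N\<rbrakk> \<Longrightarrow> \<exists>h \<in> ghom k G P M. \<forall>x \<in> carrier P. p (h x) = f x"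
  shows "P \<in> projectives U k G"
  unfolding projectives_def
proof (intro CollectI conjI ballI impI)
  fix M N p f
  assume asm: "M \<in> gmod U k G" "N \<in> gmod U k G" "p \<in> ghom k G M N" "f \<in> ghom k G P N"
    "p ` carrier M = carrier N"
  obtain h where h: "h \<in> ghom k G P M" "\<forall>x \<in> carrier P. p (h x) = f x"
    using assms(3)[OF asm(1,2,3,5,4)] by blast
  have "compose (carrier P) p h = f"
    by (rule ghom_eqI[OF ghom_compose[OF h(1) asm(3) gmodD(1)[OF assms(2,1)]] asm(4)])
      (simp add: compose_eq h(2))
  then show "\<exists>h \<in> ghom k G P M. compose (carrier P) p h = f" using h(1) by blast
qed (rule assms(2))

text \<open>The definition tests only against objects of the category. Copies of \<open>E\<close>
  and \<open>B\<close> extend the test to small modules on other types, such as coinduced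
  ones.\<close>

lemma projectives_lift:
  fixes E :: "('k, 'c, 'g) gmodule" and B :: "('k, 'd, 'g) gmodule"
  assumes U: "set_universe U" and G: "group G" and P: "P \<in> projectives U k G"
    and E: "group_module k G E" "small U (carrier E)"
    and B: "group_module k G B" "small U (carrier B)"
    and p: "p \<in> ghom k G E B" "p ` carrier E = carrier B" and f: "f \<in> ghom k G P B"
  shows "\<exists>h \<in> ghom k G P E. \<forall>x \<in> carrier P. p (h x) = f x"
proof -
  have Pg: "P \<in> gmod U k G" using P by (simp add: projectives_def)
  note Pm = gmodD(1)[OF Pg G]
  obtain E' b c where E': "E' \<in> gmod U k G" and b: "b \<in> ghom k G E E'" and c: "c \<in> ghom k G E' E"
    and cb: "\<And>x. x \<in> carrier E \<Longrightarrow> c (b x) = x" and bc: "\<And>y. y \<in> carrier E' \<Longrightarrow> b (c y) = y"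
    using small_gmodule_copy[OF U E] by metis
  obtain B' b' c' where B': "B' \<in> gmod U k G" and b': "b' \<in> ghom k G B B'" and c': "c' \<in> ghom k G B' B"
    and cb': "\<And>x. x \<in> carrier B \<Longrightarrow> c' (b' x) = x" and bc': "\<And>y. y \<in> carrier B' \<Longrightarrow> b' (c' y) = y"
    using small_gmodule_copy[OF U B] by metis
  let ?p = "compose (carrier E') b' (compose (carrier E') p c)"
  let ?f = "compose (carrier P) b' f"
  note E'm = gmodD(1)[OF E' G]
  have p': "?p \<in> ghom k G E' B'" by (intro ghom_compose[OF _ b'] ghom_compose[OF c p(1)] E'm)
  have f': "?f \<in> ghom k G P B'" by (rule ghom_compose[OF f b' Pm])
  have "?p ` carrier E' = carrier B'"
  proof (intro equalityI subsetI)
    fix y assume y: "y \<in> carrier B'"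
    then obtain x where x: "x \<in> carrier E" "c' y = p x" using ghomD(2)[OF c' y] p(2) by auto
    then have "?p (b x) = y" using y ghomD(2)[OF b x(1)] by (simp add: compose_eq cb bc' flip: x(2))
    then show "y \<in> ?p ` carrier E'" using ghomD(2)[OF b x(1)] by blast
  qed (use ghomD(2)[OF p'] in auto)
  then obtain h where h: "h \<in> ghom k G P E'" "compose (carrier P) ?p h = ?f"
    using P E' B' p' f' unfolding projectives_def by blast
  have "p (c (h x)) = f x" if x: "x \<in> carrier P" for x
  proof -
    have "b' (p (c (h x))) = b' (f x)"
      using fun_cong[OF h(2), of x] x ghomD(2)[OF h(1) x] by (simp add: compose_eq)
    then show ?thesis
      using cb' x ghomD(2)[OF p(1)] ghomD(2)[OF c] ghomD(2)[OF h(1)] ghomD(2)[OF f] by metis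
  qed
  then show ?thesis
    using ghom_compose[OF h(1) c Pm] by (intro bexI[of _ "compose (carrier P) c h"]) (auto simp: compose_eq)
qed

text \<open>Lift \<open>f r\<close> along \<open>p\<close>, then precompose with
  \<open>s\<close>.\<close>

lemma projective_retract:
  assumes U: "set_universe U" and G: "group G" and P: "P \<in> projectives U k G" and Q: "Q \<in> gmod U k G"
    and s: "s \<in> ghom k G Q P" and r: "r \<in> ghom k G P Q" and rs: "\<And>x. x \<in> carrier Q \<Longrightarrow> r (s x) = x"
  shows "Q \<in> projectives U k G"
proof (rule projectivesI[OF G Q])
  have Pg: "P \<in> gmod U k G" using P by (simp add: projectives_def)
  fix M N p f
  assume asm: "M \<in> gmod U k G" "N \<in> gmod U k G" "p \<in> ghom k G M N" "p ` carrier M = carrier N"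
    "f \<in> ghom k G Q N"
  from projectives_lift[OF U G P gmodD(1)[OF asm(1) G] gmodD(3)[OF asm(1)] gmodD(1)[OF asm(2) G]
    gmodD(3)[OF asm(2)] asm(3,4) ghom_compose[OF r asm(5) gmodD(1)[OF Pg G]]]
  obtain h where h: "h \<in> ghom k G P M" "\<forall>x \<in> carrier P. p (h x) = compose (carrier P) f r x" by blast
  show "\<exists>h \<in> ghom k G Q M. \<forall>x \<in> carrier Q. p (h x) = f x"
    using ghom_compose[OF s h(1) gmodD(1)[OF Q G]] h(2) ghomD(2)[OF s]
    by (intro bexI[of _ "compose (carrier Q) h s"]) (auto simp: compose_eq rs)
qed

context res_setting
begin

text \<open>Restriction keeps surjections. A lifting problem out of \<open>L\<close> becomes one out
  of \<open>X\<close> along \<open>\<eta>\<close>, and its solution extends to \<open>L\<close> by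
  universality.\<close>

lemma projectives_ind:
  assumes X: "X \<in> projectives U k H" and L: "ind_arrow U k G H i X L \<eta>"
  shows "L \<in> projectives U k G"
proof (rule projectivesI[OF G.is_group ind_arrowD(1)[OF L]])
  fix M N p f
  assume asm: "M \<in> gmod U k G" "N \<in> gmod U k G" "p \<in> ghom k G M N" "p ` carrier M = carrier N"
    "f \<in> ghom k G L N"
  have Xg: "X \<in> gmod U k H" using X by (simp add: projectives_def)
  note \<eta> = ind_arrowD(2)[OF L] and Xm = gmH[OF Xg]
  note M = res_gmod[OF asm(1)] and N = res_gmod[OF asm(2)]
  have f\<eta>: "compose (carrier X) f \<eta> \<in> ghom k H X (res_gmodule i N)"
    by (rule ghom_compose[OF \<eta> ghom_res[OF asm(5) hom] Xm])
  from projectives_lift[OF U H.is_group X gmH[OF M] gmodD(3)[OF M] gmH[OF N] gmodD(3)[OF N]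
    ghom_res[OF asm(3) hom] _ f\<eta>]
  obtain h where h: "h \<in> ghom k H X (res_gmodule i M)" "\<forall>x \<in> carrier X. p (h x) = f (\<eta> x)"
    using asm(4) by (auto simp: compose_eq)
  obtain u where u: "u \<in> ghom k G L M" "\<forall>x \<in> carrier X. u (\<eta> x) = h x"
    using ind_arrowD(3)[OF L asm(1) h(1)] by blast
  note Lm = gmG[OF ind_arrowD(1)[OF L]]
  have "compose (carrier L) p u = f"
    by (rule ind_arrow_eqI[OF L Xm hom asm(2) ghom_compose[OF u(1) asm(3) Lm] asm(5)])
      (use u(2) h(2) ghomD(2)[OF \<eta>] in \<open>simp add: compose_eq\<close>)
  then have "p (u x) = f x" if "x \<in> carrier L" for x using that by (metis compose_eq)
  then show "\<exists>h \<in> ghom k G L M. \<forall>x \<in> carrier L. p (h x) = f x" using u(1) by blast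
qed

text \<open>The dual argument: restriction is left adjoint to coinduction, and coinduction keeps
  surjections.\<close>

lemma projectives_res:
  assumes P: "P \<in> projectives U k G"
  shows "res_gmodule i P \<in> projectives U k H"
proof -
  have Pg: "P \<in> gmod U k G" using P by (simp add: projectives_def)
  note Pm = gmG[OF Pg]
  interpret P: group_module k G P by fact
  show ?thesis
  proof (rule projectivesI[OF H.is_group res_gmod[OF Pg]])
    fix M N p f
    assume asm: "M \<in> gmod U k H" "N \<in> gmod U k H" "p \<in> ghom k H M N" "p ` carrier M = carrier N"
      "f \<in> ghom k H (res_gmodule i P) N"
    note Mm = gmH[OF asm(1)] and Nm = gmH[OF asm(2)]
    \<comment> \<open>The transpose of \<open>f\<close>; once it is lifted, evaluation at 1
      transposes the lift back.\<close>
    let ?v = "\<lambda>y \<in> carrier P. \<lambda>x \<in> carrier G. f (act P (inv\<^bsub>G\<^esub> x) y)"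
    from projectives_lift[OF U G.is_group P group_module_coind[OF Mm] small_coind[OF asm(1)]
      group_module_coind[OF Nm] small_coind[OF asm(2)] coind_map_hom[OF Mm asm(3)]
      coind_map_surj[OF Mm Nm asm(3,4)] coind_universal[OF Nm Pm asm(5)]]
    obtain h where h: "h \<in> ghom k G P (coind_gmodule G H i M)"
      "\<forall>x \<in> carrier P. coind_map G H i M p (h x) = ?v x" by blast
    let ?e = "compose (carrier P) (\<lambda>s \<in> carrier (coind_gmodule G H i M). s \<one>\<^bsub>G\<^esub>) h"
    have "?e \<in> ghom k H (res_gmodule i P) M"
      using ghom_compose[OF ghom_res[OF h(1) hom] coind_counit_hom[OF Mm]] gmH[OF res_gmod[OF Pg]]
      by simp
    moreover have "p (?e x) = f x" if x: "x \<in> carrier P" for x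
    proof -
      have "p (?e x) = coind_map G H i M p (h x) \<one>\<^bsub>G\<^esub>"
        using x ghomD(2)[OF h(1) x] by (simp add: compose_eq coind_map_apply)
      then show ?thesis using h(2) x by simp
    qed
    ultimately show "\<exists>h \<in> ghom k H (res_gmodule i P) M. \<forall>x \<in> carrier (res_gmodule i P). p (h x) = f x"
      by auto
  qed
qed

end


section \<open>Finite groups\<close>

text \<open>Plain \<open>k\<close>-modules are treated as modules over the trivial group, so that
  the forgetful functor is a restriction and inherits both adjoints.\<close>

definition unit_group :: "unit monoid" where
  "unit_group = \<lparr> carrier = UNIV, mult = (\<lambda>_ _. ()), one = () \<rparr>"

definition unit_hom :: "'g monoid \<Rightarrow> unit \<Rightarrow> 'g" where
  "unit_hom F = (\<lambda>_. \<one>\<^bsub>F\<^esub>)"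

definition underlying :: "'g monoid \<Rightarrow> ('k, 'b, 'g) gmodule \<Rightarrow> ('k, 'b, unit) gmodule" where
  "underlying F = res_gmodule (unit_hom F)"

lemma unit_group_simps [simp]: "carrier unit_group = UNIV"
  by (simp add: unit_group_def)

lemma group_unit_group: "group unit_group"
  by (rule groupI) (auto simp: unit_group_def)

lemma underlying_simps [simp]:
  "carrier (underlying F M) = carrier M"
  "zero (underlying F M) = zero M"
  "add (underlying F M) = add M"
  "smult (underlying F M) = smult M"
  "act (underlying F M) t = act M \<one>\<^bsub>F\<^esub>"
  by (simp_all add: underlying_def unit_hom_def)

lemma res_setting_unit_group:
  assumes "set_universe U" "cring k" "group F" "finite (carrier F)"
  shows "res_setting U k F unit_group (unit_hom F)"
proof -
  interpret F: group F by fact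
  interpret unit: group unit_group by (rule group_unit_group)
  interpret k: cring k by fact
  show ?thesis
  proof unfold_locales
    show "closed_under_powers (carrier F) U"
      using closed_under_powers_finite[OF assms(1,4)] F.one_closed by blast
  qed (use assms in \<open>auto simp: hom_def inj_on_def unit_hom_def\<close>)
qed

lemma unit_ghomI:
  assumes "f \<in> linear_maps k M N" "group_module k unit_group M" "group_module k unit_group N"
  shows "f \<in> ghom k unit_group M N"
proof -
  interpret M: group_module k unit_group M by fact
  interpret N: group_module k unit_group N by fact
  have "act M g x = x" if "x \<in> carrier M" for g x using M.act_one[OF that] by (cases g) (simp add: unit_group_def)
  moreover have "act N g x = x" if "x \<in> carrier N" for g x using N.act_one[OF that] by (cases g) (simp add: unit_group_def)
  ultimately show ?thesis using assms(1) linear_mapsD(1)[OF assms(1)] by (simp add: ghom_def)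
qed

text \<open>Supplies the \<open>k\<close>-linear section that \<open>Ext1_zero_extend\<close> asks
  for: an extension of a \<open>k\<close>-projective module splits over \<open>k\<close>.\<close>

lemma linear_section:
  assumes U: "set_universe U" and k: "cring k" and F: "group F" "finite (carrier F)"
    and y: "y \<in> gmod U k F" "underlying F y \<in> projectives U k unit_group"
    and E: "E \<in> gmod U k F" and p: "p \<in> ghom k F E y" "p ` carrier E = carrier y"
  shows "\<exists>\<sigma> \<in> linear_maps k y E. \<forall>v \<in> carrier y. p (\<sigma> v) = v"
proof -
  interpret res_setting U k F unit_group "unit_hom F" by (rule res_setting_unit_group[OF U k F])
  note uy = res_gmod[OF y(1), folded underlying_def] and uE = res_gmod[OF E, folded underlying_def]
  have "p \<in> ghom k unit_group (underlying F E) (underlying F y)"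
    unfolding underlying_def by (rule ghom_res[OF p(1) hom])
  from projectives_lift[OF U group_unit_group y(2) gmH[OF uE] gmodD(3)[OF uE] gmH[OF uy] gmodD(3)[OF uy]
    this _ ghom_id[OF gmH[OF uy]]]
  obtain s where s: "s \<in> ghom k unit_group (underlying F y) (underlying F E)"
    "\<forall>v \<in> carrier y. p (s v) = v" using p(2) by auto
  have "s \<in> linear_maps k y E" using ghomD(1)[OF s(1)] by (simp add: linear_maps_def)
  then show ?thesis using s(2) by blast
qed

section \<open>Membership in \<open>Cof\<close> over a finite group as projectivity over
  \<open>k\<close>\<close>

lemma bounded_functions_simps [simp]:
  "carrier (bounded_functions k G) = {f \<in> carrier G \<rightarrow>\<^sub>E carrier k. finite (f ` carrier G)}"
  "f \<oplus>\<^bsub>bounded_functions k G\<^esub> f' = (\<lambda>x \<in> carrier G. f x \<oplus>\<^bsub>k\<^esub> f' x)"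
  "a \<odot>\<^bsub>bounded_functions k G\<^esub> f = (\<lambda>x \<in> carrier G. a \<otimes>\<^bsub>k\<^esub> f x)"
  "act (bounded_functions k G) g f = (\<lambda>x \<in> carrier G. f (inv\<^bsub>G\<^esub> g \<otimes>\<^bsub>G\<^esub> x))"
  by (simp_all add: bounded_functions_def)

text \<open>For finite \<open>G\<close> these functions, with \<open>r\<close> in \<open>G\<close>,
  form a \<open>k\<close>-basis of \<open>bounded_functions\<close>.\<close>

definition point_mass :: "'k ring \<Rightarrow> 'g monoid \<Rightarrow> 'g \<Rightarrow> 'g \<Rightarrow> 'k" where
  "point_mass k G r = (\<lambda>s \<in> carrier G. if s = r then \<one>\<^bsub>k\<^esub> else \<zero>\<^bsub>k\<^esub>)"

lemma bilinear_mapsD: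
  assumes "\<beta> \<in> bilinear_maps k M N P"
  shows "\<lbrakk>m \<in> carrier M; n \<in> carrier N\<rbrakk> \<Longrightarrow> \<beta> m n \<in> carrier P"
    and "m \<in> carrier M \<Longrightarrow> restrict (\<beta> m) (carrier N) \<in> linear_maps k N P"
    and "n \<in> carrier N \<Longrightarrow> (\<lambda>m \<in> carrier M. \<beta> m n) \<in> linear_maps k M P"
proof -
  show *: "m \<in> carrier M \<Longrightarrow> restrict (\<beta> m) (carrier N) \<in> linear_maps k N P" for m
    using assms by (auto simp: bilinear_maps_def)
  show "\<lbrakk>m \<in> carrier M; n \<in> carrier N\<rbrakk> \<Longrightarrow> \<beta> m n \<in> carrier P"
    using linear_mapsD(1)[OF *] by fastforce
qed (use assms in \<open>auto simp: bilinear_maps_def\<close>)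

lemma bilinear_mapsI:
  assumes "\<And>m n. \<lbrakk>m \<in> carrier M; n \<in> carrier N\<rbrakk> \<Longrightarrow> \<beta> m n \<in> carrier P"
    and "\<And>m m' n. \<lbrakk>m \<in> carrier M; m' \<in> carrier M; n \<in> carrier N\<rbrakk> \<Longrightarrow>
      m \<oplus>\<^bsub>M\<^esub> m' \<in> carrier M \<and> \<beta> (m \<oplus>\<^bsub>M\<^esub> m') n = \<beta> m n \<oplus>\<^bsub>P\<^esub> \<beta> m' n"
    and "\<And>m n n'. \<lbrakk>m \<in> carrier M; n \<in> carrier N; n' \<in> carrier N\<rbrakk> \<Longrightarrow>
      n \<oplus>\<^bsub>N\<^esub> n' \<in> carrier N \<and> \<beta> m (n \<oplus>\<^bsub>N\<^esub> n') = \<beta> m n \<oplus>\<^bsub>P\<^esub> \<beta> m n'"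
    and "\<And>a m n. \<lbrakk>a \<in> carrier k; m \<in> carrier M; n \<in> carrier N\<rbrakk> \<Longrightarrow>
      a \<odot>\<^bsub>M\<^esub> m \<in> carrier M \<and> \<beta> (a \<odot>\<^bsub>M\<^esub> m) n = a \<odot>\<^bsub>P\<^esub> \<beta> m n"
    and "\<And>a m n. \<lbrakk>a \<in> carrier k; m \<in> carrier M; n \<in> carrier N\<rbrakk> \<Longrightarrow>
      a \<odot>\<^bsub>N\<^esub> n \<in> carrier N \<and> \<beta> m (a \<odot>\<^bsub>N\<^esub> n) = a \<odot>\<^bsub>P\<^esub> \<beta> m n"
  shows "\<beta> \<in> bilinear_maps k M N P"
  using assms by (simp add: bilinear_maps_def linear_maps_def PiE_iff)

lemma bounded_functions_closed:
  assumes "cring k" "group F" "finite (carrier F)"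
  shows "\<lbrakk>b \<in> carrier (bounded_functions k F); b' \<in> carrier (bounded_functions k F)\<rbrakk> \<Longrightarrow>
      b \<oplus>\<^bsub>bounded_functions k F\<^esub> b' \<in> carrier (bounded_functions k F)"
    and "\<lbrakk>a \<in> carrier k; b \<in> carrier (bounded_functions k F)\<rbrakk> \<Longrightarrow>
      a \<odot>\<^bsub>bounded_functions k F\<^esub> b \<in> carrier (bounded_functions k F)"
    and "\<lbrakk>g \<in> carrier F; b \<in> carrier (bounded_functions k F)\<rbrakk> \<Longrightarrow>
      act (bounded_functions k F) g b \<in> carrier (bounded_functions k F)"
    and "point_mass k F r \<in> carrier (bounded_functions k F)"
proof -
  interpret k: cring k by fact
  interpret F: group F by fact
  note fin = finite_imageI[OF assms(3)]
  show "\<lbrakk>b \<in> carrier (bounded_functions k F); b' \<in> carrier (bounded_functions k F)\<rbrakk> \<Longrightarrow>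
      b \<oplus>\<^bsub>bounded_functions k F\<^esub> b' \<in> carrier (bounded_functions k F)"
    "\<lbrakk>a \<in> carrier k; b \<in> carrier (bounded_functions k F)\<rbrakk> \<Longrightarrow>
      a \<odot>\<^bsub>bounded_functions k F\<^esub> b \<in> carrier (bounded_functions k F)"
    "\<lbrakk>g \<in> carrier F; b \<in> carrier (bounded_functions k F)\<rbrakk> \<Longrightarrow>
      act (bounded_functions k F) g b \<in> carrier (bounded_functions k F)"
    "point_mass k F r \<in> carrier (bounded_functions k F)"
    using fin assms(3) by (auto simp: point_mass_def PiE_iff)
qed

text \<open>Tensor products are tested against records without an action field, so a target that
  carries an action has to be cut down first.\<close>

lemma module_truncate:
  assumes "module k M"
  shows "module k (module.truncate M)"
proof -
  interpret M: module k M by fact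
  have [simp]: "carrier (module.truncate M) = carrier M" "add (module.truncate M) = add M"
    "zero (module.truncate M) = zero M" "smult (module.truncate M) = smult M"
    by (simp_all add: module.truncate_def)
  have inv: "\<exists>y \<in> carrier M. y \<oplus>\<^bsub>M\<^esub> x = \<zero>\<^bsub>M\<^esub>" if "x \<in> carrier M" for x
    using M.M.l_neg[OF that] M.M.a_inv_closed[OF that] by blast
  show ?thesis
  proof (rule moduleI[OF M.R.cring_axioms])
    show "abelian_group (module.truncate M)"
      by (rule abelian_groupI) (use inv in \<open>auto simp: M.M.a_ac\<close>)
  qed (auto simp: M.smult_l_distr M.smult_r_distr M.smult_assoc1)
qed

text \<open>The projective module \<open>T\<close> stays projective over \<open>k\<close>, and
  \<open>x\<close> is a \<open>k\<close>-summand of it: \<open>m\<close> goes to the tensor of the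
  point mass at 1 with \<open>m\<close>, and \<open>b\<close> tensor \<open>m\<close> goes back to
  \<open>b(1) m\<close>. The lifting problem is solved on \<open>T\<close> and pulled back to
  \<open>x\<close>.\<close>

lemma Cof_imp_underlying_projective:
  assumes U: "set_universe U" and k: "cring k" and F: "group F" "finite (carrier F)"
    and x: "x \<in> Cof U k F"
  shows "underlying F x \<in> projectives U k unit_group"
proof -
  interpret S: res_setting U k F unit_group "unit_hom F" by (rule res_setting_unit_group[OF U k F])
  interpret k: cring k by fact
  let ?B = "bounded_functions k F"
  obtain T \<tau> where xg: "x \<in> gmod U k F" and T: "T \<in> projectives U k F" "T \<in> gmod U k F"
    and \<tau>: "is_tensor_product U k ?B x T \<tau>"
    using x by (auto simp: Cof_def is_diagonal_tensor_product_def)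
  have \<tau>b: "\<tau> \<in> bilinear_maps k ?B x T" using \<tau> by (simp add: is_tensor_product_def)
  have Tu: "underlying F T \<in> projectives U k unit_group"
    unfolding underlying_def by (rule S.projectives_res[OF T(1)])
  note xu = S.res_gmod[OF xg, folded underlying_def] and Tug = S.res_gmod[OF T(2), folded underlying_def]
  interpret x: group_module k F x by (rule S.gmG[OF xg])
  have b1: "b \<one>\<^bsub>F\<^esub> \<in> carrier k" if "b \<in> carrier ?B" for b
    using that PiE_mem[OF _ S.G.one_closed] by force
  show ?thesis
  proof (rule projectivesI[OF group_unit_group xu])
    fix M N p f
    assume asm: "M \<in> gmod U k unit_group" "N \<in> gmod U k unit_group" "p \<in> ghom k unit_group M N"
      "p ` carrier M = carrier N" "f \<in> ghom k unit_group (underlying F x) N"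
    interpret N: group_module k unit_group N by (rule S.gmH[OF asm(2)])
    note fs = ghomD(2-4)[OF asm(5), simplified]
    \<comment> \<open>Evaluation at 1 combined with \<open>f\<close>; the linear map it induces on
      \<open>T\<close> extends \<open>f\<close>.\<close>
    define \<beta> where "\<beta> b m = b \<one>\<^bsub>F\<^esub> \<odot>\<^bsub>N\<^esub> f m" for b :: "_ \<Rightarrow> _" and m
    have [simp]: "carrier (module.truncate N) = carrier N" "add (module.truncate N) = add N"
      "smult (module.truncate N) = smult N"
      by (simp_all add: module.truncate_def)
    have \<beta>b: "\<beta> \<in> bilinear_maps k ?B x (module.truncate N)"
    proof (rule bilinear_mapsI)
      note Bc = bounded_functions_closed[OF k F]
      fix b m assume b: "b \<in> carrier ?B" and m: "m \<in> carrier x"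
      show "\<beta> b m \<in> carrier (module.truncate N)" using b1[OF b] m by (simp add: \<beta>_def fs)
      show "b \<oplus>\<^bsub>?B\<^esub> b' \<in> carrier ?B \<and> \<beta> (b \<oplus>\<^bsub>?B\<^esub> b') m = \<beta> b m \<oplus>\<^bsub>module.truncate N\<^esub> \<beta> b' m"
        if b': "b' \<in> carrier ?B" for b'
        using b1[OF b] b1[OF b'] m Bc(1)[OF b b']
        by (simp add: \<beta>_def fs N.smult_l_distr del: bounded_functions_simps(1))
      show "m \<oplus>\<^bsub>x\<^esub> m' \<in> carrier x \<and> \<beta> b (m \<oplus>\<^bsub>x\<^esub> m') = \<beta> b m \<oplus>\<^bsub>module.truncate N\<^esub> \<beta> b m'"
        if m': "m' \<in> carrier x" for m'
        using b1[OF b] m m' by (simp add: \<beta>_def fs N.smult_r_distr)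
      show "a \<odot>\<^bsub>?B\<^esub> b \<in> carrier ?B \<and> \<beta> (a \<odot>\<^bsub>?B\<^esub> b) m = a \<odot>\<^bsub>module.truncate N\<^esub> \<beta> b m"
        if a: "a \<in> carrier k" for a
        using b1[OF b] m Bc(2)[OF a b] a
        by (simp add: \<beta>_def fs N.smult_assoc1 del: bounded_functions_simps(1))
      show "a \<odot>\<^bsub>x\<^esub> m \<in> carrier x \<and> \<beta> b (a \<odot>\<^bsub>x\<^esub> m) = a \<odot>\<^bsub>module.truncate N\<^esub> \<beta> b m"
        if a: "a \<in> carrier k" for a
        using b1[OF b] m a by (simp add: \<beta>_def fs k.m_comm flip: N.smult_assoc1)
    qed
    have "module k (module.truncate N) \<and> carrier (module.truncate N) \<in> U"
      using module_truncate[OF N.module_axioms] gmodD(2)[OF asm(2)] by simp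
    then obtain f' where f': "f' \<in> linear_maps k T (module.truncate N)"
      "\<forall>b \<in> carrier ?B. \<forall>m \<in> carrier x. f' (\<tau> b m) = \<beta> b m"
      using \<tau>[unfolded is_tensor_product_def, THEN conjunct2] \<beta>b by blast
    have "f' \<in> ghom k unit_group (underlying F T) N"
      by (rule unit_ghomI[OF _ S.gmH[OF Tug] N.group_module_axioms])
        (use f'(1) in \<open>simp add: linear_maps_def\<close>)
    from projectives_lift[OF U group_unit_group Tu S.gmH[OF asm(1)] gmodD(3)[OF asm(1)]
      N.group_module_axioms gmodD(3)[OF asm(2)] asm(3,4) this]
    obtain h where h: "h \<in> ghom k unit_group (underlying F T) M" "\<forall>t \<in> carrier T. p (h t) = f' t"
      by auto
    \<comment> \<open>The point mass at 1 has value 1 there, so \<open>\<beta>\<close> at it gives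
      back \<open>f\<close>.\<close>
    let ?\<delta> = "point_mass k F \<one>\<^bsub>F\<^esub>"
    note \<delta> = bounded_functions_closed(4)[OF k F, of "\<one>\<^bsub>F\<^esub>"]
    note hs = ghomD(2-4)[OF h(1), simplified]
    note \<tau>c = bilinear_mapsD(1)[OF \<tau>b \<delta>]
    have \<tau>l: "restrict (\<tau> ?\<delta>) (carrier x) \<in> ghom k unit_group (underlying F x) (underlying F T)"
      by (rule unit_ghomI[OF _ S.gmH[OF xu] S.gmH[OF Tug]])
        (use bilinear_mapsD(2)[OF \<tau>b \<delta>] in \<open>simp add: linear_maps_def\<close>)
    let ?s = "compose (carrier x) h (restrict (\<tau> ?\<delta>) (carrier x))"
    have "?s \<in> ghom k unit_group (underlying F x) M"
      using ghom_compose[OF \<tau>l h(1) S.gmH[OF xu]] by simp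
    moreover have "p (?s m) = f m" if m: "m \<in> carrier x" for m
    proof -
      have "p (?s m) = \<beta> ?\<delta> m" using m h(2) \<tau>c[OF m] f'(2) \<delta> by (simp add: compose_eq)
      then show ?thesis using m by (simp add: \<beta>_def point_mass_def fs)
    qed
    ultimately show "\<exists>h \<in> ghom k unit_group (underlying F x) M. \<forall>m \<in> carrier (underlying F x). p (h m) = f m"
      by auto
  qed
qed

text \<open>The tensor product with diagonal action is realised as the module induced from the
  underlying \<open>k\<close>-module of \<open>x\<close>, and induction keeps projectives. The
  isomorphism sends \<open>\<beta>\<close> tensor \<open>m\<close> to the function \<open>s\<close>
  to \<open>\<beta>(s) s^-1 m\<close>, which untwists the action.\<close>

lemma underlying_projective_imp_Cof:
  fixes U :: "'u set set" and k :: "'k ring" and F :: "'f monoid"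
  assumes U: "set_universe U" and k: "cring k" and F: "group F" "finite (carrier F)"
    and x: "x \<in> gmod U k F" and proj: "underlying F x \<in> projectives U k unit_group"
  shows "x \<in> Cof U k F"
proof -
  interpret S: res_setting U k F unit_group "unit_hom F" by (rule res_setting_unit_group[OF U k F])
  interpret k: cring k by fact
  interpret x: group_module k F x by (rule S.gmG[OF x])
  let ?B = "bounded_functions k F"
  define X where "X = underlying F x"
  let ?I = "ind_gmodule F unit_group (unit_hom F) X" and ?u = "ind_unit F unit_group (unit_hom F) X"
  have Xg: "X \<in> gmod U k unit_group" unfolding X_def underlying_def by (rule S.res_gmod[OF x])
  have Xs [simp]: "carrier X = carrier x" "zero X = zero x" "add X = add x" "smult X = smult x"
    "act X t m = act x \<one>\<^bsub>F\<^esub> m" for t m by (simp_all add: X_def)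
  note Xm = S.gmH[OF Xg]
  interpret I: group_module k F ?I by (rule S.group_module_ind[OF Xm])
  obtain L \<eta> where L: "ind_arrow U k F unit_group (unit_hom F) X L \<eta>"
    using S.ind_arrow_exists[OF Xg] by blast
  obtain b c where b: "b \<in> ghom k F ?I L" and c: "c \<in> ghom k F L ?I"
    and cb: "\<And>v. v \<in> carrier ?I \<Longrightarrow> c (b v) = v" and bc: "\<And>y. y \<in> carrier L \<Longrightarrow> b (c y) = y"
    by (rule S.ind_arrow_iso[OF Xg L]) (rule that; assumption)
  have Lg: "L \<in> gmod U k F" by (rule ind_arrowD(1)[OF L])
  note bs = ghomD(2-5)[OF b] and Bc = bounded_functions_closed[OF k F]
  \<comment> \<open>With \<open>F\<close> finite and the subgroup trivial, both the coset condition
    and the support condition hold for every function.\<close>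
  have IX: "v \<in> carrier ?I" if "v \<in> carrier F \<rightarrow>\<^sub>E carrier x" for v
  proof (rule ind_carrierI[of _ _ _ _ _ "carrier F"])
    show "v \<in> carrier (coind_gmodule F unit_group (unit_hom F) X)"
      using that by (intro coind_carrierI) (auto simp: PiE_iff unit_hom_def)
  qed (use F in \<open>auto simp: unit_hom_def\<close>)
  define w where "w \<beta> m = (\<lambda>s \<in> carrier F. \<beta> s \<odot>\<^bsub>x\<^esub> act x (inv\<^bsub>F\<^esub> s) m)" for \<beta> m
  have B_app: "\<beta> s \<in> carrier k" if "\<beta> \<in> carrier ?B" "s \<in> carrier F" for \<beta> s
    using that by (auto simp: PiE_iff)
  have wI: "w \<beta> m \<in> carrier ?I" if "\<beta> \<in> carrier ?B" "m \<in> carrier x" for \<beta> m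
    using that B_app[OF that(1)] by (intro IX) (simp add: w_def)
  \<comment> \<open>The point mass at \<open>r\<close> tensor \<open>m\<close> becomes
    \<open>r\<close> tensor \<open>r^-1 m\<close>; hence the generators of the induced module are
    images of elementary tensors.\<close>
  have w_unit: "w (point_mass k F r) m = act ?I r (?u (act x (inv\<^bsub>F\<^esub> r) m))"
    if r: "r \<in> carrier F" and m: "m \<in> carrier x" for r m
  proof
    fix t
    have m': "act x (inv\<^bsub>F\<^esub> r) m \<in> carrier X" using r m by simp
    consider "t \<notin> carrier F" | "t = r" | "t \<in> carrier F" "t \<noteq> r" by blast
    then show "w (point_mass k F r) m t = act ?I r (?u (act x (inv\<^bsub>F\<^esub> r) m)) t"
    proof cases
      case 2
      have "act ?I r (?u (act x (inv\<^bsub>F\<^esub> r) m)) (r \<otimes>\<^bsub>F\<^esub> unit_hom F ()) = act x (inv\<^bsub>F\<^esub> r) m"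
        using S.act_ind_unit(1)[OF Xm m' r, of "()"] r m by (simp del: ind_gmodule_simps)
      then show ?thesis
        using 2 r m by (simp add: w_def point_mass_def unit_hom_def del: ind_gmodule_simps)
    next
      case 3
      have "act ?I r (?u (act x (inv\<^bsub>F\<^esub> r) m)) t = \<zero>\<^bsub>x\<^esub>"
        using S.act_ind_unit(2)[OF Xm m' r 3(1)] 3(2) r by (simp add: unit_hom_def del: ind_gmodule_simps)
      then show ?thesis using 3 m by (simp add: w_def point_mass_def del: ind_gmodule_simps)
    qed (simp add: w_def)
  qed
  define \<tau> where "\<tau> \<beta> m = b (w \<beta> m)" for \<beta> m
  have tensor_bilinear: "\<tau> \<in> bilinear_maps k ?B x L"
  proof (rule bilinear_mapsI)
    fix \<beta> m assume \<beta>: "\<beta> \<in> carrier ?B" and m: "m \<in> carrier x"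
    note \<beta>c = B_app[OF \<beta>]
    show "\<tau> \<beta> m \<in> carrier L" unfolding \<tau>_def by (rule bs(1)[OF wI[OF \<beta> m]])
    show "\<beta> \<oplus>\<^bsub>?B\<^esub> \<beta>' \<in> carrier ?B \<and> \<tau> (\<beta> \<oplus>\<^bsub>?B\<^esub> \<beta>') m = \<tau> \<beta> m \<oplus>\<^bsub>L\<^esub> \<tau> \<beta>' m"
      if \<beta>': "\<beta>' \<in> carrier ?B" for \<beta>'
    proof
      show "\<beta> \<oplus>\<^bsub>?B\<^esub> \<beta>' \<in> carrier ?B" by (rule Bc(1)[OF \<beta> \<beta>'])
      have "w (\<beta> \<oplus>\<^bsub>?B\<^esub> \<beta>') m = w \<beta> m \<oplus>\<^bsub>?I\<^esub> w \<beta>' m"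
        using m \<beta>c B_app[OF \<beta>'] by (auto simp: w_def x.smult_l_distr fun_eq_iff)
      then show "\<tau> (\<beta> \<oplus>\<^bsub>?B\<^esub> \<beta>') m = \<tau> \<beta> m \<oplus>\<^bsub>L\<^esub> \<tau> \<beta>' m"
        unfolding \<tau>_def by (simp only: bs(2)[OF wI[OF \<beta> m] wI[OF \<beta>' m]])
    qed
    show "m \<oplus>\<^bsub>x\<^esub> m' \<in> carrier x \<and> \<tau> \<beta> (m \<oplus>\<^bsub>x\<^esub> m') = \<tau> \<beta> m \<oplus>\<^bsub>L\<^esub> \<tau> \<beta> m'"
      if m': "m' \<in> carrier x" for m'
    proof
      show "m \<oplus>\<^bsub>x\<^esub> m' \<in> carrier x" using m m' by simp
      have "w \<beta> (m \<oplus>\<^bsub>x\<^esub> m') = w \<beta> m \<oplus>\<^bsub>?I\<^esub> w \<beta> m'"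
        using m m' \<beta>c by (auto simp: w_def x.smult_r_distr x.act_add fun_eq_iff)
      then show "\<tau> \<beta> (m \<oplus>\<^bsub>x\<^esub> m') = \<tau> \<beta> m \<oplus>\<^bsub>L\<^esub> \<tau> \<beta> m'"
        unfolding \<tau>_def by (simp only: bs(2)[OF wI[OF \<beta> m] wI[OF \<beta> m']])
    qed
    fix a assume a: "a \<in> carrier k"
    show "a \<odot>\<^bsub>?B\<^esub> \<beta> \<in> carrier ?B \<and> \<tau> (a \<odot>\<^bsub>?B\<^esub> \<beta>) m = a \<odot>\<^bsub>L\<^esub> \<tau> \<beta> m"
    proof
      show "a \<odot>\<^bsub>?B\<^esub> \<beta> \<in> carrier ?B" by (rule Bc(2)[OF a \<beta>])
      have "w (a \<odot>\<^bsub>?B\<^esub> \<beta>) m = a \<odot>\<^bsub>?I\<^esub> w \<beta> m"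
        using m \<beta>c a by (auto simp: w_def x.smult_assoc1 fun_eq_iff)
      then show "\<tau> (a \<odot>\<^bsub>?B\<^esub> \<beta>) m = a \<odot>\<^bsub>L\<^esub> \<tau> \<beta> m"
        unfolding \<tau>_def by (simp only: bs(3)[OF a wI[OF \<beta> m]])
    qed
    show "a \<odot>\<^bsub>x\<^esub> m \<in> carrier x \<and> \<tau> \<beta> (a \<odot>\<^bsub>x\<^esub> m) = a \<odot>\<^bsub>L\<^esub> \<tau> \<beta> m"
    proof
      show "a \<odot>\<^bsub>x\<^esub> m \<in> carrier x" using a m by simp
      have "w \<beta> (a \<odot>\<^bsub>x\<^esub> m) = a \<odot>\<^bsub>?I\<^esub> w \<beta> m"
        using m \<beta>c a by (auto simp: w_def x.act_smult fun_eq_iff k.m_comm simp flip: x.smult_assoc1)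
      then show "\<tau> \<beta> (a \<odot>\<^bsub>x\<^esub> m) = a \<odot>\<^bsub>L\<^esub> \<tau> \<beta> m"
        unfolding \<tau>_def by (simp only: bs(3)[OF a wI[OF \<beta> m]])
    qed
  qed
  have diagonal: "act L g (\<tau> \<beta> m) = \<tau> (act ?B g \<beta>) (act x g m)"
    if g: "g \<in> carrier F" and \<beta>: "\<beta> \<in> carrier ?B" and m: "m \<in> carrier x" for g \<beta> m
  proof -
    have "act ?I g (w \<beta> m) = w (act ?B g \<beta>) (act x g m)"
      using g m B_app[OF \<beta>]
      by (auto simp: w_def fun_eq_iff S.G.inv_mult_group x.act_mult)
    then show ?thesis unfolding \<tau>_def by (simp only: bs(4)[OF g wI[OF \<beta> m], symmetric])
  qed
  have universal: "\<exists>!f. f \<in> linear_maps k L P \<and> (\<forall>\<beta> \<in> carrier ?B. \<forall>m \<in> carrier x. f (\<tau> \<beta> m) = \<Phi> \<beta> m)"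
    if P: "module k P" and \<Phi>: "\<Phi> \<in> bilinear_maps k ?B x P" for P :: "('k, 'u) module" and \<Phi>
  proof -
    interpret P: module k P by fact
    note \<Phi>c = bilinear_mapsD(1)[OF \<Phi>]
    have \<Phi>2: "\<Phi> \<beta> (m \<oplus>\<^bsub>x\<^esub> m') = \<Phi> \<beta> m \<oplus>\<^bsub>P\<^esub> \<Phi> \<beta> m'" "a \<in> carrier k \<Longrightarrow> \<Phi> \<beta> (a \<odot>\<^bsub>x\<^esub> m) = a \<odot>\<^bsub>P\<^esub> \<Phi> \<beta> m"
      if "\<beta> \<in> carrier ?B" "m \<in> carrier x" "m' \<in> carrier x" for \<beta> m m' a
      using linear_mapsD(2)[OF bilinear_mapsD(2)[OF \<Phi> that(1)] that(2,3)]
        linear_mapsD(3)[OF bilinear_mapsD(2)[OF \<Phi> that(1)] _ that(2), of a] that(2,3) by simp_all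
    have \<Phi>1: "\<Phi> (\<beta> \<oplus>\<^bsub>?B\<^esub> \<beta>') m = \<Phi> \<beta> m \<oplus>\<^bsub>P\<^esub> \<Phi> \<beta>' m"
      if "\<beta> \<in> carrier ?B" "\<beta>' \<in> carrier ?B" "m \<in> carrier x" for \<beta> \<beta>' m
      using linear_mapsD(2)[OF bilinear_mapsD(3)[OF \<Phi> that(3)] that(1,2)] that(1,2) Bc(1)[OF that(1,2)]
      by (simp only: restrict_apply')
    have \<Phi>1': "\<Phi> (a \<odot>\<^bsub>?B\<^esub> \<beta>) m = a \<odot>\<^bsub>P\<^esub> \<Phi> \<beta> m"
      if "a \<in> carrier k" "\<beta> \<in> carrier ?B" "m \<in> carrier x" for \<beta> m a
      using linear_mapsD(3)[OF bilinear_mapsD(3)[OF \<Phi> that(3)] that(1,2)] that(2) Bc(2)[OF that(1,2)]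
      by (simp only: restrict_apply')
    \<comment> \<open>By \<open>w_unit\<close>, the generator \<open>s\<close> tensor
      \<open>m\<close> is the image of the point mass at \<open>s\<close> tensor \<open>s m\<close>,
      which dictates the value of \<open>u\<close>.\<close>
    have "\<exists>u \<in> linear_maps k ?I P. \<forall>s \<in> carrier F. \<forall>m \<in> carrier X.
        u (act ?I s (?u m)) = \<Phi> (point_mass k F s) (act x s m)"
    proof (rule S.ind_linear_map[OF Xm P])
      fix s h m assume "s \<in> carrier F" "m \<in> carrier X"
      then show "\<Phi> (point_mass k F (s \<otimes>\<^bsub>F\<^esub> unit_hom F h))
          (act x (s \<otimes>\<^bsub>F\<^esub> unit_hom F h) (act X (inv\<^bsub>unit_group\<^esub> h) m)) =
          \<Phi> (point_mass k F s) (act x s m)"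
        by (simp add: unit_hom_def)
    qed (simp_all add: \<Phi>c[OF Bc(4)] \<Phi>2[OF Bc(4)] x.act_add x.act_smult del: bounded_functions_simps(1))
    then obtain u where u: "u \<in> linear_maps k ?I P"
      and u_unit: "\<And>s m. \<lbrakk>s \<in> carrier F; m \<in> carrier x\<rbrakk> \<Longrightarrow>
        u (act ?I s (?u m)) = \<Phi> (point_mass k F s) (act x s m)" by auto
    note us = linear_mapsD(1-3)[OF u]
    \<comment> \<open>Agreement on point masses is extended to all \<open>\<beta>\<close> by
      induction on a finite set outside which \<open>\<beta>\<close> vanishes, removing one point at
      a time.\<close>
    have u_w: "u (w \<beta> m) = \<Phi> \<beta> m"
      if "finite S" "S \<subseteq> carrier F" "\<beta> \<in> carrier ?B" "\<And>s. s \<in> carrier F - S \<Longrightarrow> \<beta> s = \<zero>\<^bsub>k\<^esub>"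
        and m: "m \<in> carrier x" for S \<beta> m
      using that(1-4)
    proof (induction S arbitrary: \<beta> rule: finite_induct)
      case empty
      \<comment> \<open>A function vanishing everywhere is zero times itself, so bilinearity gives
        the value zero.\<close>
      have "\<zero>\<^bsub>k\<^esub> \<odot>\<^bsub>?B\<^esub> \<beta> = \<beta>"
        using empty(2,3) by (auto simp: PiE_iff extensional_def)
      then have "\<Phi> \<beta> m = \<zero>\<^bsub>P\<^esub>"
        using \<Phi>1'[OF k.zero_closed empty(2) m] \<Phi>c[OF empty(2) m] by simp
      moreover have "w \<beta> m = \<zero>\<^bsub>?I\<^esub>" using empty(3) m by (auto simp: w_def)
      then have "u (w \<beta> m) = \<zero>\<^bsub>P\<^esub>"
        using linear_maps_zero[OF u I.module_axioms P] by simp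
      ultimately show ?case by simp
    next
      case (insert r S)
      define \<beta>' where "\<beta>' = (\<lambda>s \<in> carrier F. if s = r then \<zero>\<^bsub>k\<^esub> else \<beta> s)"
      have r: "r \<in> carrier F" and \<beta>r: "\<beta> r \<in> carrier k" using insert B_app by auto
      have \<beta>': "\<beta>' \<in> carrier ?B"
        using B_app[OF insert(5)] F(2) by (auto simp: \<beta>'_def)
      let ?\<delta> = "point_mass k F r"
      have dec: "\<beta> = \<beta>' \<oplus>\<^bsub>?B\<^esub> (\<beta> r \<odot>\<^bsub>?B\<^esub> ?\<delta>)"
        using insert(5) B_app[OF insert(5)] \<beta>r
        by (auto simp: \<beta>'_def point_mass_def fun_eq_iff PiE_iff extensional_def)
      have "w \<beta> m = w \<beta>' m \<oplus>\<^bsub>?I\<^esub> (\<beta> r \<odot>\<^bsub>?I\<^esub> w ?\<delta> m)"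
        using B_app[OF insert(5)] \<beta>r m by (auto simp: w_def \<beta>'_def point_mass_def fun_eq_iff)
      then have "u (w \<beta> m) = u (w \<beta>' m) \<oplus>\<^bsub>P\<^esub> \<beta> r \<odot>\<^bsub>P\<^esub> u (w ?\<delta> m)"
        by (simp only: us(2)[OF wI[OF \<beta>' m] I.smult_closed[OF \<beta>r wI[OF Bc(4) m]]]
            us(3)[OF \<beta>r wI[OF Bc(4) m]])
      also have "u (w \<beta>' m) = \<Phi> \<beta>' m"
        by (rule insert.IH[OF _ \<beta>']) (use insert.prems in \<open>auto simp: \<beta>'_def\<close>)
      also have "u (w ?\<delta> m) = \<Phi> ?\<delta> m"
        using u_unit[of r "act x (inv\<^bsub>F\<^esub> r) m"] r m by (simp add: w_unit del: ind_gmodule_simps)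
      also have "\<Phi> \<beta>' m \<oplus>\<^bsub>P\<^esub> \<beta> r \<odot>\<^bsub>P\<^esub> \<Phi> ?\<delta> m = \<Phi> \<beta> m"
        using arg_cong[OF dec, of "\<lambda>\<beta>. \<Phi> \<beta> m"]
        by (simp only: \<Phi>1[OF \<beta>' Bc(2)[OF \<beta>r Bc(4)] m] \<Phi>1'[OF \<beta>r Bc(4) m])
      finally show ?case .
    qed
    define f where "f = (\<lambda>y \<in> carrier L. u (c y))"
    have L_closed: "y \<oplus>\<^bsub>L\<^esub> z \<in> carrier L" "a \<in> carrier k \<Longrightarrow> a \<odot>\<^bsub>L\<^esub> y \<in> carrier L"
      if "y \<in> carrier L" "z \<in> carrier L" for y z a
    proof -
      interpret L: group_module k F L by (rule S.gmG[OF Lg])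
      show "y \<oplus>\<^bsub>L\<^esub> z \<in> carrier L" "a \<in> carrier k \<Longrightarrow> a \<odot>\<^bsub>L\<^esub> y \<in> carrier L" using that by auto
    qed
    have f: "f \<in> linear_maps k L P"
      using ghomD(2-4)[OF c] us L_closed
      by (auto simp: linear_maps_def f_def simp del: ind_gmodule_simps)
    have f_\<tau>: "f (\<tau> \<beta> m) = \<Phi> \<beta> m" if "\<beta> \<in> carrier ?B" "m \<in> carrier x" for \<beta> m
      using u_w[OF F(2) subset_refl that(1) _ that(2)] wI[OF that] bs(1)[OF wI[OF that]]
      by (simp add: f_def \<tau>_def cb)
    \<comment> \<open>Every generator of the induced module is the image of an elementary tensor, so
      two maps that agree on these tensors coincide.\<close>
    have unique: "f' = f''"
      if f': "f' \<in> linear_maps k L P" "f'' \<in> linear_maps k L P"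
        and eq: "\<And>\<beta> m. \<lbrakk>\<beta> \<in> carrier ?B; m \<in> carrier x\<rbrakk> \<Longrightarrow> f' (\<tau> \<beta> m) = f'' (\<tau> \<beta> m)" for f' f''
    proof -
      have "f' (b v) = f'' (b v)" if "v \<in> carrier ?I" for v
        using Xm that
      proof (induction rule: S.ind_induct)
        case (add v v')
        then show ?case
          by (simp add: bs linear_mapsD[OF f'(1)] linear_mapsD[OF f'(2)] del: ind_gmodule_simps)
      next
        case (unit s m)
        have "act ?I s (?u m) = w (point_mass k F s) (act x s m)"
          using unit by (simp add: w_unit del: ind_gmodule_simps)
        then show ?case using eq[OF Bc(4), of "act x s m" s] unit by (simp add: \<tau>_def)
      qed
      then have "f' y = f'' y" if "y \<in> carrier L" for y using that bc ghomD(2)[OF c] by metis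
      then show ?thesis
        using linear_mapsD(4)[OF f'(1)] linear_mapsD(4)[OF f'(2)] by (rule extensionalityI[rotated 2])
    qed
    show ?thesis
    proof (rule ex1I[of _ f])
      fix f' assume "f' \<in> linear_maps k L P \<and> (\<forall>\<beta> \<in> carrier ?B. \<forall>m \<in> carrier x. f' (\<tau> \<beta> m) = \<Phi> \<beta> m)"
      then show "f' = f" using f_\<tau> by (intro unique f) auto
    qed (use f f_\<tau> in blast)
  qed
  have "is_tensor_product U k ?B x L \<tau>"
    unfolding is_tensor_product_def using tensor_bilinear universal by blast
  then have "is_diagonal_tensor_product U k F ?B x L"
    unfolding is_diagonal_tensor_product_def using Lg diagonal by blast
  moreover have "L \<in> projectives U k F"
    by (rule S.projectives_ind[OF proj[folded X_def] L])
  ultimately show ?thesis using x by (auto simp: Cof_def)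
qed


section \<open>The classes of the proper model structure\<close>

lemma subgroup_hom_id: "group G \<Longrightarrow> subgroup F G \<Longrightarrow> (\<lambda>g. g) \<in> hom (G\<lparr>carrier := F\<rparr>) G"
  by (auto simp: hom_def dest: subgroup.mem_carrier)

lemma gmod_subgroup:
  assumes G: "group G" and F: "subgroup F G" and M: "M \<in> gmod U k G"
  shows "M \<in> gmod U k (G\<lparr>carrier := F\<rparr>)"
proof -
  have "group_module k (G\<lparr>carrier := F\<rparr>) (res_gmodule (\<lambda>g. g) M)"
    by (intro group_module_res[OF gmodD(1)[OF M G]] subgroup.subgroup_is_group[OF F G]
        subgroup_hom_id[OF G F])
  then show ?thesis using M by (simp add: gmod_def group_module_iff)
qed

lemma ghom_subgroup: "group G \<Longrightarrow> subgroup F G \<Longrightarrow> f \<in> ghom k G M N \<Longrightarrow> f \<in> ghom k (G\<lparr>carrier := F\<rparr>) M N"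
  using ghom_res[OF _ subgroup_hom_id, of f k G M N F] by simp

text \<open>Trades \<open>Cof\<close> over finite subgroups for projectivity of the underlying
  \<open>k\<close>-module, a condition that is unchanged when the action is pulled back along a
  homomorphism of groups.\<close>

lemma W_class_iff:
  assumes U: "set_universe U" and k: "cring k" and G: "group G"
  shows "w \<in> W_class U k G \<longleftrightarrow> w \<in> gmod U k G \<and>
    (\<forall>F. subgroup F G \<and> finite F \<longrightarrow>
      (\<forall>y \<in> gmod U k (G\<lparr>carrier := F\<rparr>).
        underlying (G\<lparr>carrier := F\<rparr>) y \<in> projectives U k unit_group \<longrightarrow>
        Ext1_zero U k (G\<lparr>carrier := F\<rparr>) y w))"
proof -
  have "Cof U k (G\<lparr>carrier := F\<rparr>) = {y \<in> gmod U k (G\<lparr>carrier := F\<rparr>).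
      underlying (G\<lparr>carrier := F\<rparr>) y \<in> projectives U k unit_group}"
    if F: "subgroup F G" "finite F" for F
  proof -
    have F': "group (G\<lparr>carrier := F\<rparr>)" "finite (carrier (G\<lparr>carrier := F\<rparr>))"
      using F G subgroup.subgroup_is_group by auto
    show ?thesis
      using Cof_imp_underlying_projective[OF U k F'] underlying_projective_imp_Cof[OF U k F']
      by (auto simp: Cof_def)
  qed
  then show ?thesis
    using gmod_subgroup[OF G] by (auto simp: W_class_def right_orth_def)
qed

lemma W_classD:
  assumes "set_universe U" "cring k" "group G" "w \<in> W_class U k G"
  shows "w \<in> gmod U k G"
    and "\<lbrakk>subgroup F G; finite F; y \<in> gmod U k (G\<lparr>carrier := F\<rparr>);
      underlying (G\<lparr>carrier := F\<rparr>) y \<in> projectives U k unit_group\<rbrakk> \<Longrightarrow>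
      Ext1_zero U k (G\<lparr>carrier := F\<rparr>) y w"
  using assms(4) unfolding W_class_iff[OF assms(1-3)] by blast+

text \<open>Given an extension with kernel \<open>w'\<close>, the map \<open>s\<close> extends over
  the middle term by vanishing of Ext into \<open>w\<close>, and following it with \<open>r\<close>
  retracts onto \<open>w'\<close>.\<close>

lemma W_class_retract:
  assumes U: "set_universe U" and k: "cring k" and G: "group G"
    and w: "w \<in> W_class U k G" and w': "w' \<in> gmod U k G"
    and s: "s \<in> ghom k G w' w" and r: "r \<in> ghom k G w w'"
    and rs: "\<And>x. x \<in> carrier w' \<Longrightarrow> r (s x) = x"
  shows "w' \<in> W_class U k G"
  unfolding W_class_iff[OF U k G]
proof (intro conjI allI impI ballI w')
  fix F y
  assume F: "subgroup F G \<and> finite F" and y: "y \<in> gmod U k (G\<lparr>carrier := F\<rparr>)"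
    and yp: "underlying (G\<lparr>carrier := F\<rparr>) y \<in> projectives U k unit_group"
  let ?F = "G\<lparr>carrier := F\<rparr>"
  have Fg: "group ?F" "finite (carrier ?F)" using F G subgroup.subgroup_is_group by auto
  have ext: "Ext1_zero U k ?F y w" using W_classD(2)[OF U k G w] F y yp by blast
  have wF: "w \<in> gmod U k ?F" "w' \<in> gmod U k ?F"
    using gmod_subgroup[OF G] F w' W_classD(1)[OF U k G w] by auto
  have sF: "s \<in> ghom k ?F w' w" "r \<in> ghom k ?F w w'" using F G s r by (auto intro: ghom_subgroup)
  show "Ext1_zero U k ?F y w'"
  proof (rule Ext1_zeroI_retraction[OF U Fg(1) y wF(2)])
    fix e j p
    assume e: "e \<in> gmod U k ?F" and se: "short_exact k ?F w' e y j p"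
    note se' = short_exactD[OF se]
    obtain \<sigma> where \<sigma>: "\<sigma> \<in> linear_maps k y e" "\<And>v. v \<in> carrier y \<Longrightarrow> p (\<sigma> v) = v"
      using linear_section[OF U k Fg y yp e se'(2,4)] by blast
    obtain \<psi> where \<psi>: "\<psi> \<in> ghom k ?F e w" "\<forall>a \<in> carrier w'. \<psi> (j a) = s a"
      using Ext1_zero_extend[OF U Fg(1) y wF(1) ext gmodD(1)[OF e Fg(1)] gmodD(1)[OF wF(2) Fg(1)]
          se'(1,3,2,5) \<sigma> sF(1)] by blast
    show "\<exists>r \<in> ghom k ?F e w'. \<forall>a \<in> carrier w'. r (j a) = a"
      using ghom_compose[OF \<psi>(1) sF(2) gmodD(1)[OF e Fg(1)]] \<psi>(2) ghomD(2)[OF se'(1)] rs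
      by (intro bexI[of _ "compose (carrier e) r \<psi>"]) (auto simp: compose_eq)
  qed
qed

context res_setting
begin

text \<open>A finite subgroup \<open>F\<close> of \<open>H\<close> is isomorphic to its image in
  \<open>G\<close>, and an extension over \<open>F\<close> is an extension over that image once the
  action is relabelled.\<close>

lemma W_class_res:
  assumes w: "w \<in> W_class U k G"
  shows "res_gmodule i w \<in> W_class U k H"
  unfolding W_class_iff[OF U k H.is_group]
proof (intro conjI allI impI ballI)
  note wg = W_classD(1)[OF U k G.is_group w]
  show "res_gmodule i w \<in> gmod U k H" by (rule res_gmod[OF wg])
  fix F y
  assume F: "subgroup F H \<and> finite F" and y: "y \<in> gmod U k (H\<lparr>carrier := F\<rparr>)"
    and yp: "underlying (H\<lparr>carrier := F\<rparr>) y \<in> projectives U k unit_group"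
  \<comment> \<open>The inverse of \<open>i\<close> on the image of \<open>F\<close>, along which
    \<open>F\<close>-modules become modules over a subgroup of \<open>G\<close>.\<close>
  let ?F = "H\<lparr>carrier := F\<rparr>" and ?F' = "G\<lparr>carrier := i ` F\<rparr>" and ?\<iota> = "inv_into F i"
  have FH: "F \<subseteq> carrier H" using F by (auto dest: subgroup.subset)
  then have injF: "inj_on i F" using inj inj_on_subset by blast
  have F': "subgroup (i ` F) G" "finite (i ` F)"
    using F i.subgroup_img_is_subgroup by auto
  have grp: "group ?F" "group ?F'"
    using F F' G.is_group H.is_group subgroup.subgroup_is_group by auto
  have i\<iota> [simp]: "?\<iota> (i h) = h" if "h \<in> F" for h using injF that by simp
  have \<iota>: "?\<iota> \<in> hom ?F' ?F"
  proof (rule homI)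
    fix x z assume "x \<in> carrier ?F'" "z \<in> carrier ?F'"
    then obtain a b where ab: "a \<in> F" "b \<in> F" "x = i a" "z = i b" by auto
    then have "a \<otimes>\<^bsub>H\<^esub> b \<in> F" using F by (auto simp: subgroup.m_closed)
    moreover have "x \<otimes>\<^bsub>G\<^esub> z = i (a \<otimes>\<^bsub>H\<^esub> b)"
      using ab subsetD[OF FH ab(1)] subsetD[OF FH ab(2)] by simp
    ultimately show "?\<iota> (x \<otimes>\<^bsub>?F'\<^esub> z) = ?\<iota> x \<otimes>\<^bsub>?F\<^esub> ?\<iota> z" using ab by simp
  qed auto
  have y': "res_gmodule ?\<iota> M \<in> gmod U k ?F'" if "M \<in> gmod U k ?F" for M
    using that group_module_res[OF gmodD(1)[OF that grp(1)] grp(2) \<iota>] by (auto simp: gmod_def group_module_iff)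
  have "?\<iota> \<one>\<^bsub>G\<^esub> = \<one>\<^bsub>H\<^esub>" using i\<iota>[of "\<one>\<^bsub>H\<^esub>"] F by (auto simp: subgroup.one_closed)
  then have "underlying ?F' (res_gmodule ?\<iota> y) = underlying ?F y"
    by (simp add: underlying_def unit_hom_def res_gmodule_res)
  then have ext: "Ext1_zero U k ?F' (res_gmodule ?\<iota> y) w"
    using W_classD(2)[OF U k G.is_group w F' y'[OF y]] yp by simp
  have rw: "res_gmodule i w \<in> gmod U k ?F" "w \<in> gmod U k ?F'"
    using gmod_subgroup[OF H.is_group _ res_gmod[OF wg]] gmod_subgroup[OF G.is_group F'(1) wg] F by auto
  show "Ext1_zero U k ?F y (res_gmodule i w)"
    unfolding Ext1_zero_iff[OF U grp(1) y rw(1)]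
  proof (intro ballI allI impI)
    fix e j p
    assume e: "e \<in> gmod U k ?F" and se: "short_exact k ?F (res_gmodule i w) e y j p"
    note se' = short_exactD[OF se]
    have "j \<in> ghom k ?F' w (res_gmodule ?\<iota> e)"
      using se'(1) by (auto simp: ghom_def linear_maps_def)
    moreover have "p \<in> ghom k ?F' (res_gmodule ?\<iota> e) (res_gmodule ?\<iota> y)"
      by (rule ghom_res[OF se'(2) \<iota>])
    ultimately have se2: "short_exact k ?F' w (res_gmodule ?\<iota> e) (res_gmodule ?\<iota> y) j p"
      using se by (simp add: short_exact_def)
    obtain s where s: "s \<in> ghom k ?F' (res_gmodule ?\<iota> y) (res_gmodule ?\<iota> e)"
      "\<forall>a \<in> carrier y. p (s a) = a"
      using iffD1[OF Ext1_zero_iff[OF U grp(2) y'[OF y] rw(2)] ext, rule_format, OF y'[OF e] se2] by auto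
    have "s \<in> ghom k ?F y e" using s(1) by (auto simp: ghom_def linear_maps_def)
    then show "\<exists>s \<in> ghom k ?F y e. \<forall>a \<in> carrier y. p (s a) = a" using s(2) by blast
  qed
qed

text \<open>Mackey-type argument: an \<open>F\<close>-map from \<open>e\<close> to the coinduced module amounts to one
  \<open>H \<inter> g\<^sup>-\<^sup>1Fg\<close>-map \<open>e \<rightarrow> w\<close> for each representative \<open>g\<close> of the double cosets \<open>F\<setminus>G/H\<close>, and
  each of these is obtained by extending the evaluation at \<open>g\<close> along \<open>j\<close>.\<close>

lemma W_class_coind:
  assumes w: "w \<in> W_class U k H" and R: "R \<in> gmod U k G"
    and b: "b \<in> ghom k G (coind_gmodule G H i w) R" and c: "c \<in> ghom k G R (coind_gmodule G H i w)"
    and bc: "\<And>y. y \<in> carrier R \<Longrightarrow> b (c y) = y"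
  shows "R \<in> W_class U k G"
  unfolding W_class_iff[OF U k G.is_group]
proof (intro conjI allI impI ballI R)
  note wg = W_classD(1)[OF U k H.is_group w]
  interpret w: group_module k H w by (rule gmH[OF wg])
  fix F y
  assume F: "subgroup F G \<and> finite F" and y: "y \<in> gmod U k (G\<lparr>carrier := F\<rparr>)"
    and yp: "underlying (G\<lparr>carrier := F\<rparr>) y \<in> projectives U k unit_group"
  let ?F = "G\<lparr>carrier := F\<rparr>" and ?C = "coind_gmodule G H i w"
  have Fg: "group ?F" "finite (carrier ?F)" using F G.is_group subgroup.subgroup_is_group by auto
  have FG [simp]: "f \<in> carrier G" if "f \<in> F" for f using F that by (auto dest: subgroup.mem_carrier)
  have Fc [simp]: "\<one>\<^bsub>G\<^esub> \<in> F" "\<And>f. f \<in> F \<Longrightarrow> inv\<^bsub>G\<^esub> f \<in> F" "\<And>f f'. f \<in> F \<Longrightarrow> f' \<in> F \<Longrightarrow> f \<otimes>\<^bsub>G\<^esub> f' \<in> F"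
    using F by (auto simp: subgroup.one_closed subgroup.m_inv_closed subgroup.m_closed)
  have RF: "R \<in> gmod U k ?F" using gmod_subgroup[OF G.is_group _ R] F by auto
  show "Ext1_zero U k ?F y R"
  proof (rule Ext1_zeroI_retraction[OF U Fg(1) y RF])
    fix e j p
    assume e: "e \<in> gmod U k ?F" and se: "short_exact k ?F R e y j p"
    note se' = short_exactD[OF se]
    note em = gmodD(1)[OF e Fg(1)] and Rm = gmodD(1)[OF RF Fg(1)]
    interpret e: group_module k ?F e by (rule em)
    have e_act: "act e f v \<in> carrier e" if "f \<in> F" "v \<in> carrier e" for f v
      using e.act_closed that by simp
    have e_mult: "act e (f \<otimes>\<^bsub>G\<^esub> f') v = act e f (act e f' v)" if "f \<in> F" "f' \<in> F" "v \<in> carrier e" for f f' v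
      using e.act_mult that by simp
    obtain \<sigma> where \<sigma>: "\<sigma> \<in> linear_maps k y e" "\<And>v. v \<in> carrier y \<Longrightarrow> p (\<sigma> v) = v"
      using linear_section[OF U k Fg y yp e se'(2,4)] by blast
    \<comment> \<open>The stabiliser part of the Mackey decomposition at \<open>g\<close>: those
      \<open>h\<close> whose conjugate by \<open>g\<close> lies in \<open>F\<close>. Conjugation
      \<open>\<gamma> g\<close> maps it injectively into \<open>F\<close>, hence it is
      finite.\<close>
    define K where "K g = {h \<in> carrier H. g \<otimes>\<^bsub>G\<^esub> i h \<otimes>\<^bsub>G\<^esub> inv\<^bsub>G\<^esub> g \<in> F}" for g
    define \<gamma> where "\<gamma> g h = g \<otimes>\<^bsub>G\<^esub> i h \<otimes>\<^bsub>G\<^esub> inv\<^bsub>G\<^esub> g" for g h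
    have \<gamma>_mult: "\<gamma> g (h \<otimes>\<^bsub>H\<^esub> h') = \<gamma> g h \<otimes>\<^bsub>G\<^esub> \<gamma> g h'"
      if "g \<in> carrier G" "h \<in> carrier H" "h' \<in> carrier H" for g h h'
    proof -
      have "inv\<^bsub>G\<^esub> g \<otimes>\<^bsub>G\<^esub> (g \<otimes>\<^bsub>G\<^esub> (i h' \<otimes>\<^bsub>G\<^esub> inv\<^bsub>G\<^esub> g)) = i h' \<otimes>\<^bsub>G\<^esub> inv\<^bsub>G\<^esub> g"
        using that by (simp flip: G.m_assoc)
      then show ?thesis using that by (simp add: \<gamma>_def G.m_assoc)
    qed
    have \<gamma>_inv: "\<gamma> g (inv\<^bsub>H\<^esub> h) = inv\<^bsub>G\<^esub> (\<gamma> g h)" if "g \<in> carrier G" "h \<in> carrier H" for g h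
      using that by (simp add: \<gamma>_def G.inv_mult_group G.m_assoc)
    have \<gamma>_one: "\<gamma> g \<one>\<^bsub>H\<^esub> = \<one>\<^bsub>G\<^esub>" if "g \<in> carrier G" for g using that by (simp add: \<gamma>_def)
    \<comment> \<open>The component of the future retraction at the point \<open>g\<close>:
      evaluation at \<open>g\<close> is extended from \<open>R\<close> to \<open>e\<close>.\<close>
    have "\<exists>\<rho>. \<rho> \<in> ghom k (H\<lparr>carrier := K g\<rparr>) (res_gmodule (\<gamma> g) e) w \<and>
        (\<forall>a \<in> carrier R. \<rho> (j a) = c a g)" if g: "g \<in> carrier G" for g
    proof -
      let ?K = "H\<lparr>carrier := K g\<rparr>"
      have sub: "subgroup (K g) H"
      proof (rule H.subgroupI)
        show "K g \<noteq> {}" using \<gamma>_one[OF g] by (auto simp: K_def \<gamma>_def intro!: exI[of _ "\<one>\<^bsub>H\<^esub>"])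
        show "inv\<^bsub>H\<^esub> h \<in> K g" if "h \<in> K g" for h
          using that \<gamma>_inv[OF g, of h] by (auto simp: K_def \<gamma>_def simp del: i_simps)
        show "h \<otimes>\<^bsub>H\<^esub> h' \<in> K g" if "h \<in> K g" "h' \<in> K g" for h h'
          using that \<gamma>_mult[OF g, of h h'] by (auto simp: K_def \<gamma>_def simp del: i_simps)
      qed (auto simp: K_def)
      have "inj_on (\<gamma> g) (K g)"
        using g inj by (auto simp: inj_on_def \<gamma>_def K_def)
      moreover have "\<gamma> g ` K g \<subseteq> F" by (auto simp: K_def \<gamma>_def)
      ultimately have fin: "finite (K g)" using F by (meson finite_subset inj_on_finite)
      have Kg: "group ?K" using sub H.is_group subgroup.subgroup_is_group by auto
      have \<gamma>h: "\<gamma> g \<in> hom ?K ?F"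
        using \<gamma>_mult[OF g] by (auto simp: hom_def K_def \<gamma>_def)
      have res: "res_gmodule (\<gamma> g) M \<in> gmod U k ?K" if "M \<in> gmod U k ?F" for M
        using that group_module_res[OF gmodD(1)[OF that Fg(1)] Kg \<gamma>h]
        by (auto simp: gmod_def group_module_iff)
      have "underlying ?K (res_gmodule (\<gamma> g) y) = underlying ?F y"
        by (simp add: underlying_def unit_hom_def res_gmodule_res \<gamma>_one[OF g])
      \<comment> \<open>Pulling \<open>y\<close> back along \<open>\<gamma> g\<close> leaves its
        underlying \<open>k\<close>-module unchanged, so the hypothesis on \<open>w\<close> applies
        over the finite group \<open>K g\<close>.\<close>
      then have ext: "Ext1_zero U k ?K (res_gmodule (\<gamma> g) y) w"
        using W_classD(2)[OF U k H.is_group w sub fin res[OF y]] yp by simp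
      have wK: "w \<in> gmod U k ?K" by (rule gmod_subgroup[OF H.is_group sub wg])
      \<comment> \<open>Acting by the conjugate of \<open>h\<close> and evaluating at
        \<open>g\<close> is evaluation at \<open>g i(h^-1)\<close>, which the coset condition turns
        into the action of \<open>h\<close> on the value at \<open>g\<close>.\<close>
      have ev: "(\<lambda>a \<in> carrier R. c a g) \<in> ghom k ?K (res_gmodule (\<gamma> g) R) w"
      proof -
        have "restrict (\<lambda>a. c a g) (carrier (res_gmodule (\<gamma> g) R)) \<in> ghom k ?K (res_gmodule (\<gamma> g) R) w"
        proof (rule ghomI[OF gmodD(1)[OF res[OF RF] Kg]])
          fix h a assume h: "h \<in> carrier ?K" and a: "a \<in> carrier (res_gmodule (\<gamma> g) R)"
          then have hH: "h \<in> carrier H" "\<gamma> g h \<in> carrier G" using g by (auto simp: K_def \<gamma>_def)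
          have "c (act (res_gmodule (\<gamma> g) R) h a) g = c a (inv\<^bsub>G\<^esub> (\<gamma> g h) \<otimes>\<^bsub>G\<^esub> g)"
            using a hH g by (simp add: ghomD(5)[OF c])
          also have "inv\<^bsub>G\<^esub> (\<gamma> g h) \<otimes>\<^bsub>G\<^esub> g = g \<otimes>\<^bsub>G\<^esub> i (inv\<^bsub>H\<^esub> h)"
            using hH g by (simp add: \<gamma>_def G.inv_mult_group G.m_assoc)
          also have "c a \<dots> = act w h (c a g)"
            using a hH g by (subst coind_carrierD(3)[OF ghomD(2)[OF c]]) auto
          finally show "c (act (res_gmodule (\<gamma> g) R) h a) g = act w h (c a g)" .
        qed (use g in \<open>auto simp: ghomD[OF c] coind_carrierD(2)[OF ghomD(2)[OF c]]\<close>)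
        then show ?thesis by simp
      qed
      have "\<exists>\<psi> \<in> ghom k ?K (res_gmodule (\<gamma> g) e) w. \<forall>a \<in> carrier (res_gmodule (\<gamma> g) R).
          \<psi> (j a) = (\<lambda>a \<in> carrier R. c a g) a"
      proof (rule Ext1_zero_extend[OF U Kg res[OF y] wK ext gmodD(1)[OF res[OF e] Kg]
            gmodD(1)[OF res[OF RF] Kg] ghom_res[OF se'(1) \<gamma>h] _ ghom_res[OF se'(2) \<gamma>h] _ _ _ ev])
        show "\<sigma> \<in> linear_maps k (res_gmodule (\<gamma> g) y) (res_gmodule (\<gamma> g) e)"
          using \<sigma>(1) by (simp add: linear_maps_def)
      qed (use se'(3,5) \<sigma>(2) in simp_all)
      then show ?thesis by auto
    qed
    then obtain \<rho> where \<rho>: "\<And>g. g \<in> carrier G \<Longrightarrow> \<rho> g \<in> ghom k (H\<lparr>carrier := K g\<rparr>) (res_gmodule (\<gamma> g) e) w"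
      "\<And>g a. g \<in> carrier G \<Longrightarrow> a \<in> carrier R \<Longrightarrow> \<rho> g (j a) = c a g"
      by metis
    note \<rho>s = ghomD(2-4)[OF \<rho>(1), simplified]
    have \<rho>_act: "\<rho> g (act e (\<gamma> g h) v) = act w h (\<rho> g v)"
      if "g \<in> carrier G" "h \<in> carrier H" "\<gamma> g h \<in> F" "v \<in> carrier e" for g h v
      using ghomD(5)[OF \<rho>(1)[OF that(1)], of h v] that by (simp add: K_def \<gamma>_def)
    \<comment> \<open>The double coset of \<open>x\<close>; its representative \<open>d x\<close> is
      chosen from the set itself, so that it is constant on double cosets.\<close>
    define D where "D x = {f \<otimes>\<^bsub>G\<^esub> x \<otimes>\<^bsub>G\<^esub> i h | f h. f \<in> F \<and> h \<in> carrier H}" for x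
    define d where "d x = (SOME z. z \<in> D x)" for x
    have D_sub: "D (f \<otimes>\<^bsub>G\<^esub> x \<otimes>\<^bsub>G\<^esub> i h) \<subseteq> D x"
      if x: "x \<in> carrier G" and f: "f \<in> F" and h: "h \<in> carrier H" for x f h
    proof
      fix z assume "z \<in> D (f \<otimes>\<^bsub>G\<^esub> x \<otimes>\<^bsub>G\<^esub> i h)"
      then obtain f' h' where fh: "f' \<in> F" "h' \<in> carrier H" "z = f' \<otimes>\<^bsub>G\<^esub> (f \<otimes>\<^bsub>G\<^esub> x \<otimes>\<^bsub>G\<^esub> i h) \<otimes>\<^bsub>G\<^esub> i h'"
        by (auto simp: D_def)
      have "z = (f' \<otimes>\<^bsub>G\<^esub> f) \<otimes>\<^bsub>G\<^esub> x \<otimes>\<^bsub>G\<^esub> i (h \<otimes>\<^bsub>H\<^esub> h')" using that fh by (simp add: G.m_assoc)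
      moreover have "f' \<otimes>\<^bsub>G\<^esub> f \<in> F" "h \<otimes>\<^bsub>H\<^esub> h' \<in> carrier H" using fh f h by auto
      ultimately show "z \<in> D x" unfolding D_def by blast
    qed
    have D_eq: "D (f \<otimes>\<^bsub>G\<^esub> x \<otimes>\<^bsub>G\<^esub> i h) = D x"
      if x: "x \<in> carrier G" and f: "f \<in> F" and h: "h \<in> carrier H" for x f h
    proof
      have "inv\<^bsub>G\<^esub> f \<otimes>\<^bsub>G\<^esub> (f \<otimes>\<^bsub>G\<^esub> x \<otimes>\<^bsub>G\<^esub> i h) \<otimes>\<^bsub>G\<^esub> i (inv\<^bsub>H\<^esub> h) = x"
        using that by (simp add: G.m_assoc) (simp flip: G.m_assoc)
      then show "D x \<subseteq> D (f \<otimes>\<^bsub>G\<^esub> x \<otimes>\<^bsub>G\<^esub> i h)"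
        using D_sub[of "f \<otimes>\<^bsub>G\<^esub> x \<otimes>\<^bsub>G\<^esub> i h" "inv\<^bsub>G\<^esub> f" "inv\<^bsub>H\<^esub> h"] that by simp
    qed (rule D_sub[OF that])
    have d_eq: "d (f \<otimes>\<^bsub>G\<^esub> x \<otimes>\<^bsub>G\<^esub> i h) = d x"
      if "x \<in> carrier G" "f \<in> F" "h \<in> carrier H" for x f h
      using D_eq[OF that] by (simp add: d_def)
    have "\<exists>f h. f \<in> F \<and> h \<in> carrier H \<and> x = f \<otimes>\<^bsub>G\<^esub> d x \<otimes>\<^bsub>G\<^esub> i h \<and> d x \<in> carrier G"
      if x: "x \<in> carrier G" for x
    proof -
      have "\<one>\<^bsub>G\<^esub> \<otimes>\<^bsub>G\<^esub> x \<otimes>\<^bsub>G\<^esub> i \<one>\<^bsub>H\<^esub> \<in> D x" unfolding D_def using Fc(1) H.one_closed by blast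
      then have "d x \<in> D x" unfolding d_def by (rule someI)
      then obtain f h where fh: "f \<in> F" "h \<in> carrier H" "d x = f \<otimes>\<^bsub>G\<^esub> x \<otimes>\<^bsub>G\<^esub> i h" by (auto simp: D_def)
      then have "x = inv\<^bsub>G\<^esub> f \<otimes>\<^bsub>G\<^esub> d x \<otimes>\<^bsub>G\<^esub> i (inv\<^bsub>H\<^esub> h)"
        using x by (simp add: G.m_assoc) (simp flip: G.m_assoc)
      then show ?thesis using fh x by (intro exI[of _ "inv\<^bsub>G\<^esub> f"] exI[of _ "inv\<^bsub>H\<^esub> h"]) auto
    qed
    then obtain \<phi> \<chi> where fh: "\<And>x. x \<in> carrier G \<Longrightarrow> \<phi> x \<in> F" "\<And>x. x \<in> carrier G \<Longrightarrow> \<chi> x \<in> carrier H"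
      "\<And>x. x \<in> carrier G \<Longrightarrow> x = \<phi> x \<otimes>\<^bsub>G\<^esub> d x \<otimes>\<^bsub>G\<^esub> i (\<chi> x)" "\<And>x. x \<in> carrier G \<Longrightarrow> d x \<in> carrier G"
      by metis
    \<comment> \<open>The components at the representatives are spread over their double cosets:
      \<open>F\<close> acts on the argument in \<open>e\<close>, \<open>H\<close> on the value in
      \<open>w\<close>.\<close>
    define q where "q v = (\<lambda>x \<in> carrier G. act w (inv\<^bsub>H\<^esub> (\<chi> x)) (\<rho> (d x) (act e (inv\<^bsub>G\<^esub> (\<phi> x)) v)))" for v
    \<comment> \<open>Two decompositions of \<open>x\<close> differ by \<open>l\<close> in
      \<open>K (d x)\<close>, whose conjugate is \<open>f^-1 f0\<close>; equivariance of
      \<open>\<rho> (d x)\<close> under \<open>K (d x)\<close> makes the values agree.\<close>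
    have q_eq: "q v x = act w (inv\<^bsub>H\<^esub> h) (\<rho> (d x) (act e (inv\<^bsub>G\<^esub> f) v))"
      if v: "v \<in> carrier e" and x: "x \<in> carrier G" and f: "f \<in> F" and h: "h \<in> carrier H"
        and eq: "x = f \<otimes>\<^bsub>G\<^esub> d x \<otimes>\<^bsub>G\<^esub> i h" for v x f h
    proof -
      define f0 h0 where "f0 = \<phi> x" and "h0 = \<chi> x"
      have fh0: "f0 \<in> F" "h0 \<in> carrier H" "x = f0 \<otimes>\<^bsub>G\<^esub> d x \<otimes>\<^bsub>G\<^esub> i h0" "d x \<in> carrier G"
        using fh[OF x] by (auto simp: f0_def h0_def)
      define l where "l = h \<otimes>\<^bsub>H\<^esub> inv\<^bsub>H\<^esub> h0"
      have l: "l \<in> carrier H" using h fh0 by (simp add: l_def)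
      have "\<gamma> (d x) l = inv\<^bsub>G\<^esub> f \<otimes>\<^bsub>G\<^esub> (f \<otimes>\<^bsub>G\<^esub> d x \<otimes>\<^bsub>G\<^esub> i h) \<otimes>\<^bsub>G\<^esub> inv\<^bsub>G\<^esub> (i h0) \<otimes>\<^bsub>G\<^esub> inv\<^bsub>G\<^esub> (d x)"
        using f h fh0 by (simp add: \<gamma>_def l_def flip: G.m_assoc)
      also have "\<dots> = inv\<^bsub>G\<^esub> f \<otimes>\<^bsub>G\<^esub> (f0 \<otimes>\<^bsub>G\<^esub> d x \<otimes>\<^bsub>G\<^esub> i h0) \<otimes>\<^bsub>G\<^esub> inv\<^bsub>G\<^esub> (i h0) \<otimes>\<^bsub>G\<^esub> inv\<^bsub>G\<^esub> (d x)"
        by (simp only: eq[symmetric] fh0(3)[symmetric])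
      also have "\<dots> = inv\<^bsub>G\<^esub> f \<otimes>\<^bsub>G\<^esub> f0"
        using f fh0(1,2,4) by (simp add: G.m_assoc)
      finally have \<gamma>l: "\<gamma> (d x) l = inv\<^bsub>G\<^esub> f \<otimes>\<^bsub>G\<^esub> f0" .
      have v': "act e (inv\<^bsub>G\<^esub> f0) v \<in> carrier e" using v fh0 by (simp add: e_act)
      have "act e (\<gamma> (d x) l) (act e (inv\<^bsub>G\<^esub> f0) v) = act e (inv\<^bsub>G\<^esub> f \<otimes>\<^bsub>G\<^esub> f0 \<otimes>\<^bsub>G\<^esub> inv\<^bsub>G\<^esub> f0) v"
        unfolding \<gamma>l using f fh0 v by (intro e_mult[symmetric]) auto
      also have "inv\<^bsub>G\<^esub> f \<otimes>\<^bsub>G\<^esub> f0 \<otimes>\<^bsub>G\<^esub> inv\<^bsub>G\<^esub> f0 = inv\<^bsub>G\<^esub> f" using f fh0 by (simp add: G.m_assoc)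
      finally have "\<rho> (d x) (act e (inv\<^bsub>G\<^esub> f) v) = act w l (\<rho> (d x) (act e (inv\<^bsub>G\<^esub> f0) v))"
        using \<rho>_act[OF fh0(4) l _ v'] \<gamma>l f fh0 by simp
      moreover have "act w (inv\<^bsub>H\<^esub> h) (act w l m) = act w (inv\<^bsub>H\<^esub> h0) m" if "m \<in> carrier w" for m
      proof -
        have "inv\<^bsub>H\<^esub> h \<otimes>\<^bsub>H\<^esub> l = inv\<^bsub>H\<^esub> h0" using h fh0 by (simp add: l_def flip: H.m_assoc)
        then show ?thesis using that h l by (simp flip: w.act_mult)
      qed
      ultimately show ?thesis
        using x \<rho>s(1)[OF fh0(4) v'] by (simp add: q_def f0_def h0_def)
    qed
    have q_coind: "q v \<in> carrier ?C" if v: "v \<in> carrier e" for v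
    proof (rule coind_carrierI)
      fix x assume x: "x \<in> carrier G"
      note fhx = fh[OF x]
      have val: "\<rho> (d x) (act e (inv\<^bsub>G\<^esub> (\<phi> x)) v) \<in> carrier w"
        using fhx v by (intro \<rho>s(1) e_act) auto
      then show "q v x \<in> carrier w" using x fhx by (simp add: q_def)
      fix h assume h: "h \<in> carrier H"
      have "d (\<one>\<^bsub>G\<^esub> \<otimes>\<^bsub>G\<^esub> x \<otimes>\<^bsub>G\<^esub> i h) = d x" by (rule d_eq[OF x Fc(1) h])
      then have dx: "d (x \<otimes>\<^bsub>G\<^esub> i h) = d x" using x by simp
      have "x \<otimes>\<^bsub>G\<^esub> i h = \<phi> x \<otimes>\<^bsub>G\<^esub> d x \<otimes>\<^bsub>G\<^esub> i (\<chi> x) \<otimes>\<^bsub>G\<^esub> i h" using fhx(3) by simp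
      also have "\<dots> = \<phi> x \<otimes>\<^bsub>G\<^esub> d (x \<otimes>\<^bsub>G\<^esub> i h) \<otimes>\<^bsub>G\<^esub> i (\<chi> x \<otimes>\<^bsub>H\<^esub> h)"
        using fhx(1,2,4) h by (simp add: dx G.m_assoc)
      finally have eq: "x \<otimes>\<^bsub>G\<^esub> i h = \<phi> x \<otimes>\<^bsub>G\<^esub> d (x \<otimes>\<^bsub>G\<^esub> i h) \<otimes>\<^bsub>G\<^esub> i (\<chi> x \<otimes>\<^bsub>H\<^esub> h)" .
      have "q v (x \<otimes>\<^bsub>G\<^esub> i h) = act w (inv\<^bsub>H\<^esub> (\<chi> x \<otimes>\<^bsub>H\<^esub> h)) (\<rho> (d x) (act e (inv\<^bsub>G\<^esub> (\<phi> x)) v))"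
        using q_eq[OF v G.m_closed[OF x i_simps(1)[OF h]] fhx(1) H.m_closed[OF fhx(2) h] eq]
        unfolding dx .
      then show "q v (x \<otimes>\<^bsub>G\<^esub> i h) = act w (inv\<^bsub>H\<^esub> h) (q v x)"
        using x h fhx(2) val by (simp add: q_def H.inv_mult_group w.act_mult)
    qed (simp add: q_def)
    have q_hom: "restrict q (carrier e) \<in> ghom k ?F e ?C"
    proof (rule ghomI[OF em])
      show "q v \<in> carrier ?C" if "v \<in> carrier e" for v by (rule q_coind[OF that])
      show "q (v \<oplus>\<^bsub>e\<^esub> v') = q v \<oplus>\<^bsub>?C\<^esub> q v'" if "v \<in> carrier e" "v' \<in> carrier e" for v v'
        using that fh e.act_add e_act by (auto simp: q_def fun_eq_iff \<rho>s w.act_add)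
      show "q (a \<odot>\<^bsub>e\<^esub> v) = a \<odot>\<^bsub>?C\<^esub> q v" if "a \<in> carrier k" "v \<in> carrier e" for a v
        using that fh e.act_smult e_act by (auto simp: q_def fun_eq_iff \<rho>s w.act_smult)
      show "q (act e f v) = act ?C f (q v)" if f: "f \<in> carrier ?F" and v: "v \<in> carrier e" for f v
      proof
        fix x
        show "q (act e f v) x = act ?C f (q v) x"
        proof (cases "x \<in> carrier G")
          case x: True
          note fhx = fh[OF x]
          have fF: "f \<in> F" using f by simp
          have "d (inv\<^bsub>G\<^esub> f \<otimes>\<^bsub>G\<^esub> x \<otimes>\<^bsub>G\<^esub> i \<one>\<^bsub>H\<^esub>) = d x" using fF by (intro d_eq x) auto
          then have dx: "d (inv\<^bsub>G\<^esub> f \<otimes>\<^bsub>G\<^esub> x) = d x" using x fF by simp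
          have "inv\<^bsub>G\<^esub> f \<otimes>\<^bsub>G\<^esub> x = inv\<^bsub>G\<^esub> f \<otimes>\<^bsub>G\<^esub> (\<phi> x \<otimes>\<^bsub>G\<^esub> d x \<otimes>\<^bsub>G\<^esub> i (\<chi> x))" using fhx(3) by simp
          also have "\<dots> = (inv\<^bsub>G\<^esub> f \<otimes>\<^bsub>G\<^esub> \<phi> x) \<otimes>\<^bsub>G\<^esub> d (inv\<^bsub>G\<^esub> f \<otimes>\<^bsub>G\<^esub> x) \<otimes>\<^bsub>G\<^esub> i (\<chi> x)"
            using fhx(1,2,4) fF by (simp add: dx G.m_assoc)
          finally have eq: "inv\<^bsub>G\<^esub> f \<otimes>\<^bsub>G\<^esub> x =
              (inv\<^bsub>G\<^esub> f \<otimes>\<^bsub>G\<^esub> \<phi> x) \<otimes>\<^bsub>G\<^esub> d (inv\<^bsub>G\<^esub> f \<otimes>\<^bsub>G\<^esub> x) \<otimes>\<^bsub>G\<^esub> i (\<chi> x)" .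
          have "q v (inv\<^bsub>G\<^esub> f \<otimes>\<^bsub>G\<^esub> x) =
              act w (inv\<^bsub>H\<^esub> (\<chi> x)) (\<rho> (d x) (act e (inv\<^bsub>G\<^esub> (inv\<^bsub>G\<^esub> f \<otimes>\<^bsub>G\<^esub> \<phi> x)) v))"
            using q_eq[OF v G.m_closed[OF G.inv_closed[OF FG[OF fF]] x]
                Fc(3)[OF Fc(2)[OF fF] fhx(1)] fhx(2) eq]
            unfolding dx .
          also have "inv\<^bsub>G\<^esub> (inv\<^bsub>G\<^esub> f \<otimes>\<^bsub>G\<^esub> \<phi> x) = inv\<^bsub>G\<^esub> (\<phi> x) \<otimes>\<^bsub>G\<^esub> f"
            using fF fhx(1) by (simp add: G.inv_mult_group)
          also have "act e (inv\<^bsub>G\<^esub> (\<phi> x) \<otimes>\<^bsub>G\<^esub> f) v = act e (inv\<^bsub>G\<^esub> (\<phi> x)) (act e f v)"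
            using fF fhx(1) v by (intro e_mult) auto
          finally show ?thesis using x fF by (simp add: q_def)
        qed (simp add: q_def)
      qed
    qed
    \<comment> \<open>On the image of \<open>j\<close> each component is an evaluation of
      \<open>c a\<close>, and the coset condition together with equivariance of \<open>c\<close>
      restores the value at \<open>x\<close>.\<close>
    have q_j: "q (j a) = c a" if a: "a \<in> carrier R" for a
    proof (rule coind_eqI)
      note ja = ghomD(2)[OF se'(1) a] and ca = ghomD(2)[OF c a]
      show "q (j a) \<in> carrier ?C" "c a \<in> carrier ?C" using q_coind[OF ja] ca by auto
      fix x assume x: "x \<in> carrier G"
      note fhx = fh[OF x]
      have aR: "act R (inv\<^bsub>G\<^esub> (\<phi> x)) a \<in> carrier R"
        using group_module.act_closed[OF gmG[OF R]] fhx(1) a by simp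
      have "act e (inv\<^bsub>G\<^esub> (\<phi> x)) (j a) = j (act R (inv\<^bsub>G\<^esub> (\<phi> x)) a)"
        using ghomD(5)[OF se'(1) _ a, of "inv\<^bsub>G\<^esub> (\<phi> x)"] fhx(1) by simp
      then have "q (j a) x = act w (inv\<^bsub>H\<^esub> (\<chi> x)) (c (act R (inv\<^bsub>G\<^esub> (\<phi> x)) a) (d x))"
        using x \<rho>(2)[OF fhx(4) aR] by (simp add: q_def)
      also have "c (act R (inv\<^bsub>G\<^esub> (\<phi> x)) a) (d x) = c a (\<phi> x \<otimes>\<^bsub>G\<^esub> d x)"
        using fhx(1,4) a by (simp add: ghomD(5)[OF c])
      also have "act w (inv\<^bsub>H\<^esub> (\<chi> x)) \<dots> = c a (\<phi> x \<otimes>\<^bsub>G\<^esub> d x \<otimes>\<^bsub>G\<^esub> i (\<chi> x))"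
        using fhx(1,2,4) by (intro coind_carrierD(3)[OF ca, symmetric]) auto
      finally show "q (j a) x = c a x" using fhx(3) by simp
    qed
    \<comment> \<open>Since \<open>q j = c\<close> and \<open>b c\<close> is the identity on
      \<open>R\<close>, the composite of \<open>q\<close> and \<open>b\<close> is the wanted
      retraction.\<close>
    have "b \<in> ghom k ?F ?C R" using ghom_subgroup[OF G.is_group _ b] F by blast
    from ghom_compose[OF q_hom this em]
    show "\<exists>r \<in> ghom k ?F e R. \<forall>a \<in> carrier R. r (j a) = a"
      by (rule bexI[rotated]) (simp add: compose_eq ghomD(2)[OF se'(1)] q_j bc)
  qed
qed

end

section \<open>The class \<open>PCof\<close> under induction and restriction\<close>

lemma Ext1_zero_projective:
  assumes U: "set_universe U" and G: "group G" and P: "P \<in> projectives U k G" and y: "y \<in> gmod U k G"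
  shows "Ext1_zero U k G P y"
proof -
  have Pg: "P \<in> gmod U k G" using P by (simp add: projectives_def)
  note Pm = gmodD(1)[OF Pg G]
  show ?thesis
    unfolding Ext1_zero_iff[OF U G Pg y]
  proof (intro ballI allI impI)
    fix e j p
    assume e: "e \<in> gmod U k G" and se: "short_exact k G y e P j p"
    from projectives_lift[OF U G P gmodD(1)[OF e G] gmodD(3)[OF e] Pm gmodD(3)[OF Pg]
      short_exactD(2,4)[OF se] ghom_id[OF Pm]]
    show "\<exists>s \<in> ghom k G P e. \<forall>a \<in> carrier P. p (s a) = a" by auto
  qed
qed

lemma PCofI:
  "\<lbrakk>x \<in> gmod U k G; \<And>w. w \<in> W_class U k G \<Longrightarrow> Ext1_zero U k G x w\<rbrakk> \<Longrightarrow> x \<in> PCof U k G"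
  by (simp add: PCof_def left_orth_def)

lemma PCofD:
  "x \<in> PCof U k G \<Longrightarrow> x \<in> gmod U k G"
  "\<lbrakk>x \<in> PCof U k G; w \<in> W_class U k G\<rbrakk> \<Longrightarrow> Ext1_zero U k G x w"
  by (auto simp: PCof_def left_orth_def)

lemma W_class_subset: "W_class U k G \<subseteq> gmod U k G"
  by (auto simp: W_class_def)

lemma projectives_subset_PCof:
  "set_universe U \<Longrightarrow> group G \<Longrightarrow> projectives U k G \<subseteq> PCof U k G"
  using Ext1_zero_projective W_class_subset by (blast intro: PCofI dest: projectives_def[THEN equalityD1, THEN subsetD])

context res_setting
begin

text \<open>A section over \<open>L\<close> amounts, by universality, to a lift of
  \<open>\<eta>\<close> through the restricted extension. The kernel of that extension lies in the
  class W over \<open>H\<close>, so the lift exists.\<close>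

lemma PCof_ind:
  assumes C: "C \<in> PCof U k H" and L: "ind_arrow U k G H i C L \<eta>"
  shows "L \<in> PCof U k G"
proof (rule PCofI)
  show Lg: "L \<in> gmod U k G" by (rule ind_arrowD(1)[OF L])
  fix w assume w: "w \<in> W_class U k G"
  note wg = subsetD[OF W_class_subset w] and Cg = PCofD(1)[OF C]
  show "Ext1_zero U k G L w"
    unfolding Ext1_zero_iff[OF U G.is_group Lg wg]
  proof (intro ballI allI impI)
    fix e j p
    assume e: "e \<in> gmod U k G" and se: "short_exact k G w e L j p"
    note se' = short_exactD[OF se] and re = res_gmod[OF e]
    have "\<exists>s \<in> ghom k H C (res_gmodule i e). \<forall>a \<in> carrier C. p (s a) = \<eta> a"
    proof (rule Ext1_zero_lift[OF U H.is_group Cg res_gmod[OF wg] PCofD(2)[OF C W_class_res[OF w]]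
          gmH[OF re] gmodD(3)[OF re] gmH[OF res_gmod[OF Lg]] ghom_res[OF se'(1) hom] _
          ghom_res[OF se'(2) hom] _ ind_arrowD(2)[OF L]])
      show "\<eta> ` carrier C \<subseteq> p ` carrier (res_gmodule i e)"
        using ghomD(2)[OF ind_arrowD(2)[OF L]] se'(4) by auto
    qed (use se'(3,5) in auto)
    then obtain s where s: "s \<in> ghom k H C (res_gmodule i e)" "\<forall>a \<in> carrier C. p (s a) = \<eta> a" by blast
    obtain u where u: "u \<in> ghom k G L e" "\<forall>x \<in> carrier C. u (\<eta> x) = s x"
      using ind_arrowD(3)[OF L e s(1)] by blast
    \<comment> \<open>Both maps give \<open>\<eta>\<close> after \<open>\<eta>\<close>, and maps out
      of \<open>L\<close> are determined there.\<close>
    have eq: "compose (carrier L) p u = (\<lambda>x \<in> carrier L. x)"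
      by (rule ind_arrow_eqI[OF L gmH[OF Cg] hom Lg ghom_compose[OF u(1) se'(2) gmG[OF Lg]] ghom_id[OF gmG[OF Lg]]])
        (use ghomD(2)[OF ind_arrowD(2)[OF L]] s u in \<open>simp add: compose_eq\<close>)
    have "p (u x) = x" if "x \<in> carrier L" for x using fun_cong[OF eq, of x] that by (simp add: compose_eq)
    then show "\<exists>s \<in> ghom k G L e. \<forall>a \<in> carrier L. p (s a) = a" using u(1) by blast
  qed
qed

text \<open>An extension of \<open>res C\<close> by \<open>w\<close> is split by lifting the unit \<open>C \<rightarrow> coind (res C)\<close> along
  the coinduced extension, whose kernel lies in the class \<open>W\<close>.\<close>

lemma PCof_res:
  assumes C: "C \<in> PCof U k G"
  shows "res_gmodule i C \<in> PCof U k H"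
proof (rule PCofI)
  note Cg = PCofD(1)[OF C]
  interpret C: group_module k G C by (rule gmG[OF Cg])
  let ?C = "res_gmodule i C"
  show rC: "?C \<in> gmod U k H" by (rule res_gmod[OF Cg])
  fix w assume w: "w \<in> W_class U k H"
  note wg = subsetD[OF W_class_subset w]
  show "Ext1_zero U k H ?C w"
    unfolding Ext1_zero_iff[OF U H.is_group rC wg]
  proof (intro ballI allI impI)
    fix e j p
    assume e: "e \<in> gmod U k H" and se: "short_exact k H w e ?C j p"
    note se' = short_exactD[OF se]
    note wm = gmH[OF wg] and em = gmH[OF e] and rCm = gmH[OF rC]
    \<comment> \<open>The coinduced module is replaced by a copy in the category, because membership
      in W is only meaningful for objects.\<close>
    obtain R b c where R: "R \<in> gmod U k G" and b: "b \<in> ghom k G (coind_gmodule G H i w) R"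
      and c: "c \<in> ghom k G R (coind_gmodule G H i w)"
      and cb: "\<And>x. x \<in> carrier (coind_gmodule G H i w) \<Longrightarrow> c (b x) = x"
      and bc: "\<And>y. y \<in> carrier R \<Longrightarrow> b (c y) = y"
      using small_gmodule_copy[OF U group_module_coind[OF wm] small_coind[OF wg]] by metis
    have RW: "R \<in> W_class U k G" by (rule W_class_coind[OF w R b c bc])
    let ?j = "compose (carrier R) (coind_map G H i w j) c"
    \<comment> \<open>The transpose of the identity of the restricted module, that is, the unit of
      the adjunction between restriction and coinduction.\<close>
    let ?f = "\<lambda>y \<in> carrier C. \<lambda>x \<in> carrier G. (\<lambda>y \<in> carrier C. y) (act C (inv\<^bsub>G\<^esub> x) y)"
    have id: "(\<lambda>y \<in> carrier C. y) \<in> ghom k H ?C ?C" using ghom_id[OF rCm] by simp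
    have j: "?j \<in> ghom k G R (coind_gmodule G H i e)"
      by (rule ghom_compose[OF c coind_map_hom[OF wm se'(1)] gmG[OF R]])
    have f: "?f \<in> ghom k G C (coind_gmodule G H i ?C)"
      by (rule coind_universal[OF rCm C.group_module_axioms id])
    have im: "?j ` carrier R = coind_map G H i w j ` carrier (coind_gmodule G H i w)"
    proof (intro equalityI subsetI)
      fix z assume "z \<in> coind_map G H i w j ` carrier (coind_gmodule G H i w)"
      then obtain s where s: "s \<in> carrier (coind_gmodule G H i w)" "z = coind_map G H i w j s" by auto
      then have "z = ?j (b s)" "b s \<in> carrier R" using ghomD(2)[OF b] by (auto simp: compose_eq cb)
      then show "z \<in> ?j ` carrier R" by blast
    qed (use ghomD(2)[OF c] in \<open>auto simp: compose_eq\<close>)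
    have "\<exists>s \<in> ghom k G C (coind_gmodule G H i e). \<forall>a \<in> carrier C. coind_map G H i e p (s a) = ?f a"
    proof (rule Ext1_zero_lift[OF U G.is_group Cg R PCofD(2)[OF C RW] group_module_coind[OF em]
          small_coind[OF e] group_module_coind[OF rCm] j _ coind_map_hom[OF em se'(2)] _ f])
      show "inj_on ?j (carrier R)"
      proof (rule inj_onI)
        fix x y assume xy: "x \<in> carrier R" "y \<in> carrier R" "?j x = ?j y"
        then have "c x = c y"
          using inj_onD[OF coind_map_inj[OF se'(3)]] ghomD(2)[OF c] by (simp add: compose_eq)
        then show "x = y" using bc xy by metis
      qed
      show "?j ` carrier R = {s \<in> carrier (coind_gmodule G H i e).
          coind_map G H i e p s = \<zero>\<^bsub>coind_gmodule G H i ?C\<^esub>}"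
        unfolding im by (rule coind_map_kernel[OF wm em se'(1,2,5)])
      show "?f ` carrier C \<subseteq> coind_map G H i e p ` carrier (coind_gmodule G H i e)"
        unfolding coind_map_surj[OF em rCm se'(2,4)] using ghomD(2)[OF f] by blast
    qed
    then obtain s where s: "s \<in> ghom k G C (coind_gmodule G H i e)"
      "\<And>a. a \<in> carrier C \<Longrightarrow> coind_map G H i e p (s a) = ?f a" by blast
    \<comment> \<open>Evaluation at 1 transposes the lift back to a section of \<open>p\<close> over
      \<open>H\<close>.\<close>
    let ?t = "compose (carrier C) (\<lambda>s \<in> carrier (coind_gmodule G H i e). s \<one>\<^bsub>G\<^esub>) s"
    have "?t \<in> ghom k H ?C e"
      using ghom_compose[OF ghom_res[OF s(1) hom] coind_counit_hom[OF em] rCm] by simp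
    moreover have "p (?t a) = a" if a: "a \<in> carrier C" for a
    proof -
      have "p (?t a) = coind_map G H i e p (s a) \<one>\<^bsub>G\<^esub>"
        using a ghomD(2)[OF s(1) a] by (simp add: compose_eq coind_map_apply)
      then show ?thesis using a s(2)[OF a] by simp
    qed
    ultimately show "\<exists>s \<in> ghom k H ?C e. \<forall>a \<in> carrier ?C. p (s a) = a" by auto
  qed
qed

end


section \<open>Trivial cofibrations and trivial fibrations\<close>

text \<open>The zero module is kernel and cokernel of an identity map. An identity can therefore
  serve as the second factor of a trivial cofibration or the first factor of a trivial fibration,
  which makes both weak equivalences.\<close>

lemma zero_submodule:
  fixes U :: "'u set set" and M :: "('k, 'u, 'g) gmodule"
  assumes U: "set_universe U" and k: "cring k" and G: "group G" and M: "M \<in> gmod U k G"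
  shows "M\<lparr>carrier := {\<zero>\<^bsub>M\<^esub>}\<rparr> \<in> W_class U k G"
    and "M\<lparr>carrier := {\<zero>\<^bsub>M\<^esub>}\<rparr> \<in> projectives U k G"
    and "short_exact k G (M\<lparr>carrier := {\<zero>\<^bsub>M\<^esub>}\<rparr>) M M
      (\<lambda>x \<in> {\<zero>\<^bsub>M\<^esub>}. x) (\<lambda>x \<in> carrier M. x)"
    and "short_exact k G M M (M\<lparr>carrier := {\<zero>\<^bsub>M\<^esub>}\<rparr>)
      (\<lambda>x \<in> carrier M. x) (\<lambda>x \<in> carrier M. \<zero>\<^bsub>M\<^esub>)"
proof -
  let ?Z = "M\<lparr>carrier := {\<zero>\<^bsub>M\<^esub>}\<rparr>"
  interpret M: group_module k G M by (rule gmodD(1)[OF M G])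
  have Z: "group_module k G ?Z"
    by (rule group_module_sub[OF M.group_module_axioms]) auto
  have "{\<zero>\<^bsub>M\<^esub>} \<lesssim> carrier M" by (rule subset_imp_lepoll) auto
  then have "{\<zero>\<^bsub>M\<^esub>} \<in> U" using U gmodD(2)[OF M] by (auto simp: set_universe_def)
  then have Zg: "?Z \<in> gmod U k G" using Z by (simp add: gmod_def group_module_iff)
  have zero_hom: "(\<lambda>x \<in> carrier N. \<zero>\<^bsub>M\<^esub>) \<in> ghom k G' N ?Z"
    if "group_module k G' N" "group_module k G' ?Z" for N :: "('k, 'u, 'g) gmodule" and G'
  proof -
    interpret Z: group_module k G' ?Z by fact
    show ?thesis using Z.act_zero by (intro ghomI[OF that(1)]) auto
  qed
  show "?Z \<in> W_class U k G"
    unfolding W_class_iff[OF U k G]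
  proof (intro conjI allI impI ballI Zg)
    fix F y assume F: "subgroup F G \<and> finite F" and y: "y \<in> gmod U k (G\<lparr>carrier := F\<rparr>)"
    let ?F = "G\<lparr>carrier := F\<rparr>"
    have Fg: "group ?F" using F G subgroup.subgroup_is_group by auto
    have ZF: "?Z \<in> gmod U k ?F" using gmod_subgroup[OF G _ Zg] F by blast
    show "Ext1_zero U k ?F y ?Z"
    proof (rule Ext1_zeroI_retraction[OF U Fg y ZF])
      fix e j p assume e: "e \<in> gmod U k ?F"
      show "\<exists>r \<in> ghom k ?F e ?Z. \<forall>a \<in> carrier ?Z. r (j a) = a" if "short_exact k ?F ?Z e y j p"
        using zero_hom[OF gmodD(1)[OF e Fg] gmodD(1)[OF ZF Fg]] ghomD(2)[OF short_exactD(1)[OF that]]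
        by (intro bexI[of _ "\<lambda>x \<in> carrier e. \<zero>\<^bsub>M\<^esub>"]) auto
    qed
  qed
  show "?Z \<in> projectives U k G"
  proof (rule projectivesI[OF G Zg])
    fix A B p f
    assume asm: "A \<in> gmod U k G" "B \<in> gmod U k G" "p \<in> ghom k G A B" "f \<in> ghom k G ?Z B"
    note Am = gmodD(1)[OF asm(1) G] and Bm = gmodD(1)[OF asm(2) G]
    interpret A: group_module k G A by (rule Am)
    have "restrict (\<lambda>x. \<zero>\<^bsub>A\<^esub>) (carrier ?Z) \<in> ghom k G ?Z A" by (rule ghomI[OF Z]) auto
    moreover have "p \<zero>\<^bsub>A\<^esub> = f \<zero>\<^bsub>M\<^esub>"
      using ghom_zero[OF asm(3) Am Bm] ghom_zero[OF asm(4) Z Bm] by simp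
    ultimately show "\<exists>h \<in> ghom k G ?Z A. \<forall>x \<in> carrier ?Z. p (h x) = f x"
      by (intro bexI[of _ "restrict (\<lambda>x. \<zero>\<^bsub>A\<^esub>) (carrier ?Z)"]) auto
  qed
  have inc: "(\<lambda>x \<in> {\<zero>\<^bsub>M\<^esub>}. x) \<in> ghom k G ?Z M"
    using ghomI[OF Z, of "\<lambda>x. x" M] by simp
  show "short_exact k G ?Z M M (\<lambda>x \<in> {\<zero>\<^bsub>M\<^esub>}. x) (\<lambda>x \<in> carrier M. x)"
    using inc ghom_id[OF M.group_module_axioms] by (auto simp: short_exact_def inj_on_def)
  show "short_exact k G M M ?Z (\<lambda>x \<in> carrier M. x) (\<lambda>x \<in> carrier M. \<zero>\<^bsub>M\<^esub>)"
    using zero_hom[OF M.group_module_axioms Z] ghom_id[OF M.group_module_axioms]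
    by (auto simp: short_exact_def inj_on_def image_iff)
qed

lemma compose_id:
  assumes "f \<in> ghom k G M N"
  shows "compose (carrier M) (\<lambda>x \<in> carrier N. x) f = f" "compose (carrier M) f (\<lambda>x \<in> carrier M. x) = f"
  using assms ghomD(2)[OF assms] ghomD(6)[OF assms]
  by (auto simp: compose_def fun_eq_iff extensional_def)

lemma proper_weqI:
  "\<lbrakk>L \<in> gmod U k G; j \<in> mono_with_coker_in U k G (projectives U k G) M L;
    q \<in> epi_with_ker_in U k G (W_class U k G) L N; compose (carrier M) q j = f\<rbrakk> \<Longrightarrow>
    f \<in> proper_weq U k G M N"
  by (auto simp: proper_weq_def)

text \<open>If \<open>f = q j\<close> with \<open>coker j\<close> projective and \<open>ker q\<close> in \<open>W\<close>, then \<open>ker q \<rightarrow> coker j \<rightarrow> coker f\<close>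
  is short exact, and it splits when \<open>coker f\<close> is in \<open>PCof\<close>.\<close>

lemma trivial_cofibrations:
  assumes U: "set_universe U" and k: "cring k" and G: "group G"
    and M: "M \<in> gmod U k G" and N: "N \<in> gmod U k G"
  shows "mono_with_coker_in U k G (PCof U k G) M N \<inter> proper_weq U k G M N =
    mono_with_coker_in U k G (projectives U k G) M N"
proof (intro equalityI subsetI)
  fix f assume "f \<in> mono_with_coker_in U k G (projectives U k G) M N"
  then obtain C p where C: "C \<in> gmod U k G" "short_exact k G M N C f p" "C \<in> projectives U k G"
    by (auto simp: mono_with_coker_in_def)
  note zero = zero_submodule[OF U k G N]
  have "f \<in> mono_with_coker_in U k G (PCof U k G) M N"
    using C projectives_subset_PCof[OF U G] by (auto simp: mono_with_coker_in_def)
  moreover have "(\<lambda>x \<in> carrier N. x) \<in> epi_with_ker_in U k G (W_class U k G) N N"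
    using zero(1,3) subsetD[OF W_class_subset zero(1)] unfolding epi_with_ker_in_def by blast
  then have "f \<in> proper_weq U k G M N"
    using C by (intro proper_weqI[OF N _ _ compose_id(1)[OF short_exactD(1)[OF C(2)]]])
      (auto simp: mono_with_coker_in_def)
  ultimately show "f \<in> mono_with_coker_in U k G (PCof U k G) M N \<inter> proper_weq U k G M N" by blast
next
  fix f assume f: "f \<in> mono_with_coker_in U k G (PCof U k G) M N \<inter> proper_weq U k G M N"
  then obtain C pc where C: "C \<in> gmod U k G" "short_exact k G M N C f pc" "C \<in> PCof U k G"
    by (auto simp: mono_with_coker_in_def)
  obtain L j q where L: "L \<in> gmod U k G" "f = compose (carrier M) q j"
    "j \<in> mono_with_coker_in U k G (projectives U k G) M L" "q \<in> epi_with_ker_in U k G (W_class U k G) L N"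
    using f by (auto simp: proper_weq_def)
  obtain P \<pi> where P: "P \<in> gmod U k G" "short_exact k G M L P j \<pi>" "P \<in> projectives U k G"
    using L(3) by (auto simp: mono_with_coker_in_def)
  obtain K \<iota> where K: "K \<in> gmod U k G" "short_exact k G K L N \<iota> q" "K \<in> W_class U k G"
    using L(4) by (auto simp: epi_with_ker_in_def)
  note c = short_exactD[OF C(2)] and pp = short_exactD[OF P(2)] and kk = short_exactD[OF K(2)]
  note Mm = gmodD(1)[OF M G] and Nm = gmodD(1)[OF N G] and Lm = gmodD(1)[OF L(1) G]
    and Cm = gmodD(1)[OF C(1) G] and Pm = gmodD(1)[OF P(1) G] and Km = gmodD(1)[OF K(1) G]
  interpret L: group_module k G L by (rule Lm)
  interpret N: group_module k G N by (rule Nm)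
  interpret P: group_module k G P by (rule Pm)
  have qj: "q (j m) = f m" if "m \<in> carrier M" for m using L(2) that by (simp add: compose_eq)
  \<comment> \<open>The composite kills the image of \<open>j\<close>, since \<open>q j = f\<close>
    and \<open>pc f = 0\<close>, so it factors through \<open>P\<close>.\<close>
  let ?r = "compose (carrier L) pc q"
  have r: "?r \<in> ghom k G L C" by (rule ghom_compose[OF kk(2) c(2) Lm])
  have "?r l = \<zero>\<^bsub>C\<^esub>" if l: "l \<in> carrier L" "\<pi> l = \<zero>\<^bsub>P\<^esub>" for l
  proof -
    obtain m where "m \<in> carrier M" "l = j m" using l pp(5) by auto
    then show ?thesis using l(1) qj c(6) by (simp add: compose_eq)
  qed
  from ghom_factor[OF pp(2,4) r this Lm Pm Cm]
  obtain s where s: "s \<in> ghom k G P C" "\<And>l. l \<in> carrier L \<Longrightarrow> s (\<pi> l) = pc (q l)"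
    by (auto simp: compose_eq)
  \<comment> \<open>Injective because an element of \<open>K\<close> killed by \<open>\<pi>\<close>
    comes from some \<open>m\<close> in \<open>M\<close> with \<open>f m = 0\<close>, and
    \<open>f\<close> is injective.\<close>
  let ?\<kappa> = "compose (carrier K) \<pi> \<iota>"
  have \<kappa>: "?\<kappa> \<in> ghom k G K P" by (rule ghom_compose[OF kk(1) pp(2) Km])
  have "inj_on ?\<kappa> (carrier K)"
  proof (rule ghom_inj_onI[OF \<kappa> Km Pm])
    fix a assume a: "a \<in> carrier K" "?\<kappa> a = \<zero>\<^bsub>P\<^esub>"
    then have \<iota>a: "\<iota> a \<in> carrier L" "\<pi> (\<iota> a) = \<zero>\<^bsub>P\<^esub>" using ghomD(2)[OF kk(1)] by (auto simp: compose_eq)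
    then obtain m where m: "m \<in> carrier M" "\<iota> a = j m" using pp(5) by auto
    then have "f m = f \<zero>\<^bsub>M\<^esub>" using qj kk(6) a(1) ghom_zero[OF c(1) Mm Nm] by metis
    then have "m = \<zero>\<^bsub>M\<^esub>"
      using inj_onD[OF c(3)] m(1) module.axioms(2)[of k M] Mm abelian_group.axioms
      by (metis abelian_groupE(2) group_module.axioms(1))
    then have "\<iota> a = \<iota> \<zero>\<^bsub>K\<^esub>" using m ghom_zero[OF pp(1) Mm Lm] ghom_zero[OF kk(1) Km Lm] by simp
    then show "a = \<zero>\<^bsub>K\<^esub>"
      using inj_onD[OF kk(3)] a(1) Km
      by (metis abelian_groupE(2) group_module.axioms(1) module.axioms(2))
  qed
  moreover have "s ` carrier P = carrier C"
  proof (intro equalityI subsetI)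
    fix x assume "x \<in> carrier C"
    then obtain n where n: "n \<in> carrier N" "x = pc n" using c(4) by auto
    then obtain l where l: "l \<in> carrier L" "n = q l" using kk(4) by auto
    then have "x = s (\<pi> l)" using n s(2) by simp
    then show "x \<in> s ` carrier P" using ghomD(2)[OF pp(2) l(1)] by blast
  qed (use ghomD(2)[OF s(1)] in auto)
  moreover have "?\<kappa> ` carrier K = {b \<in> carrier P. s b = \<zero>\<^bsub>C\<^esub>}"
  proof (intro equalityI subsetI)
    fix x assume "x \<in> ?\<kappa> ` carrier K"
    then obtain a where a: "a \<in> carrier K" "x = \<pi> (\<iota> a)" by (auto simp: compose_eq)
    then have "\<iota> a \<in> carrier L" using ghomD(2)[OF kk(1)] by auto
    then have "s x = pc \<zero>\<^bsub>N\<^esub>" using a s(2) kk(6) by simp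
    then show "x \<in> {b \<in> carrier P. s b = \<zero>\<^bsub>C\<^esub>}"
      using ghom_zero[OF c(2) Nm Cm] a ghomD(2)[OF pp(2) \<open>\<iota> a \<in> carrier L\<close>] by simp
  next
    fix x assume x: "x \<in> {b \<in> carrier P. s b = \<zero>\<^bsub>C\<^esub>}"
    then have "x \<in> \<pi> ` carrier L" using pp(4) by simp
    then obtain l where l: "l \<in> carrier L" "x = \<pi> l" "s (\<pi> l) = \<zero>\<^bsub>C\<^esub>" using x by auto
    then have "q l \<in> f ` carrier M" using s(2) c(5) ghomD(2)[OF kk(2)] by auto
    \<comment> \<open>The representative \<open>l\<close> is corrected by \<open>j m\<close>, which
      changes neither its image in \<open>P\<close> nor the need to land in the kernel of
      \<open>q\<close>: the difference is killed by \<open>q\<close>.\<close>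
    then obtain m where m: "m \<in> carrier M" "q l = q (j m)" using qj by auto
    have jm: "j m \<in> carrier L" by (rule ghomD(2)[OF pp(1) m(1)])
    have "q (l \<ominus>\<^bsub>L\<^esub> j m) = \<zero>\<^bsub>N\<^esub>"
      using l(1) jm m ghomD(2)[OF kk(2)] by (simp add: ghom_minus[OF kk(2) Lm Nm] N.minus_eq_zero_iff)
    then obtain a where a: "a \<in> carrier K" "\<iota> a = l \<ominus>\<^bsub>L\<^esub> j m"
      using kk(5) L.M.minus_closed[OF l(1) jm] by force
    have "\<pi> (\<iota> a) = x"
      using a l jm m pp(6) ghomD(2)[OF pp(2)] by (simp add: ghom_minus[OF pp(2) Lm Pm] P.M.minus_eq)
    then show "x \<in> ?\<kappa> ` carrier K" using a(1) by (force simp: compose_eq)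
  qed
  ultimately have "short_exact k G K P C ?\<kappa> s" using \<kappa> s(1) by (simp add: short_exact_def)
  then obtain t where t: "t \<in> ghom k G C P" "\<forall>a \<in> carrier C. s (t a) = a"
    using PCofD(2)[OF C(3) K(3)] P(1) unfolding Ext1_zero_iff[OF U G C(1) K(1)] by blast
  \<comment> \<open>Vanishing of Ext from \<open>C\<close> into \<open>K\<close> splits the
    sequence, so \<open>C\<close> is a retract of the projective \<open>P\<close>.\<close>
  have "C \<in> projectives U k G"
    by (rule projective_retract[OF U G P(3) C(1) t(1) s(1)]) (use t(2) in auto)
  then show "f \<in> mono_with_coker_in U k G (projectives U k G) M N"
    using C by (auto simp: mono_with_coker_in_def)
qed

text \<open>If \<open>p = q j\<close> with \<open>coker j\<close> projective and \<open>ker q\<close> in \<open>W\<close>, then \<open>ker p \<rightarrow> ker q \<rightarrow> coker j\<close>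
  is split short exact.\<close>

lemma trivial_fibrations:
  assumes U: "set_universe U" and k: "cring k" and G: "group G"
    and M: "M \<in> gmod U k G" and N: "N \<in> gmod U k G"
  shows "epi_with_ker_in U k G (gmod U k G) M N \<inter> proper_weq U k G M N =
    epi_with_ker_in U k G (W_class U k G) M N"
proof (intro equalityI subsetI)
  fix p assume p: "p \<in> epi_with_ker_in U k G (W_class U k G) M N"
  then have hom: "p \<in> ghom k G M N" by (auto simp: epi_with_ker_in_def dest: short_exactD)
  note zero = zero_submodule[OF U k G M]
  have "M\<lparr>carrier := {\<zero>\<^bsub>M\<^esub>}\<rparr> \<in> gmod U k G" using zero(2) by (simp add: projectives_def)
  then have "(\<lambda>x \<in> carrier M. x) \<in> mono_with_coker_in U k G (projectives U k G) M M"
    using zero(2,4) unfolding mono_with_coker_in_def by blast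
  then have "p \<in> proper_weq U k G M N"
    by (intro proper_weqI[OF M _ p compose_id(2)[OF hom]])
  moreover have "p \<in> epi_with_ker_in U k G (gmod U k G) M N"
    using p by (auto simp: epi_with_ker_in_def)
  ultimately show "p \<in> epi_with_ker_in U k G (gmod U k G) M N \<inter> proper_weq U k G M N" by blast
next
  fix p assume p: "p \<in> epi_with_ker_in U k G (gmod U k G) M N \<inter> proper_weq U k G M N"
  then obtain K i where K: "K \<in> gmod U k G" "short_exact k G K M N i p"
    by (auto simp: epi_with_ker_in_def)
  obtain L j q where L: "L \<in> gmod U k G" "p = compose (carrier M) q j"
    "j \<in> mono_with_coker_in U k G (projectives U k G) M L" "q \<in> epi_with_ker_in U k G (W_class U k G) L N"
    using p by (auto simp: proper_weq_def)
  obtain P \<pi> where P: "P \<in> gmod U k G" "short_exact k G M L P j \<pi>" "P \<in> projectives U k G"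
    using L(3) by (auto simp: mono_with_coker_in_def)
  obtain K' \<iota> where K': "K' \<in> gmod U k G" "short_exact k G K' L N \<iota> q" "K' \<in> W_class U k G"
    using L(4) by (auto simp: epi_with_ker_in_def)
  note ii = short_exactD[OF K(2)] and pp = short_exactD[OF P(2)] and kk = short_exactD[OF K'(2)]
  note Mm = gmodD(1)[OF M G] and Nm = gmodD(1)[OF N G] and Lm = gmodD(1)[OF L(1) G]
    and Pm = gmodD(1)[OF P(1) G] and Km = gmodD(1)[OF K(1) G] and Km' = gmodD(1)[OF K'(1) G]
  interpret L: group_module k G L by (rule Lm)
  interpret N: group_module k G N by (rule Nm)
  interpret P: group_module k G P by (rule Pm)
  have qj: "q (j m) = p m" if "m \<in> carrier M" for m using L(2) that by (simp add: compose_eq)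
  \<comment> \<open>Elements of the kernel of \<open>p\<close> are carried by \<open>j\<close> into
    the kernel of \<open>q\<close>; this embeds \<open>K\<close> in \<open>K'\<close>.\<close>
  let ?a = "compose (carrier K) j i"
  have a: "?a \<in> ghom k G K L" by (rule ghom_compose[OF ii(1) pp(1) Km])
  have a_inj: "inj_on ?a (carrier K)"
    using ii(3) pp(3) ghomD(2)[OF ii(1)] by (auto simp: inj_on_def compose_eq)
  have "?a ` carrier K \<subseteq> \<iota> ` carrier K'"
    unfolding kk(5) using ghomD(2)[OF a] ghomD(2)[OF ii(1)] ii(6) by (auto simp: compose_eq qj)
  from ghom_inv_into[OF kk(1,3) a this Km' Km]
  obtain s where s: "s \<in> ghom k G K K'" "\<And>x. x \<in> carrier K \<Longrightarrow> \<iota> (s x) = j (i x)"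
    by (auto simp: compose_eq)
  let ?\<pi> = "compose (carrier K') \<pi> \<iota>"
  have \<pi>: "?\<pi> \<in> ghom k G K' P" by (rule ghom_compose[OF kk(1) pp(2) Km'])
  have "?\<pi> ` carrier K' = carrier P"
  proof (intro equalityI subsetI)
    fix x assume "x \<in> carrier P"
    then obtain l where l: "l \<in> carrier L" "x = \<pi> l" using pp(4) by auto
    obtain m where m: "m \<in> carrier M" "q l = q (j m)"
      using ghomD(2)[OF kk(2) l(1)] ii(4) qj by (metis imageE)
    have jm: "j m \<in> carrier L" by (rule ghomD(2)[OF pp(1) m(1)])
    have "q (l \<ominus>\<^bsub>L\<^esub> j m) = \<zero>\<^bsub>N\<^esub>"
      using l(1) jm m ghomD(2)[OF kk(2)] by (simp add: ghom_minus[OF kk(2) Lm Nm] N.minus_eq_zero_iff)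
    then obtain y where y: "y \<in> carrier K'" "\<iota> y = l \<ominus>\<^bsub>L\<^esub> j m"
      using kk(5) L.M.minus_closed[OF l(1) jm] by force
    have "\<pi> (\<iota> y) = x"
      using y l jm m pp(6) ghomD(2)[OF pp(2)] by (simp add: ghom_minus[OF pp(2) Lm Pm] P.M.minus_eq)
    then show "x \<in> ?\<pi> ` carrier K'" using y(1) by (force simp: compose_eq)
  qed (use ghomD(2)[OF \<pi>] in auto)
  \<comment> \<open>Projectivity of \<open>P\<close> splits the surjection from \<open>K'\<close>
    onto \<open>P\<close>, so \<open>K\<close> will be a retract of \<open>K'\<close>.\<close>
  from projectives_lift[OF U G P(3) Km' gmodD(3)[OF K'(1)] Pm gmodD(3)[OF P(1)] \<pi> this ghom_id[OF Pm]]
  obtain \<sigma> where \<sigma>': "\<sigma> \<in> ghom k G P K'" "\<forall>x \<in> carrier P. ?\<pi> (\<sigma> x) = (\<lambda>x \<in> carrier P. x) x" by blast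
  have \<sigma>: "\<sigma> \<in> ghom k G P K'" "\<And>x. x \<in> carrier P \<Longrightarrow> \<pi> (\<iota> (\<sigma> x)) = x"
  proof -
    fix x assume x: "x \<in> carrier P"
    show "\<pi> (\<iota> (\<sigma> x)) = x"
      using bspec[OF \<sigma>'(2) x] x ghomD(2)[OF \<sigma>'(1) x] by (simp add: compose_eq)
  qed (rule \<sigma>'(1))
  \<comment> \<open>Subtracting the part carried by \<open>\<sigma>\<close> leaves an element killed
    by both \<open>\<pi>\<close> and \<open>q\<close>, hence one coming from the kernel of
    \<open>p\<close>.\<close>
  let ?h = "\<lambda>x \<in> carrier K'. \<iota> x \<ominus>\<^bsub>L\<^esub> compose (carrier K') \<iota> (compose (carrier K') \<sigma> ?\<pi>) x"
  have h: "?h \<in> ghom k G K' L"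
    by (intro ghom_diff kk(1) ghom_compose[OF _ kk(1)] ghom_compose[OF \<pi> \<sigma>(1)] Km' Lm)
  have h_eq: "?h x = \<iota> x \<ominus>\<^bsub>L\<^esub> \<iota> (\<sigma> (\<pi> (\<iota> x)))" if "x \<in> carrier K'" for x
    using that by (simp add: compose_eq)
  have "?h ` carrier K' \<subseteq> ?a ` carrier K"
  proof
    fix z assume "z \<in> ?h ` carrier K'"
    then obtain x where x: "x \<in> carrier K'" "z = ?h x" by blast
    have cl: "\<iota> x \<in> carrier L" "\<pi> (\<iota> x) \<in> carrier P" "\<sigma> (\<pi> (\<iota> x)) \<in> carrier K'"
      "\<iota> (\<sigma> (\<pi> (\<iota> x))) \<in> carrier L"
      using x(1) ghomD(2)[OF kk(1)] ghomD(2)[OF pp(2)] ghomD(2)[OF \<sigma>(1)] by auto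
    have z: "z \<in> carrier L" using ghomD(2)[OF h x(1)] x(2) by simp
    have "\<pi> z = \<zero>\<^bsub>P\<^esub>"
      unfolding x(2) h_eq[OF x(1)] using cl \<sigma>(2)[OF cl(2)]
      by (simp add: ghom_minus[OF pp(2) Lm Pm] P.minus_eq_zero_iff)
    then obtain m where m: "m \<in> carrier M" "z = j m" using z pp(5) by auto
    have "q z = \<zero>\<^bsub>N\<^esub>"
      unfolding x(2) h_eq[OF x(1)] using cl x(1) kk(6)
      by (simp add: ghom_minus[OF kk(2) Lm Nm] N.minus_eq_zero_iff)
    then have "p m = \<zero>\<^bsub>N\<^esub>" using qj m by simp
    then obtain y where "y \<in> carrier K" "m = i y" using m(1) ii(5) by auto
    then show "z \<in> ?a ` carrier K" using m(2) by (force simp: compose_eq)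
  qed
  from ghom_inv_into[OF a a_inj h this Km Km']
  obtain r where r: "r \<in> ghom k G K' K" "\<And>x. x \<in> carrier K' \<Longrightarrow> ?a (r x) = ?h x" by blast
  have "r (s x) = x" if x: "x \<in> carrier K" for x
  proof (rule inj_onD[OF a_inj _ _ x])
    have sx: "s x \<in> carrier K'" and ix: "i x \<in> carrier M" "j (i x) \<in> carrier L"
      using x ghomD(2)[OF s(1)] ghomD(2)[OF ii(1)] ghomD(2)[OF pp(1)] by auto
    show "r (s x) \<in> carrier K" by (rule ghomD(2)[OF r(1) sx])
    have "?a (r (s x)) = j (i x) \<ominus>\<^bsub>L\<^esub> \<iota> (\<sigma> (\<pi> (j (i x))))"
      using r(2)[OF sx] h_eq[OF sx] s(2)[OF x] by simp
    also have "\<dots> = j (i x) \<ominus>\<^bsub>L\<^esub> \<zero>\<^bsub>L\<^esub>"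
      using pp(6)[OF ix(1)] ghom_zero[OF \<sigma>(1) Pm Km'] ghom_zero[OF kk(1) Km' Lm] by simp
    also have "\<dots> = ?a x" using x ix by (simp add: compose_eq L.M.minus_eq)
    finally show "?a (r (s x)) = ?a x" .
  qed
  then have "K \<in> W_class U k G" by (rule W_class_retract[OF U k G K'(3) K(1) s(1) r(1)])
  then show "p \<in> epi_with_ker_in U k G (W_class U k G) M N"
    using K by (auto simp: epi_with_ker_in_def)
qed


section \<open>Adjunctions with the restriction functor\<close>

lemma proper_model_simps [simp]:
  "Obj (proper_model U k G) = gmod U k G"
  "Hom (proper_model U k G) = ghom k G"
  "Comp (proper_model U k G) X Y Z g f = compose (carrier X) g f"
  "Ident (proper_model U k G) X = (\<lambda>x \<in> carrier X. x)"
  "Cofib (proper_model U k G) = mono_with_coker_in U k G (PCof U k G)"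
  "Fibr (proper_model U k G) = epi_with_ker_in U k G (gmod U k G)"
  "Weq (proper_model U k G) = proper_weq U k G"
  by (simp_all add: proper_model_def gmod_category_def category.extend_def model_category.fields_def)

lemma res_functor_simps [simp]:
  "fobj (res_functor i) = res_gmodule i"
  "farr (res_functor i) M N f = f"
  by (simp_all add: res_functor_def)

lemma short_exact_res:
  "short_exact k G A B C f p \<Longrightarrow> i \<in> hom H G \<Longrightarrow>
    short_exact k H (res_gmodule i A) (res_gmodule i B) (res_gmodule i C) f p"
  by (auto simp: short_exact_def intro: ghom_res)

context res_setting
begin

lemma is_functor_res: "is_functor (proper_model U k G) (proper_model U k H) (res_functor i)"
  by (simp add: is_functor_def res_gmod ghom_res[OF _ hom])

text \<open>Universal arrows at all objects assemble to a left adjoint: existence defines the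
  functor on morphisms, and uniqueness gives the functor laws.\<close>

lemma adjunction_ind_exists:
  "\<exists>L. adjunction (proper_model U k H) (proper_model U k G) L (res_functor i)"
proof -
  obtain L \<eta> where L: "\<And>X. X \<in> gmod U k H \<Longrightarrow> ind_arrow U k G H i X (L X) (\<eta> X)"
    using ind_arrow_exists by metis
  have "\<exists>u. u \<in> ghom k G (L X) (L X') \<and> (\<forall>x \<in> carrier X. u (\<eta> X x) = \<eta> X' (f x))"
    if X: "X \<in> gmod U k H" "X' \<in> gmod U k H" and f: "f \<in> ghom k H X X'" for X X' f
    using ind_arrowD(3)[OF L[OF X(1)] ind_arrowD(1)[OF L[OF X(2)]]
      ghom_compose[OF f ind_arrowD(2)[OF L[OF X(2)]] gmH[OF X(1)]]]
    by (auto simp: compose_eq)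
  then obtain A where A: "\<And>X X' f. \<lbrakk>X \<in> gmod U k H; X' \<in> gmod U k H; f \<in> ghom k H X X'\<rbrakk> \<Longrightarrow>
      A X X' f \<in> ghom k G (L X) (L X')"
    "\<And>X X' f x. \<lbrakk>X \<in> gmod U k H; X' \<in> gmod U k H; f \<in> ghom k H X X'; x \<in> carrier X\<rbrakk> \<Longrightarrow>
      A X X' f (\<eta> X x) = \<eta> X' (f x)"
    by metis
  define F where "F = \<lparr>fobj = L, farr = A\<rparr>"
  have [simp]: "fobj F = L" "farr F = A" by (simp_all add: F_def)
  have Lg: "L X \<in> gmod U k G" and \<eta>: "\<eta> X \<in> ghom k H X (res_gmodule i (L X))"
    if "X \<in> gmod U k H" for X using ind_arrowD(1,2)[OF L[OF that]] .
  have \<eta>c: "\<eta> X x \<in> carrier (L X)" if "X \<in> gmod U k H" "x \<in> carrier X" for X x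
    using ghomD(2)[OF \<eta>] that by simp
  have "is_functor (proper_model U k H) (proper_model U k G) F"
    unfolding is_functor_def
  proof (intro conjI ballI; simp)
    fix X assume X: "X \<in> gmod U k H"
    show "L X \<in> gmod U k G" by (rule Lg[OF X])
    show "A X X (\<lambda>x \<in> carrier X. x) = (\<lambda>x \<in> carrier (L X). x)"
      by (rule ind_arrow_eqI[OF L[OF X] gmH[OF X] hom Lg[OF X] A(1)[OF X X ghom_id[OF gmH[OF X]]]
            ghom_id[OF gmG[OF Lg[OF X]]]])
        (simp add: A(2)[OF X X ghom_id[OF gmH[OF X]]] \<eta>c[OF X])
    fix Y assume Y: "Y \<in> gmod U k H"
    fix f assume f: "f \<in> ghom k H X Y"
    show "A X Y f \<in> ghom k G (L X) (L Y)" by (rule A(1)[OF X Y f])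
    fix Z assume Z: "Z \<in> gmod U k H"
    fix g assume g: "g \<in> ghom k H Y Z"
    note gf = ghom_compose[OF f g gmH[OF X]]
    show "A X Z (compose (carrier X) g f) = compose (carrier (L X)) (A Y Z g) (A X Y f)"
      by (rule ind_arrow_eqI[OF L[OF X] gmH[OF X] hom Lg[OF Z] A(1)[OF X Z gf]
            ghom_compose[OF A(1)[OF X Y f] A(1)[OF Y Z g] gmG[OF Lg[OF X]]]])
        (simp add: A(2)[OF X Z gf] A(2)[OF X Y f] A(2)[OF Y Z g] \<eta>c[OF X] ghomD(2)[OF f] compose_eq)
  qed
  \<comment> \<open>Transposition is composition with the unit; its bijectivity restates the
    universal property.\<close>
  moreover define \<phi> where "\<phi> X Y u = compose (carrier X) u (\<eta> X)" 
    for X :: "('k, 'u, 'h) gmodule" and Y :: "('k, 'u, 'g) gmodule" and u :: "'u \<Rightarrow> 'u"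
  have "bij_betw (\<phi> X Y) (ghom k G (L X) Y) (ghom k H X (res_gmodule i Y))"
    if X: "X \<in> gmod U k H" and Y: "Y \<in> gmod U k G" for X Y
  proof (rule bij_betw_imageI)
    note im = ghom_compose[OF \<eta>[OF X] ghom_res[OF _ hom] gmH[OF X]]
    show "inj_on (\<phi> X Y) (ghom k G (L X) Y)"
    proof (rule inj_onI)
      fix u v assume uv: "u \<in> ghom k G (L X) Y" "v \<in> ghom k G (L X) Y" and eq: "\<phi> X Y u = \<phi> X Y v"
      show "u = v"
      proof (rule ind_arrow_eqI[OF L[OF X] gmH[OF X] hom Y uv])
        fix x assume "x \<in> carrier X"
        then show "u (\<eta> X x) = v (\<eta> X x)"
          using fun_cong[OF eq, of x] by (simp add: \<phi>_def compose_eq)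
      qed
    qed
    show "\<phi> X Y ` ghom k G (L X) Y = ghom k H X (res_gmodule i Y)"
    proof (intro equalityI subsetI)
      fix h assume h: "h \<in> ghom k H X (res_gmodule i Y)"
      obtain u where u: "u \<in> ghom k G (L X) Y" "\<forall>x \<in> carrier X. u (\<eta> X x) = h x"
        using ind_arrowD(3)[OF L[OF X] Y h] by blast
      have "\<phi> X Y u = h"
        unfolding \<phi>_def by (rule ghom_eqI[OF im[OF u(1)] h]) (simp add: u(2) compose_eq)
      then show "h \<in> \<phi> X Y ` ghom k G (L X) Y" using u(1) by blast
    qed (use im in \<open>auto simp: \<phi>_def\<close>)
  qed
  moreover have "\<phi> X' Y' (compose (carrier (L X')) g (compose (carrier (L X')) u (A X' X f))) =
      compose (carrier X') g (compose (carrier X') (\<phi> X Y u) f)"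
    if X: "X \<in> gmod U k H" "X' \<in> gmod U k H" and f: "f \<in> ghom k H X' X" for X X' Y Y' f u g
    using \<eta>c[OF X(2)] ghomD(2)[OF f] by (auto simp: \<phi>_def compose_def fun_eq_iff A(2)[OF X(2,1) f])
  ultimately have "adjunction (proper_model U k H) (proper_model U k G) F (res_functor i)"
    unfolding adjunction_def using is_functor_res by (intro conjI exI[of _ \<phi>]) simp_all
  then show ?thesis by blast
qed

lemma adjunction_coind_exists:
  "\<exists>R. adjunction (proper_model U k G) (proper_model U k H) (res_functor i) R"
proof -
  obtain R \<epsilon> where R: "\<And>X. X \<in> gmod U k H \<Longrightarrow> coind_arrow U k G H i X (R X) (\<epsilon> X)"
    using coind_arrow_exists by metis
  have Rg: "R X \<in> gmod U k G" and \<epsilon>: "\<epsilon> X \<in> ghom k H (res_gmodule i (R X)) X"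
    if "X \<in> gmod U k H" for X using coind_arrowD(1,2)[OF R[OF that]] .
  have \<epsilon>c: "\<epsilon> X y \<in> carrier X" if "X \<in> gmod U k H" "y \<in> carrier (R X)" for X y
    using ghomD(2)[OF \<epsilon>] that by simp
  note eqI = coind_arrow_eqI[OF R G.is_group H.is_group hom]
  have "\<exists>u. u \<in> ghom k G (R X) (R X') \<and> (\<forall>y \<in> carrier (R X). \<epsilon> X' (u y) = f (\<epsilon> X y))"
    if X: "X \<in> gmod U k H" "X' \<in> gmod U k H" and f: "f \<in> ghom k H X X'" for X X' f
    using coind_arrowD(3)[OF R[OF X(2)] Rg[OF X(1)]
      ghom_compose[OF \<epsilon>[OF X(1)] f gmH[OF res_gmod[OF Rg[OF X(1)]]]]]
    by (auto simp: compose_eq)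
  then obtain A where A: "\<And>X X' f. \<lbrakk>X \<in> gmod U k H; X' \<in> gmod U k H; f \<in> ghom k H X X'\<rbrakk> \<Longrightarrow>
      A X X' f \<in> ghom k G (R X) (R X')"
    "\<And>X X' f y. \<lbrakk>X \<in> gmod U k H; X' \<in> gmod U k H; f \<in> ghom k H X X'; y \<in> carrier (R X)\<rbrakk> \<Longrightarrow>
      \<epsilon> X' (A X X' f y) = f (\<epsilon> X y)"
    by metis
  \<comment> \<open>Here transposition goes towards the universal object, so it is the solution of
    the universal problem and its inverse is composition with the counit.\<close>
  define \<phi> where "\<phi> Y X h = (SOME u. u \<in> ghom k G Y (R X) \<and> (\<forall>y \<in> carrier Y. \<epsilon> X (u y) = h y))"
    for Y :: "('k, 'u, 'g) gmodule" and X and h :: "'u \<Rightarrow> 'u"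
  have \<phi>_some: "\<phi> Y X h \<in> ghom k G Y (R X) \<and> (\<forall>y \<in> carrier Y. \<epsilon> X (\<phi> Y X h y) = h y)"
    if "X \<in> gmod U k H" "Y \<in> gmod U k G" "h \<in> ghom k H (res_gmodule i Y) X" for X Y h
  proof -
    have "\<exists>u. u \<in> ghom k G Y (R X) \<and> (\<forall>y \<in> carrier Y. \<epsilon> X (u y) = h y)"
      using coind_arrowD(3)[OF R[OF that(1)] that(2,3)] by blast
    then show ?thesis unfolding \<phi>_def by (rule someI_ex)
  qed
  have \<phi>: "\<And>X Y h. \<lbrakk>X \<in> gmod U k H; Y \<in> gmod U k G; h \<in> ghom k H (res_gmodule i Y) X\<rbrakk> \<Longrightarrow>
      \<phi> Y X h \<in> ghom k G Y (R X)"
    "\<And>X Y h y. \<lbrakk>X \<in> gmod U k H; Y \<in> gmod U k G; h \<in> ghom k H (res_gmodule i Y) X; y \<in> carrier Y\<rbrakk> \<Longrightarrow>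
      \<epsilon> X (\<phi> Y X h y) = h y"
    using \<phi>_some by blast+
  define F where "F = \<lparr>fobj = R, farr = A\<rparr>"
  have [simp]: "fobj F = R" "farr F = A" by (simp_all add: F_def)
  have "is_functor (proper_model U k H) (proper_model U k G) F"
    unfolding is_functor_def
  proof (intro conjI ballI; simp)
    fix X assume X: "X \<in> gmod U k H"
    show "R X \<in> gmod U k G" by (rule Rg[OF X])
    note id = ghom_id[OF gmH[OF X]]
    show "A X X (\<lambda>x \<in> carrier X. x) = (\<lambda>x \<in> carrier (R X). x)"
      by (rule eqI[OF X Rg[OF X] A(1)[OF X X id] ghom_id[OF gmG[OF Rg[OF X]]]])
        (simp add: A(2)[OF X X id] \<epsilon>c[OF X])
    fix Y assume Y: "Y \<in> gmod U k H"
    fix f assume f: "f \<in> ghom k H X Y"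
    show "A X Y f \<in> ghom k G (R X) (R Y)" by (rule A(1)[OF X Y f])
    fix Z assume Z: "Z \<in> gmod U k H"
    fix g assume g: "g \<in> ghom k H Y Z"
    note gf = ghom_compose[OF f g gmH[OF X]]
    show "A X Z (compose (carrier X) g f) = compose (carrier (R X)) (A Y Z g) (A X Y f)"
      by (rule eqI[OF Z Rg[OF X] A(1)[OF X Z gf]
            ghom_compose[OF A(1)[OF X Y f] A(1)[OF Y Z g] gmG[OF Rg[OF X]]]])
        (simp add: A(2)[OF X Z gf] A(2)[OF X Y f] A(2)[OF Y Z g] \<epsilon>c[OF X]
          ghomD(2)[OF A(1)[OF X Y f]] compose_eq)
  qed
  moreover have "bij_betw (\<phi> Y X) (ghom k H (res_gmodule i Y) X) (ghom k G Y (R X))"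
    if X: "X \<in> gmod U k H" and Y: "Y \<in> gmod U k G" for X Y
  proof (rule bij_betw_imageI)
    show "inj_on (\<phi> Y X) (ghom k H (res_gmodule i Y) X)"
    proof (rule inj_onI)
      fix h h' assume h: "h \<in> ghom k H (res_gmodule i Y) X" "h' \<in> ghom k H (res_gmodule i Y) X"
        and eq: "\<phi> Y X h = \<phi> Y X h'"
      show "h = h'"
        by (rule ghom_eqI[OF h]) (use \<phi>(2)[OF X Y h(1)] \<phi>(2)[OF X Y h(2)] eq in simp)
    qed
    show "\<phi> Y X ` ghom k H (res_gmodule i Y) X = ghom k G Y (R X)"
    proof (intro equalityI subsetI)
      fix u assume u: "u \<in> ghom k G Y (R X)"
      have h: "compose (carrier Y) (\<epsilon> X) u \<in> ghom k H (res_gmodule i Y) X"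
        using ghom_compose[OF ghom_res[OF u hom] \<epsilon>[OF X] gmH[OF res_gmod[OF Y]]] by simp
      have "\<phi> Y X (compose (carrier Y) (\<epsilon> X) u) = u"
        by (rule eqI[OF X Y \<phi>(1)[OF X Y h] u]) (simp add: \<phi>(2)[OF X Y h] compose_eq)
      then show "u \<in> \<phi> Y X ` ghom k H (res_gmodule i Y) X" using h by (metis imageI)
    qed (use \<phi>(1)[OF X Y] in auto)
  qed
  moreover have "\<phi> X' Y' (compose (carrier X') g (compose (carrier X') u f)) =
      compose (carrier X') (A Y Y' g) (compose (carrier X') (\<phi> X Y u) f)"
    if X: "X \<in> gmod U k G" "X' \<in> gmod U k G" and Y: "Y \<in> gmod U k H" "Y' \<in> gmod U k H"
      and f: "f \<in> ghom k G X' X" and u: "u \<in> ghom k H (res_gmodule i X) Y" and g: "g \<in> ghom k H Y Y'"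
    for X X' Y Y' f u g
  proof -
    have uf: "compose (carrier X') u f \<in> ghom k H (res_gmodule i X') Y"
      using ghom_compose[OF ghom_res[OF f hom] u gmH[OF res_gmod[OF X(2)]]] by simp
    have guf: "compose (carrier X') g (compose (carrier X') u f) \<in> ghom k H (res_gmodule i X') Y'"
      using ghom_compose[OF uf g gmH[OF res_gmod[OF X(2)]]] by simp
    show ?thesis
    proof (rule eqI[OF Y(2) X(2) \<phi>(1)[OF Y(2) X(2) guf]])
      show "compose (carrier X') (A Y Y' g) (compose (carrier X') (\<phi> X Y u) f) \<in> ghom k G X' (R Y')"
        by (rule ghom_compose[OF ghom_compose[OF f \<phi>(1)[OF Y(1) X(1) u] gmG[OF X(2)]] A(1)[OF Y g] gmG[OF X(2)]])
      fix x assume x: "x \<in> carrier X'"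
      note fx = ghomD(2)[OF f x]
      show "\<epsilon> Y' (\<phi> X' Y' (compose (carrier X') g (compose (carrier X') u f)) x) =
          \<epsilon> Y' (compose (carrier X') (A Y Y' g) (compose (carrier X') (\<phi> X Y u) f) x)"
        using x fx by (simp add: \<phi>(2)[OF Y(2) X(2) guf x] compose_eq A(2)[OF Y g]
            ghomD(2)[OF \<phi>(1)[OF Y(1) X(1) u]] \<phi>(2)[OF Y(1) X(1) u])
    qed
  qed
  ultimately have "adjunction (proper_model U k G) (proper_model U k H) (res_functor i) F"
    unfolding adjunction_def using is_functor_res by (intro conjI exI[of _ \<phi>]) simp_all
  then show ?thesis by blast
qed

text \<open>The Yoneda argument: the unit is the transpose of the identity, and naturality shows
  that every transpose is composition with it.\<close>

lemma adjunction_ind_arrow: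
  assumes adj: "adjunction (proper_model U k H) (proper_model U k G) L (res_functor i)"
  obtains \<eta> where "\<And>X. X \<in> gmod U k H \<Longrightarrow> ind_arrow U k G H i X (fobj L X) (\<eta> X)"
    "\<And>X X' f. \<lbrakk>X \<in> gmod U k H; X' \<in> gmod U k H; f \<in> ghom k H X X'\<rbrakk> \<Longrightarrow>
      farr L X X' f \<in> ghom k G (fobj L X) (fobj L X')"
    "\<And>X X' f x. \<lbrakk>X \<in> gmod U k H; X' \<in> gmod U k H; f \<in> ghom k H X X'; x \<in> carrier X\<rbrakk> \<Longrightarrow>
      farr L X X' f (\<eta> X x) = \<eta> X' (f x)"
proof -
  have Lfun: "is_functor (proper_model U k H) (proper_model U k G) L"
    using adj by (simp add: adjunction_def)
  have Lg: "fobj L X \<in> gmod U k G" if "X \<in> gmod U k H" for X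
    using Lfun that by (simp add: is_functor_def)
  have Lh: "farr L X X' f \<in> ghom k G (fobj L X) (fobj L X')"
    if "X \<in> gmod U k H" "X' \<in> gmod U k H" "f \<in> ghom k H X X'" for X X' f
    using Lfun that by (simp add: is_functor_def)
  have Lid: "farr L X X (\<lambda>x \<in> carrier X. x) = (\<lambda>x \<in> carrier (fobj L X). x)"
    if "X \<in> gmod U k H" for X
    using Lfun that by (simp add: is_functor_def)
  obtain \<phi> where "\<forall>X \<in> gmod U k H. \<forall>Y \<in> gmod U k G.
      bij_betw (\<phi> X Y) (ghom k G (fobj L X) Y) (ghom k H X (res_gmodule i Y))"
    "\<forall>X \<in> gmod U k H. \<forall>X' \<in> gmod U k H. \<forall>Y \<in> gmod U k G. \<forall>Y' \<in> gmod U k G.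
      \<forall>f \<in> ghom k H X' X. \<forall>u \<in> ghom k G (fobj L X) Y. \<forall>g \<in> ghom k G Y Y'.
      \<phi> X' Y' (compose (carrier (fobj L X')) g (compose (carrier (fobj L X')) u (farr L X' X f))) =
      compose (carrier X') g (compose (carrier X') (\<phi> X Y u) f)"
    using adj by (auto simp: adjunction_def)
  then have bij: "\<And>X Y. \<lbrakk>X \<in> gmod U k H; Y \<in> gmod U k G\<rbrakk> \<Longrightarrow>
      bij_betw (\<phi> X Y) (ghom k G (fobj L X) Y) (ghom k H X (res_gmodule i Y))"
    and nat: "\<And>X X' Y Y' f u g. \<lbrakk>X \<in> gmod U k H; X' \<in> gmod U k H; Y \<in> gmod U k G; Y' \<in> gmod U k G;
        f \<in> ghom k H X' X; u \<in> ghom k G (fobj L X) Y; g \<in> ghom k G Y Y'\<rbrakk> \<Longrightarrow>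
      \<phi> X' Y' (compose (carrier (fobj L X')) g (compose (carrier (fobj L X')) u (farr L X' X f))) =
      compose (carrier X') g (compose (carrier X') (\<phi> X Y u) f)"
    by blast+
  define \<eta> where "\<eta> X = \<phi> X (fobj L X) (\<lambda>x \<in> carrier (fobj L X). x)" for X
  have Lid_hom: "(\<lambda>x \<in> carrier (fobj L X). x) \<in> ghom k G (fobj L X) (fobj L X)"
    if "X \<in> gmod U k H" for X by (rule ghom_id[OF gmG[OF Lg[OF that]]])
  have \<eta>: "\<eta> X \<in> ghom k H X (res_gmodule i (fobj L X))" if X: "X \<in> gmod U k H" for X
    unfolding \<eta>_def using bij_betw_apply[OF bij[OF X Lg[OF X]] Lid_hom[OF X]] .
  \<comment> \<open>Naturality is applied to an identity on the \<open>H\<close>-side and to the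
    identity of \<open>fobj L X\<close>, leaving only \<open>u\<close>.\<close>
  have \<phi>_eq: "\<phi> X Y u = compose (carrier X) u (\<eta> X)"
    if X: "X \<in> gmod U k H" and Y: "Y \<in> gmod U k G" and u: "u \<in> ghom k G (fobj L X) Y" for X Y u
    using nat[OF X X Lg[OF X] Y ghom_id[OF gmH[OF X]] Lid_hom[OF X] u]
    by (simp add: Lid[OF X] compose_id[OF u] compose_id[OF Lid_hom[OF X]] compose_id[OF \<eta>[OF X], simplified]
        flip: \<eta>_def)
  have "ind_arrow U k G H i X (fobj L X) (\<eta> X)" if X: "X \<in> gmod U k H" for X
    unfolding ind_arrow_def
  proof (intro conjI ballI Lg[OF X] \<eta>[OF X])
    fix Y h assume Y: "Y \<in> gmod U k G" and h: "h \<in> ghom k H X (res_gmodule i Y)"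
    have iff: "(\<forall>x \<in> carrier X. u (\<eta> X x) = h x) \<longleftrightarrow> \<phi> X Y u = h"
      if u: "u \<in> ghom k G (fobj L X) Y" for u
      unfolding \<phi>_eq[OF X Y u] using ghomD(6)[OF h]
      by (auto simp: compose_def fun_eq_iff extensional_def)
    have "h \<in> \<phi> X Y ` ghom k G (fobj L X) Y"
      using h by (simp add: bij_betw_imp_surj_on[OF bij[OF X Y]])
    then obtain u where u: "u \<in> ghom k G (fobj L X) Y" "\<phi> X Y u = h" by blast
    show "\<exists>!u. u \<in> ghom k G (fobj L X) Y \<and> (\<forall>x \<in> carrier X. u (\<eta> X x) = h x)"
    proof (rule ex1I[of _ u])
      show "u \<in> ghom k G (fobj L X) Y \<and> (\<forall>x \<in> carrier X. u (\<eta> X x) = h x)"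
        using u iff[OF u(1)] by simp
      fix v assume v: "v \<in> ghom k G (fobj L X) Y \<and> (\<forall>x \<in> carrier X. v (\<eta> X x) = h x)"
      then have "\<phi> X Y v = \<phi> X Y u" using iff[of v] u(2) by simp
      then show "v = u" using inj_onD[OF bij_betw_imp_inj_on[OF bij[OF X Y]]] v u(1) by blast
    qed
  qed
  moreover have "farr L X X' f (\<eta> X x) = \<eta> X' (f x)"
    if X: "X \<in> gmod U k H" "X' \<in> gmod U k H" and f: "f \<in> ghom k H X X'" and x: "x \<in> carrier X" for X X' f x
  proof -
    have "compose (carrier X) (farr L X X' f) (\<eta> X) = compose (carrier X) (\<eta> X') f"
      using nat[OF X(2,1) Lg[OF X(2)] Lg[OF X(2)] f Lid_hom[OF X(2)] Lid_hom[OF X(2)]]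
        compose_id[OF Lh[OF X f]] compose_id[OF ghom_compose[OF f \<eta>[OF X(2)] gmH[OF X(1)]]]
      by (simp add: \<phi>_eq[OF X(1) Lg[OF X(2)] Lh[OF X f]] flip: \<eta>_def)
    from fun_cong[OF this, of x] show ?thesis using x by (simp add: compose_eq)
  qed
  ultimately show ?thesis using Lh by (intro that) auto
qed

text \<open>The dual Yoneda argument, with the counit as the map whose transpose is the
  identity.\<close>

lemma adjunction_coind_arrow:
  assumes adj: "adjunction (proper_model U k G) (proper_model U k H) (res_functor i) R"
  obtains \<epsilon> where "\<And>X. X \<in> gmod U k H \<Longrightarrow> coind_arrow U k G H i X (fobj R X) (\<epsilon> X)"
    "\<And>X X' f. \<lbrakk>X \<in> gmod U k H; X' \<in> gmod U k H; f \<in> ghom k H X X'\<rbrakk> \<Longrightarrow>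
      farr R X X' f \<in> ghom k G (fobj R X) (fobj R X')"
    "\<And>X X' f y. \<lbrakk>X \<in> gmod U k H; X' \<in> gmod U k H; f \<in> ghom k H X X'; y \<in> carrier (fobj R X)\<rbrakk> \<Longrightarrow>
      \<epsilon> X' (farr R X X' f y) = f (\<epsilon> X y)"
proof -
  have Rfun: "is_functor (proper_model U k H) (proper_model U k G) R"
    using adj by (simp add: adjunction_def)
  have Rg: "fobj R X \<in> gmod U k G" if "X \<in> gmod U k H" for X
    using Rfun that by (simp add: is_functor_def)
  have Rh: "farr R X X' f \<in> ghom k G (fobj R X) (fobj R X')"
    if "X \<in> gmod U k H" "X' \<in> gmod U k H" "f \<in> ghom k H X X'" for X X' f
    using Rfun that by (simp add: is_functor_def)
  have Rid: "farr R X X (\<lambda>x \<in> carrier X. x) = (\<lambda>x \<in> carrier (fobj R X). x)"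
    if "X \<in> gmod U k H" for X
    using Rfun that by (simp add: is_functor_def)
  obtain \<phi> where "\<forall>X \<in> gmod U k G. \<forall>Y \<in> gmod U k H.
      bij_betw (\<phi> X Y) (ghom k H (res_gmodule i X) Y) (ghom k G X (fobj R Y))"
    "\<forall>X \<in> gmod U k G. \<forall>X' \<in> gmod U k G. \<forall>Y \<in> gmod U k H. \<forall>Y' \<in> gmod U k H.
      \<forall>f \<in> ghom k G X' X. \<forall>u \<in> ghom k H (res_gmodule i X) Y. \<forall>g \<in> ghom k H Y Y'.
      \<phi> X' Y' (compose (carrier X') g (compose (carrier X') u f)) =
      compose (carrier X') (farr R Y Y' g) (compose (carrier X') (\<phi> X Y u) f)"
    using adj by (auto simp: adjunction_def)
  then have bij: "\<And>X Y. \<lbrakk>X \<in> gmod U k G; Y \<in> gmod U k H\<rbrakk> \<Longrightarrow>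
      bij_betw (\<phi> X Y) (ghom k H (res_gmodule i X) Y) (ghom k G X (fobj R Y))"
    and nat: "\<And>X X' Y Y' f u g. \<lbrakk>X \<in> gmod U k G; X' \<in> gmod U k G; Y \<in> gmod U k H; Y' \<in> gmod U k H;
        f \<in> ghom k G X' X; u \<in> ghom k H (res_gmodule i X) Y; g \<in> ghom k H Y Y'\<rbrakk> \<Longrightarrow>
      \<phi> X' Y' (compose (carrier X') g (compose (carrier X') u f)) =
      compose (carrier X') (farr R Y Y' g) (compose (carrier X') (\<phi> X Y u) f)"
    by blast+
  have Rid_hom: "(\<lambda>x \<in> carrier (fobj R X). x) \<in> ghom k G (fobj R X) (fobj R X)"
    if "X \<in> gmod U k H" for X by (rule ghom_id[OF gmG[OF Rg[OF that]]])
  define \<epsilon> where "\<epsilon> X = inv_into (ghom k H (res_gmodule i (fobj R X)) X) (\<phi> (fobj R X) X)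
      (\<lambda>x \<in> carrier (fobj R X). x)" for X
  have \<epsilon>: "\<epsilon> X \<in> ghom k H (res_gmodule i (fobj R X)) X"
    "\<phi> (fobj R X) X (\<epsilon> X) = (\<lambda>x \<in> carrier (fobj R X). x)" if X: "X \<in> gmod U k H" for X
  proof -
    have "(\<lambda>x \<in> carrier (fobj R X). x) \<in> \<phi> (fobj R X) X ` ghom k H (res_gmodule i (fobj R X)) X"
      using Rid_hom[OF X] by (simp add: bij_betw_imp_surj_on[OF bij[OF Rg[OF X] X]])
    then show "\<epsilon> X \<in> ghom k H (res_gmodule i (fobj R X)) X"
      "\<phi> (fobj R X) X (\<epsilon> X) = (\<lambda>x \<in> carrier (fobj R X). x)"
      unfolding \<epsilon>_def by (rule inv_into_into, rule f_inv_into_f)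
  qed
  have comp: "compose (carrier Y) (\<epsilon> X) v \<in> ghom k H (res_gmodule i Y) X"
    if "X \<in> gmod U k H" "Y \<in> gmod U k G" "v \<in> ghom k G Y (fobj R X)" for X Y v
    using ghom_compose[OF ghom_res[OF that(3) hom] \<epsilon>(1)[OF that(1)] gmH[OF res_gmod[OF that(2)]]] by simp
  \<comment> \<open>Transposition inverts composition with the counit; surjectivity and uniqueness
    in the universal property are read off from this.\<close>
  have \<phi>_eq: "\<phi> Y X (compose (carrier Y) (\<epsilon> X) v) = v"
    if X: "X \<in> gmod U k H" and Y: "Y \<in> gmod U k G" and v: "v \<in> ghom k G Y (fobj R X)" for X Y v
    using nat[OF Rg[OF X] Y X X v \<epsilon>(1)[OF X] ghom_id[OF gmH[OF X]]]
      compose_id(1)[OF comp[OF X Y v]] compose_id(1)[OF v]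
    by (simp add: Rid[OF X] \<epsilon>(2)[OF X])
  have "coind_arrow U k G H i X (fobj R X) (\<epsilon> X)" if X: "X \<in> gmod U k H" for X
    unfolding coind_arrow_def
  proof (intro conjI ballI Rg[OF X] \<epsilon>(1)[OF X])
    fix Y h assume Y: "Y \<in> gmod U k G" and h: "h \<in> ghom k H (res_gmodule i Y) X"
    show "\<exists>!u. u \<in> ghom k G Y (fobj R X) \<and> (\<forall>y \<in> carrier Y. \<epsilon> X (u y) = h y)"
    proof (rule ex1I)
      have u: "\<phi> Y X h \<in> ghom k G Y (fobj R X)" by (rule bij_betw_apply[OF bij[OF Y X] h])
      have eq: "compose (carrier Y) (\<epsilon> X) (\<phi> Y X h) = h"
        using inj_onD[OF bij_betw_imp_inj_on[OF bij[OF Y X]] \<phi>_eq[OF X Y u] comp[OF X Y u] h] .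
      then show "\<phi> Y X h \<in> ghom k G Y (fobj R X) \<and> (\<forall>y \<in> carrier Y. \<epsilon> X (\<phi> Y X h y) = h y)"
      proof (intro conjI u ballI)
        fix y assume "y \<in> carrier Y"
        then show "\<epsilon> X (\<phi> Y X h y) = h y" using fun_cong[OF eq, of y] by (simp add: compose_eq)
      qed
      fix u assume u: "u \<in> ghom k G Y (fobj R X) \<and> (\<forall>y \<in> carrier Y. \<epsilon> X (u y) = h y)"
      then have "compose (carrier Y) (\<epsilon> X) u = h"
        using ghomD(6)[OF h] by (auto simp: compose_def fun_eq_iff extensional_def)
      then show "u = \<phi> Y X h" using \<phi>_eq[OF X Y] u by metis
    qed
  qed
  moreover have "\<epsilon> X' (farr R X X' f y) = f (\<epsilon> X y)"
    if X: "X \<in> gmod U k H" "X' \<in> gmod U k H" and f: "f \<in> ghom k H X X'" and y: "y \<in> carrier (fobj R X)"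
    for X X' f y
  proof -
    note RX = Rg[OF X(1)]
    have f\<epsilon>: "compose (carrier (fobj R X)) f (\<epsilon> X) \<in> ghom k H (res_gmodule i (fobj R X)) X'"
      using ghom_compose[OF \<epsilon>(1)[OF X(1)] f gmH[OF res_gmod[OF RX]]] by simp
    have "\<phi> (fobj R X) X' (compose (carrier (fobj R X)) f (\<epsilon> X)) = farr R X X' f"
      using nat[OF RX RX X Rid_hom[OF X(1)] \<epsilon>(1)[OF X(1)] f]
        compose_id(2)[OF \<epsilon>(1)[OF X(1)]] compose_id[OF Rid_hom[OF X(1)]] compose_id(2)[OF Rh[OF X f]]
      by (simp add: \<epsilon>(2)[OF X(1)])
    then have "compose (carrier (fobj R X)) (\<epsilon> X') (farr R X X' f) = compose (carrier (fobj R X)) f (\<epsilon> X)"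
      using inj_onD[OF bij_betw_imp_inj_on[OF bij[OF RX X(2)]] _ comp[OF X(2) RX Rh[OF X f]] f\<epsilon>]
        \<phi>_eq[OF X(2) RX Rh[OF X f]] by simp
    from fun_cong[OF this, of y] show ?thesis using y by (simp add: compose_eq)
  qed
  ultimately show ?thesis using Rh by (intro that) auto
qed

section \<open>Preservation of the classes of maps\<close>

lemma res_epi_with_ker:
  assumes "p \<in> epi_with_ker_in U k G X M N"
    and "\<And>K. K \<in> gmod U k G \<Longrightarrow> K \<in> X \<Longrightarrow> res_gmodule i K \<in> Y"
  shows "p \<in> epi_with_ker_in U k H Y (res_gmodule i M) (res_gmodule i N)"
proof -
  obtain K j where K: "K \<in> gmod U k G" "short_exact k G K M N j p" "K \<in> X"
    using assms(1) by (auto simp: epi_with_ker_in_def)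
  then show ?thesis
    using assms(2)[OF K(1,3)] res_gmod[OF K(1)] short_exact_res[OF K(2) hom]
    by (auto simp: epi_with_ker_in_def)
qed

lemma res_mono_with_coker:
  assumes "f \<in> mono_with_coker_in U k G X M N"
    and "\<And>C. C \<in> gmod U k G \<Longrightarrow> C \<in> X \<Longrightarrow> res_gmodule i C \<in> Y"
  shows "f \<in> mono_with_coker_in U k H Y (res_gmodule i M) (res_gmodule i N)"
proof -
  obtain C p where C: "C \<in> gmod U k G" "short_exact k G M N C f p" "C \<in> X"
    using assms(1) by (auto simp: mono_with_coker_in_def)
  then show ?thesis
    using assms(2)[OF C(1,3)] res_gmod[OF C(1)] short_exact_res[OF C(2) hom]
    by (auto simp: mono_with_coker_in_def)
qed

text \<open>Exactness of the adjoints leaves only conditions on objects: \<open>PCof_ind\<close> for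
  cofibrations, \<open>projectives_ind\<close> for trivial ones, and \<open>W_class_res\<close> for
  trivial fibrations.\<close>

lemma quillen_ind_res:
  assumes adj: "adjunction (proper_model U k H) (proper_model U k G) L (res_functor i)"
  shows "quillen_adjunction (proper_model U k H) (proper_model U k G) L (res_functor i)"
proof -
  obtain \<eta> where L: "\<And>X. X \<in> gmod U k H \<Longrightarrow> ind_arrow U k G H i X (fobj L X) (\<eta> X)"
    "\<And>X X' f. \<lbrakk>X \<in> gmod U k H; X' \<in> gmod U k H; f \<in> ghom k H X X'\<rbrakk> \<Longrightarrow>
      farr L X X' f \<in> ghom k G (fobj L X) (fobj L X')"
    "\<And>X X' f x. \<lbrakk>X \<in> gmod U k H; X' \<in> gmod U k H; f \<in> ghom k H X X'; x \<in> carrier X\<rbrakk> \<Longrightarrow>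
      farr L X X' f (\<eta> X x) = \<eta> X' (f x)"
    by (rule adjunction_ind_arrow[OF adj]) (rule that; assumption)
  have Lg: "fobj L X \<in> gmod U k G" if "X \<in> gmod U k H" for X by (rule ind_arrowD(1)[OF L(1)[OF that]])
  have mono: "farr L M N f \<in> mono_with_coker_in U k G Y (fobj L M) (fobj L N)"
    if M: "M \<in> gmod U k H" and N: "N \<in> gmod U k H" and f: "f \<in> mono_with_coker_in U k H X M N"
      and XY: "\<And>C. C \<in> gmod U k H \<Longrightarrow> C \<in> X \<Longrightarrow> fobj L C \<in> Y" for M N f X Y
  proof -
    obtain C p where C: "C \<in> gmod U k H" "short_exact k H M N C f p" "C \<in> X"
      using f by (auto simp: mono_with_coker_in_def)
    note fh = short_exactD(1)[OF C(2)] and ph = short_exactD(2)[OF C(2)]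
    have "short_exact k G (fobj L M) (fobj L N) (fobj L C) (farr L M N f) (farr L N C p)"
      by (rule ind_arrow_short_exact[OF M L(1)[OF M] N L(1)[OF N] C(1) L(1)[OF C(1)] C(2)
            L(2)[OF M N fh] L(3)[OF M N fh] L(2)[OF N C(1) ph] L(3)[OF N C(1) ph]])
    then show ?thesis using Lg[OF C(1)] XY[OF C(1,3)] by (auto simp: mono_with_coker_in_def)
  qed
  show ?thesis
    unfolding quillen_adjunction_def preserves_def
  proof (intro conjI ballI adj; simp only: proper_model_simps res_functor_simps)
    fix M N assume M: "M \<in> gmod U k H" and N: "N \<in> gmod U k H"
    show "farr L M N f \<in> mono_with_coker_in U k G (PCof U k G) (fobj L M) (fobj L N)"
      if "f \<in> mono_with_coker_in U k H (PCof U k H) M N" for f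
      using mono[OF M N that] PCof_ind[OF _ L(1)] by blast
    show "farr L M N f \<in> mono_with_coker_in U k G (PCof U k G) (fobj L M) (fobj L N) \<inter>
        proper_weq U k G (fobj L M) (fobj L N)"
      if "f \<in> mono_with_coker_in U k H (PCof U k H) M N \<inter> proper_weq U k H M N" for f
      using that mono[OF M N] projectives_ind[OF _ L(1)]
      unfolding trivial_cofibrations[OF U k H.is_group M N]
        trivial_cofibrations[OF U k G.is_group Lg[OF M] Lg[OF N]] by blast
  next
    fix M N assume M: "M \<in> gmod U k G" and N: "N \<in> gmod U k G"
    show "p \<in> epi_with_ker_in U k H (gmod U k H) (res_gmodule i M) (res_gmodule i N)"
      if "p \<in> epi_with_ker_in U k G (gmod U k G) M N" for p
      using res_epi_with_ker[OF that res_gmod] .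
    show "p \<in> epi_with_ker_in U k H (gmod U k H) (res_gmodule i M) (res_gmodule i N) \<inter>
        proper_weq U k H (res_gmodule i M) (res_gmodule i N)"
      if "p \<in> epi_with_ker_in U k G (gmod U k G) M N \<inter> proper_weq U k G M N" for p
      using that res_epi_with_ker W_class_res
      unfolding trivial_fibrations[OF U k G.is_group M N]
        trivial_fibrations[OF U k H.is_group res_gmod[OF M] res_gmod[OF N]] by blast
  qed
qed

text \<open>The object conditions are here \<open>PCof_res\<close>, \<open>projectives_res\<close>
  and \<open>W_class_coind\<close>; exactness of coinduction settles plain fibrations.\<close>

lemma quillen_res_coind:
  assumes adj: "adjunction (proper_model U k G) (proper_model U k H) (res_functor i) R"
  shows "quillen_adjunction (proper_model U k G) (proper_model U k H) (res_functor i) R"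
proof -
  obtain \<epsilon> where R: "\<And>X. X \<in> gmod U k H \<Longrightarrow> coind_arrow U k G H i X (fobj R X) (\<epsilon> X)"
    "\<And>X X' f. \<lbrakk>X \<in> gmod U k H; X' \<in> gmod U k H; f \<in> ghom k H X X'\<rbrakk> \<Longrightarrow>
      farr R X X' f \<in> ghom k G (fobj R X) (fobj R X')"
    "\<And>X X' f y. \<lbrakk>X \<in> gmod U k H; X' \<in> gmod U k H; f \<in> ghom k H X X'; y \<in> carrier (fobj R X)\<rbrakk> \<Longrightarrow>
      \<epsilon> X' (farr R X X' f y) = f (\<epsilon> X y)"
    by (rule adjunction_coind_arrow[OF adj]) (rule that; assumption)
  have Rg: "fobj R X \<in> gmod U k G" if "X \<in> gmod U k H" for X by (rule coind_arrowD(1)[OF R(1)[OF that]])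
  have epi: "farr R M N p \<in> epi_with_ker_in U k G Y (fobj R M) (fobj R N)"
    if M: "M \<in> gmod U k H" and N: "N \<in> gmod U k H" and p: "p \<in> epi_with_ker_in U k H X M N"
      and XY: "\<And>K. K \<in> gmod U k H \<Longrightarrow> K \<in> X \<Longrightarrow> fobj R K \<in> Y" for M N p X Y
  proof -
    obtain K j where K: "K \<in> gmod U k H" "short_exact k H K M N j p" "K \<in> X"
      using p by (auto simp: epi_with_ker_in_def)
    note jh = short_exactD(1)[OF K(2)] and ph = short_exactD(2)[OF K(2)]
    have "short_exact k G (fobj R K) (fobj R M) (fobj R N) (farr R K M j) (farr R M N p)"
      by (rule coind_arrow_short_exact[OF K(1) R(1)[OF K(1)] M R(1)[OF M] N R(1)[OF N] K(2)
            R(2)[OF K(1) M jh] R(3)[OF K(1) M jh] R(2)[OF M N ph] R(3)[OF M N ph]])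
    then show ?thesis using Rg[OF K(1)] XY[OF K(1,3)] by (auto simp: epi_with_ker_in_def)
  qed
  \<comment> \<open>\<open>W_class_coind\<close> speaks of any object that is a retract of the
    explicit coinduced module, so it covers the value of an arbitrary right adjoint.\<close>
  have RW: "fobj R K \<in> W_class U k G" if K: "K \<in> gmod U k H" "K \<in> W_class U k H" for K
  proof -
    obtain b c where b: "b \<in> ghom k G (coind_gmodule G H i K) (fobj R K)"
      and c: "c \<in> ghom k G (fobj R K) (coind_gmodule G H i K)"
      and bc: "\<And>y. y \<in> carrier (fobj R K) \<Longrightarrow> b (c y) = y"
      by (rule coind_arrow_iso[OF K(1) R(1)[OF K(1)]]) (rule that; assumption)
    show ?thesis by (rule W_class_coind[OF K(2) Rg[OF K(1)] b c bc])
  qed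
  show ?thesis
    unfolding quillen_adjunction_def preserves_def
  proof (intro conjI ballI adj; simp only: proper_model_simps res_functor_simps)
    fix M N assume M: "M \<in> gmod U k G" and N: "N \<in> gmod U k G"
    show "f \<in> mono_with_coker_in U k H (PCof U k H) (res_gmodule i M) (res_gmodule i N)"
      if "f \<in> mono_with_coker_in U k G (PCof U k G) M N" for f
      using res_mono_with_coker[OF that PCof_res] .
    show "f \<in> mono_with_coker_in U k H (PCof U k H) (res_gmodule i M) (res_gmodule i N) \<inter>
        proper_weq U k H (res_gmodule i M) (res_gmodule i N)"
      if "f \<in> mono_with_coker_in U k G (PCof U k G) M N \<inter> proper_weq U k G M N" for f
      using that res_mono_with_coker projectives_res
      unfolding trivial_cofibrations[OF U k G.is_group M N]
        trivial_cofibrations[OF U k H.is_group res_gmod[OF M] res_gmod[OF N]] by blast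
  next
    fix M N assume M: "M \<in> gmod U k H" and N: "N \<in> gmod U k H"
    show "farr R M N p \<in> epi_with_ker_in U k G (gmod U k G) (fobj R M) (fobj R N)"
      if "p \<in> epi_with_ker_in U k H (gmod U k H) M N" for p
      using epi[OF M N that] Rg by blast
    show "farr R M N p \<in> epi_with_ker_in U k G (gmod U k G) (fobj R M) (fobj R N) \<inter>
        proper_weq U k G (fobj R M) (fobj R N)"
      if "p \<in> epi_with_ker_in U k H (gmod U k H) M N \<inter> proper_weq U k H M N" for p
      using that epi[OF M N] RW
      unfolding trivial_fibrations[OF U k H.is_group M N]
        trivial_fibrations[OF U k G.is_group Rg[OF M] Rg[OF N]] by blast
  qed
qed

end

text \<open>Adjoints are determined only up to isomorphism, so the claim is made for every adjoint
  of restriction; the existence parts keep it from being vacuous.\<close>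

theorem lemma3p13:
  fixes k :: "'k ring" and G :: "'g monoid" and H :: "'h monoid" and i :: "'h \<Rightarrow> 'g"
    and U :: "'u set set"
  assumes "cring k" and "group G" and "group H"
    and "i \<in> hom H G" and "inj_on i (carrier H)"
    and "module_universe k G U"
  shows
    "(\<exists>ind. adjunction (proper_model U k H) (proper_model U k G) ind (res_functor i)) \<and>
     (\<forall>ind. adjunction (proper_model U k H) (proper_model U k G) ind (res_functor i) \<longrightarrow>
        quillen_adjunction (proper_model U k H) (proper_model U k G) ind (res_functor i)) \<and>
     (\<exists>coind. adjunction (proper_model U k G) (proper_model U k H) (res_functor i) coind) \<and>
     (\<forall>coind. adjunction (proper_model U k G) (proper_model U k H) (res_functor i) coind \<longrightarrow>
        quillen_adjunction (proper_model U k G) (proper_model U k H) (res_functor i) coind)"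
proof -
  interpret G: group G by fact
  interpret H: group H by fact
  interpret k: cring k by fact
  have "set_universe U" "closed_under_powers (carrier G) U"
    using assms(6) by (auto simp: module_universe_def set_universe_def)
  then interpret res_setting U k G H i
    by unfold_locales (use assms in auto)
  show ?thesis
    using adjunction_ind_exists quillen_ind_res adjunction_coind_exists quillen_res_coind by blast
qed

end
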